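(* Let $X$ be a smooth irreducible affine variety over a field $K$ of characteristic zero, let $\mathcal{D}(X)$ be the ring of differential operators on $X$, and let $D=D(X)=\mathrm{Frac}(\mathcal{D}(X))$ be its quotient division algebra. Then $D\otimes D^o$ is a Noetherian domain, and so the following hold for every $\Delta=\{\delta_1,\ldots,\delta_t\}$ which is either a finite set of commuting $K$-derivations or a finite set of commuting $K$-automorphisms of $D$: 1. $D$ satisfies the ascending chain condition on division $K$-subalgebras, or equivalently, every division $K$-subalgebra of $D$ is a finitely generated division $K$-algebra. 2. The group of eigenvalues $\mathrm{Ev}(\Delta)$ is a finitely generated abelian group, and so $\mathrm{Ev}(\Delta)=\mathcal{T}\oplus\mathbb{Z}^r$, where $r$ is the rank of $\mathrm{Ev}(\Delta)$ and $\mathcal{T}$ is a finite abelian group. 3. The eigen-algebra $D(\Delta)$ is a Noetherian domain isomorphic to an iterated skew Laurent extension: $D_{\mathcal{T}}:=\bigoplus_{\lambda\in\mathcal{T}}D_\lambda$ is a division algebra of right and left dimension $|\mathcal{T}|$ over the division algebra $D_0$, and $D(\Delta)$ is isomorphic to an iterated skew Laurent extension $D_{\mathcal{T}}[x_1,x_1^{-1};\sigma_1]\cdots[x_r,x_r^{-1};\sigma_r]$. 4. For each subgroup $F$ of $\mathrm{Ev}(\Delta)$, $\mathcal{F}(F):=\bigoplus_{\lambda\in F}D_\lambda$ is a Noetherian domain whose quotient division algebra $\mathrm{Frac}(\mathcal{F}(F))$ is $\Delta$-invariant and satisfies $\mathrm{Ev}(\mathrm{Frac}(\mathcal{F}(F)))=F$;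 any $\Delta$-eigenvector $v\in\mathrm{Frac}(\mathcal{F}(F))_\lambda$ has the form $u^{-1}w$ for some $0\neq u\in D_\mu$, $w\in D_{\lambda+\mu}$, with $\lambda,\mu\in F$.
   Context: Notation: $\otimes=\otimes_K$; "Noetherian" for rings means left and right Noetherian. $A^o$ is the opposite algebra of $A$ (multiplication $a*b=ba$). For a Noetherian domain $A$, $\mathrm{Frac}(A)$ is its quotient division algebra. A division $K$-algebra $E$ is a finitely generated division algebra if there are finitely many elements $x_1,\ldots,x_n\in E$ such that $E$ is the only division $K$-subalgebra of $E$ containing $x_1,\ldots,x_n$. Eigenvalues. In the derivation case $\mathrm{Ev}(\Delta):=\{\lambda\in K^t \mid \delta_i(u)=\lambda_iu,\ i=1,\ldots,t,\ \text{for some } 0\ne u\in D\}$, an additive subgroup of $K^t$. In the automorphism case $\mathrm{Ev}(\Delta):=\{\lambda\in (K^* )^t\mid \delta_i(u)=\lambda_iu,\ i=1,\ldots,t,\ \text{for some } 0\neq u\in D\}$, a multiplicative subgroup of $(K^* )^t$, $K^*=K\setminus\{0\}$; its operation is also written additively, so $\lambda+\mu$ means the componentwise product and $0$ means $(1,\ldots,1)$. For $\lambda\in\mathrm{Ev}(\Delta)$, $D_\lambda:=\{u\in D\mid\delta_i(u)=\lambda_iu,\ i=1,\ldots,t\}$; in particular $D_0$ is the division subalgebra of $\Delta$-constants. The eigen-algebra is $D(\Delta):=\bigoplus_{\lambda\in\mathrm{Ev}(\Delta)}D_\lambda\subseteq D$. For a $\Delta$-invariant division subalgebra $E\subseteq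 D$, $\mathrm{Ev}(E)$ and $E_\lambda$ are defined in the same way with $E$ in place of $D$; $\mathrm{Frac}(\mathcal{F}(F))$ is viewed inside $D$. The rank of an abelian group $G$ is $\dim_{\mathbb{Q}}(\mathbb{Q}\otimes_{\mathbb{Z}}G)$; $\mathcal{T}$ is the torsion subgroup of $\mathrm{Ev}(\Delta)$. For a ring $\Gamma$ and an automorphism $\sigma$ of $\Gamma$, the skew Laurent extension $\Gamma[x,x^{-1};\sigma]$ is generated by $\Gamma$ and $x^{\pm1}$ subject to $x^{\pm1}a=\sigma^{\pm1}(a)x^{\pm1}$ for $a\in\Gamma$ (free as a left $\Gamma$-module on the powers of $x$). Iterated skew Laurent extensions are defined inductively by $A_n=A_{n-1}[x_n,x_n^{-1};\sigma_n]$ with $\sigma_n$ an automorphism of $A_{n-1}$, $A_0=\Gamma$.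
   Formalization: "Irreducible" is taken to mean irreducible over the algebraic closure of K; with irreducibility over K alone the claim that D⊗D^o is a domain fails (X = Spec Q(i) over Q, D = Q(i)). *)

theory Defs
  imports
    "HOL-Analysis.Cartesian_Space"
    "HOL-Algebra.Product_Groups"
    "HOL-Algebra.QuotRing"
    "HOL-Algebra.Algebraic_Closure_Type"
    "HOL-Library.Poly_Mapping"
begin

section \<open>Rings, not necessarily commutative\<close>

text \<open>
  The locales \<open>domain\<close> and \<open>noetherian_ring\<close> of the algebra library concern commutative domains
  and two-sided ideals, whereas one-sided ideals of noncommutative rings are needed here.
\<close>

definition left_ideal :: "'a set \<Rightarrow> ('a, 'm) ring_scheme \<Rightarrow> bool" where
  "left_ideal I R \<longleftrightarrow> additive_subgroup I R \<and> (\<forall>a\<in>carrier R. \<forall>x\<in>I. a \<otimes>\<^bsub>R\<^esub> x \<in> I)"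

definition right_ideal :: "'a set \<Rightarrow> ('a, 'm) ring_scheme \<Rightarrow> bool" where
  "right_ideal I R \<longleftrightarrow> additive_subgroup I R \<and> (\<forall>a\<in>carrier R. \<forall>x\<in>I. x \<otimes>\<^bsub>R\<^esub> a \<in> I)"

definition acc_on :: "('a set \<Rightarrow> bool) \<Rightarrow> bool" where
  "acc_on P \<longleftrightarrow> (\<forall>I :: nat \<Rightarrow> 'a set. (\<forall>n. P (I n)) \<and> (\<forall>n. I n \<subseteq> I (Suc n)) \<longrightarrow>
     (\<exists>N. \<forall>n\<ge>N. I n = I N))"

definition nc_noetherian :: "('a, 'm) ring_scheme \<Rightarrow> bool" where
  "nc_noetherian R \<longleftrightarrow> acc_on (\<lambda>I. left_ideal I R) \<and> acc_on (\<lambda>I. right_ideal I R)"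

definition nc_domain :: "('a, 'm) ring_scheme \<Rightarrow> bool" where
  "nc_domain R \<longleftrightarrow> ring R \<and> \<one>\<^bsub>R\<^esub> \<noteq> \<zero>\<^bsub>R\<^esub> \<and>
     (\<forall>a\<in>carrier R. \<forall>b\<in>carrier R. a \<otimes>\<^bsub>R\<^esub> b = \<zero>\<^bsub>R\<^esub> \<longrightarrow> a = \<zero>\<^bsub>R\<^esub> \<or> b = \<zero>\<^bsub>R\<^esub>)"

definition opposite :: "('a, 'm) ring_scheme \<Rightarrow> 'a ring" where
  "opposite R = \<lparr>carrier = carrier R, monoid.mult = (\<lambda>a b. b \<otimes>\<^bsub>R\<^esub> a), one = \<one>\<^bsub>R\<^esub>,
     zero = \<zero>\<^bsub>R\<^esub>, add = (\<lambda>a b. a \<oplus>\<^bsub>R\<^esub> b)\<rparr>"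

text \<open>A subset of a type-class ring as a ring in the sense of the algebra library.\<close>

definition set_ring :: "'a::ring_1 set \<Rightarrow> 'a ring" where
  "set_ring S = \<lparr>carrier = S, monoid.mult = (*), one = 1, zero = 0, add = (+)\<rparr>"

definition division_subring :: "'a::division_ring set \<Rightarrow> bool" where
  "division_subring E \<longleftrightarrow> 0 \<in> E \<and> 1 \<in> E \<and>
     (\<forall>x\<in>E. \<forall>y\<in>E. x - y \<in> E \<and> x * y \<in> E) \<and> (\<forall>x\<in>E. inverse x \<in> E)"

text \<open>
  \<open>E\<close>, with the embedding \<open>\<iota>\<close>, is the (two-sided) quotient division ring of \<open>A\<close>.
\<close>

definition is_Frac :: "('a, 'm) ring_scheme \<Rightarrow> 'd::division_ring set \<Rightarrow> ('a \<Rightarrow> 'd) \<Rightarrow> bool" where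
  "is_Frac A E \<iota> \<longleftrightarrow> division_subring E \<and> \<iota> \<in> ring_hom A (set_ring E) \<and> inj_on \<iota> (carrier A) \<and>
     (\<forall>q\<in>E. \<exists>s\<in>carrier A - {\<zero>\<^bsub>A\<^esub>}. \<exists>a\<in>carrier A. q = inverse (\<iota> s) * \<iota> a) \<and>
     (\<forall>q\<in>E. \<exists>s\<in>carrier A - {\<zero>\<^bsub>A\<^esub>}. \<exists>a\<in>carrier A. q = \<iota> a * inverse (\<iota> s))"

definition left_fractions :: "'d::division_ring set \<Rightarrow> 'd set" where
  "left_fractions S = {inverse u * w | u w. u \<in> S \<and> u \<noteq> 0 \<and> w \<in> S}"


section \<open>Tensor products\<close>

text \<open>
  The tensor product of two modules over the scalars \<open>'s\<close> is the free abelian group on pairs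
  modulo the bilinearity relations. The modules are given by abelian groups \<open>G\<close>, \<open>H\<close> (their
  addition being the group operation) and scalar actions \<open>l\<close>, \<open>r\<close>.
\<close>

definition formal_sums :: "('a, 'm) monoid_scheme \<Rightarrow> ('b, 'n) monoid_scheme \<Rightarrow> (('a \<times> 'b) \<Rightarrow>\<^sub>0 int) set" where
  "formal_sums G H = {p. Poly_Mapping.keys p \<subseteq> carrier G \<times> carrier H}"

abbreviation pure :: "'a \<Rightarrow> 'b \<Rightarrow> ('a \<times> 'b) \<Rightarrow>\<^sub>0 int" where
  "pure a b \<equiv> Poly_Mapping.single (a, b) 1"

inductive_set tensor_null ::
  "('a, 'm) monoid_scheme \<Rightarrow> ('b, 'n) monoid_scheme \<Rightarrow> ('s \<Rightarrow> 'a \<Rightarrow> 'a) \<Rightarrow> ('s \<Rightarrow> 'b \<Rightarrow> 'b) \<Rightarrow>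
    (('a \<times> 'b) \<Rightarrow>\<^sub>0 int) set"
  for G :: "('a, 'm) monoid_scheme" and H :: "('b, 'n) monoid_scheme"
    and l :: "'s \<Rightarrow> 'a \<Rightarrow> 'a" and r :: "'s \<Rightarrow> 'b \<Rightarrow> 'b" where
  left_additive: "\<lbrakk>a \<in> carrier G; a' \<in> carrier G; b \<in> carrier H\<rbrakk> \<Longrightarrow>
    pure (a \<otimes>\<^bsub>G\<^esub> a') b - pure a b - pure a' b \<in> tensor_null G H l r"
| right_additive: "\<lbrakk>a \<in> carrier G; b \<in> carrier H; b' \<in> carrier H\<rbrakk> \<Longrightarrow>
    pure a (b \<otimes>\<^bsub>H\<^esub> b') - pure a b - pure a b' \<in> tensor_null G H l r"
| balanced: "\<lbrakk>a \<in> carrier G; b \<in> carrier H\<rbrakk> \<Longrightarrow>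
    pure (l c a) b - pure a (r c b) \<in> tensor_null G H l r"
| zero: "0 \<in> tensor_null G H l r"
| diff: "\<lbrakk>p \<in> tensor_null G H l r; q \<in> tensor_null G H l r\<rbrakk> \<Longrightarrow> p - q \<in> tensor_null G H l r"

definition formal_group ::
  "('a, 'm) monoid_scheme \<Rightarrow> ('b, 'n) monoid_scheme \<Rightarrow> (('a \<times> 'b) \<Rightarrow>\<^sub>0 int) monoid" where
  "formal_group G H = \<lparr>carrier = formal_sums G H, monoid.mult = (+), one = 0\<rparr>"

definition tensor_group ::
  "('a, 'm) monoid_scheme \<Rightarrow> ('b, 'n) monoid_scheme \<Rightarrow> ('s \<Rightarrow> 'a \<Rightarrow> 'a) \<Rightarrow> ('s \<Rightarrow> 'b \<Rightarrow> 'b) \<Rightarrow>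
    (('a \<times> 'b) \<Rightarrow>\<^sub>0 int) set monoid" where
  "tensor_group G H l r = formal_group G H Mod tensor_null G H l r"

definition formal_ring ::
  "('a, 'm) ring_scheme \<Rightarrow> ('b, 'n) ring_scheme \<Rightarrow> (('a \<times> 'b) \<Rightarrow>\<^sub>0 int) ring" where
  "formal_ring A B =
     \<lparr>carrier = formal_sums A B,
      monoid.mult = (\<lambda>p q. \<Sum>x\<in>Poly_Mapping.keys p. \<Sum>y\<in>Poly_Mapping.keys q.
        Poly_Mapping.single (fst x \<otimes>\<^bsub>A\<^esub> fst y, snd x \<otimes>\<^bsub>B\<^esub> snd y)
          (Poly_Mapping.lookup p x * Poly_Mapping.lookup q y)),
      one = pure \<one>\<^bsub>A\<^esub> \<one>\<^bsub>B\<^esub>, zero = 0, add = (+)\<rparr>"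

definition tensor_ring ::
  "('a, 'm) ring_scheme \<Rightarrow> ('b, 'n) ring_scheme \<Rightarrow> ('s \<Rightarrow> 'a \<Rightarrow> 'a) \<Rightarrow> ('s \<Rightarrow> 'b \<Rightarrow> 'b) \<Rightarrow>
    (('a \<times> 'b) \<Rightarrow>\<^sub>0 int) set ring" where
  "tensor_ring A B l r = formal_ring A B Quot tensor_null (add_monoid A) (add_monoid B) l r"


section \<open>Dimension and rank\<close>

text \<open>
  The \<open>S\<close>-space on the abelian group \<open>V\<close> (written multiplicatively) with scalar action \<open>act\<close> has a
  basis with \<open>n\<close> elements.
\<close>

definition has_dimension ::
  "'s set \<Rightarrow> ('s \<Rightarrow> 'v \<Rightarrow> 'v) \<Rightarrow> ('v, 'm) monoid_scheme \<Rightarrow> nat \<Rightarrow> bool" where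
  "has_dimension S act V n \<longleftrightarrow>
     (\<exists>b \<in> {..<n} \<rightarrow> carrier V. \<forall>v\<in>carrier V.
        \<exists>!c. c \<in> {..<n} \<rightarrow>\<^sub>E S \<and> v = finprod V (\<lambda>i. act (c i) (b i)) {..<n})"

definition rational_tensor ::
  "('g, 'm) monoid_scheme \<Rightarrow> ((rat \<times> 'g) \<Rightarrow>\<^sub>0 int) set monoid" where
  "rational_tensor G =
     tensor_group (add_monoid (set_ring (UNIV :: rat set))) G
       (\<lambda>m::int. \<lambda>q. of_int m * q) (\<lambda>m g. g [^]\<^bsub>G\<^esub> m)"

definition formal_scale :: "rat \<Rightarrow> ((rat \<times> 'g) \<Rightarrow>\<^sub>0 int) \<Rightarrow> ((rat \<times> 'g) \<Rightarrow>\<^sub>0 int)" where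
  "formal_scale q p =
     (\<Sum>x\<in>Poly_Mapping.keys p. Poly_Mapping.single (q * fst x, snd x) (Poly_Mapping.lookup p x))"

definition rational_scale ::
  "('g, 'm) monoid_scheme \<Rightarrow> rat \<Rightarrow> ((rat \<times> 'g) \<Rightarrow>\<^sub>0 int) set \<Rightarrow> ((rat \<times> 'g) \<Rightarrow>\<^sub>0 int) set" where
  "rational_scale G q P =
     {formal_scale q p + k | p k. p \<in> P \<and> k \<in> \<one>\<^bsub>rational_tensor G\<^esub>}"

definition has_rank :: "('g, 'm) monoid_scheme \<Rightarrow> nat \<Rightarrow> bool" where
  "has_rank G r \<longleftrightarrow> has_dimension (UNIV :: rat set) (rational_scale G) (rational_tensor G) r"

definition torsion_part :: "('g, 'm) monoid_scheme \<Rightarrow> 'g set" where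
  "torsion_part G = {a \<in> carrier G. \<exists>m::nat. m > 0 \<and> a [^]\<^bsub>G\<^esub> m = \<one>\<^bsub>G\<^esub>}"


section \<open>Affine varieties\<close>

type_synonym ('n, 'c) polynomials = "('n \<Rightarrow>\<^sub>0 nat) \<Rightarrow>\<^sub>0 'c"

definition eval_at :: "'c::field ^ 'n::finite \<Rightarrow> ('n, 'c) polynomials \<Rightarrow> 'c" where
  "eval_at p f = (\<Sum>m\<in>Poly_Mapping.keys f. Poly_Mapping.lookup f m *
     (\<Prod>i\<in>UNIV. (p $ i) ^ Poly_Mapping.lookup m i))"

definition partial_at :: "'c::field ^ 'n::finite \<Rightarrow> 'n \<Rightarrow> ('n, 'c) polynomials \<Rightarrow> 'c" where
  "partial_at p i f = (\<Sum>m\<in>Poly_Mapping.keys f. Poly_Mapping.lookup f m *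
     of_nat (Poly_Mapping.lookup m i) * (p $ i) ^ (Poly_Mapping.lookup m i - 1) *
     (\<Prod>j\<in>UNIV - {i}. (p $ j) ^ Poly_Mapping.lookup m j))"

definition zero_locus :: "('n, 'c) polynomials set \<Rightarrow> ('c::field ^ 'n::finite) set" where
  "zero_locus S = {p. \<forall>f\<in>S. eval_at p f = 0}"

definition zariski_closed :: "('c::field ^ 'n::finite) set \<Rightarrow> bool" where
  "zariski_closed Z \<longleftrightarrow> (\<exists>S. Z = zero_locus S)"

definition irreducible_closed :: "('c::field ^ 'n::finite) set \<Rightarrow> bool" where
  "irreducible_closed Z \<longleftrightarrow> zariski_closed Z \<and> Z \<noteq> {} \<and>
     (\<forall>A B. zariski_closed A \<and> zariski_closed B \<and> Z \<subseteq> A \<union> B \<longrightarrow> Z \<subseteq> A \<or> Z \<subseteq> B)"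

text \<open>The lengths of the chains below are at most \<open>CARD('n)\<close>, so the supremum is a maximum.\<close>

definition variety_dim :: "('c::field ^ 'n::finite) set \<Rightarrow> nat" where
  "variety_dim V = Sup {d. \<exists>Z :: nat \<Rightarrow> ('c ^ 'n) set.
     (\<forall>i\<le>d. irreducible_closed (Z i) \<and> Z i \<subseteq> V) \<and> (\<forall>i<d. Z i \<subset> Z (Suc i))}"

definition tangent_space :: "('c::field ^ 'n::finite) set \<Rightarrow> 'c ^ 'n \<Rightarrow> ('c ^ 'n) set" where
  "tangent_space V p = {v. \<forall>f. (\<forall>x\<in>V. eval_at x f = 0) \<longrightarrow> (\<Sum>i\<in>UNIV. partial_at p i f * v $ i) = 0}"

definition smooth_variety :: "('c::field ^ 'n::finite) set \<Rightarrow> bool" where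
  "smooth_variety V \<longleftrightarrow> (\<forall>p\<in>V. vec.dim (tangent_space V p) = variety_dim V)"

text \<open>
  An irreducible affine variety over \<open>K\<close> is the set of points with coordinates in the algebraic
  closure of \<open>K\<close> of an irreducible (over the algebraic closure) zero locus of polynomials with
  coefficients in \<open>K\<close>. Irreducibility over \<open>K\<close> alone does not suffice for the results below: the
  point with residue field \<open>L\<close>, a proper finite extension of \<open>K\<close>, has \<open>D = L\<close>, and the
  tensor square of \<open>L\<close> over \<open>K\<close> has zero divisors.
\<close>

definition smooth_irreducible_affine_variety :: "('k::field_char_0 alg_closure ^ 'n::finite) set \<Rightarrow> bool" where
  "smooth_irreducible_affine_variety V \<longleftrightarrow>
     (\<exists>S :: ('n, 'k) polynomials set. V = zero_locus (Poly_Mapping.map to_ac ` S)) \<and>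
     irreducible_closed V \<and> smooth_variety V"

text \<open>
  The coordinate ring \<open>K[x\<^sub>1, \<dots>, x\<^sub>n]/I(V)\<close>, as the ring of functions on \<open>V\<close> given by polynomials
  over \<open>K\<close>.
\<close>

definition coord_ring ::
  "('k::field_char_0 alg_closure ^ 'n::finite) set \<Rightarrow> ('k alg_closure ^ 'n \<Rightarrow> 'k alg_closure) ring" where
  "coord_ring V =
     \<lparr>carrier = range (\<lambda>f :: ('n, 'k) polynomials. \<lambda>p\<in>V. eval_at p (Poly_Mapping.map to_ac f)),
      monoid.mult = (\<lambda>f g. \<lambda>p\<in>V. f p * g p), one = (\<lambda>p\<in>V. 1),
      zero = (\<lambda>p\<in>V. 0), add = (\<lambda>f g. \<lambda>p\<in>V. f p + g p)\<rparr>"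

definition coord_const ::
  "('k::field_char_0 alg_closure ^ 'n::finite) set \<Rightarrow> 'k \<Rightarrow> ('k alg_closure ^ 'n \<Rightarrow> 'k alg_closure)" where
  "coord_const V c = (\<lambda>p\<in>V. to_ac c)"


section \<open>Differential operators\<close>

text \<open>
  \<open>R\<close> is a commutative algebra with structure map \<open>s\<close> from the ground field; operators are
  extensional functions on its carrier.
\<close>

definition linear_endos :: "('r, 'm) ring_scheme \<Rightarrow> ('k \<Rightarrow> 'r) \<Rightarrow> ('r \<Rightarrow> 'r) set" where
  "linear_endos R s = {P \<in> carrier R \<rightarrow>\<^sub>E carrier R.
     (\<forall>f\<in>carrier R. \<forall>g\<in>carrier R. P (f \<oplus>\<^bsub>R\<^esub> g) = P f \<oplus>\<^bsub>R\<^esub> P g) \<and>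
     (\<forall>c. \<forall>f\<in>carrier R. P (s c \<otimes>\<^bsub>R\<^esub> f) = s c \<otimes>\<^bsub>R\<^esub> P f)}"

definition mult_operator :: "('r, 'm) ring_scheme \<Rightarrow> 'r \<Rightarrow> 'r \<Rightarrow> 'r" where
  "mult_operator R f = (\<lambda>g\<in>carrier R. f \<otimes>\<^bsub>R\<^esub> g)"

definition commutator_with :: "('r, 'm) ring_scheme \<Rightarrow> ('r \<Rightarrow> 'r) \<Rightarrow> 'r \<Rightarrow> 'r \<Rightarrow> 'r" where
  "commutator_with R P f = (\<lambda>g\<in>carrier R. P (f \<otimes>\<^bsub>R\<^esub> g) \<ominus>\<^bsub>R\<^esub> f \<otimes>\<^bsub>R\<^esub> P g)"

primrec diffops_le :: "('r, 'm) ring_scheme \<Rightarrow> ('k \<Rightarrow> 'r) \<Rightarrow> nat \<Rightarrow> ('r \<Rightarrow> 'r) set" where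
  "diffops_le R s 0 = mult_operator R ` carrier R"
| "diffops_le R s (Suc n) =
     {P \<in> linear_endos R s. \<forall>f\<in>carrier R. commutator_with R P f \<in> diffops_le R s n}"

definition diffop_ring :: "('r, 'm) ring_scheme \<Rightarrow> ('k \<Rightarrow> 'r) \<Rightarrow> ('r \<Rightarrow> 'r) ring" where
  "diffop_ring R s =
     \<lparr>carrier = (\<Union>n. diffops_le R s n), monoid.mult = compose (carrier R),
      one = (\<lambda>g\<in>carrier R. g), zero = (\<lambda>g\<in>carrier R. \<zero>\<^bsub>R\<^esub>),
      add = (\<lambda>P Q. \<lambda>g\<in>carrier R. P g \<oplus>\<^bsub>R\<^esub> Q g)\<rparr>"

definition variety_diffops :: "('k::field_char_0 alg_closure ^ 'n::finite) set \<Rightarrow>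
    (('k alg_closure ^ 'n \<Rightarrow> 'k alg_closure) \<Rightarrow> ('k alg_closure ^ 'n \<Rightarrow> 'k alg_closure)) ring" where
  "variety_diffops V = diffop_ring (coord_ring V) (coord_const V)"

text \<open>The \<open>K\<close>-algebra structure map of the quotient division ring of \<open>\<D>(V)\<close>.\<close>

definition structure_map :: "('k::field_char_0 alg_closure ^ 'n::finite) set \<Rightarrow>
    ((('k alg_closure ^ 'n \<Rightarrow> 'k alg_closure) \<Rightarrow> ('k alg_closure ^ 'n \<Rightarrow> 'k alg_closure)) \<Rightarrow> 'd) \<Rightarrow>
    'k \<Rightarrow> 'd::division_ring" where
  "structure_map V \<iota> c = \<iota> (mult_operator (coord_ring V) (coord_const V c))"


section \<open>Division algebras, derivations and automorphisms\<close>

text \<open>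
  In this section the type \<open>'d\<close> is a division algebra over the field \<open>'k\<close> with structure map
  \<open>\<kappa>\<close>, and \<open>\<delta> 0, \<dots>, \<delta> (t - 1)\<close> is the family \<open>\<Delta>\<close>.
\<close>

definition division_subalgebra :: "('k \<Rightarrow> 'd::division_ring) \<Rightarrow> 'd set \<Rightarrow> bool" where
  "division_subalgebra \<kappa> E \<longleftrightarrow> division_subring E \<and> range \<kappa> \<subseteq> E"

definition fg_division_algebra :: "('k \<Rightarrow> 'd::division_ring) \<Rightarrow> 'd set \<Rightarrow> bool" where
  "fg_division_algebra \<kappa> E \<longleftrightarrow>
     (\<exists>xs. finite xs \<and> xs \<subseteq> E \<and>
       (\<forall>E'. division_subalgebra \<kappa> E' \<and> E' \<subseteq> E \<and> xs \<subseteq> E' \<longrightarrow> E' = E))"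

definition tensor_with_opposite ::
  "('k \<Rightarrow> 'd::division_ring) \<Rightarrow> (('d \<times> 'd) \<Rightarrow>\<^sub>0 int) set ring" where
  "tensor_with_opposite \<kappa> =
     tensor_ring (set_ring UNIV) (opposite (set_ring UNIV)) (\<lambda>c x. \<kappa> c * x) (\<lambda>c x. \<kappa> c * x)"

datatype family_kind = Derivations | Automorphisms

definition K_derivation :: "('k \<Rightarrow> 'd::division_ring) \<Rightarrow> ('d \<Rightarrow> 'd) \<Rightarrow> bool" where
  "K_derivation \<kappa> d \<longleftrightarrow> (\<forall>x y. d (x + y) = d x + d y) \<and> (\<forall>c x. d (\<kappa> c * x) = \<kappa> c * d x) \<and>
     (\<forall>x y. d (x * y) = d x * y + x * d y)"

definition K_automorphism :: "('k \<Rightarrow> 'd::division_ring) \<Rightarrow> ('d \<Rightarrow> 'd) \<Rightarrow> bool" where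
  "K_automorphism \<kappa> s \<longleftrightarrow> s \<in> ring_iso (set_ring UNIV) (set_ring UNIV) \<and>
     (\<forall>c x. s (\<kappa> c * x) = \<kappa> c * s x)"

definition commuting_family ::
  "('k \<Rightarrow> 'd::division_ring) \<Rightarrow> family_kind \<Rightarrow> nat \<Rightarrow> (nat \<Rightarrow> 'd \<Rightarrow> 'd) \<Rightarrow> bool" where
  "commuting_family \<kappa> kind t \<delta> \<longleftrightarrow>
     (\<forall>i<t. case kind of Derivations \<Rightarrow> K_derivation \<kappa> (\<delta> i) | Automorphisms \<Rightarrow> K_automorphism \<kappa> (\<delta> i)) \<and>
     (\<forall>i<t. \<forall>j<t. \<delta> i \<circ> \<delta> j = \<delta> j \<circ> \<delta> i)"

text \<open>
  The group \<open>K\<^sup>t\<close>, respectively \<open>(K\<^sup>*)\<^sup>t\<close>, containing the eigenvalues; in both cases the operation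
  is the multiplication of the record, and \<open>\<one>\<close> is the element called \<open>0\<close> when the operation is
  written additively.
\<close>

definition weight_group :: "family_kind \<Rightarrow> nat \<Rightarrow> (nat \<Rightarrow> 'k::field) monoid" where
  "weight_group kind t = product_group {..<t} (\<lambda>_. case kind of
       Derivations \<Rightarrow> \<lparr>carrier = UNIV, monoid.mult = (+), one = 0\<rparr>
     | Automorphisms \<Rightarrow> \<lparr>carrier = UNIV - {0}, monoid.mult = (*), one = 1\<rparr>)"

definition eigenspace ::
  "('k \<Rightarrow> 'd::division_ring) \<Rightarrow> nat \<Rightarrow> (nat \<Rightarrow> 'd \<Rightarrow> 'd) \<Rightarrow> 'd set \<Rightarrow> (nat \<Rightarrow> 'k) \<Rightarrow> 'd set" where
  "eigenspace \<kappa> t \<delta> E a = {u \<in> E. \<forall>i<t. \<delta> i u = \<kappa> (a i) * u}"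

definition Ev ::
  "('k::field \<Rightarrow> 'd::division_ring) \<Rightarrow> family_kind \<Rightarrow> nat \<Rightarrow> (nat \<Rightarrow> 'd \<Rightarrow> 'd) \<Rightarrow> 'd set \<Rightarrow> (nat \<Rightarrow> 'k) set" where
  "Ev \<kappa> kind t \<delta> E = {a \<in> carrier (weight_group kind t). \<exists>u. u \<noteq> 0 \<and> u \<in> eigenspace \<kappa> t \<delta> E a}"

definition Ev_group ::
  "('k::field \<Rightarrow> 'd::division_ring) \<Rightarrow> family_kind \<Rightarrow> nat \<Rightarrow> (nat \<Rightarrow> 'd \<Rightarrow> 'd) \<Rightarrow> (nat \<Rightarrow> 'k) monoid" where
  "Ev_group \<kappa> kind t \<delta> = (weight_group kind t)\<lparr>carrier := Ev \<kappa> kind t \<delta> UNIV\<rparr>"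

text \<open>The sum of the eigenspaces with weights in \<open>L\<close>, and its directness.\<close>

definition eigen_sum ::
  "('k \<Rightarrow> 'd::division_ring) \<Rightarrow> nat \<Rightarrow> (nat \<Rightarrow> 'd \<Rightarrow> 'd) \<Rightarrow> (nat \<Rightarrow> 'k) set \<Rightarrow> 'd set" where
  "eigen_sum \<kappa> t \<delta> L = {\<Sum>a\<in>S. u a | S u. finite S \<and> S \<subseteq> L \<and> (\<forall>a\<in>S. u a \<in> eigenspace \<kappa> t \<delta> UNIV a)}"

definition eigen_sum_direct ::
  "('k \<Rightarrow> 'd::division_ring) \<Rightarrow> nat \<Rightarrow> (nat \<Rightarrow> 'd \<Rightarrow> 'd) \<Rightarrow> (nat \<Rightarrow> 'k) set \<Rightarrow> bool" where
  "eigen_sum_direct \<kappa> t \<delta> L \<longleftrightarrow>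
     (\<forall>S u. finite S \<and> S \<subseteq> L \<and> (\<forall>a\<in>S. u a \<in> eigenspace \<kappa> t \<delta> UNIV a) \<and> (\<Sum>a\<in>S. u a) = 0 \<longrightarrow>
       (\<forall>a\<in>S. u a = 0))"

text \<open>Invariance under a family of automorphisms means invariance under their inverses as well.\<close>

definition invariant_under ::
  "family_kind \<Rightarrow> nat \<Rightarrow> (nat \<Rightarrow> 'd \<Rightarrow> 'd) \<Rightarrow> 'd set \<Rightarrow> bool" where
  "invariant_under kind t \<delta> E \<longleftrightarrow>
     (\<forall>i<t. case kind of Derivations \<Rightarrow> \<delta> i ` E \<subseteq> E | Automorphisms \<Rightarrow> \<delta> i ` E = E)"


section \<open>Skew Laurent extensions\<close>

text \<open>
  The subring \<open>B\<close> is \<open>A[x, x\<^sup>-\<^sup>1; \<sigma>]\<close>: it contains \<open>A\<close> and the unit \<open>x\<close>, the commutation relations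
  hold, and \<open>B\<close> is free as a left \<open>A\<close>-module on the powers of \<open>x\<close>.
\<close>

definition skew_laurent ::
  "'d::division_ring set \<Rightarrow> 'd \<Rightarrow> ('d \<Rightarrow> 'd) \<Rightarrow> 'd set \<Rightarrow> bool" where
  "skew_laurent A x \<sigma> B \<longleftrightarrow>
     ring (set_ring A) \<and> ring (set_ring B) \<and> A \<subseteq> B \<and>
     \<sigma> \<in> ring_iso (set_ring A) (set_ring A) \<and>
     x \<noteq> 0 \<and> x \<in> B \<and> inverse x \<in> B \<and>
     (\<forall>a\<in>A. x * a = \<sigma> a * x \<and> inverse x * a = inv_into A \<sigma> a * inverse x) \<and>
     (\<forall>b\<in>B. \<exists>!c :: int \<Rightarrow> 'd. range c \<subseteq> A \<and> finite {i. c i \<noteq> 0} \<and>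
        b = (\<Sum>i | c i \<noteq> 0. c i * x powi i))"

inductive iterated_skew_laurent :: "'d::division_ring set \<Rightarrow> nat \<Rightarrow> 'd set \<Rightarrow> bool"
  for \<Gamma> :: "'d::division_ring set" where
  base: "iterated_skew_laurent \<Gamma> 0 \<Gamma>"
| step: "\<lbrakk>iterated_skew_laurent \<Gamma> n A; skew_laurent A x \<sigma> B\<rbrakk> \<Longrightarrow> iterated_skew_laurent \<Gamma> (Suc n) B"

end

theory Submission
  imports Defs
begin

text \<open>
  Let \<open>A\<close> be the coordinate ring and \<open>Q\<close> its field of fractions. A minimal set of coordinates \<open>x j\<close> that
  separates the derivations of \<open>Q\<close> has dual derivations \<open>y j\<close> in \<open>D\<close>, and by the Euler formula
  \<open>n P = \<Sum>j. [P, x j] y j\<close> up to lower order, the \<open>y j\<close> and \<open>Q\<close> generate all operators. So the enveloping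
  algebra \<open>D \<otimes> D\<^sup>o\<close> arises from \<open>K\<close> by localisations and by adjoining the finitely many elements
  \<open>x i \<otimes> 1\<close>, \<open>1 \<otimes> x i\<close>, \<open>y j \<otimes> 1\<close>, \<open>1 \<otimes> y j\<close>, whose commutators with the ring reached so far stay in it;
  it is Noetherian by Hilbert's argument. The commutators with \<open>x j \<otimes> 1\<close> and \<open>1 \<otimes> x j\<close> are locally
  nilpotent with common kernel \<open>A \<otimes> A\<close>, which is a domain because \<open>V\<close> is irreducible over the algebraic
  closure; looking at leading terms, \<open>D \<otimes> D\<^sup>o\<close> is a domain.

  A division subalgebra \<open>E\<close> is determined by the left ideal that is the kernel of
  \<open>D \<otimes> D\<^sup>o \<rightarrow> D \<otimes>\<^sub>E D\<close>, which gives the chain condition on division subalgebras.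

  The eigen-algebra is graded by the group of weights, with all nonzero homogeneous elements invertible.
  The sum of the eigenspaces over a finitely generated group \<open>F\<close> of weights is Noetherian, by adjoining
  one eigenvector and its inverse at a time, and hence an Ore domain. The weights of its division ring
  of fractions are again \<open>F\<close>, so the chain condition on division subalgebras passes to groups of weights,
  all of which are therefore finitely generated.
\<close>

section \<open>Noetherian extensions\<close>

text \<open>All computations take place on formal sums: an ideal of
  \<open>D \<otimes> D\<^sup>o\<close> is an ideal containing the null sums, which are carried along
  as a parameter \<open>N\<close>. The same Noetherian arguments then serve the enveloping algebra,
  subrings of \<open>D\<close> (with \<open>N = {0}\<close>) and, for the flipped multiplication,
  right ideals. Null sums are recognised by normal forms: once the right entries are linearly
  independent, a sum is null only if all left entries vanish. To read a sum over \<open>A\<close> as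
  a function on \<open>V\<close> \<times> \<open>V\<close>, elements of \<open>A\<close> that are
  independent over the ground field must stay independent over the closure; automorphisms of the
  closure provide this. Irreducibility is then applied in one variable at a time. A circularity has
  to be avoided: the fractions over a group of weights are needed to see that the group is finitely
  generated, while the basis theorem needs finitely many generators. Two elements involve only
  finitely many weights, so the Ore condition for an arbitrary group is inherited from its finitely
  generated subgroups.\<close>

definition add_closed :: "'a::ab_group_add set \<Rightarrow> bool" where
  "add_closed H \<longleftrightarrow> 0 \<in> H \<and> (\<forall>x\<in>H. \<forall>y\<in>H. x - y \<in> H)"

lemma add_closedD:
  assumes "add_closed H"
  shows "0 \<in> H" "x \<in> H \<Longrightarrow> y \<in> H \<Longrightarrow> x - y \<in> H" "x \<in> H \<Longrightarrow> - x \<in> H"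
    "x \<in> H \<Longrightarrow> y \<in> H \<Longrightarrow> x + y \<in> H"
proof -
  show *: "0 \<in> H" "x \<in> H \<Longrightarrow> y \<in> H \<Longrightarrow> x - y \<in> H" for x y
    using assms by (auto simp: add_closed_def)
  show **: "x \<in> H \<Longrightarrow> - x \<in> H" for x
    using *(2)[OF *(1), of x] by simp
  show "x \<in> H \<Longrightarrow> y \<in> H \<Longrightarrow> x + y \<in> H"
    using *(2)[of x "-y"] **[of y] by simp
qed

lemma add_closed_sum: "add_closed H \<Longrightarrow> (\<And>i. i \<in> I \<Longrightarrow> f i \<in> H) \<Longrightarrow> sum f I \<in> H"
  by (induction I rule: infinite_finite_induct) (auto intro: add_closedD)

text \<open>
  The multiplication is a parameter, so that statements about right ideals are the statements
  about left ideals for the flipped multiplication.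
\<close>

locale ring_mult =
  fixes mult :: "'a::ab_group_add \<Rightarrow> 'a \<Rightarrow> 'a" (infixl "\<star>" 70) and e :: 'a
  assumes assoc: "x \<star> y \<star> z = x \<star> (y \<star> z)"
    and one_left [simp]: "e \<star> x = x" and one_right [simp]: "x \<star> e = x"
    and distl: "x \<star> (y + z) = x \<star> y + x \<star> z" and distr: "(x + y) \<star> z = x \<star> z + y \<star> z"
begin

lemma flip: "ring_mult (\<lambda>x y. y \<star> x) e"
  by unfold_locales (auto simp: assoc distl distr)

lemma mult_zero [simp]: "x \<star> 0 = 0" "0 \<star> x = 0"
  using distl[of x 0 0] distr[of 0 0 x] by auto

lemma mult_minus [simp]: "x \<star> (- y) = - (x \<star> y)" "(- x) \<star> y = - (x \<star> y)"
  using distl[of x y "-y"] distr[of x "-x" y] by (auto simp: eq_neg_iff_add_eq_0 add.commute)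

lemma mult_diff: "x \<star> (y - z) = x \<star> y - x \<star> z" "(x - y) \<star> z = x \<star> z - y \<star> z"
  using distl[of x y "-z"] distr[of x "-y" z] by auto

lemmas mult_algebra = assoc distl distr mult_diff

lemma mult_sum_left: "sum f I \<star> x = (\<Sum>i\<in>I. f i \<star> x)"
  by (induction I rule: infinite_finite_induct) (auto simp: distr)

lemma mult_sum_right: "x \<star> sum f I = (\<Sum>i\<in>I. x \<star> f i)"
  by (induction I rule: infinite_finite_induct) (auto simp: distl)

definition bracket :: "'a \<Rightarrow> 'a \<Rightarrow> 'a" where
  "bracket x y = x \<star> y - y \<star> x"

definition sub_ring :: "'a set \<Rightarrow> bool" where
  "sub_ring R \<longleftrightarrow> add_closed R \<and> e \<in> R \<and> (\<forall>x\<in>R. \<forall>y\<in>R. x \<star> y \<in> R)"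

definition two_sided :: "'a set \<Rightarrow> bool" where
  "two_sided N \<longleftrightarrow> add_closed N \<and> (\<forall>x. \<forall>y\<in>N. x \<star> y \<in> N \<and> y \<star> x \<in> N)"

text \<open>Preimages of the left ideals of \<open>R\<close> modulo \<open>N\<close>. With this
  encoding no quotient ring is formed until the final statement about the enveloping
  algebra.\<close>

definition left_ideal_over :: "'a set \<Rightarrow> 'a set \<Rightarrow> 'a set \<Rightarrow> bool" where
  "left_ideal_over N R I \<longleftrightarrow> add_closed I \<and> N \<subseteq> I \<and> I \<subseteq> R \<and> (\<forall>r\<in>R. \<forall>x\<in>I. r \<star> x \<in> I)"

definition left_noetherian :: "'a set \<Rightarrow> 'a set \<Rightarrow> bool" where
  "left_noetherian N R \<longleftrightarrow> acc_on (left_ideal_over N R)"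

lemma sub_ringD:
  assumes "sub_ring R"
  shows "add_closed R" "e \<in> R" "x \<in> R \<Longrightarrow> y \<in> R \<Longrightarrow> x \<star> y \<in> R"
    "0 \<in> R" "x \<in> R \<Longrightarrow> y \<in> R \<Longrightarrow> x - y \<in> R" "x \<in> R \<Longrightarrow> - x \<in> R"
    "x \<in> R \<Longrightarrow> y \<in> R \<Longrightarrow> x + y \<in> R"
  using assms add_closedD[of R] by (auto simp: sub_ring_def)

text \<open>Horner form of the sums of \<xi>^i r_i with i < n. The bound is strict, so that index 0
  is the zero polynomial, and the coefficients stand to the right of the powers of \<xi>.\<close>

primrec lower_polys :: "'a set \<Rightarrow> 'a \<Rightarrow> nat \<Rightarrow> 'a set" where
  "lower_polys R \<xi> 0 = {0}"
| "lower_polys R \<xi> (Suc n) = {r + \<xi> \<star> w | r w. r \<in> R \<and> w \<in> lower_polys R \<xi> n}"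

definition adjoin :: "'a set \<Rightarrow> 'a \<Rightarrow> 'a set" where
  "adjoin R \<xi> = (\<Union>n. lower_polys R \<xi> n)"

text \<open>The two exchange conditions cover both later uses: commutators that fall into
  \<open>R\<close> (take \<open>r' = r\<close>), and conjugation by a unit (the difference is then
  0). The first makes products of polynomials polynomials, the second makes the leading coefficients
  a left ideal.\<close>

context
  fixes N R \<xi>
  assumes N: "two_sided N" "N \<subseteq> R" and R: "sub_ring R"
    and left_to_right: "\<And>r. r \<in> R \<Longrightarrow> \<exists>r'\<in>R. r \<star> \<xi> - \<xi> \<star> r' \<in> R"
    and right_to_left: "\<And>r. r \<in> R \<Longrightarrow> \<exists>r'\<in>R. r' \<star> \<xi> - \<xi> \<star> r \<in> R"
begin

private abbreviation "P \<equiv> lower_polys R \<xi>"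
private abbreviation pow where "pow n \<equiv> ((\<star>) \<xi> ^^ n)"

lemma lower_SucI: "r \<in> R \<Longrightarrow> w \<in> P n \<Longrightarrow> r + \<xi> \<star> w \<in> P (Suc n)"
  by auto

lemma add_closed_lower: "add_closed (P n)"
proof (induction n)
  case (Suc n)
  have "0 \<in> P (Suc n)"
    using lower_SucI[OF sub_ringD(4)[OF R] add_closedD(1)[OF Suc]] by simp
  moreover have "x - y \<in> P (Suc n)" if xy: "x \<in> P (Suc n)" "y \<in> P (Suc n)" for x y
  proof -
    obtain r w r' w' where eq: "x = r + \<xi> \<star> w" "y = r' + \<xi> \<star> w'" and
      mem: "r \<in> R" "r' \<in> R" "w \<in> P n" "w' \<in> P n"
      using xy by auto
    have "x - y = (r - r') + \<xi> \<star> (w - w')"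
      by (simp add: eq mult_algebra)
    then show ?thesis
      using lower_SucI[OF sub_ringD(5)[OF R mem(1,2)] add_closedD(2)[OF Suc mem(3,4)]] by simp
  qed
  ultimately show ?case
    unfolding add_closed_def by blast
qed (auto simp: add_closed_def)

lemma lower_mono: "P n \<subseteq> P (Suc n)"
proof (induction n)
  case 0
  have "(0::'a) = 0 + \<xi> \<star> 0" by simp
  then show ?case using sub_ringD(4)[OF R] by fastforce
next
  case (Suc n)
  show ?case
  proof
    fix x assume "x \<in> P (Suc n)"
    then obtain r w where x: "x = r + \<xi> \<star> w" "r \<in> R" "w \<in> P n" by auto
    then show "x \<in> P (Suc (Suc n))" using lower_SucI[of r w "Suc n"] Suc by blast
  qed
qed

lemma lower_mono': "m \<le> n \<Longrightarrow> P m \<subseteq> P n"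
  using lower_mono by (rule lift_Suc_mono_le)

text \<open>The degree bound does not grow: \<open>s\<close> passes \<xi> and turns into
  \<open>s'\<close>, and the correction is a coefficient acting on a polynomial of lower
  degree.\<close>

lemma coeff_mult_lower: "s \<in> R \<Longrightarrow> w \<in> P n \<Longrightarrow> s \<star> w \<in> P n"
proof (induction n arbitrary: s w)
  case (Suc n)
  obtain r v where w: "w = r + \<xi> \<star> v" "r \<in> R" "v \<in> P n" using Suc.prems by auto
  obtain s' where s': "s' \<in> R" "s \<star> \<xi> - \<xi> \<star> s' \<in> R" using left_to_right Suc.prems by blast
  have "s \<star> w = (s \<star> r + \<xi> \<star> (s' \<star> v)) + (s \<star> \<xi> - \<xi> \<star> s') \<star> v"
    by (simp add: w mult_algebra)
  moreover have "s \<star> r + \<xi> \<star> (s' \<star> v) \<in> P (Suc n)"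
    using Suc.IH[OF s'(1) w(3)] sub_ringD(3)[OF R Suc.prems(1) w(2)] by auto
  moreover have "(s \<star> \<xi> - \<xi> \<star> s') \<star> v \<in> P (Suc n)"
    using Suc.IH[OF s'(2) w(3)] lower_mono by blast
  ultimately show ?case
    using add_closedD(4)[OF add_closed_lower] by metis
qed auto

lemma gen_mult_lower: "w \<in> P n \<Longrightarrow> \<xi> \<star> w \<in> P (Suc n)"
  using lower_SucI[OF sub_ringD(4)[OF R], of w n] by simp

lemma lower_mult_lower: "w \<in> P n \<Longrightarrow> v \<in> P m \<Longrightarrow> w \<star> v \<in> P (n + m)"
proof (induction n arbitrary: w)
  case (Suc n)
  obtain r u where w: "w = r + \<xi> \<star> u" "r \<in> R" "u \<in> P n" using Suc.prems by auto
  have "r \<star> v \<in> P (Suc n + m)"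
    using coeff_mult_lower[OF w(2) Suc.prems(2)] lower_mono'[of m "Suc n + m"] by auto
  moreover have "\<xi> \<star> (u \<star> v) \<in> P (Suc n + m)"
    using gen_mult_lower[OF Suc.IH[OF w(3) Suc.prems(2)]] by simp
  ultimately show ?case
    using add_closedD(4)[OF add_closed_lower] by (simp only: w mult_algebra)
qed (use add_closedD[OF add_closed_lower] in auto)

lemma coeff_subset_adjoin: "R \<subseteq> adjoin R \<xi>"
proof -
  have "r = r + \<xi> \<star> 0" for r by simp
  then have "R \<subseteq> P (Suc 0)" by auto
  then show ?thesis unfolding adjoin_def by blast
qed

lemma gen_in_adjoin: "\<xi> \<in> adjoin R \<xi>"
proof -
  have "e \<in> P (Suc 0)" using lower_SucI[OF sub_ringD(2)[OF R], of 0 0] by simp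
  from gen_mult_lower[OF this] show ?thesis unfolding adjoin_def by (metis UN_I UNIV_I one_right)
qed

lemma sub_ring_adjoin: "sub_ring (adjoin R \<xi>)"
  unfolding sub_ring_def
proof (intro conjI ballI)
  show "e \<in> adjoin R \<xi>" using coeff_subset_adjoin sub_ringD(2)[OF R] by auto
  show "x \<star> y \<in> adjoin R \<xi>" if "x \<in> adjoin R \<xi>" "y \<in> adjoin R \<xi>" for x y
    using that lower_mult_lower unfolding adjoin_def by blast
  have "x - y \<in> adjoin R \<xi>" if xy: "x \<in> adjoin R \<xi>" "y \<in> adjoin R \<xi>" for x y
  proof -
    obtain m n where "x \<in> P m" "y \<in> P n" using xy by (auto simp: adjoin_def)
    then have "x \<in> P (max m n)" "y \<in> P (max m n)"
      using lower_mono'[of m "max m n"] lower_mono'[of n "max m n"] by auto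
    then have "x - y \<in> P (max m n)" by (rule add_closedD(2)[OF add_closed_lower])
    then show ?thesis by (auto simp: adjoin_def)
  qed
  then show "add_closed (adjoin R \<xi>)"
    using coeff_subset_adjoin sub_ringD(4)[OF R] unfolding add_closed_def by blast
qed

text \<open>The Horner form exposes the constant term, whereas the basis theorem works with the
  leading one.\<close>

lemma lower_Suc_leading: "x \<in> P (Suc n) \<longleftrightarrow> (\<exists>r\<in>R. \<exists>p\<in>P n. x = pow n r + p)"
proof (induction n arbitrary: x)
  case (Suc n)
  show ?case
  proof
    assume "x \<in> P (Suc (Suc n))"
    then obtain r w where x: "x = r + \<xi> \<star> w" "r \<in> R" "w \<in> P (Suc n)" by auto
    then obtain s p where "w = pow n s + p" "s \<in> R" "p \<in> P n" using Suc by blast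
    then show "\<exists>r\<in>R. \<exists>p\<in>P (Suc n). x = pow (Suc n) r + p"
      using x by (intro bexI[of _ s] bexI[of _ "r + \<xi> \<star> p"]) (auto simp: distl)
  next
    assume "\<exists>r\<in>R. \<exists>p\<in>P (Suc n). x = pow (Suc n) r + p"
    then obtain r p where x: "x = pow (Suc n) r + p" "r \<in> R" "p \<in> P (Suc n)" by blast
    then obtain s w where p: "p = s + \<xi> \<star> w" "s \<in> R" "w \<in> P n" by auto
    have "pow n r + w \<in> P (Suc n)" using Suc p x by blast
    moreover have "x = s + \<xi> \<star> (pow n r + w)" by (simp add: x p distl algebra_simps)
    ultimately show "x \<in> P (Suc (Suc n))" using p by auto
  qed
qed auto

lemma pow_diff: "pow n (x - y) = pow n x - pow n y"
  by (induction n) (auto simp: mult_algebra)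

text \<open>To multiply a leading coefficient by \<open>s'\<close> one needs an element that becomes
  \<open>s'\<close> after passing n powers of \<xi>; it is found by applying
  \<open>right_to_left\<close> once for each power. The witness is independent of
  \<open>r\<close>.\<close>

lemma pow_leading_mult: "s' \<in> R \<Longrightarrow> \<exists>s\<in>R. \<forall>r\<in>R. s \<star> pow n r - pow n (s' \<star> r) \<in> P n"
proof (induction n)
  case (Suc n)
  obtain s1 where s1: "s1 \<in> R" "\<And>r. r \<in> R \<Longrightarrow> s1 \<star> pow n r - pow n (s' \<star> r) \<in> P n"
    using Suc by blast
  obtain s where s: "s \<in> R" "s \<star> \<xi> - \<xi> \<star> s1 \<in> R" using right_to_left s1(1) by blast
  have "s \<star> pow (Suc n) r - pow (Suc n) (s' \<star> r) \<in> P (Suc n)" if "r \<in> R" for r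
  proof -
    have "s \<star> pow (Suc n) r - pow (Suc n) (s' \<star> r) =
      (s \<star> \<xi> - \<xi> \<star> s1) \<star> pow n r + \<xi> \<star> (s1 \<star> pow n r - pow n (s' \<star> r))"
      by (simp add: mult_algebra)
    moreover have "pow n r \<in> P (Suc n)"
      using lower_Suc_leading that add_closedD(1)[OF add_closed_lower] by (metis add_0_right)
    ultimately show ?thesis
      using coeff_mult_lower[OF s(2)] gen_mult_lower[OF s1(2)[OF that]] add_closedD(4)[OF add_closed_lower]
      by metis
  qed
  then show ?case using s by blast
qed auto

private definition leading where
  "leading n I = {r\<in>R. \<exists>p\<in>P n. pow n r + p \<in> I}"

lemma left_ideal_leading:
  assumes I: "left_ideal_over N (adjoin R \<xi>) I"
  shows "left_ideal_over N R (leading n I)"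
proof -
  have I': "add_closed I" "N \<subseteq> I" "\<And>r x. r \<in> adjoin R \<xi> \<Longrightarrow> x \<in> I \<Longrightarrow> r \<star> x \<in> I"
    using I by (auto simp: left_ideal_over_def)
  have pow_N: "pow n r \<in> N" if "r \<in> N" for r
    using that N(1) by (induction n) (auto simp: two_sided_def)
  have "N \<subseteq> leading n I"
  proof
    fix r assume "r \<in> N"
    then have "pow n r + 0 \<in> I" using pow_N I' by auto
    then show "r \<in> leading n I"
      using \<open>r \<in> N\<close> N add_closedD(1)[OF add_closed_lower] unfolding leading_def by blast
  qed
  moreover have "r \<star> x \<in> leading n I" if rx: "r \<in> R" "x \<in> leading n I" for r x
  proof -
    obtain p where p: "x \<in> R" "p \<in> P n" "pow n x + p \<in> I"
      using rx by (auto simp: leading_def)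
    obtain s where s: "s \<in> R" "s \<star> pow n x - pow n (r \<star> x) \<in> P n"
      using pow_leading_mult[OF rx(1)] p(1) by blast
    have "pow n (r \<star> x) + ((s \<star> pow n x - pow n (r \<star> x)) + s \<star> p) = s \<star> (pow n x + p)"
      by (simp add: mult_algebra)
    moreover have "s \<star> (pow n x + p) \<in> I"
      using I'(3) coeff_subset_adjoin s p by auto
    moreover have "(s \<star> pow n x - pow n (r \<star> x)) + s \<star> p \<in> P n"
      using s p coeff_mult_lower add_closedD(4)[OF add_closed_lower] by blast
    ultimately show ?thesis
      using sub_ringD(3)[OF R rx(1) p(1)] unfolding leading_def mem_Collect_eq by metis
  qed
  moreover have "x - y \<in> leading n I" if xy: "x \<in> leading n I" "y \<in> leading n I" for x y
  proof -
    obtain p q where pq: "p \<in> P n" "q \<in> P n" "pow n x + p \<in> I" "pow n y + q \<in> I" "x \<in> R" "y \<in> R"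
      using xy by (auto simp: leading_def)
    have "pow n (x - y) + (p - q) = (pow n x + p) - (pow n y + q)" by (simp add: pow_diff)
    then show ?thesis
      using pq add_closedD(2)[OF I'(1)] add_closedD(2)[OF add_closed_lower] sub_ringD(5)[OF R]
      unfolding leading_def mem_Collect_eq by metis
  qed
  moreover have "leading n I \<subseteq> R" by (auto simp: leading_def)
  moreover have "0 \<in> leading n I"
    using \<open>N \<subseteq> leading n I\<close> N(1) by (auto simp: two_sided_def add_closed_def)
  ultimately show ?thesis unfolding left_ideal_over_def add_closed_def by blast
qed

lemma leading_mono: "I \<subseteq> J \<Longrightarrow> leading n I \<subseteq> leading n J"
  by (auto simp: leading_def)

lemma leading_Suc:
  assumes I: "left_ideal_over N (adjoin R \<xi>) I"
  shows "leading n I \<subseteq> leading (Suc n) I"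
proof
  fix r assume "r \<in> leading n I"
  then obtain p where p: "r \<in> R" "p \<in> P n" "pow n r + p \<in> I" by (auto simp: leading_def)
  have "\<xi> \<star> (pow n r + p) \<in> I"
    using I gen_in_adjoin p by (auto simp: left_ideal_over_def)
  then have "pow (Suc n) r + \<xi> \<star> p \<in> I" by (simp add: distl)
  then show "r \<in> leading (Suc n) I"
    using gen_mult_lower[OF p(2)] p(1) unfolding leading_def by blast
qed

text \<open>Descent on the degree: from an element of \<open>J\<close> subtract an element of
  \<open>I\<close> with the same leading coefficient.\<close>

lemma ideal_eq_of_leading:
  assumes IJ: "left_ideal_over N (adjoin R \<xi>) I" "left_ideal_over N (adjoin R \<xi>) J" "I \<subseteq> J"
    and eq: "\<And>n. leading n J = leading n I"
  shows "J = I"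
proof -
  have "x \<in> I" if "x \<in> J" "x \<in> P n" for x n
    using that
  proof (induction n arbitrary: x)
    case 0
    then show ?case using IJ(1) by (auto simp: left_ideal_over_def add_closed_def)
  next
    case (Suc n)
    obtain r p where x: "x = pow n r + p" "r \<in> R" "p \<in> P n"
      using lower_Suc_leading Suc.prems(2) by blast
    then have "r \<in> leading n J" using Suc.prems unfolding leading_def by blast
    then have "r \<in> leading n I" using eq by simp
    then obtain q where q: "q \<in> P n" "pow n r + q \<in> I" unfolding leading_def by blast
    have "p - q = x - (pow n r + q)" by (simp add: x)
    moreover have "add_closed J" "pow n r + q \<in> J"
      using q IJ by (auto simp: left_ideal_over_def)
    ultimately have "p - q \<in> J"
      using add_closedD(2) Suc.prems(1) by metis
    then have "p - q \<in> I"
      by (rule Suc.IH[OF _ add_closedD(2)[OF add_closed_lower x(3) q(1)]])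
    moreover have "x = (p - q) + (pow n r + q)" by (simp add: x)
    ultimately show ?case
      using q(2) IJ(1) add_closedD(4)[of I] unfolding left_ideal_over_def by metis
  qed
  moreover have "J \<subseteq> adjoin R \<xi>" using IJ(2) by (simp add: left_ideal_over_def)
  ultimately have "J \<subseteq> I" unfolding adjoin_def by blast
  then show ?thesis using IJ(3) by (rule subset_antisym)
qed

text \<open>
  Hilbert's basis theorem: the doubly indexed family of ideals of leading coefficients is
  increasing in both directions.
\<close>

theorem left_noetherian_adjoin:
  assumes noeth: "left_noetherian N R"
  shows "left_noetherian N (adjoin R \<xi>)"
  unfolding left_noetherian_def acc_on_def
proof (intro allI impI)
  fix I :: "nat \<Rightarrow> 'a set"
  assume "(\<forall>n. left_ideal_over N (adjoin R \<xi>) (I n)) \<and> (\<forall>n. I n \<subseteq> I (Suc n))"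
  then have I: "\<And>n. left_ideal_over N (adjoin R \<xi>) (I n)" and inc: "\<And>n. I n \<subseteq> I (Suc n)" by auto
  have mono: "I m \<subseteq> I n" if "m \<le> n" for m n using lift_Suc_mono_le[of I, OF inc that] .
  have stab: "\<exists>M. \<forall>n\<ge>M. f n = f M"
    if "\<And>n. left_ideal_over N R (f n)" "\<And>n. f n \<subseteq> f (Suc n)" for f :: "nat \<Rightarrow> 'a set"
    using noeth that unfolding left_noetherian_def acc_on_def by blast
  have lead_mono: "leading m (I k) \<subseteq> leading n (I k)" if "m \<le> n" for m n k
    using lift_Suc_mono_le[of "\<lambda>n. leading n (I k)", OF leading_Suc[OF I] that] .
  \<comment> \<open>The diagonal of the doubly indexed family is itself an increasing chain.\<close>
  obtain M where M: "\<And>n. n \<ge> M \<Longrightarrow> leading n (I n) = leading M (I M)"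
    using stab[of "\<lambda>n. leading n (I n)"] left_ideal_leading[OF I] leading_mono[OF inc] leading_Suc[OF I]
    by (metis (no_types, lifting) subset_trans)
  have "\<exists>M'. \<forall>k\<ge>M'. leading n (I k) = leading n (I M')" for n
    using stab[of "\<lambda>k. leading n (I k)"] left_ideal_leading[OF I] leading_mono[OF inc] by blast
  then obtain g where g: "\<And>n k. k \<ge> g n \<Longrightarrow> leading n (I k) = leading n (I (g n))" by metis
  \<comment> \<open>Degrees up to \<open>M\<close> are finitely many, each with its own
    stabilisation index \<open>g n\<close>. Degrees above \<open>M\<close> are squeezed between the
    value at (\<open>M\<close>, \<open>M\<close>) and a later value on the diagonal.\<close>
  define B where "B = Max (insert M (g ` {..M}))"
  have B: "M \<le> B" "\<And>n. n \<le> M \<Longrightarrow> g n \<le> B" unfolding B_def by (intro Max_ge; auto)+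
  have "leading n (I k) = leading n (I B)" if "k \<ge> B" for n k
  proof (cases "n \<le> M")
    case True
    then show ?thesis using g[of n] B that by (metis order.trans)
  next
    case False
    have "leading n (I j) = leading M (I M)" if "j \<ge> B" for j
    proof
      have "leading n (I j) \<subseteq> leading (max n j) (I (max n j))"
        by (rule order_trans[OF lead_mono leading_mono[OF mono]]) simp_all
      also have "\<dots> = leading M (I M)" using False by (intro M) simp
      finally show "leading n (I j) \<subseteq> leading M (I M)" .
      have "leading M (I M) \<subseteq> leading M (I j)" by (intro leading_mono mono order_trans[OF B(1) that])
      also have "\<dots> \<subseteq> leading n (I j)" using False by (intro lead_mono) simp
      finally show "leading M (I M) \<subseteq> leading n (I j)" .
    qed
    then show ?thesis using that by simp
  qed
  then have "I k = I B" if "k \<ge> B" for k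
    using ideal_eq_of_leading[OF I I mono[OF that]] that by blast
  then show "\<exists>B. \<forall>n\<ge>B. I n = I B" by blast
qed

end

text \<open>The multiplier \<open>u\<close> is invertible from the left modulo \<open>N\<close>, so
  an ideal of \<open>R'\<close> is determined by its intersection with \<open>R\<close>.
  Denominators may depend on the element, and no multiplicative set has to be named.\<close>

lemma left_noetherian_localisation:
  assumes N: "two_sided N" and R: "sub_ring R" "sub_ring R'" "R \<subseteq> R'" "N \<subseteq> R"
    and denom: "\<And>x. x \<in> R' \<Longrightarrow> \<exists>u\<in>R'. \<exists>v\<in>R'. v \<star> u - e \<in> N \<and> u \<star> x \<in> R"
    and noeth: "left_noetherian N R"
  shows "left_noetherian N R'"
  unfolding left_noetherian_def acc_on_def
proof (intro allI impI)
  fix I :: "nat \<Rightarrow> 'a set"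
  assume "(\<forall>n. left_ideal_over N R' (I n)) \<and> (\<forall>n. I n \<subseteq> I (Suc n))"
  then have I: "\<And>n. left_ideal_over N R' (I n)" and inc: "\<And>n. I n \<subseteq> I (Suc n)" by auto
  have mono: "I m \<subseteq> I n" if "m \<le> n" for m n using lift_Suc_mono_le[of I, OF inc that] .
  have "left_ideal_over N R (I n \<inter> R)" for n
  proof -
    have "add_closed (I n)" "N \<subseteq> I n" "\<And>r x. r \<in> R \<Longrightarrow> x \<in> I n \<Longrightarrow> r \<star> x \<in> I n"
      using I[of n] R(3) unfolding left_ideal_over_def by blast+
    then show ?thesis
      using sub_ringD[OF R(1)] R(4) unfolding left_ideal_over_def add_closed_def by simp
  qed
  then obtain M where M: "\<And>n. n \<ge> M \<Longrightarrow> I n \<inter> R = I M \<inter> R"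
    using noeth[unfolded left_noetherian_def acc_on_def, rule_format, of "\<lambda>n. I n \<inter> R"] inc by blast
  have "I n \<subseteq> I M" if "n \<ge> M" for n
  proof
    fix x assume x: "x \<in> I n"
    then have "x \<in> R'" using I[of n] by (auto simp: left_ideal_over_def)
    then obtain u v where uv: "u \<in> R'" "v \<in> R'" "v \<star> u - e \<in> N" "u \<star> x \<in> R" using denom by blast
    have "u \<star> x \<in> I n" using I[of n] x uv(1) unfolding left_ideal_over_def by blast
    then have "u \<star> x \<in> I M" using uv(4) M[OF that] by blast
    then have "v \<star> (u \<star> x) \<in> I M" using I[of M] uv(2) unfolding left_ideal_over_def by blast
    moreover have "(v \<star> u - e) \<star> x \<in> I M"
      using N uv(3) I[of M] unfolding left_ideal_over_def two_sided_def by blast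
    moreover have "x = v \<star> (u \<star> x) - (v \<star> u - e) \<star> x" by (simp add: mult_algebra)
    ultimately show "x \<in> I M" using I[of M] add_closedD(2)[of "I M"]
      unfolding left_ideal_over_def by metis
  qed
  then have "\<forall>n\<ge>M. I n = I M" using mono by (simp add: subset_antisym)
  then show "\<exists>B. \<forall>n\<ge>B. I n = I B" ..
qed

end


section \<open>Tensor products over a central field\<close>

lemma frag_cmul_single: "frag_cmul m (Poly_Mapping.single x n) = Poly_Mapping.single x (m * n)"
  by (intro poly_mapping_eqI) (auto simp: lookup_single when_def)

lemma frag_extend_fun_add: "frag_extend (\<lambda>x. f x + g x) p = frag_extend f p + frag_extend g p"
  by (simp add: frag_extend_def sum.distrib frag_cmul_distrib2)

lemma frag_extend_fun_diff: "frag_extend (\<lambda>x. f x - g x) p = frag_extend f p - frag_extend g p"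
  using frag_extend_fun_add[of "\<lambda>x. f x - g x" g p] by (simp add: algebra_simps)

lemma frag_extend_zero_fun [simp]: "frag_extend (\<lambda>x. 0) p = 0"
  by (simp add: frag_extend_def)

text \<open>The product of \<open>D \<otimes> D\<^sup>o\<close>, lifted to formal sums; the second
  entries are therefore multiplied in reverse order. Associativity and the unit laws hold already
  here, before null sums are factored out.\<close>

definition tensor_mult :: "(('d::division_ring \<times> 'd) \<Rightarrow>\<^sub>0 int) \<Rightarrow> ('d \<times> 'd \<Rightarrow>\<^sub>0 int) \<Rightarrow> ('d \<times> 'd \<Rightarrow>\<^sub>0 int)" where
  "tensor_mult p q = frag_extend (\<lambda>x. frag_extend (\<lambda>y. pure (fst x * fst y) (snd y * snd x)) q) p"

lemma tensor_mult_pure: "tensor_mult (pure a b) (pure c d) = pure (a * c) (d * b)"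
  by (simp add: tensor_mult_def)

lemma tensor_mult_distl: "tensor_mult p (q + r) = tensor_mult p q + tensor_mult p r"
  by (simp add: tensor_mult_def frag_extend_add frag_extend_fun_add)

lemma tensor_mult_distr: "tensor_mult (p + q) r = tensor_mult p r + tensor_mult q r"
  by (simp add: tensor_mult_def frag_extend_add)

lemma tensor_mult_diffl: "tensor_mult p (q - r) = tensor_mult p q - tensor_mult p r"
  by (simp add: tensor_mult_def frag_extend_diff frag_extend_fun_diff)

lemma tensor_mult_diffr: "tensor_mult (p - q) r = tensor_mult p r - tensor_mult q r"
  by (simp add: tensor_mult_def frag_extend_diff)

lemma tensor_mult_zero [simp]: "tensor_mult 0 r = 0" "tensor_mult r 0 = 0"
  by (simp_all add: tensor_mult_def)

lemma tensor_induct [consumes 1, case_names zero pure diff]: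
  assumes "Poly_Mapping.keys Z \<subseteq> P \<times> Q" "Prop 0" "\<And>a b. a \<in> P \<Longrightarrow> b \<in> Q \<Longrightarrow> Prop (pure a b)"
    "\<And>x y. Prop x \<Longrightarrow> Prop y \<Longrightarrow> Prop (x - y)"
  shows "Prop Z"
  using assms(1) by (rule frag_induction) (use assms in auto)

lemma ring_mult_tensor: "ring_mult tensor_mult (pure 1 1)"
proof
  fix x y z :: "('d::division_ring \<times> 'd) \<Rightarrow>\<^sub>0 int"
  have 1: "tensor_mult (tensor_mult (pure a b) (pure c d)) z = tensor_mult (pure a b) (tensor_mult (pure c d) z)"
    for a b c d :: 'd and z
    by (rule tensor_induct[of z UNIV UNIV])
      (auto simp: tensor_mult_pure tensor_mult_diffl mult.assoc)
  have 2: "tensor_mult (tensor_mult (pure a b) y) z = tensor_mult (pure a b) (tensor_mult y z)"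
    for a b :: 'd and y
    by (rule tensor_induct[of y UNIV UNIV]) (auto simp: 1 tensor_mult_diffl tensor_mult_diffr)
  show "tensor_mult (tensor_mult x y) z = tensor_mult x (tensor_mult y z)"
    by (rule tensor_induct[of x UNIV UNIV]) (auto simp: 2 tensor_mult_diffr)
  show "tensor_mult (pure 1 1) x = x"
    by (rule tensor_induct[of x UNIV UNIV]) (auto simp: tensor_mult_pure tensor_mult_diffl)
  show "tensor_mult x (pure 1 1) = x"
    by (rule tensor_induct[of x UNIV UNIV]) (auto simp: tensor_mult_pure tensor_mult_diffr)
qed (auto simp: tensor_mult_distl tensor_mult_distr)

interpretation tensor: ring_mult tensor_mult "pure 1 1"
  by (rule ring_mult_tensor)

lemma mult_formal_ring:
  "p \<otimes>\<^bsub>formal_ring (set_ring UNIV) (opposite (set_ring UNIV))\<^esub> q = tensor_mult p q"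
  by (simp add: formal_ring_def tensor_mult_def frag_extend_def frag_cmul_sum frag_cmul_single
      set_ring_def opposite_def)

definition pair_extend :: "('a \<Rightarrow> 'b \<Rightarrow> 'c::ring_1) \<Rightarrow> ('a \<times> 'b \<Rightarrow>\<^sub>0 int) \<Rightarrow> 'c" where
  "pair_extend f Z = (\<Sum>x\<in>Poly_Mapping.keys Z. of_int (Poly_Mapping.lookup Z x) * f (fst x) (snd x))"

lemma pair_extend_superset:
  "finite S \<Longrightarrow> Poly_Mapping.keys Z \<subseteq> S \<Longrightarrow>
    pair_extend f Z = (\<Sum>x\<in>S. of_int (Poly_Mapping.lookup Z x) * f (fst x) (snd x))"
  unfolding pair_extend_def by (rule sum.mono_neutral_left) (auto simp: in_keys_iff)

lemma pair_extend_pure [simp]: "pair_extend f (pure a b) = f a b"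
  by (simp add: pair_extend_def)

lemma pair_extend_zero [simp]: "pair_extend f 0 = 0"
  by (simp add: pair_extend_def)

lemma pair_extend_diff: "pair_extend f (Z - Y) = pair_extend f Z - pair_extend f Y"
proof -
  let ?S = "Poly_Mapping.keys Z \<union> Poly_Mapping.keys Y"
  have "Poly_Mapping.keys (Z - Y) \<subseteq> ?S" by (rule keys_diff)
  then show ?thesis
    by (simp add: pair_extend_superset[of ?S] lookup_minus sum_subtractf left_diff_distrib)
qed

lemma pair_extend_uminus: "pair_extend f (- Z) = - pair_extend f Z"
  using pair_extend_diff[of f 0 Z] by simp

lemma pair_extend_add: "pair_extend f (Z + Y) = pair_extend f Z + pair_extend f Y"
  using pair_extend_diff[of f Z "- Y"] by (simp add: pair_extend_uminus)

lemma pair_extend_sum: "pair_extend f (\<Sum>i\<in>I. g i) = (\<Sum>i\<in>I. pair_extend f (g i))"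
  by (induction I rule: infinite_finite_induct) (auto simp: pair_extend_add)

locale central_field =
  fixes \<kappa> :: "'k::field \<Rightarrow> 'd::division_ring"
  assumes \<kappa>_add: "\<kappa> (a + b) = \<kappa> a + \<kappa> b" and \<kappa>_mult: "\<kappa> (a * b) = \<kappa> a * \<kappa> b"
    and \<kappa>_1 [simp]: "\<kappa> 1 = 1" and central: "\<kappa> a * x = x * \<kappa> a"
begin

lemma \<kappa>_0 [simp]: "\<kappa> 0 = 0"
  using \<kappa>_add[of 0 0] by simp

lemma \<kappa>_minus: "\<kappa> (- a) = - \<kappa> a"
  using \<kappa>_add[of a "- a"] by (simp add: eq_neg_iff_add_eq_0 add.commute)

lemma \<kappa>_diff: "\<kappa> (a - b) = \<kappa> a - \<kappa> b"
  using \<kappa>_add[of a "- b"] by (simp add: \<kappa>_minus)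

lemma \<kappa>_inverse: "\<kappa> (inverse a) = inverse (\<kappa> a)"
proof (cases "a = 0")
  case False
  then have "\<kappa> a * \<kappa> (inverse a) = 1" by (simp flip: \<kappa>_mult)
  then show ?thesis by (metis inverse_unique)
qed simp

lemma \<kappa>_eq_0 [simp]: "\<kappa> a = 0 \<longleftrightarrow> a = 0"
  using \<kappa>_inverse[of a] \<kappa>_mult[of a "inverse a"] by (metis \<kappa>_0 \<kappa>_1 mult_zero_left right_inverse zero_neq_one)

abbreviation scale :: "'k \<Rightarrow> 'd \<Rightarrow> 'd" where
  "scale c x \<equiv> \<kappa> c * x"

sublocale vs: vector_space scale
  by unfold_locales (auto simp: \<kappa>_add \<kappa>_mult distrib_left distrib_right mult.assoc)

text \<open>Relations whose generators have entries in \<open>P\<close> and \<open>Q\<close>. This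
  is kept apart from \<open>N\<close> because evaluation at points is meaningful on the coordinate
  ring only, so a relation between its elements must be witnessed inside it.\<close>

definition null :: "'d set \<Rightarrow> 'd set \<Rightarrow> (('d \<times> 'd) \<Rightarrow>\<^sub>0 int) set" where
  "null P Q = tensor_null (add_monoid (set_ring P)) (add_monoid (set_ring Q)) scale scale"

lemma null_add_left: "a \<in> P \<Longrightarrow> a' \<in> P \<Longrightarrow> b \<in> Q \<Longrightarrow> pure (a + a') b - pure a b - pure a' b \<in> null P Q"
  using tensor_null.left_additive[of a "add_monoid (set_ring P)" a' b "add_monoid (set_ring Q)"]
  by (auto simp: null_def set_ring_def)

lemma null_add_right: "a \<in> P \<Longrightarrow> b \<in> Q \<Longrightarrow> b' \<in> Q \<Longrightarrow> pure a (b + b') - pure a b - pure a b' \<in> null P Q"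
  using tensor_null.right_additive[of a "add_monoid (set_ring P)" b "add_monoid (set_ring Q)" b']
  by (auto simp: null_def set_ring_def)

lemma null_balanced: "a \<in> P \<Longrightarrow> b \<in> Q \<Longrightarrow> pure (scale c a) b - pure a (scale c b) \<in> null P Q"
  using tensor_null.balanced[of a "add_monoid (set_ring P)" b "add_monoid (set_ring Q)"]
  by (auto simp: null_def set_ring_def)

lemma add_closed_null: "add_closed (null P Q)"
  by (auto simp: null_def add_closed_def intro: tensor_null.zero tensor_null.diff)

lemma null_induct [consumes 1, case_names left right balanced zero diff]:
  assumes "Z \<in> null P Q"
    "\<And>a a' b. a \<in> P \<Longrightarrow> a' \<in> P \<Longrightarrow> b \<in> Q \<Longrightarrow> Prop (pure (a + a') b - pure a b - pure a' b)"
    "\<And>a b b'. a \<in> P \<Longrightarrow> b \<in> Q \<Longrightarrow> b' \<in> Q \<Longrightarrow> Prop (pure a (b + b') - pure a b - pure a b')"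
    "\<And>a b c. a \<in> P \<Longrightarrow> b \<in> Q \<Longrightarrow> Prop (pure (scale c a) b - pure a (scale c b))"
    "Prop 0" "\<And>x y. Prop x \<Longrightarrow> Prop y \<Longrightarrow> Prop (x - y)"
  shows "Prop Z"
  using assms(1) unfolding null_def
  by (induction rule: tensor_null.induct) (use assms in \<open>auto simp: set_ring_def\<close>)

lemmas nullD = add_closedD[OF add_closed_null]

lemma null_mono: "P \<subseteq> P' \<Longrightarrow> Q \<subseteq> Q' \<Longrightarrow> null P Q \<subseteq> null P' Q'"
proof
  fix Z assume PQ: "P \<subseteq> P'" "Q \<subseteq> Q'" and "Z \<in> null P Q"
  from this(3) show "Z \<in> null P' Q'"
    by (induction rule: null_induct)
      (use PQ in \<open>auto intro: null_add_left null_add_right null_balanced nullD\<close>)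
qed

abbreviation "N \<equiv> null UNIV UNIV"

lemma two_sided_null: "tensor.two_sided N"
  unfolding tensor.two_sided_def
proof (intro conjI allI ballI)
  fix Z Y assume Y: "Y \<in> N"
  have *: "tensor_mult (pure a b) Y \<in> N \<and> tensor_mult Y (pure a b) \<in> N" for a b
    using Y
  proof (induction rule: null_induct)
    case (balanced c d r)
    have "scale r a * c = a * scale r c" "scale r (a * c) = a * (scale r c)" "d * scale r b = scale r (d * b)"
      by (metis central mult.assoc)+
    then show ?case
      using null_balanced[of "a * c" UNIV "d * b" UNIV r] null_balanced[of "c * a" UNIV "b * d" UNIV r]
      by (simp add: tensor_mult_diffl tensor_mult_diffr tensor_mult_pure mult.assoc)
         (metis central mult.assoc)
  qed (auto simp: tensor_mult_diffl tensor_mult_diffr tensor_mult_pure distrib_left distrib_right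
        intro: null_add_left null_add_right nullD)
  show "tensor_mult Z Y \<in> N"
    by (rule tensor_induct[of Z UNIV UNIV]) (use * in \<open>auto simp: tensor_mult_diffr intro: nullD\<close>)
  show "tensor_mult Y Z \<in> N"
    by (rule tensor_induct[of Z UNIV UNIV]) (use * in \<open>auto simp: tensor_mult_diffl intro: nullD\<close>)
qed (rule add_closed_null)

text \<open>The universal property of the tensor product. It is the only means of showing that a
  formal sum is not null: find a balanced biadditive \<open>f\<close> with nonzero value.\<close>

lemma pair_extend_null:
  fixes f :: "'d \<Rightarrow> 'd \<Rightarrow> 'c::ring_1"
  assumes "Z \<in> null P Q"
    and "\<And>a a' b. a \<in> P \<Longrightarrow> a' \<in> P \<Longrightarrow> b \<in> Q \<Longrightarrow> f (a + a') b = f a b + f a' b"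
    and "\<And>a b b'. a \<in> P \<Longrightarrow> b \<in> Q \<Longrightarrow> b' \<in> Q \<Longrightarrow> f a (b + b') = f a b + f a b'"
    and "\<And>a b c. a \<in> P \<Longrightarrow> b \<in> Q \<Longrightarrow> f (scale c a) b = f a (scale c b)"
  shows "pair_extend f Z = 0"
  using assms(1) by (induction rule: null_induct) (use assms in \<open>auto simp: pair_extend_diff\<close>)

lemma pure_zero_null: "a \<in> P \<Longrightarrow> 0 \<in> Q \<Longrightarrow> pure a 0 \<in> null P Q" "0 \<in> P \<Longrightarrow> b \<in> Q \<Longrightarrow> pure 0 b \<in> null P Q"
  using nullD(3)[OF null_add_right[of a P 0 Q 0]] nullD(3)[OF null_add_left[of 0 P 0 b Q]] by auto

lemma pure_sum_right:
  assumes "a \<in> P" "add_closed Q" "\<And>i. i \<in> I \<Longrightarrow> f i \<in> Q"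
  shows "pure a (\<Sum>i\<in>I. f i) - (\<Sum>i\<in>I. pure a (f i)) \<in> null P Q"
  using assms(3)
proof (induction I rule: infinite_finite_induct)
  case (insert i I)
  then have "pure a (f i + (\<Sum>i\<in>I. f i)) - pure a (f i) - pure a (\<Sum>i\<in>I. f i) \<in> null P Q"
    by (intro null_add_right assms(1) add_closed_sum[OF assms(2)]) auto
  then have "pure a (f i + (\<Sum>i\<in>I. f i)) - pure a (f i) - pure a (\<Sum>i\<in>I. f i)
    + (pure a (\<Sum>i\<in>I. f i) - (\<Sum>i\<in>I. pure a (f i))) \<in> null P Q"
    using insert by (intro nullD(4)) auto
  then show ?case using insert by (simp add: algebra_simps)
qed (use pure_zero_null(1)[OF assms(1) add_closedD(1)[OF assms(2)]] in auto)

lemma pure_diff_left: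
  assumes "a \<in> P" "a' \<in> P" "add_closed P" "b \<in> Q"
  shows "pure a b - pure a' b - pure (a - a') b \<in> null P Q"
  using null_add_left[OF add_closedD(2)[OF assms(3,1,2)] assms(2,4)]
  by (simp add: algebra_simps)

definition linear_subspace :: "'d set \<Rightarrow> bool" where
  "linear_subspace P \<longleftrightarrow> add_closed P \<and> (\<forall>c. \<forall>x\<in>P. scale c x \<in> P)"

lemma linear_subspaceD:
  assumes "linear_subspace P" shows "add_closed P" "x \<in> P \<Longrightarrow> scale c x \<in> P"
  using assms by (auto simp: linear_subspace_def)

text \<open>Expand the right entries in a maximal independent subset of themselves and move the
  scalars to the left. As that subset consists of entries of \<open>Z\<close>, the result stays in
  \<open>Q\<close>, and the relations used stay in \<open>null P Q\<close>.\<close>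

lemma reduce_right:
  assumes P: "linear_subspace P" and Q: "linear_subspace Q" and Z: "Poly_Mapping.keys Z \<subseteq> P \<times> Q"
  obtains B a where "finite B" "B \<subseteq> Q" "vs.independent B" "\<And>b. b \<in> B \<Longrightarrow> a b \<in> P"
    "Z - (\<Sum>b\<in>B. pure (a b) b) \<in> null P Q"
proof -
  let ?S = "snd ` Poly_Mapping.keys Z"
  obtain B where B: "B \<subseteq> ?S" "vs.independent B" "?S \<subseteq> vs.span B"
    by (rule vs.maximal_independent_subset)
  have fin: "finite B" by (rule finite_subset[OF B(1)]) simp
  have "?S \<subseteq> Q" using Z by fastforce
  with B(1) have BQ: "B \<subseteq> Q" by (rule subset_trans)
  have "Poly_Mapping.keys Z \<subseteq> P \<times> ?S"
  proof
    fix x assume x: "x \<in> Poly_Mapping.keys Z"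
    then have "fst x \<in> P" using Z by auto
    with x show "x \<in> P \<times> ?S" by (simp add: mem_Times_iff)
  qed
  then have "\<exists>a. (\<forall>b\<in>B. a b \<in> P) \<and> Z - (\<Sum>b\<in>B. pure (a b) b) \<in> null P Q"
  proof (induction Z rule: tensor_induct)
    case zero
    have "(\<Sum>b\<in>B. pure 0 b) \<in> null P Q"
      using BQ pure_zero_null(2) add_closedD(1) linear_subspaceD(1)[OF P]
      by (intro add_closed_sum[OF add_closed_null]) blast
    then show ?case
      using nullD(3) add_closedD(1)[OF linear_subspaceD(1)[OF P]] by (intro exI[of _ "\<lambda>_. 0"]) auto
  next
    case (pure a s)
    then obtain r where s: "s = (\<Sum>b\<in>B. scale (r b) b)"
      using B(3) vs.span_finite[OF fin] by auto
    have "pure a s - (\<Sum>b\<in>B. pure a (scale (r b) b)) \<in> null P Q"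
      unfolding s using pure BQ linear_subspaceD[OF Q] by (intro pure_sum_right) auto
    moreover have "(\<Sum>b\<in>B. pure (scale (r b) a) b - pure a (scale (r b) b)) \<in> null P Q"
      using pure BQ by (intro add_closed_sum[OF add_closed_null] null_balanced) auto
    ultimately have "pure a s - (\<Sum>b\<in>B. pure a (scale (r b) b)) -
      (\<Sum>b\<in>B. pure (scale (r b) a) b - pure a (scale (r b) b)) \<in> null P Q"
      by (rule nullD(2))
    then have "pure a s - (\<Sum>b\<in>B. pure (scale (r b) a) b) \<in> null P Q"
      by (simp add: sum_subtractf)
    then show ?case
      using pure linear_subspaceD[OF P] by (intro exI[of _ "\<lambda>b. scale (r b) a"]) auto
  next
    case (diff x y)
    then obtain a a' where a: "\<And>b. b \<in> B \<Longrightarrow> a b \<in> P" "x - (\<Sum>b\<in>B. pure (a b) b) \<in> null P Q"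
      and a': "\<And>b. b \<in> B \<Longrightarrow> a' b \<in> P" "y - (\<Sum>b\<in>B. pure (a' b) b) \<in> null P Q" by blast
    have *: "(\<Sum>b\<in>B. pure (a b) b - pure (a' b) b - pure (a b - a' b) b) \<in> null P Q"
      using a a' BQ linear_subspaceD(1)[OF P]
      by (intro add_closed_sum[OF add_closed_null] pure_diff_left) auto
    have "(x - (\<Sum>b\<in>B. pure (a b) b) - (y - (\<Sum>b\<in>B. pure (a' b) b))) +
      (\<Sum>b\<in>B. pure (a b) b - pure (a' b) b - pure (a b - a' b) b) \<in> null P Q"
      by (rule nullD(4)[OF nullD(2)[OF a(2) a'(2)] *])
    moreover have "(x - (\<Sum>b\<in>B. pure (a b) b) - (y - (\<Sum>b\<in>B. pure (a' b) b))) +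
      (\<Sum>b\<in>B. pure (a b) b - pure (a' b) b - pure (a b - a' b) b) =
      x - y - (\<Sum>b\<in>B. pure (a b - a' b) b)"
      unfolding sum_subtractf by (simp add: algebra_simps)
    ultimately have "x - y - (\<Sum>b\<in>B. pure (a b - a' b) b) \<in> null P Q" by simp
    then show ?case
      using a a' add_closedD(2)[OF linear_subspaceD(1)[OF P]]
      by (intro exI[of _ "\<lambda>b. a b - a' b"]) auto
  qed
  then show ?thesis using that[OF fin BQ B(2)] by blast
qed

text \<open>Extend \<open>B\<close> to a basis of the division ring and apply the balanced map that
  multiplies the left entry by the \<open>b\<close>-coordinate of the right entry.\<close>

lemma independent_right:
  assumes "finite B" "vs.independent B" "(\<Sum>b\<in>B. pure (a b) b) \<in> N" "b \<in> B"
  shows "a b = 0"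
proof -
  let ?B = "vs.extend_basis B"
  let ?f = "\<lambda>x y. x * \<kappa> (vs.representation ?B y b)"
  have B: "B \<subseteq> ?B" "vs.independent ?B" "vs.span ?B = UNIV"
    using vs.extend_basis_superset vs.independent_extend_basis vs.span_extend_basis assms(2) by auto
  have "pair_extend ?f (\<Sum>b\<in>B. pure (a b) b) = 0"
  proof (rule pair_extend_null[OF assms(3)])
    show "?f x (y + y') = ?f x y + ?f x y'" for x y y'
      using vs.representation_add[OF B(2)] B(3) by (simp add: \<kappa>_add distrib_left)
    show "?f (scale c x) y = ?f x (scale c y)" for x y c
    proof -
      have "vs.representation ?B (scale c y) b = c * vs.representation ?B y b"
        using vs.representation_scale[OF B(2)] B(3) by simp
      then show ?thesis by (simp add: \<kappa>_mult mult.assoc) (metis central mult.assoc)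
    qed
  qed (simp add: distrib_right)
  also have "pair_extend ?f (\<Sum>b\<in>B. pure (a b) b) = (\<Sum>b'\<in>B. if b' = b then a b else 0)"
    unfolding pair_extend_sum pair_extend_pure
    by (rule sum.cong) (use B vs.representation_basis in \<open>auto simp: subsetD\<close>)
  finally show ?thesis using assms by simp
qed

text \<open>An involution that reverses products in \<open>D \<otimes> D\<^sup>o\<close>. It turns
  right ideals into left ideals and statements on second entries into statements on first
  entries.\<close>

definition swap_pairs :: "('d \<times> 'd \<Rightarrow>\<^sub>0 int) \<Rightarrow> ('d \<times> 'd \<Rightarrow>\<^sub>0 int)" where
  "swap_pairs = frag_extend (\<lambda>x. frag_of (snd x, fst x))"

lemma swap_pairs_simps [simp]:
  "swap_pairs 0 = 0" "swap_pairs (pure a b) = pure b a"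
  "swap_pairs (x - y) = swap_pairs x - swap_pairs y"
  by (auto simp: swap_pairs_def frag_extend_diff)

lemma swap_pairs_swap_pairs [simp]: "swap_pairs (swap_pairs Z) = Z"
  by (rule tensor_induct[of Z UNIV UNIV]) auto

lemma swap_pairs_null: "Z \<in> null P Q \<Longrightarrow> swap_pairs Z \<in> null Q P"
proof (induction rule: null_induct)
  case (balanced a b c)
  have "- (pure (scale c b) a - pure b (scale c a)) \<in> null Q P"
    using balanced by (intro nullD(3) null_balanced)
  then show ?case by simp
qed (auto intro: null_add_left null_add_right nullD)

end


lemma acc_onD:
  assumes "acc_on P" "\<And>n. P (I n)" "\<And>n. I n \<subseteq> I (Suc n)"
  shows "\<exists>N. \<forall>n\<ge>N. I n = I N"
  using assms by (simp add: acc_on_def)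

lemma division_subringD:
  assumes "division_subring E"
  shows "add_closed E" "0 \<in> E" "1 \<in> E" "x \<in> E \<Longrightarrow> y \<in> E \<Longrightarrow> x - y \<in> E" "x \<in> E \<Longrightarrow> y \<in> E \<Longrightarrow> x * y \<in> E"
    "x \<in> E \<Longrightarrow> inverse x \<in> E" "x \<in> E \<Longrightarrow> y \<in> E \<Longrightarrow> x + y \<in> E" "x \<in> E \<Longrightarrow> - x \<in> E"
proof -
  show "add_closed E" using assms by (auto simp: division_subring_def add_closed_def)
  then show "x \<in> E \<Longrightarrow> y \<in> E \<Longrightarrow> x + y \<in> E" "x \<in> E \<Longrightarrow> - x \<in> E"
    by (auto intro: add_closedD)
qed (use assms in \<open>auto simp: division_subring_def\<close>)

section \<open>Quotient rings by two-sided ideals\<close>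

context ring_mult
begin

definition as_ring :: "'a ring" where
  "as_ring = \<lparr>carrier = UNIV, monoid.mult = (\<star>), one = e, zero = 0, add = (+)\<rparr>"

lemma as_ring_simps [simp]:
  "carrier as_ring = UNIV" "x \<otimes>\<^bsub>as_ring\<^esub> y = x \<star> y" "\<one>\<^bsub>as_ring\<^esub> = e" "\<zero>\<^bsub>as_ring\<^esub> = 0"
  "x \<oplus>\<^bsub>as_ring\<^esub> y = x + y"
  by (simp_all add: as_ring_def)

lemma ring_as_ring: "ring as_ring"
proof (rule ringI)
  have "\<exists>y. y + x = 0" for x :: 'a by (rule exI[of _ "- x"]) simp
  then show "abelian_group as_ring"
    by (intro abelian_groupI) (auto simp: algebra_simps)
  show "Group.monoid as_ring"
    by (intro monoidI) (auto simp: assoc)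
qed (auto simp: distl distr)

lemma a_inv_as_ring: "\<ominus>\<^bsub>as_ring\<^esub> x = - x"
  using abelian_group.minus_equality[OF ring.is_abelian_group[OF ring_as_ring], of "- x" x] by simp

lemma ideal_as_ring:
  assumes "two_sided N"
  shows "ideal N as_ring"
proof (rule idealI[OF ring_as_ring])
  interpret ring as_ring by (rule ring_as_ring)
  have N: "add_closed N" using assms by (simp add: two_sided_def)
  have "\<ominus>\<^bsub>as_ring\<^esub> a \<in> N" if "a \<in> N" for a
    using add_closedD(3)[OF N that] by (simp add: a_inv_as_ring)
  then show "subgroup N (add_monoid as_ring)"
    using add_closedD[OF N] by (intro add.subgroupI) (auto simp: a_inv_def)
qed (use assms in \<open>auto simp: two_sided_def\<close>)

context
  fixes N
  assumes N: "two_sided N"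
begin

interpretation I: ideal N as_ring
  by (rule ideal_as_ring[OF N])

private abbreviation "U \<equiv> as_ring Quot N"
private abbreviation "\<pi> \<equiv> (+>\<^bsub>as_ring\<^esub>) N"

interpretation h: ring_hom_ring as_ring U \<pi>
  by (rule I.rcos_ring_hom_ring)

lemma carrier_quot: "carrier (as_ring Quot N) = range ((+>\<^bsub>as_ring\<^esub>) N)"
  by (auto simp: FactRing_def A_RCOSETS_defs a_r_coset_def)

lemma rcoset_eq_zero: "\<pi> x = \<zero>\<^bsub>U\<^esub> \<longleftrightarrow> x \<in> N"
  using I.a_rcos_const[of x] I.a_rcos_self[of x] by (auto simp: FactRing_def)

lemma rcoset_diff: "\<pi> (x - y) = \<pi> x \<oplus>\<^bsub>U\<^esub> \<ominus>\<^bsub>U\<^esub> \<pi> y"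
  using h.hom_add[of x "- y"] h.hom_a_inv[of y] by (simp add: a_inv_as_ring)

lemma add_closed_vimage:
  assumes "additive_subgroup J U"
  shows "add_closed {x. \<pi> x \<in> J}" "N \<subseteq> {x. \<pi> x \<in> J}"
proof -
  interpret J: additive_subgroup J U by fact
  have zero: "\<pi> x \<in> J" if "x \<in> N" for x
    using J.zero_closed rcoset_eq_zero[of x] that by simp
  have "\<ominus>\<^bsub>U\<^esub> y \<in> J" if "y \<in> J" for y
    using subgroup.m_inv_closed[OF J.a_subgroup that] by (simp add: a_inv_def)
  then have "\<pi> (x - y) \<in> J" if "\<pi> x \<in> J" "\<pi> y \<in> J" for x y
    unfolding rcoset_diff using that J.a_closed by blast
  then show "add_closed {x. \<pi> x \<in> J}"
    using zero[of 0] N by (auto simp: add_closed_def two_sided_def)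
  show "N \<subseteq> {x. \<pi> x \<in> J}" using zero by blast
qed

lemma image_vimage_coset:
  assumes "additive_subgroup J U"
  shows "\<pi> ` {x. \<pi> x \<in> J} = J"
  using additive_subgroup.a_subset[OF assms] unfolding carrier_quot by auto

text \<open>The projection is surjective, so a set of cosets is recovered as the image of its
  preimage, and chains can be tested upstairs.\<close>

lemma acc_on_quot:
  assumes "acc_on Q" "\<And>J. R J \<Longrightarrow> additive_subgroup J U" "\<And>J. R J \<Longrightarrow> Q {x. \<pi> x \<in> J}"
  shows "acc_on R"
  unfolding acc_on_def
proof (intro allI impI)
  fix J :: "nat \<Rightarrow> 'a set set"
  assume J: "(\<forall>n. R (J n)) \<and> (\<forall>n. J n \<subseteq> J (Suc n))"
  have "(\<forall>n. Q {x. \<pi> x \<in> J n}) \<and> (\<forall>n. {x. \<pi> x \<in> J n} \<subseteq> {x. \<pi> x \<in> J (Suc n)})"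
    using J assms(3) by blast
  then obtain M where M: "\<forall>n\<ge>M. {x. \<pi> x \<in> J n} = {x. \<pi> x \<in> J M}"
    using assms(1) unfolding acc_on_def by meson
  have "J n = J M" if "n \<ge> M" for n
    using image_vimage_coset[OF assms(2), of "J n"] image_vimage_coset[OF assms(2), of "J M"] J M that
    by metis
  then show "\<exists>M. \<forall>n\<ge>M. J n = J M" by blast
qed

lemma nc_noetherian_quot:
  assumes "left_noetherian N UNIV" "ring_mult.left_noetherian (\<lambda>x y. y \<star> x) N UNIV"
  shows "nc_noetherian (as_ring Quot N)"
  unfolding nc_noetherian_def
proof
  interpret flip: ring_mult "\<lambda>x y. y \<star> x" e by (rule flip)
  have mult: "\<pi> (r \<star> x) = \<pi> r \<otimes>\<^bsub>U\<^esub> \<pi> x" for r x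
    using h.hom_mult[of r x] by simp
  show "acc_on (\<lambda>I. left_ideal I U)"
    using assms(1) unfolding left_noetherian_def
    by (rule acc_on_quot)
      (use add_closed_vimage in \<open>auto simp: left_ideal_def left_ideal_over_def carrier_quot mult\<close>)
  show "acc_on (\<lambda>I. right_ideal I U)"
    using assms(2) unfolding flip.left_noetherian_def
    by (rule acc_on_quot)
      (use add_closed_vimage in \<open>auto simp: right_ideal_def flip.left_ideal_over_def carrier_quot mult\<close>)
qed

lemma nc_domain_quot:
  assumes "e \<notin> N" "\<And>x y. x \<star> y \<in> N \<Longrightarrow> x \<in> N \<or> y \<in> N"
  shows "nc_domain (as_ring Quot N)"
  unfolding nc_domain_def
proof (intro conjI ballI impI)
  show "ring U" by (rule I.quotient_is_ring)
  show "\<one>\<^bsub>U\<^esub> \<noteq> \<zero>\<^bsub>U\<^esub>" using rcoset_eq_zero[of e] assms(1) h.hom_one by simp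
  show "a = \<zero>\<^bsub>U\<^esub> \<or> b = \<zero>\<^bsub>U\<^esub>" if ab: "a \<in> carrier U" "b \<in> carrier U" "a \<otimes>\<^bsub>U\<^esub> b = \<zero>\<^bsub>U\<^esub>" for a b
  proof -
    obtain x y where "a = \<pi> x" "b = \<pi> y" using ab(1,2) unfolding carrier_quot by blast
    then show ?thesis
      using ab(3) h.hom_mult[of x y] rcoset_eq_zero[of "x \<star> y"] rcoset_eq_zero[of x] rcoset_eq_zero[of y]
        assms(2) by auto
  qed
qed

end

end

context central_field
begin

lemma tensor_with_opposite_quot: "tensor_with_opposite \<kappa> = tensor.as_ring Quot N"
proof -
  have "formal_ring (set_ring UNIV) (opposite (set_ring (UNIV :: 'd set))) = tensor.as_ring"
    using mult_formal_ring[where ?'a = 'd] unfolding tensor.as_ring_def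
    by (auto simp: formal_ring_def formal_sums_def set_ring_def opposite_def fun_eq_iff)
  moreover have "tensor_null (add_monoid (set_ring UNIV)) (add_monoid (opposite (set_ring (UNIV :: 'd set))))
     scale scale = N"
    by (simp add: null_def opposite_def set_ring_def)
  ultimately show ?thesis
    by (simp add: tensor_with_opposite_def tensor_ring_def)
qed

lemma independent_one: "\<not> pure 1 1 \<in> N"
  using independent_right[of "{1}" "\<lambda>_. 1" 1] by auto


section \<open>Chains of division subalgebras\<close>

text \<open>The kernel of \<open>\<phi>\<close> is a maximal subspace among those containing \<open>1\<close> and not \<open>x\<close>.\<close>

lemma linear_form_separating:
  fixes x :: "'d"
  assumes E: "division_subring E" and x: "x \<notin> E"
  obtains \<phi> :: "'d \<Rightarrow> 'd" where "\<And>y z. \<phi> (y + z) = \<phi> y + \<phi> z"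
    "\<And>c y. c \<in> E \<Longrightarrow> \<phi> (c * y) = c * \<phi> y" "\<phi> 1 = 0" "\<phi> x = 1"
proof -
  define \<A> where "\<A> = {H. add_closed H \<and> (\<forall>c\<in>E. \<forall>y\<in>H. c * y \<in> H) \<and> 1 \<in> H \<and> x \<notin> H}"
  have "E \<in> \<A>" using division_subringD[OF E] x by (auto simp: \<A>_def)
  have chain: "\<Union>\<C> \<in> \<A>" if "\<C> \<noteq> {}" "subset.chain \<A> \<C>" for \<C>
  proof -
    have sub: "\<C> \<subseteq> \<A>" and tot: "\<And>S T. S \<in> \<C> \<Longrightarrow> T \<in> \<C> \<Longrightarrow> S \<subseteq> T \<or> T \<subseteq> S"
      using that(2) by (auto simp: subset.chain_def subset_chain_def)
    have "a - b \<in> \<Union>\<C>" if ab: "a \<in> \<Union>\<C>" "b \<in> \<Union>\<C>" for a b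
    proof -
      obtain S where "S \<in> \<C>" "a \<in> S" "b \<in> S"
        using ab tot by (metis UnionE subsetD)
      moreover have "add_closed S" using \<open>S \<in> \<C>\<close> sub by (auto simp: \<A>_def)
      ultimately show ?thesis using add_closedD(2) by blast
    qed
    moreover have "0 \<in> \<Union>\<C>" "1 \<in> \<Union>\<C>" "x \<notin> \<Union>\<C>"
      using \<open>\<C> \<noteq> {}\<close> sub by (auto simp: \<A>_def add_closed_def)
    moreover have "c * y \<in> \<Union>\<C>" if cy: "c \<in> E" "y \<in> \<Union>\<C>" for c y
    proof -
      obtain S where S: "S \<in> \<C>" "y \<in> S" using cy(2) by blast
      then have "c * y \<in> S" using sub cy(1) unfolding \<A>_def by blast
      with S(1) show ?thesis by blast
    qed
    ultimately show ?thesis by (simp add: \<A>_def add_closed_def)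
  qed
  obtain H where H: "H \<in> \<A>" and max: "\<And>S. S \<in> \<A> \<Longrightarrow> H \<subseteq> S \<Longrightarrow> S = H"
    using subset_Zorn_nonempty[of \<A>] chain \<open>E \<in> \<A>\<close> by blast
  have clH: "add_closed H" and EH: "\<And>c y. c \<in> E \<Longrightarrow> y \<in> H \<Longrightarrow> c * y \<in> H" and "1 \<in> H" "x \<notin> H"
    using H by (auto simp: \<A>_def)
  note HD = add_closedD[OF clH] and ED = division_subringD[OF E]
  have ex: "\<exists>c\<in>E. y - c * x \<in> H" for y
  proof (cases "y \<in> H")
    case False
    define S where "S = {h + c * y | h c. h \<in> H \<and> c \<in> E}"
    have SI: "h + c * y \<in> S" if "h \<in> H" "c \<in> E" for h c using that by (auto simp: S_def)
    have "add_closed S"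
      unfolding add_closed_def
    proof (intro conjI ballI)
      show "0 \<in> S" using SI[OF HD(1) ED(2)] by simp
      fix a b assume "a \<in> S" "b \<in> S"
      then obtain h c h' c' where eq: "a = h + c * y" "b = h' + c' * y" and
        mem: "h \<in> H" "h' \<in> H" "c \<in> E" "c' \<in> E" by (auto simp: S_def)
      have "a - b = (h - h') + (c - c') * y" by (simp add: eq algebra_simps)
      then show "a - b \<in> S" using SI[OF HD(2)[OF mem(1,2)] ED(4)[OF mem(3,4)]] by simp
    qed
    moreover have "c * a \<in> S" if c: "c \<in> E" and "a \<in> S" for c a
    proof -
      obtain h d where "a = h + d * y" "h \<in> H" "d \<in> E" using \<open>a \<in> S\<close> by (auto simp: S_def)
      then show ?thesis
        using SI[OF EH[OF c] ED(5)[OF c], of h d] by (simp add: distrib_left mult.assoc)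
    qed
    moreover have HS: "H \<subseteq> S" using SI[OF _ ED(2)] by auto
    moreover have "y \<in> S" using SI[OF HD(1) ED(3)] by simp
    \<comment> \<open>By maximality the strictly larger subspace generated by \<open>H\<close> and
      \<open>y\<close> must contain \<open>x\<close>; solving for \<open>y\<close> shows that
      \<open>H\<close> and \<open>x\<close> generate everything.\<close>
    ultimately have "x \<in> S" using max[of S] False \<open>1 \<in> H\<close> by (auto simp: \<A>_def)
    then obtain h c where hc: "x = h + c * y" "h \<in> H" "c \<in> E" by (auto simp: S_def)
    then have "c \<noteq> 0" using \<open>x \<notin> H\<close> by auto
    then have "y - inverse c * x = - (inverse c * h)"
      by (simp add: hc(1) distrib_left flip: mult.assoc)
    then have "y - inverse c * x \<in> H" using HD(3)[OF EH[OF ED(6)[OF hc(3)] hc(2)]] by simp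
    then show ?thesis using ED(6)[OF hc(3)] by blast
  qed (use ED(2) in \<open>auto intro!: bexI[of _ 0]\<close>)
  have unique: "c = d" if cd: "c \<in> E" "d \<in> E" "y - c * x \<in> H" "y - d * x \<in> H" for c d y
  proof (rule ccontr)
    assume "c \<noteq> d"
    have "(c - d) * x = (y - d * x) - (y - c * x)" by (simp add: algebra_simps)
    also have "\<dots> \<in> H" by (rule HD(2)[OF cd(4,3)])
    finally have "inverse (c - d) * ((c - d) * x) \<in> H"
      using EH ED(4,6) cd by blast
    then show False using \<open>c \<noteq> d\<close> \<open>x \<notin> H\<close> by (simp flip: mult.assoc)
  qed
  define \<phi> where "\<phi> y = (THE c. c \<in> E \<and> y - c * x \<in> H)" for y
  have \<phi>: "\<phi> y = c" if "c \<in> E" "y - c * x \<in> H" for y c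
    unfolding \<phi>_def using that unique by (intro the_equality) auto
  have \<phi>_mem: "\<phi> y \<in> E" "y - \<phi> y * x \<in> H" for y
    using ex[of y] \<phi> by auto
  show ?thesis
  proof (rule that[of \<phi>])
    show "\<phi> (y + z) = \<phi> y + \<phi> z" for y z
    proof (rule \<phi>[OF ED(7)[OF \<phi>_mem(1) \<phi>_mem(1)]])
      show "y + z - (\<phi> y + \<phi> z) * x \<in> H"
        using HD(4)[OF \<phi>_mem(2)[of y] \<phi>_mem(2)[of z]] by (simp add: algebra_simps)
    qed
    show "\<phi> (c * y) = c * \<phi> y" if "c \<in> E" for c y
    proof (rule \<phi>[OF ED(5)[OF that \<phi>_mem(1)]])
      show "c * y - c * \<phi> y * x \<in> H"
        using EH[OF that \<phi>_mem(2)[of y]] by (simp add: algebra_simps)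
    qed
    show "\<phi> 1 = 0" using \<open>1 \<in> H\<close> ED(2) by (intro \<phi>) auto
    show "\<phi> x = 1" using HD(1) ED(3) by (intro \<phi>) auto
  qed
qed

text \<open>The kernel of \<open>D \<otimes>\<^sub>K D \<rightarrow> D \<otimes>\<^sub>E D\<close>.\<close>

definition relative_kernel :: "'d set \<Rightarrow> ('d \<times> 'd \<Rightarrow>\<^sub>0 int) set" where
  "relative_kernel E = {Z. \<forall>\<phi>. (\<forall>y z. \<phi> (y + z) = \<phi> y + \<phi> z) \<and> (\<forall>c\<in>E. \<forall>y. \<phi> (c * y) = c * \<phi> y) \<longrightarrow>
     pair_extend (\<lambda>a b. a * \<phi> b) Z = 0}"

lemma left_ideal_relative_kernel:
  assumes E: "division_subalgebra \<kappa> E"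
  shows "tensor.left_ideal_over N UNIV (relative_kernel E)"
  unfolding tensor.left_ideal_over_def
proof (intro conjI ballI)
  show "add_closed (relative_kernel E)"
    by (simp add: add_closed_def relative_kernel_def pair_extend_diff)
  show "N \<subseteq> relative_kernel E"
  proof
    fix Z assume Z: "Z \<in> N"
    show "Z \<in> relative_kernel E"
      unfolding relative_kernel_def
    proof (intro CollectI allI impI, elim conjE)
      fix \<phi> :: "'d \<Rightarrow> 'd"
      assume \<phi>: "\<forall>y z. \<phi> (y + z) = \<phi> y + \<phi> z" "\<forall>c\<in>E. \<forall>y. \<phi> (c * y) = c * \<phi> y"
      have "\<phi> (scale c y) = scale c (\<phi> y)" for c y
        using E \<phi>(2) by (auto simp: division_subalgebra_def)
      then have "scale c a * \<phi> b = a * \<phi> (scale c b)" for a b c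
        by (simp add: mult.assoc) (metis central mult.assoc)
      then show "pair_extend (\<lambda>a b. a * \<phi> b) Z = 0"
        using Z by (intro pair_extend_null[of Z UNIV UNIV]) (auto simp: \<phi> distrib_left distrib_right)
    qed
  qed
  fix Y Z :: "('d \<times> 'd) \<Rightarrow>\<^sub>0 int" assume Z: "Z \<in> relative_kernel E"
  show "tensor_mult Y Z \<in> relative_kernel E"
    unfolding relative_kernel_def
  proof (intro CollectI allI impI)
    fix \<phi> :: "'d \<Rightarrow> 'd"
    assume \<phi>: "(\<forall>y z. \<phi> (y + z) = \<phi> y + \<phi> z) \<and> (\<forall>c\<in>E. \<forall>y. \<phi> (c * y) = c * \<phi> y)"
    \<comment> \<open>In the opposite factor \<open>d\<close> acts by right multiplication, so
      multiplying by \<open>pure c d\<close> replaces \<phi> by its composite with right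
      multiplication by \<open>d\<close>, which is again left linear over \<open>E\<close>.\<close>
    have "pair_extend (\<lambda>a b. a * \<phi> b) (tensor_mult (pure c d) W) = c * pair_extend (\<lambda>a b. a * \<phi> (b * d)) W"
      for c d W
      by (rule tensor_induct[of W UNIV UNIV])
        (auto simp: tensor_mult_pure tensor_mult_diffl pair_extend_diff algebra_simps)
    moreover have "pair_extend (\<lambda>a b. a * \<phi> (b * d)) Z = 0" for d
      using Z[unfolded relative_kernel_def mem_Collect_eq, rule_format, of "\<lambda>b. \<phi> (b * d)"] \<phi>
      by (simp add: distrib_right mult.assoc)
    ultimately have *: "pair_extend (\<lambda>a b. a * \<phi> b) (tensor_mult (pure c d) Z) = 0" for c d
      by simp
    show "pair_extend (\<lambda>a b. a * \<phi> b) (tensor_mult Y Z) = 0"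
      by (rule tensor_induct[of Y UNIV UNIV]) (auto simp: * tensor_mult_diffr pair_extend_diff)
  qed
qed auto

lemma relative_kernel_mono: "E \<subseteq> E' \<Longrightarrow> relative_kernel E \<subseteq> relative_kernel E'"
  unfolding relative_kernel_def by blast

text \<open>This recovers \<open>E\<close> from its kernel, so that strict chains of division
  subalgebras give strict chains of left ideals. If x lies outside \<open>E\<close>, a form with
  \<phi> 1 = 0 and \<phi> x = 1 takes the value -1 on the difference.\<close>

lemma relative_kernel_mem:
  assumes "division_subring E"
  shows "pure x 1 - pure 1 x \<in> relative_kernel E \<longleftrightarrow> x \<in> E"
proof
  assume x: "x \<in> E"
  have "\<phi> x = x * \<phi> 1" if "\<forall>c\<in>E. \<forall>y. \<phi> (c * y) = c * \<phi> y" for \<phi> :: "'d \<Rightarrow> 'd"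
    using that[rule_format, OF x, of 1] by simp
  then show "pure x 1 - pure 1 x \<in> relative_kernel E"
    by (auto simp: relative_kernel_def pair_extend_diff)
next
  assume *: "pure x 1 - pure 1 x \<in> relative_kernel E"
  show "x \<in> E"
  proof (rule ccontr)
    assume "x \<notin> E"
    then obtain \<phi> :: "'d \<Rightarrow> 'd" where \<phi>: "\<And>y z. \<phi> (y + z) = \<phi> y + \<phi> z"
      "\<And>c y. c \<in> E \<Longrightarrow> \<phi> (c * y) = c * \<phi> y" "\<phi> 1 = 0" "\<phi> x = 1"
      using linear_form_separating[OF assms] by metis
    then have "pair_extend (\<lambda>a b. a * \<phi> b) (pure x 1 - pure 1 x) = 0"
      using * unfolding relative_kernel_def by blast
    then show False using \<phi> by (simp add: pair_extend_diff)
  qed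
qed

theorem acc_division_subalgebras:
  assumes "tensor.left_noetherian N (UNIV :: ('d \<times> 'd \<Rightarrow>\<^sub>0 int) set)"
  shows "acc_on (division_subalgebra \<kappa>)"
  unfolding acc_on_def
proof (intro allI impI)
  fix E :: "nat \<Rightarrow> 'd set"
  assume E: "(\<forall>n. division_subalgebra \<kappa> (E n)) \<and> (\<forall>n. E n \<subseteq> E (Suc n))"
  then have "tensor.left_ideal_over N UNIV (relative_kernel (E n))"
    "relative_kernel (E n) \<subseteq> relative_kernel (E (Suc n))" for n
    by (auto intro: left_ideal_relative_kernel relative_kernel_mono[THEN subsetD])
  from acc_onD[where I = "\<lambda>n. relative_kernel (E n)", OF assms[unfolded tensor.left_noetherian_def] this]
  obtain M where M: "\<forall>n\<ge>M. relative_kernel (E n) = relative_kernel (E M)" ..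
  have "E n = E M" if "n \<ge> M" for n
  proof (rule Set.set_eqI)
    have "division_subring (E n)" "division_subring (E M)"
      using E by (simp_all add: division_subalgebra_def)
    then show "x \<in> E n \<longleftrightarrow> x \<in> E M" for x
      using relative_kernel_mem[of "E n" x] relative_kernel_mem[of "E M" x] M[rule_format, OF that]
      by metis
  qed
  then have "\<forall>n\<ge>M. E n = E M" by blast
  then show "\<exists>M. \<forall>n\<ge>M. E n = E M" ..
qed

lemma division_subalgebra_Inter:
  "(\<And>E. E \<in> \<E> \<Longrightarrow> division_subalgebra \<kappa> E) \<Longrightarrow> division_subalgebra \<kappa> (\<Inter>\<E>)"
  by (auto simp: division_subalgebra_def division_subring_def)

lemma fg_division_subalgebra:
  assumes acc: "acc_on (division_subalgebra \<kappa>)" and E: "division_subalgebra \<kappa> E"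
  shows "fg_division_algebra \<kappa> E"
proof (rule ccontr)
  assume nfg: "\<not> fg_division_algebra \<kappa> E"
  define cl where "cl xs = \<Inter>{E'. division_subalgebra \<kappa> E' \<and> xs \<subseteq> E'}" for xs
  have cl: "division_subalgebra \<kappa> (cl xs)" "xs \<subseteq> cl xs" for xs
    by (auto simp: cl_def intro: division_subalgebra_Inter)
  have cl_mono: "cl xs \<subseteq> cl ys" if "xs \<subseteq> ys" for xs ys using that by (auto simp: cl_def)
  have ex: "\<exists>y\<in>E. y \<notin> cl xs" if "finite xs" "xs \<subseteq> E" for xs
  proof -
    have "\<not> (\<forall>E'. division_subalgebra \<kappa> E' \<and> E' \<subseteq> E \<and> xs \<subseteq> E' \<longrightarrow> E' = E)"
      using nfg[unfolded fg_division_algebra_def not_ex, THEN spec, of xs] that by simp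
    then obtain E' where E': "division_subalgebra \<kappa> E'" "E' \<subseteq> E" "xs \<subseteq> E'" "E' \<noteq> E"
      by auto
    then obtain y where "y \<in> E" "y \<notin> E'" by auto
    moreover have "cl xs \<subseteq> E'" unfolding cl_def by (rule Inter_lower) (simp add: E')
    ultimately show ?thesis by auto
  qed
  \<comment> \<open>If \<open>E\<close> is not finitely generated, elements outside the current
    closure can be added forever, which contradicts the chain condition for the closures.\<close>
  have "\<exists>xs. \<forall>n. (finite (xs n) \<and> xs n \<subseteq> E) \<and> (xs n \<subseteq> xs (Suc n) \<and> \<not> xs (Suc n) \<subseteq> cl (xs n))"
  proof (rule dependent_nat_choice[of "\<lambda>_ xs. finite xs \<and> xs \<subseteq> E" "\<lambda>_ xs ys. xs \<subseteq> ys \<and> \<not> ys \<subseteq> cl xs"])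
    fix xs n assume xs: "finite xs \<and> xs \<subseteq> E"
    then obtain y where "y \<in> E" "y \<notin> cl xs" using ex by blast
    then show "\<exists>ys. (finite ys \<and> ys \<subseteq> E) \<and> xs \<subseteq> ys \<and> \<not> ys \<subseteq> cl xs"
      using xs by (intro exI[of _ "insert y xs"]) auto
  qed (auto intro: exI[of _ "{}"])
  then obtain xs where xs: "\<And>n. finite (xs n) \<and> xs n \<subseteq> E" "\<And>n. xs n \<subseteq> xs (Suc n)"
    "\<And>n. \<not> xs (Suc n) \<subseteq> cl (xs n)" by blast
  from acc_onD[where I = "\<lambda>n. cl (xs n)", OF acc cl(1) cl_mono[OF xs(2)]]
  obtain M where M: "\<forall>n\<ge>M. cl (xs n) = cl (xs M)" ..
  have "cl (xs (Suc M)) = cl (xs M)" by (rule M[rule_format]) simp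
  then show False using cl(2)[of "xs (Suc M)"] xs(3)[of M] by blast
qed

end


section \<open>Rings of differential operators inside a division ring\<close>

definition brk :: "'a::ring \<Rightarrow> 'a \<Rightarrow> 'a" where
  "brk x y = x * y - y * x"

lemma brk_linear:
  "brk (x + y) z = brk x z + brk y z" "brk (x - y) z = brk x z - brk y z" "brk 0 z = 0"
  "brk x (y - z) = brk x y - brk x z"
  by (simp_all add: brk_def algebra_simps)

lemma brk_sum: "brk (sum f I) z = (\<Sum>i\<in>I. brk (f i) z)"
  by (induction I rule: infinite_finite_induct) (auto simp: brk_linear)

lemma brk_mult_left: "brk (x * y) z = x * brk y z + brk x z * y"
  by (simp add: brk_def algebra_simps)

lemma brk_mult_right: "brk x (y * z) = brk x y * z + y * brk x z"
  by (simp add: brk_def algebra_simps)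

lemma brk_brk: "brk x y = 0 \<Longrightarrow> brk (brk z x) y = brk (brk z y) x"
  by (simp add: brk_def algebra_simps) (metis mult.assoc)

lemma brk_eq_0: "brk x y = 0 \<longleftrightarrow> x * y = y * x"
  by (simp add: brk_def)

lemma commute_inverse:
  fixes x y :: "'a::division_ring"
  shows "x * y = y * x \<Longrightarrow> inverse x * y = y * inverse x"
  by (cases "x = 0") (simp_all, metis mult.assoc mult.left_neutral mult.right_neutral left_inverse right_inverse)

interpretation std: ring_mult "(*) :: 'a::ring_1 \<Rightarrow> 'a \<Rightarrow> 'a" 1
  by unfold_locales (simp_all add: algebra_simps)

text \<open>
  \<open>A\<close> is a commutative algebra generated by the \<open>x i\<close>, the set \<open>F n\<close> consists of differential
  operators of order at most \<open>n\<close>, and the division ring consists of fractions of differential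
  operators.
\<close>

locale diffop_division_ring = central_field \<kappa>
  for \<kappa> :: "'k::field_char_0 \<Rightarrow> 'd::division_ring" +
  fixes A :: "'d set" and F :: "nat \<Rightarrow> 'd set" and x :: "'n::finite \<Rightarrow> 'd"
  assumes F_0: "F 0 = A"
    and A_commute: "a \<in> A \<Longrightarrow> b \<in> A \<Longrightarrow> a * b = b * a"
    and \<kappa>_mem: "\<kappa> c \<in> A" and x_mem: "x i \<in> A"
    and F_add: "add_closed (F n)" and F_mult: "P \<in> F m \<Longrightarrow> Q \<in> F n \<Longrightarrow> P * Q \<in> F (m + n)"
    and F_Suc: "F n \<subseteq> F (Suc n)"
    and F_brk: "P \<in> F (Suc n) \<Longrightarrow> a \<in> A \<Longrightarrow> brk P a \<in> F n"
    and centraliser: "P \<in> F n \<Longrightarrow> (\<And>a. a \<in> A \<Longrightarrow> brk P a = 0) \<Longrightarrow> P \<in> A"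
    and generated: "a \<in> A \<Longrightarrow> std.sub_ring B \<Longrightarrow> range \<kappa> \<subseteq> B \<Longrightarrow> range x \<subseteq> B \<Longrightarrow> a \<in> B"
    and left_fraction: "\<exists>s\<in>(\<Union>n. F n) - {0}. s * q \<in> (\<Union>n. F n)"
    and right_fraction: "\<exists>s\<in>(\<Union>n. F n) - {0}. q * s \<in> (\<Union>n. F n)"
begin

lemma \<kappa>_of_nat: "\<kappa> (of_nat n) = of_nat n"
  by (induction n) (simp_all add: \<kappa>_add)

lemma F_mono: "m \<le> n \<Longrightarrow> F m \<subseteq> F n"
  using F_Suc by (rule lift_Suc_mono_le)

lemma A_subset_F: "A \<subseteq> F n"
  using F_mono[of 0 n] by (simp add: F_0)

definition ops :: "'d set" where
  "ops = (\<Union>n. F n)"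

lemma sub_ring_A: "std.sub_ring A"
  using F_add[of 0] F_mult[of _ 0 _ 0] \<kappa>_mem[of 1] by (auto simp: std.sub_ring_def F_0)

lemma sub_ring_ops: "std.sub_ring ops"
  unfolding std.sub_ring_def
proof (intro conjI ballI)
  show "add_closed ops"
    unfolding add_closed_def
  proof (intro conjI ballI)
    show "0 \<in> ops" using add_closedD(1)[OF F_add] by (auto simp: ops_def)
    fix P Q assume "P \<in> ops" "Q \<in> ops"
    then obtain m n where "P \<in> F m" "Q \<in> F n" by (auto simp: ops_def)
    then have "P \<in> F (m + n)" "Q \<in> F (m + n)" using F_mono by (meson le_add1 le_add2 subsetD)+
    then show "P - Q \<in> ops" unfolding ops_def by (blast intro: add_closedD(2)[OF F_add])
  qed
  show "1 \<in> ops" using A_subset_F \<kappa>_mem[of 1] by (auto simp: ops_def)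
  show "P * Q \<in> ops" if "P \<in> ops" "Q \<in> ops" for P Q
    using that F_mult unfolding ops_def by blast
qed

lemmas A_D = std.sub_ringD[OF sub_ring_A] and ops_D = std.sub_ringD[OF sub_ring_ops]

lemma A_subset_ops: "A \<subseteq> ops"
  using A_subset_F by (auto simp: ops_def)

definition fractions :: "'d set" where
  "fractions = {q. \<exists>a\<in>A - {0}. a * q \<in> A}"

text \<open>Operators with coefficients in the field of fractions of \<open>A\<close>. The
  derivations dual to the coordinates are obtained by dividing by elements of that field, so they
  need this larger ring.\<close>

definition localised_ops :: "'d set" where
  "localised_ops = {q. \<exists>a\<in>A - {0}. a * q \<in> ops}"

lemma fractionsI: "a \<in> A \<Longrightarrow> a \<noteq> 0 \<Longrightarrow> a * q \<in> A \<Longrightarrow> q \<in> fractions"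
  by (auto simp: fractions_def)

lemma localised_opsI: "a \<in> A \<Longrightarrow> a \<noteq> 0 \<Longrightarrow> a * q \<in> ops \<Longrightarrow> q \<in> localised_ops"
  by (auto simp: localised_ops_def)

lemma A_subset_fractions: "A \<subseteq> fractions"
  using fractionsI[of 1] A_D(2) by auto

lemma ops_subset_localised: "ops \<subseteq> localised_ops"
  using localised_opsI[of 1] A_D(2) by auto

lemma fractions_commute_A:
  assumes "q \<in> fractions" "b \<in> A"
  shows "q * b = b * q"
proof -
  obtain a where a: "a \<in> A" "a \<noteq> 0" "a * q \<in> A" using assms(1) by (auto simp: fractions_def)
  then have "a * (q * b) = a * (b * q)"
    using A_commute[OF a(3) assms(2)] A_commute[OF a(1) assms(2)] by (simp flip: mult.assoc)
  then show ?thesis using a(2) by simp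
qed

lemma inverse_fractions: "q \<in> fractions \<Longrightarrow> inverse q \<in> fractions"
proof (cases "q = 0")
  case False
  assume "q \<in> fractions"
  then obtain a where a: "a \<in> A" "a \<noteq> 0" "a * q \<in> A" by (auto simp: fractions_def)
  then have "(a * q) * inverse q \<in> A" using False by (simp add: mult.assoc)
  then show ?thesis using a False by (intro fractionsI[of "a * q"]) auto
qed auto

lemma sub_ring_fractions: "std.sub_ring fractions"
  unfolding std.sub_ring_def add_closed_def
proof (intro conjI ballI)
  fix q r assume qr: "q \<in> fractions" "r \<in> fractions"
  then obtain a b where a: "a \<in> A" "a \<noteq> 0" "a * q \<in> A" and b: "b \<in> A" "b \<noteq> 0" "b * r \<in> A"
    by (auto simp: fractions_def)
  have "a * b * (q - r) = b * a * q - a * b * r"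
    using A_commute[OF a(1) b(1)] by (simp add: algebra_simps)
  then have "a * b * (q - r) = b * (a * q) - a * (b * r)"
    by (simp only: mult.assoc)
  then show "q - r \<in> fractions"
    using a b A_D by (intro fractionsI[of "a * b"]) auto
  have "a * b * (q * r) = (a * q) * (b * r)"
    using fractions_commute_A[OF qr(1) b(1)] by (simp add: mult.assoc) (metis mult.assoc)
  then show "q * r \<in> fractions"
    using a b A_D by (intro fractionsI[of "a * b"]) auto
qed (use A_subset_fractions A_D in auto)

lemmas fractions_D = std.sub_ringD[OF sub_ring_fractions]

text \<open>The Ore condition for denominators from \<open>A\<close>, by induction on the order: b P
  b^-1 differs from P by [P, b] b^-1, and [P, b] has lower order.\<close>

lemma ops_mult_inverse:
  assumes "b \<in> A" "b \<noteq> 0" "P \<in> F n"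
  shows "\<exists>c\<in>A - {0}. c * P * inverse b \<in> ops"
  using assms(3)
proof (induction n arbitrary: P)
  case 0
  then have "b * P * inverse b = P"
    using A_commute[OF assms(1)] assms(2) by (simp add: F_0 mult.assoc)
  then have "b * P * inverse b \<in> ops" using 0 by (simp add: F_0 A_subset_ops[THEN subsetD])
  then show ?case using assms by blast
next
  case (Suc n)
  obtain c where c: "c \<in> A" "c \<noteq> 0" "c * brk P b * inverse b \<in> ops"
    using Suc.IH[OF F_brk[OF Suc.prems assms(1)]] by auto
  have "c * b * P * inverse b = c * P - c * brk P b * inverse b"
    using assms(2) by (simp add: brk_def algebra_simps)
  moreover have "P \<in> ops" "c \<in> ops" using Suc.prems c(1) A_subset_ops by (auto simp: ops_def)
  ultimately have "c * b * P * inverse b \<in> ops" using c(3) ops_D(3,5) by metis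
  then show ?case using c assms A_D(3) by (intro bexI[of _ "c * b"]) auto
qed

lemma sub_ring_localised: "std.sub_ring localised_ops"
  unfolding std.sub_ring_def add_closed_def
proof (intro conjI ballI)
  fix z w assume zw: "z \<in> localised_ops" "w \<in> localised_ops"
  then obtain a b where a: "a \<in> A" "a \<noteq> 0" "a * z \<in> ops" and b: "b \<in> A" "b \<noteq> 0" "b * w \<in> ops"
    by (auto simp: localised_ops_def)
  have "a * b * (z - w) = b * a * z - a * b * w"
    using A_commute[OF a(1) b(1)] by (simp add: algebra_simps)
  then have "a * b * (z - w) = b * (a * z) - a * (b * w)"
    by (simp only: mult.assoc)
  moreover have "a \<in> ops" "b \<in> ops" using a b A_subset_ops by auto
  ultimately show "z - w \<in> localised_ops"
    using a b A_D(3) ops_D(3,5) by (intro localised_opsI[of "a * b"]) auto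
  obtain n where "a * z \<in> F n" using a by (auto simp: ops_def)
  then obtain c where c: "c \<in> A" "c \<noteq> 0" "c * (a * z) * inverse b \<in> ops"
    using ops_mult_inverse b by blast
  have "c * a * (z * w) = (c * (a * z) * inverse b) * (b * w)"
    using b by (simp add: mult.assoc flip: mult.assoc[of "inverse b"])
  then show "z * w \<in> localised_ops"
    using a b c A_D(3) ops_D(3) by (intro localised_opsI[of "c * a"]) auto
qed (use ops_subset_localised ops_D in auto)

lemmas localised_D = std.sub_ringD[OF sub_ring_localised]

lemma fractions_subset_localised: "fractions \<subseteq> localised_ops"
  using A_subset_ops unfolding fractions_def localised_ops_def by blast

lemma centraliser_localised:
  assumes "z \<in> localised_ops" "\<And>a. a \<in> A \<Longrightarrow> brk z a = 0"
  shows "z \<in> fractions"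
proof -
  obtain a n where a: "a \<in> A" "a \<noteq> 0" "a * z \<in> F n" using assms by (auto simp: localised_ops_def ops_def)
  have "a * z \<in> A"
  proof (rule centraliser[OF a(3)])
    fix b assume "b \<in> A"
    then have "brk a b = 0" "brk z b = 0"
      using assms(2) A_commute[OF a(1)] by (auto simp: brk_eq_0)
    then show "brk (a * z) b = 0" by (simp add: brk_mult_left)
  qed
  then show ?thesis using a fractionsI by blast
qed

text \<open>Operators of order strictly below n, characterised by commutators alone. The shift by
  one lets inductions start at the zero operator; index 1 gives \<open>fractions\<close>.\<close>

primrec order_less :: "nat \<Rightarrow> 'd set" where
  "order_less 0 = {0}"
| "order_less (Suc n) = {P \<in> localised_ops. \<forall>a\<in>A. brk P a \<in> order_less n}"

lemma order_less_1: "order_less (Suc 0) = fractions"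
  using centraliser_localised fractions_subset_localised fractions_commute_A
  by (auto simp: brk_eq_0)

lemma order_less_subset: "order_less n \<subseteq> localised_ops"
  using localised_D(4) by (cases n) auto

lemma add_closed_order_less: "add_closed (order_less n)"
proof (induction n)
  case (Suc n)
  then show ?case
    using localised_D(1) by (auto simp: add_closed_def brk_linear)
qed (auto simp: add_closed_def)

lemmas order_less_D = add_closedD[OF add_closed_order_less]

lemma order_less_mult_fractions:
  assumes "P \<in> order_less n" "q \<in> fractions"
  shows "P * q \<in> order_less n" "q * P \<in> order_less n"
proof -
  have q: "q \<in> localised_ops" "\<And>a. a \<in> A \<Longrightarrow> brk q a = 0"
    using assms(2) fractions_subset_localised fractions_commute_A by (auto simp: brk_eq_0)
  have "P * q \<in> order_less n \<and> q * P \<in> order_less n"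
    using assms(1)
  proof (induction n arbitrary: P)
    case (Suc n)
    then show ?case using q localised_D(3) by (auto simp: brk_mult_left)
  qed auto
  then show "P * q \<in> order_less n" "q * P \<in> order_less n" by auto
qed

lemma F_order_less: "P \<in> F n \<Longrightarrow> P \<in> order_less (Suc n)"
proof (induction n arbitrary: P)
  case 0
  then show ?case using A_subset_fractions order_less_1 by (simp only: F_0) blast
next
  case (Suc n)
  then have "brk P a \<in> order_less (Suc n)" if "a \<in> A" for a
    using F_brk[OF Suc.prems that] by blast
  moreover have "P \<in> localised_ops"
    using Suc.prems ops_subset_localised by (auto simp: ops_def)
  ultimately show ?case by (simp only: order_less.simps(2)[of "Suc n"]) blast
qed

lemma localised_order_less: "P \<in> localised_ops \<Longrightarrow> \<exists>n. P \<in> order_less n"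
proof -
  assume "P \<in> localised_ops"
  then obtain a n where a: "a \<in> A" "a \<noteq> 0" "a * P \<in> F n" by (auto simp: localised_ops_def ops_def)
  have "inverse a \<in> fractions" using a A_subset_fractions inverse_fractions by auto
  from order_less_mult_fractions(2)[OF F_order_less[OF a(3)] this]
  have "P \<in> order_less (Suc n)" using a(2) by (simp flip: mult.assoc)
  then show ?thesis ..
qed

text \<open>These are all operators of order at most one, hence derivations only up to adding an
  element of \<open>fractions\<close>. This does no harm, as only their commutators with elements of
  \<open>fractions\<close> and with each other matter.\<close>

abbreviation (input) "derivations \<equiv> order_less (Suc (Suc 0))"

lemma derivationsD: "y \<in> derivations \<Longrightarrow> a \<in> A \<Longrightarrow> brk y a \<in> fractions"
  using order_less_1 by (simp only: order_less.simps(2)) auto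

lemma derivationsI: "y \<in> localised_ops \<Longrightarrow> (\<And>a. a \<in> A \<Longrightarrow> brk y a \<in> fractions) \<Longrightarrow> y \<in> derivations"
  using order_less_1 by (simp only: order_less.simps(2)) auto

lemma derivations_fractions:
  assumes y: "y \<in> derivations" and q: "q \<in> fractions"
  shows "brk y q \<in> fractions"
proof -
  obtain a where a: "a \<in> A" "a \<noteq> 0" "a * q \<in> A" using q by (auto simp: fractions_def)
  have "brk y q = inverse a * (brk y (a * q) - brk y a * q)"
    using a(2) by (simp add: brk_mult_right flip: mult.assoc)
  moreover have "inverse a \<in> fractions" using a inverse_fractions A_subset_fractions by auto
  ultimately show ?thesis
    using derivationsD[OF y a(1)] derivationsD[OF y a(3)] q fractions_D(3,5) by auto
qed

lemma brk_zero_of_generators: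
  assumes "\<And>i. brk y (x i) = 0" "a \<in> A"
  shows "brk y a = 0"
proof -
  have "std.sub_ring {a. brk y a = 0}"
    by (auto simp: std.sub_ring_def add_closed_def brk_linear brk_mult_right) (simp_all add: brk_def)
  then have "a \<in> {a. brk y a = 0}"
    by (rule generated[OF assms(2)]) (use assms(1) central in \<open>auto simp: brk_eq_0\<close>)
  then show ?thesis by simp
qed

definition separating :: "'n set \<Rightarrow> bool" where
  "separating J \<longleftrightarrow> (\<forall>y\<in>derivations. (\<forall>j\<in>J. brk y (x j) = 0) \<longrightarrow> (\<forall>a\<in>A. brk y a = 0))"

text \<open>A minimal separating set of coordinates plays the role of a transcendence basis.\<close>

lemma coordinate_derivations:
  obtains J :: "'n set" and y :: "'n \<Rightarrow> 'd" where "separating J"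
    "\<And>j. j \<in> J \<Longrightarrow> y j \<in> derivations"
    "\<And>i j. i \<in> J \<Longrightarrow> j \<in> J \<Longrightarrow> brk (y j) (x i) = (if i = j then 1 else 0)"
proof -
  have "separating UNIV" using brk_zero_of_generators by (auto simp: separating_def)
  from ex_has_least_nat[of separating, OF this, of card]
  obtain J where J: "separating J" and min: "\<And>J'. separating J' \<Longrightarrow> card J \<le> card J'"
    by blast
  have "\<exists>y\<in>derivations. \<forall>i\<in>J. brk y (x i) = (if i = j then 1 else 0)" if j: "j \<in> J" for j
  proof -
    \<comment> \<open>By minimality some derivation kills the other coordinates of \<open>J\<close>
      but not all of \<open>A\<close>. It cannot kill \<open>x j\<close>, since \<open>J\<close>
      separates; dividing by that value normalises it.\<close>
    have "card (J - {j}) < card J" using j by (intro psubset_card_mono) auto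
    then have "\<not> separating (J - {j})" using min by (metis leD)
    then obtain y where y: "y \<in> derivations" "\<And>i. i \<in> J - {j} \<Longrightarrow> brk y (x i) = 0"
      "\<exists>a\<in>A. brk y a \<noteq> 0" unfolding separating_def by blast
    let ?q = "brk y (x j)"
    have q: "?q \<noteq> 0" using y J unfolding separating_def by (metis Diff_iff singletonD)
    have qf: "inverse ?q \<in> fractions" using derivationsD[OF y(1) x_mem] inverse_fractions by blast
    have "brk (inverse ?q * y) (x i) = inverse ?q * brk y (x i)" for i
      using fractions_commute_A[OF qf x_mem] by (simp add: brk_mult_left) (simp add: brk_def)
    then have "\<forall>i\<in>J. brk (inverse ?q * y) (x i) = (if i = j then 1 else 0)"
      using y(2) q by auto
    then show ?thesis using order_less_mult_fractions(2)[OF y(1) qf] by blast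
  qed
  then obtain y where "\<And>j. j \<in> J \<Longrightarrow> y j \<in> derivations"
    "\<And>i j. i \<in> J \<Longrightarrow> j \<in> J \<Longrightarrow> brk (y j) (x i) = (if i = j then 1 else 0)" by metis
  then show ?thesis using that J by blast
qed

context
  fixes J :: "'n set" and y :: "'n \<Rightarrow> 'd"
  assumes separating: "separating J"
    and y: "\<And>j. j \<in> J \<Longrightarrow> y j \<in> derivations"
    and dual: "\<And>i j. i \<in> J \<Longrightarrow> j \<in> J \<Longrightarrow> brk (y j) (x i) = (if i = j then 1 else 0)"
begin

text \<open>By the Jacobi identity the commutator is again of order at most one, and it kills the
  coordinates in \<open>J\<close> because the values of \<open>y i\<close> and \<open>y j\<close> on
  them are the constants 0 and 1. Hence it commutes with \<open>A\<close>.\<close>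

lemma derivations_commute:
  assumes ij: "i \<in> J" "j \<in> J"
  shows "brk (y i) (y j) \<in> fractions"
proof -
  have loc: "brk (y i) (y j) \<in> localised_ops"
    using y[OF ij(1)] y[OF ij(2)] order_less_subset localised_D(3,5) unfolding brk_def by blast
  have jac: "brk (brk (y i) (y j)) a = brk (y i) (brk (y j) a) - brk (y j) (brk (y i) a)" for a
    by (simp add: brk_def algebra_simps)
  have "brk (y i) (y j) \<in> derivations"
    unfolding jac[symmetric]
    by (rule derivationsI[OF loc])
      (use jac derivations_fractions derivationsD y ij fractions_D(5) in simp)
  moreover have "brk (brk (y i) (y j)) (x k) = 0" if "k \<in> J" for k
    unfolding jac using dual ij that by (simp add: brk_def)
  ultimately have "\<forall>a\<in>A. brk (brk (y i) (y j)) a = 0"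
    using separating unfolding separating_def by blast
  then show ?thesis using centraliser_localised[OF loc] by blast
qed

text \<open>The chain rule in top order. Bracketing with one more element lowers the order of P; in
  the base case the error term is a derivation killing the coordinates in \<open>J\<close>, hence
  killing \<open>A\<close>, and the identity is exact.\<close>

lemma brk_expansion:
  assumes "P \<in> order_less (Suc (Suc n))" "a \<in> A"
  shows "brk P a - (\<Sum>j\<in>J. brk P (x j) * brk (y j) a) \<in> order_less n"
  using assms
proof (induction n arbitrary: P)
  case 0
  define z where "z = P - (\<Sum>j\<in>J. brk P (x j) * y j)"
  have Px: "brk P (x j) \<in> fractions" for j using derivationsD[OF 0(1) x_mem] .
  have "z \<in> derivations"
    unfolding z_def using 0(1) Px y order_less_mult_fractions(2)
    by (intro order_less_D(2) add_closed_sum[OF add_closed_order_less]) blast+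
  moreover have zb: "brk z a = brk P a - (\<Sum>j\<in>J. brk P (x j) * brk (y j) a)" if "a \<in> A" for a
    using fractions_commute_A[OF Px that]
    by (simp add: z_def brk_linear brk_sum brk_mult_left) (simp add: brk_def)
  moreover have "brk z (x i) = 0" if "i \<in> J" for i
  proof -
    have "(\<Sum>j\<in>J. brk P (x j) * brk (y j) (x i)) = (\<Sum>j\<in>J. if i = j then brk P (x i) else 0)"
      using dual[OF that] by (intro sum.cong) auto
    then show ?thesis using zb[OF x_mem] that by simp
  qed
  ultimately have "brk z a = 0" using separating 0(2) unfolding separating_def by blast
  then show ?case using zb[OF 0(2)] by simp
next
  case (Suc n)
  define z where "z = brk P a - (\<Sum>j\<in>J. brk P (x j) * brk (y j) a)"
  have P: "P \<in> localised_ops" "\<And>b. b \<in> A \<Longrightarrow> brk P b \<in> order_less (Suc (Suc n))"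
    using Suc.prems(1) by (simp_all only: order_less.simps(2)[of "Suc (Suc n)"]) auto
  have ya: "brk (y j) a \<in> fractions" if "j \<in> J" for j
    using derivationsD[OF y[OF that] Suc.prems(2)] .
  have "brk z b = brk (brk P b) a - (\<Sum>j\<in>J. brk (brk P b) (x j) * brk (y j) a)" if b: "b \<in> A" for b
  proof -
    have "brk (brk P a) b = brk (brk P b) a" "\<And>j. brk (brk P (x j)) b = brk (brk P b) (x j)"
      using A_commute b Suc.prems(2) x_mem by (auto intro!: brk_brk simp: brk_eq_0)
    moreover have "brk (brk P (x j) * brk (y j) a) b = brk (brk P (x j)) b * brk (y j) a" if "j \<in> J" for j
      using fractions_commute_A[OF ya[OF that] b] by (simp add: brk_mult_left) (simp add: brk_def)
    ultimately show ?thesis by (simp add: z_def brk_linear brk_sum)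
  qed
  then have "brk z b \<in> order_less n" if "b \<in> A" for b
    using Suc.IH[OF P(2)[OF that] Suc.prems(2)] that by simp
  moreover have "z \<in> localised_ops"
    unfolding z_def using P(2) x_mem Suc.prems(2) order_less_subset ya fractions_subset_localised
    by (intro localised_D(5) add_closed_sum[OF localised_D(1)] localised_D(3)) blast+
  ultimately show ?case by (simp add: z_def)
qed

text \<open>The Euler operator of the order filtration, up to lower order.\<close>

lemma euler:
  assumes "P \<in> order_less (Suc n)"
  shows "of_nat n * P - (\<Sum>j\<in>J. brk P (x j) * y j) \<in> order_less n"
  using assms
proof (induction n arbitrary: P)
  case 0
  then have "brk P (x j) = 0" for j using x_mem by auto
  then show ?case by simp
next
  case (Suc n)
  define z where "z = of_nat (Suc n) * P - (\<Sum>j\<in>J. brk P (x j) * y j)"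
  have P: "P \<in> localised_ops" "\<And>b. b \<in> A \<Longrightarrow> brk P b \<in> order_less (Suc n)"
    using Suc.prems by (simp_all only: order_less.simps(2)[of "Suc n"]) auto
  have "brk z a \<in> order_less n" if a: "a \<in> A" for a
  proof -
    have "brk (brk P (x j)) a = brk (brk P a) (x j)" for j
      using A_commute[OF x_mem a] by (intro brk_brk) (simp add: brk_eq_0)
    then have "brk z a = of_nat (Suc n) * brk P a -
      (\<Sum>j\<in>J. brk P (x j) * brk (y j) a + brk (brk P a) (x j) * y j)"
      by (simp add: z_def brk_linear brk_sum brk_mult_left) (simp add: brk_def algebra_simps mult_of_nat_commute)
    \<comment> \<open>Of the \<open>Suc n\<close> copies of \<open>brk P a\<close>, n go into the
      induction hypothesis for \<open>brk P a\<close> and one into the chain rule.\<close>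
    also have "\<dots> = (of_nat n * brk P a - (\<Sum>j\<in>J. brk (brk P a) (x j) * y j)) +
      (brk P a - (\<Sum>j\<in>J. brk P (x j) * brk (y j) a))"
      by (simp add: sum.distrib algebra_simps)
    also have "\<dots> \<in> order_less n"
      by (intro order_less_D(4) Suc.IH P(2) a brk_expansion Suc.prems)
    finally show ?thesis .
  qed
  moreover have "z \<in> localised_ops"
  proof -
    have "of_nat (Suc n) \<in> localised_ops"
      using \<kappa>_mem[of "of_nat (Suc n)"] A_subset_ops ops_subset_localised
      unfolding \<kappa>_of_nat by blast
    moreover have "y j \<in> localised_ops" if "j \<in> J" for j
      using y[OF that] order_less_subset by blast
    moreover have "brk P (x j) \<in> localised_ops" for j
      using P(2)[OF x_mem] order_less_subset by blast
    ultimately show ?thesis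
      unfolding z_def using P(1)
      by (intro localised_D(5) add_closed_sum[OF localised_D(1)] localised_D(3)) auto
  qed
  ultimately show ?case by (simp add: z_def)
qed



text \<open>Induction on the order: Euler's formula expresses n P through commutators of lower order
  and the \<open>y j\<close>, and n is invertible in characteristic zero.\<close>

lemma localised_subset_generated:
  assumes W: "std.sub_ring W" "fractions \<subseteq> W" "\<And>j. j \<in> J \<Longrightarrow> y j \<in> W"
  shows "localised_ops \<subseteq> W"
proof -
  note WD = std.sub_ringD[OF W(1)]
  have "order_less n \<subseteq> W" for n
  proof (induction n)
    case (Suc n)
    show ?case
    proof (cases n)
      case 0
      then show ?thesis using W(2) order_less_1 by simp
    next
      case (Suc m)
      show ?thesis
      proof
        fix P assume P: "P \<in> order_less (Suc n)"
        have "brk P (x j) \<in> W" for j using P x_mem Suc.IH by auto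
        then have "(\<Sum>j\<in>J. brk P (x j) * y j) \<in> W"
          using W(3) WD by (intro add_closed_sum[OF WD(1)]) auto
        moreover have "of_nat n * P - (\<Sum>j\<in>J. brk P (x j) * y j) \<in> W"
          using euler[OF P] Suc.IH by blast
        ultimately have "of_nat n * P \<in> W" using WD(7) by fastforce
        moreover have "\<kappa> (inverse (of_nat n)) \<in> W"
          using \<kappa>_mem A_subset_fractions W(2) by blast
        ultimately have "\<kappa> (inverse (of_nat n)) * (of_nat n * P) \<in> W" by (rule WD(3)[rotated])
        moreover have "\<kappa> (inverse (of_nat n)) * of_nat n = 1"
          using Suc by (simp add: \<kappa>_of_nat[symmetric] \<kappa>_mult[symmetric] del: of_nat_Suc)
        ultimately show "P \<in> W" by (simp flip: mult.assoc)
      qed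
    qed
  qed (use WD in auto)
  then show ?thesis using localised_order_less by blast
qed

text \<open>If P commutes with the coordinates in \<open>J\<close>, Euler's formula leaves n P equal
  to something of lower order. So finitely many commutators suffice to cut out \<open>A\<close>,
  which makes the argument with nilpotent derivations finite.\<close>

lemma centraliser_coordinates:
  assumes "P \<in> ops" "\<And>j. j \<in> J \<Longrightarrow> brk P (x j) = 0"
  shows "P \<in> A"
proof -
  have "P \<in> order_less (Suc n) \<Longrightarrow> P \<in> fractions" for n
  proof (induction n)
    case 0
    then show ?case using order_less_1 by (simp only:)
  next
    case (Suc n)
    have "of_nat (Suc n) * P \<in> order_less (Suc n)"
      using euler[OF Suc.prems] assms(2) by simp
    then have "\<kappa> (inverse (of_nat (Suc n))) * (of_nat (Suc n) * P) \<in> order_less (Suc n)"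
      by (rule order_less_mult_fractions(2)) (use \<kappa>_mem A_subset_fractions in blast)
    moreover have "\<kappa> (inverse (of_nat (Suc n))) * of_nat (Suc n) = 1"
      by (simp add: \<kappa>_of_nat[symmetric] \<kappa>_mult[symmetric] del: of_nat_Suc)
    ultimately have "P \<in> order_less (Suc n)" by (simp del: of_nat_Suc flip: mult.assoc)
    then show ?case by (rule Suc.IH)
  qed
  moreover obtain n where "P \<in> F n" using assms(1) by (auto simp: ops_def)
  ultimately have "P \<in> fractions" using F_order_less by blast
  then show ?thesis
    using centraliser[OF \<open>P \<in> F n\<close>] fractions_commute_A by (simp add: brk_eq_0)
qed

end

end


section \<open>Generated subrings and repeated adjunction\<close>

context ring_mult
begin

lemma sub_ring_Inter: "\<S> \<noteq> {} \<Longrightarrow> (\<And>R. R \<in> \<S> \<Longrightarrow> sub_ring R) \<Longrightarrow> sub_ring (\<Inter>\<S>)"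
  by (auto simp: sub_ring_def add_closed_def)

definition ring_hull :: "'a set \<Rightarrow> 'a set" where
  "ring_hull S = \<Inter>{R. sub_ring R \<and> S \<subseteq> R}"

lemma sub_ring_UNIV: "sub_ring UNIV"
  by (simp add: sub_ring_def add_closed_def)

lemma sub_ring_hull: "sub_ring (ring_hull S)"
  unfolding ring_hull_def using sub_ring_UNIV by (intro sub_ring_Inter) auto

lemma hull_subset: "S \<subseteq> ring_hull S"
  by (auto simp: ring_hull_def)

lemma hull_minimal: "sub_ring R \<Longrightarrow> S \<subseteq> R \<Longrightarrow> ring_hull S \<subseteq> R"
  by (auto simp: ring_hull_def)

lemma hull_mono: "S \<subseteq> T \<Longrightarrow> ring_hull S \<subseteq> ring_hull T"
  by (auto simp: ring_hull_def)

lemma hull_insert_hull: "ring_hull (insert \<xi> (ring_hull S)) = ring_hull (insert \<xi> S)"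
proof
  show "ring_hull (insert \<xi> (ring_hull S)) \<subseteq> ring_hull (insert \<xi> S)"
    using hull_mono[of S "insert \<xi> S"] hull_subset[of "insert \<xi> S"]
    by (intro hull_minimal[OF sub_ring_hull]) blast
  show "ring_hull (insert \<xi> S) \<subseteq> ring_hull (insert \<xi> (ring_hull S))"
    using hull_subset[of S] by (intro hull_mono) blast
qed

lemma bracket_hull:
  assumes "\<And>s. s \<in> S \<Longrightarrow> bracket \<xi> s \<in> ring_hull S" "r \<in> ring_hull S"
  shows "bracket \<xi> r \<in> ring_hull S"
proof -
  note D = sub_ringD[OF sub_ring_hull]
  have "sub_ring {r \<in> ring_hull S. bracket \<xi> r \<in> ring_hull S}"
    unfolding sub_ring_def add_closed_def
  proof (intro conjI ballI CollectI)
    fix r s assume rs: "r \<in> {r \<in> ring_hull S. bracket \<xi> r \<in> ring_hull S}"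
      "s \<in> {r \<in> ring_hull S. bracket \<xi> r \<in> ring_hull S}"
    have "bracket \<xi> (r - s) = bracket \<xi> r - bracket \<xi> s"
      "bracket \<xi> (r \<star> s) = bracket \<xi> r \<star> s + r \<star> bracket \<xi> s"
      by (simp_all add: bracket_def mult_algebra)
    with rs show "bracket \<xi> (r - s) \<in> ring_hull S" "bracket \<xi> (r \<star> s) \<in> ring_hull S"
      "r - s \<in> ring_hull S" "r \<star> s \<in> ring_hull S"
      using D by auto
  qed (use D in \<open>auto simp: bracket_def\<close>)
  moreover have "S \<subseteq> {r \<in> ring_hull S. bracket \<xi> r \<in> ring_hull S}"
    using assms(1) hull_subset by auto
  ultimately have "ring_hull S \<subseteq> {r \<in> ring_hull S. bracket \<xi> r \<in> ring_hull S}"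
    by (rule hull_minimal)
  then show ?thesis using assms(2) by blast
qed

lemma adjoin_eq_hull:
  assumes N: "two_sided N" "N \<subseteq> R" and R: "sub_ring R"
    and normal: "\<And>r. r \<in> R \<Longrightarrow> \<exists>r'\<in>R. r \<star> \<xi> - \<xi> \<star> r' \<in> R"
      "\<And>r. r \<in> R \<Longrightarrow> \<exists>r'\<in>R. r' \<star> \<xi> - \<xi> \<star> r \<in> R"
  shows "adjoin R \<xi> = ring_hull (insert \<xi> R)"
proof
  have sub: "sub_ring (adjoin R \<xi>)" by (rule sub_ring_adjoin[OF assms])
  have "insert \<xi> R \<subseteq> adjoin R \<xi>"
    using gen_in_adjoin[OF assms] coeff_subset_adjoin[OF assms] by blast
  then show "ring_hull (insert \<xi> R) \<subseteq> adjoin R \<xi>"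
    by (rule hull_minimal[OF sub])
  note D = sub_ringD[OF sub_ring_hull[of "insert \<xi> R"]]
  have sub: "insert \<xi> R \<subseteq> ring_hull (insert \<xi> R)" by (rule hull_subset)
  have "lower_polys R \<xi> n \<subseteq> ring_hull (insert \<xi> R)" for n
  proof (induction n)
    case (Suc n)
    show ?case
    proof
      fix z assume "z \<in> lower_polys R \<xi> (Suc n)"
      then obtain r w where "z = r + \<xi> \<star> w" "r \<in> R" "w \<in> lower_polys R \<xi> n" by auto
      then show "z \<in> ring_hull (insert \<xi> R)" using D(7)[OF _ D(3)[of \<xi> w]] sub Suc by blast
    qed
  qed (use D in auto)
  then show "adjoin R \<xi> \<subseteq> ring_hull (insert \<xi> R)" unfolding adjoin_def by blast
qed

lemma left_noetherian_hull_insert: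
  assumes N: "two_sided N" "N \<subseteq> S" and br: "\<And>s. s \<in> S \<Longrightarrow> bracket \<xi> s \<in> ring_hull S"
    and noeth: "left_noetherian N (ring_hull S)"
  shows "left_noetherian N (ring_hull (insert \<xi> S))"
proof -
  let ?R = "ring_hull S"
  have NR: "N \<subseteq> ?R" using N(2) hull_subset by blast
  have 1: "\<exists>r'\<in>?R. r \<star> \<xi> - \<xi> \<star> r' \<in> ?R" "\<exists>r'\<in>?R. r' \<star> \<xi> - \<xi> \<star> r \<in> ?R" if "r \<in> ?R" for r
  proof -
    have "- bracket \<xi> r \<in> ?R" using bracket_hull[OF br that] sub_ringD(6)[OF sub_ring_hull] by blast
    then have "r \<star> \<xi> - \<xi> \<star> r \<in> ?R" by (simp add: bracket_def)
    then show "\<exists>r'\<in>?R. r \<star> \<xi> - \<xi> \<star> r' \<in> ?R" "\<exists>r'\<in>?R. r' \<star> \<xi> - \<xi> \<star> r \<in> ?R"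
      using that by blast+
  qed
  note adj = N(1) NR sub_ring_hull[of S] 1
  from left_noetherian_adjoin[OF adj noeth] show ?thesis
    by (simp add: adjoin_eq_hull[OF adj] hull_insert_hull)
qed

text \<open>The commutators among the new elements are required to lie in the hull of
  \<open>S\<close> itself. The elements can therefore be adjoined one at a time in any order, each
  with commutators in the ring already reached.\<close>

lemma left_noetherian_hull_Un:
  assumes "finite T" and N: "two_sided N" "N \<subseteq> S" and noeth: "left_noetherian N (ring_hull S)"
    and br: "\<And>\<xi> s. \<xi> \<in> T \<Longrightarrow> s \<in> S \<union> T \<Longrightarrow> bracket \<xi> s \<in> ring_hull S"
  shows "left_noetherian N (ring_hull (S \<union> T))"
  using assms(1) br
proof (induction T rule: finite_induct)
  case (insert \<xi> T)
  have "bracket \<xi> s \<in> ring_hull (S \<union> T)" if "s \<in> S \<union> T" for s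
    using insert.prems[of \<xi> s] hull_mono[of S "S \<union> T"] that by auto
  then have "left_noetherian N (ring_hull (insert \<xi> (S \<union> T)))"
    using insert N by (intro left_noetherian_hull_insert) auto
  then show ?case by simp
qed (use noeth in simp)


section \<open>Locally nilpotent derivations\<close>

definition multiple :: "nat \<Rightarrow> 'a \<Rightarrow> 'a" where
  "multiple n x = (\<Sum>i<n. x)"

lemma multiple_simps: "multiple 0 x = 0" "multiple (Suc n) x = multiple n x + x"
  by (simp_all add: multiple_def)

lemma multiple_add: "multiple (m + n) x = multiple m x + multiple n x"
  by (induction n) (auto simp: multiple_simps algebra_simps)

abbreviation ad :: "'a \<Rightarrow> 'a \<Rightarrow> 'a" where
  "ad c x \<equiv> bracket x c"

lemma ad_mult: "ad c (x \<star> y) = ad c x \<star> y + x \<star> ad c y"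
  by (simp add: bracket_def mult_algebra)

lemma ad_linear: "ad c (x + y) = ad c x + ad c y" "ad c (x - y) = ad c x - ad c y" "ad c 0 = 0"
  by (simp_all add: bracket_def mult_algebra)

lemma ad_pow_add: "(ad c ^^ n) (x + y) = (ad c ^^ n) x + (ad c ^^ n) y"
  by (induction n) (auto simp: ad_linear)

context
  fixes N
  assumes N: "two_sided N"
begin

lemma two_sidedD: "add_closed N" "y \<in> N \<Longrightarrow> x \<star> y \<in> N" "y \<in> N \<Longrightarrow> y \<star> x \<in> N"
  using N by (auto simp: two_sided_def)

lemma ad_null: "x \<in> N \<Longrightarrow> ad c x \<in> N"
  unfolding bracket_def by (intro add_closedD(2)[OF two_sidedD(1)] two_sidedD(2,3))

lemma ad_N: "x \<in> N \<Longrightarrow> (ad c ^^ n) x \<in> N"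
  by (induction n) (auto intro: ad_null)

text \<open>The coefficient is the binomial coefficient \<open>n + m\<close> over \<open>n\<close>, of which only positivity matters.\<close>

lemma ad_pow_leading:
  assumes "(ad c ^^ Suc n) x \<in> N" "(ad c ^^ Suc m) y \<in> N"
  shows "\<exists>k>0. (ad c ^^ (n + m)) (x \<star> y) - multiple k ((ad c ^^ n) x \<star> (ad c ^^ m) y) \<in> N"
  using assms
proof (induction "n + m" arbitrary: n m x y)
  case 0
  then show ?case
    by (intro exI[of _ 1]) (simp add: multiple_def add_closedD[OF two_sidedD(1)])
next
  case (Suc l)
  note ND = add_closedD[OF two_sidedD(1)]
  let ?t = "(ad c ^^ n) x \<star> (ad c ^^ m) y"
  have pow: "(ad c ^^ (n + m)) (x \<star> y) = (ad c ^^ l) (ad c x \<star> y) + (ad c ^^ l) (x \<star> ad c y)"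
    unfolding Suc(2)[symmetric] funpow_Suc_right o_apply ad_mult ad_pow_add ..
  \<comment> \<open>For \<open>n = 0\<close> this half of the Leibniz rule is null and contributes
    \<open>k = 0\<close>. Since \<open>n + m\<close> is positive, one of the two halves contributes
    a positive coefficient.\<close>
  have 1: "\<exists>k. (ad c ^^ l) (ad c x \<star> y) - multiple k ?t \<in> N \<and> (n > 0 \<longrightarrow> k > 0)"
  proof (cases n)
    case 0
    then have "ad c x \<star> y \<in> N" using Suc.prems two_sidedD(3) by simp
    then show ?thesis using 0 ad_N by (intro exI[of _ 0]) (simp add: multiple_simps)
  next
    case (Suc n')
    have "(ad c ^^ Suc n') (ad c x) \<in> N" using Suc.prems Suc by (simp only: funpow_Suc_right o_apply)
    moreover have l: "l = n' + m" using Suc Suc.hyps(2) by simp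
    ultimately obtain k where "k > 0" "(ad c ^^ (n' + m)) (ad c x \<star> y) -
        multiple k ((ad c ^^ n') (ad c x) \<star> (ad c ^^ m) y) \<in> N"
      using Suc.hyps(1)[of n' m "ad c x" y] Suc.prems(2) by blast
    moreover have "(ad c ^^ n') (ad c x) = (ad c ^^ n) x" unfolding Suc funpow_Suc_right o_apply ..
    ultimately show ?thesis unfolding l by auto
  qed
  have 2: "\<exists>k. (ad c ^^ l) (x \<star> ad c y) - multiple k ?t \<in> N \<and> (m > 0 \<longrightarrow> k > 0)"
  proof (cases m)
    case 0
    then have "x \<star> ad c y \<in> N" using Suc.prems two_sidedD(2) by simp
    then show ?thesis using 0 ad_N by (intro exI[of _ 0]) (simp add: multiple_simps)
  next
    case (Suc m')
    have "(ad c ^^ Suc m') (ad c y) \<in> N" using Suc.prems Suc by (simp only: funpow_Suc_right o_apply)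
    moreover have l: "l = n + m'" using Suc Suc.hyps(2) by simp
    ultimately obtain k where "k > 0" "(ad c ^^ (n + m')) (x \<star> ad c y) -
        multiple k ((ad c ^^ n) x \<star> (ad c ^^ m') (ad c y)) \<in> N"
      using Suc.hyps(1)[of n m' x "ad c y"] Suc.prems(1) by blast
    moreover have "(ad c ^^ m') (ad c y) = (ad c ^^ m) y" unfolding Suc funpow_Suc_right o_apply ..
    ultimately show ?thesis unfolding l by auto
  qed
  obtain k k' where k: "(ad c ^^ l) (ad c x \<star> y) - multiple k ?t \<in> N" "n > 0 \<longrightarrow> k > 0"
    "(ad c ^^ l) (x \<star> ad c y) - multiple k' ?t \<in> N" "m > 0 \<longrightarrow> k' > 0" using 1 2 by blast
  have "(ad c ^^ (n + m)) (x \<star> y) - multiple (k + k') ?t =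
    ((ad c ^^ l) (ad c x \<star> y) - multiple k ?t) + ((ad c ^^ l) (x \<star> ad c y) - multiple k' ?t)"
    by (simp add: pow multiple_add)
  also have "\<dots> \<in> N" using ND(4) k by blast
  finally show ?case using k Suc.hyps(2) by (intro exI[of _ "k + k'"]) auto
qed

context
  assumes torsion_free: "\<And>k x. multiple k x \<in> N \<Longrightarrow> k > 0 \<Longrightarrow> x \<in> N"
begin

text \<open>The last iterated commutators of \<open>x\<close> and \<open>y\<close> outside
  \<open>N\<close> lie in the kernel modulo \<open>N\<close>. Their product is, up to a positive
  multiple, the top iterated commutator of \<open>x \<star> y\<close>, so it is null if
  \<open>x \<star> y\<close> is.\<close>

lemma domain_of_kernel:
  assumes B: "\<And>x. x \<in> B \<Longrightarrow> ad c x \<in> B" "\<And>x. x \<in> B \<Longrightarrow> \<exists>n. (ad c ^^ n) x \<in> N"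
    and kernel: "\<And>x y. x \<in> B \<Longrightarrow> y \<in> B \<Longrightarrow> ad c x \<in> N \<Longrightarrow> ad c y \<in> N \<Longrightarrow> x \<star> y \<in> N \<Longrightarrow> x \<in> N \<or> y \<in> N"
    and xy: "x \<in> B" "y \<in> B" "x \<star> y \<in> N"
  shows "x \<in> N \<or> y \<in> N"
proof (rule ccontr)
  assume not: "\<not> (x \<in> N \<or> y \<in> N)"
  have top: "\<exists>n. (ad c ^^ n) z \<notin> N \<and> (ad c ^^ Suc n) z \<in> N" if z: "z \<in> B" "z \<notin> N" for z
  proof -
    define n where "n = (LEAST n. (ad c ^^ n) z \<in> N)"
    have n: "(ad c ^^ n) z \<in> N" unfolding n_def using B(2)[OF z(1)] by (rule LeastI_ex)
    then obtain m where m: "n = Suc m" using z(2) by (cases n) auto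
    have "(ad c ^^ m) z \<notin> N" using not_less_Least[of m "\<lambda>n. (ad c ^^ n) z \<in> N"] m n_def by auto
    then show ?thesis using n m by blast
  qed
  obtain n m where n: "(ad c ^^ n) x \<notin> N" "(ad c ^^ Suc n) x \<in> N"
    and m: "(ad c ^^ m) y \<notin> N" "(ad c ^^ Suc m) y \<in> N"
    using top[OF xy(1)] top[OF xy(2)] not by blast
  obtain k where k: "k > 0" "(ad c ^^ (n + m)) (x \<star> y) - multiple k ((ad c ^^ n) x \<star> (ad c ^^ m) y) \<in> N"
    using ad_pow_leading[OF n(2) m(2)] by blast
  have "multiple k ((ad c ^^ n) x \<star> (ad c ^^ m) y) \<in> N"
    using add_closedD(2)[OF two_sidedD(1) ad_N[OF xy(3), of "n + m" c] k(2)] by simp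
  then have "(ad c ^^ n) x \<star> (ad c ^^ m) y \<in> N" using k(1) by (rule torsion_free)
  moreover have "(ad c ^^ n) z \<in> B" if "z \<in> B" for n z
    using that by (induction n) (auto intro: B(1))
  ultimately show False using kernel[of "(ad c ^^ n) x" "(ad c ^^ m) y"] n m xy by auto
qed

text \<open>The induction hypothesis for \<open>C\<close> leaves a pair killed by all
  \<open>ad d\<close>. The set of such elements is stable under \<open>ad c\<close>, because the
  elements of \<open>insert c C\<close> commute, so \<open>domain_of_kernel\<close> applies to
  it.\<close>

lemma domain_of_common_kernel:
  assumes "finite C" "\<And>c d. c \<in> C \<Longrightarrow> d \<in> C \<Longrightarrow> c \<star> d = d \<star> c"
    and B: "\<And>c x. c \<in> C \<Longrightarrow> x \<in> B \<Longrightarrow> ad c x \<in> B" "\<And>c x. c \<in> C \<Longrightarrow> x \<in> B \<Longrightarrow> \<exists>n. (ad c ^^ n) x \<in> N"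
    and kernel: "\<And>x y. x \<in> B \<Longrightarrow> y \<in> B \<Longrightarrow> \<forall>c\<in>C. ad c x \<in> N \<Longrightarrow> \<forall>c\<in>C. ad c y \<in> N \<Longrightarrow> x \<star> y \<in> N \<Longrightarrow>
      x \<in> N \<or> y \<in> N"
    and xy: "x \<in> B" "y \<in> B" "x \<star> y \<in> N"
  shows "x \<in> N \<or> y \<in> N"
  using assms
proof (induction C arbitrary: B x y rule: finite_induct)
  case (insert c C)
  have ad_commute: "ad d (ad c z) = ad c (ad d z)" if "d \<in> C" for d z
    using insert.prems(1)[of c d] that by (simp add: bracket_def mult_algebra) (metis assoc)
  show ?case
  proof (rule insert.IH[of B x y])
    fix u v assume uv: "u \<in> B" "v \<in> B" "\<forall>d\<in>C. ad d u \<in> N" "\<forall>d\<in>C. ad d v \<in> N" "u \<star> v \<in> N"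
    show "u \<in> N \<or> v \<in> N"
    proof (rule domain_of_kernel[of "{z \<in> B. \<forall>d\<in>C. ad d z \<in> N}" c u v])
      fix z assume z: "z \<in> {z \<in> B. \<forall>d\<in>C. ad d z \<in> N}"
      then show "ad c z \<in> {z \<in> B. \<forall>d\<in>C. ad d z \<in> N}"
        using insert.prems(2) ad_commute ad_null by auto
      show "\<exists>n. (ad c ^^ n) z \<in> N" using z insert.prems(3) by auto
    qed (use uv insert.prems(4) in auto)
  qed (use insert.prems in auto)
qed blast

end

end

end


section \<open>The enveloping algebra of a division ring of differential operators\<close>

context central_field
begin

lemma swap_pairs_mult: "swap_pairs (tensor_mult Y Z) = tensor_mult (swap_pairs Z) (swap_pairs Y)"
proof -
  have "swap_pairs (tensor_mult (pure a b) Z) = tensor_mult (swap_pairs Z) (pure b a)" for a b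
    by (rule tensor_induct[of Z UNIV UNIV])
      (auto simp: tensor_mult_pure tensor_mult_diffl tensor_mult_diffr)
  then show ?thesis
    by - (rule tensor_induct[of Y UNIV UNIV], auto simp: tensor_mult_diffl tensor_mult_diffr)
qed

lemma swap_pairs_null_iff: "swap_pairs Z \<in> N \<longleftrightarrow> Z \<in> N"
  using swap_pairs_null[of Z UNIV UNIV] swap_pairs_null[of "swap_pairs Z" UNIV UNIV] by auto

text \<open>The enveloping algebra is isomorphic to its opposite by swapping the factors, so the
  right-handed condition comes for free.\<close>

lemma right_noetherian_tensor:
  assumes "tensor.left_noetherian N UNIV"
  shows "ring_mult.left_noetherian (\<lambda>x y. tensor_mult y x) N UNIV"
proof -
  interpret flip: ring_mult "\<lambda>x y :: ('d \<times> 'd \<Rightarrow>\<^sub>0 int). tensor_mult y x" "pure 1 1" by (rule tensor.flip)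
  have vimage: "tensor.left_ideal_over N UNIV (swap_pairs -` I)" if I: "flip.left_ideal_over N UNIV I" for I
  proof -
    have I': "add_closed I" "N \<subseteq> I" "\<And>y z. z \<in> I \<Longrightarrow> tensor_mult z y \<in> I"
      using I by (auto simp: flip.left_ideal_over_def)
    have "swap_pairs z \<in> I" if "z \<in> N" for z
      using that swap_pairs_null_iff I'(2) by (metis subsetD)
    then show ?thesis
      using I'(1,3) by (auto simp: tensor.left_ideal_over_def add_closed_def swap_pairs_mult)
  qed
  show ?thesis
    unfolding flip.left_noetherian_def acc_on_def
  proof (intro allI impI)
    fix I :: "nat \<Rightarrow> ('d \<times> 'd \<Rightarrow>\<^sub>0 int) set"
    assume I: "(\<forall>n. flip.left_ideal_over N UNIV (I n)) \<and> (\<forall>n. I n \<subseteq> I (Suc n))"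
    have "\<exists>M. \<forall>n\<ge>M. swap_pairs -` I n = swap_pairs -` I M"
      by (rule acc_onD[where I = "\<lambda>n. swap_pairs -` I n", OF assms[unfolded tensor.left_noetherian_def]])
        (use I vimage in \<open>simp_all add: vimage_mono\<close>)
    then obtain M where M: "\<And>n. n \<ge> M \<Longrightarrow> swap_pairs -` I n = swap_pairs -` I M" by blast
    have surj: "surj (swap_pairs :: ('d \<times> 'd \<Rightarrow>\<^sub>0 int) \<Rightarrow> _)" by (rule surjI) (rule swap_pairs_swap_pairs)
    have "I n = I M" if "n \<ge> M" for n
      using surj_image_vimage_eq[OF surj, of "I n"] surj_image_vimage_eq[OF surj, of "I M"] M[OF that]
      by simp
    then show "\<exists>M. \<forall>n\<ge>M. I n = I M" by blast
  qed
qed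

text \<open>The image of \<open>P \<otimes> Q\<close> in the tensor square of the division ring,
  saturated by the null sums so that it can be compared with ideals and subrings that contain
  \<open>N\<close>.\<close>

definition tensor_span :: "'d set \<Rightarrow> 'd set \<Rightarrow> ('d \<times> 'd \<Rightarrow>\<^sub>0 int) set" where
  "tensor_span P Q = {Z. \<exists>Y. Poly_Mapping.keys Y \<subseteq> P \<times> Q \<and> Z - Y \<in> N}"

lemma null_subset_span: "N \<subseteq> tensor_span P Q"
proof
  fix Z assume "Z \<in> N"
  then have "Z - 0 \<in> N" unfolding diff_zero .
  then show "Z \<in> tensor_span P Q" unfolding tensor_span_def by (intro CollectI exI[of _ 0]) simp
qed

lemma pure_in_span: "a \<in> P \<Longrightarrow> b \<in> Q \<Longrightarrow> pure a b \<in> tensor_span P Q"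
  using nullD(1) unfolding tensor_span_def by (auto intro!: exI[of _ "pure a b"])

lemma add_closed_span: "add_closed (tensor_span P Q)"
  unfolding add_closed_def
proof (intro conjI ballI)
  show "0 \<in> tensor_span P Q" using null_subset_span nullD(1) by blast
  fix y z assume "y \<in> tensor_span P Q" "z \<in> tensor_span P Q"
  then obtain u v where u: "Poly_Mapping.keys u \<subseteq> P \<times> Q" "y - u \<in> N"
    and v: "Poly_Mapping.keys v \<subseteq> P \<times> Q" "z - v \<in> N" by (auto simp: tensor_span_def)
  have "y - z - (u - v) = (y - u) - (z - v)" by simp
  then have "y - z - (u - v) \<in> N" using nullD(2)[OF u(2) v(2)] by (simp only:)
  moreover have "Poly_Mapping.keys (u - v) \<subseteq> P \<times> Q" using keys_diff[of u v] u v by blast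
  ultimately show "y - z \<in> tensor_span P Q" unfolding tensor_span_def by blast
qed

lemmas span_D = add_closedD[OF add_closed_span]

lemma span_induct [consumes 1, case_names null pure diff]:
  assumes "Z \<in> tensor_span P Q" "\<And>z. z \<in> N \<Longrightarrow> Prop z" "\<And>a b. a \<in> P \<Longrightarrow> b \<in> Q \<Longrightarrow> Prop (pure a b)"
    "\<And>x y. Prop x \<Longrightarrow> Prop y \<Longrightarrow> Prop (x - y)"
  shows "Prop Z"
proof -
  obtain Y where Y: "Poly_Mapping.keys Y \<subseteq> P \<times> Q" "Z - Y \<in> N" using assms(1) by (auto simp: tensor_span_def)
  have "Prop Y" by (rule tensor_induct[OF Y(1)]) (use assms nullD(1) in auto)
  moreover have "- (Z - Y) \<in> N" by (rule nullD(3)[OF Y(2)])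
  ultimately have "Prop (Y - - (Z - Y))" using assms(2,4) by blast
  then show ?thesis by simp
qed

lemma span_mono: "P \<subseteq> P' \<Longrightarrow> Q \<subseteq> Q' \<Longrightarrow> tensor_span P Q \<subseteq> tensor_span P' Q'"
  unfolding tensor_span_def by blast

lemma swap_pairs_span: "Z \<in> tensor_span P Q \<Longrightarrow> swap_pairs Z \<in> tensor_span Q P"
  by (induction rule: span_induct)
    (use swap_pairs_null_iff null_subset_span in \<open>auto intro: pure_in_span span_D(2)\<close>)

lemma sub_ring_span:
  assumes "std.sub_ring P" "std.sub_ring Q"
  shows "tensor.sub_ring (tensor_span P Q)"
  unfolding tensor.sub_ring_def
proof (intro conjI ballI)
  show "add_closed (tensor_span P Q)" by (rule add_closed_span)
  show "pure 1 1 \<in> tensor_span P Q" using assms by (auto simp: std.sub_ring_def intro: pure_in_span)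
  fix y z assume y: "y \<in> tensor_span P Q" and z: "z \<in> tensor_span P Q"
  note N = tensor.two_sidedD[OF two_sided_null]
  have *: "tensor_mult (pure a b) z \<in> tensor_span P Q" if "a \<in> P" "b \<in> Q" for a b
    using z
  proof (induction rule: span_induct)
    case (null z)
    then show ?case using N null_subset_span by blast
  next
    case (pure c d)
    then show ?case using that assms by (auto simp: tensor_mult_pure std.sub_ring_def intro!: pure_in_span)
  qed (auto simp: tensor_mult_diffl intro: span_D(2))
  show "tensor_mult y z \<in> tensor_span P Q"
    using y
  proof (induction rule: span_induct)
    case (null y)
    then show ?case using N null_subset_span by blast
  qed (use * in \<open>auto simp: tensor_mult_diffr intro: span_D(2)\<close>)
qed

lemma pure_linear:
  "pure (a - a') b - (pure a b - pure a' b) \<in> N" "pure b (a - a') - (pure b a - pure b a') \<in> N"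
proof -
  show *: "pure (a - a') b - (pure a b - pure a' b) \<in> N" for a a' b
    using nullD(3)[OF pure_diff_left[of a UNIV a' b UNIV]] by (simp add: add_closed_def algebra_simps)
  show "pure b (a - a') - (pure b a - pure b a') \<in> N"
    using swap_pairs_null[OF *[of a a' b]] by simp
qed

lemma null_in_sub_ring:
  assumes "tensor.sub_ring R" "N \<subseteq> R"
  shows "y - z \<in> N \<Longrightarrow> z \<in> R \<Longrightarrow> y \<in> R"
proof -
  assume *: "y - z \<in> N" "z \<in> R"
  have "y - z \<in> R" by (rule subsetD[OF assms(2) *(1)])
  from tensor.sub_ringD(7)[OF assms(1) this *(2)] show "y \<in> R" unfolding diff_add_cancel .
qed

text \<open>This and its companion for the other factor turn questions about a subring of the
  enveloping algebra into questions about subrings of the division ring, where generators of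
  \<open>A\<close> and of the operators are known.\<close>

lemma sub_ring_left_factor:
  assumes R: "tensor.sub_ring R" "N \<subseteq> R"
  shows "std.sub_ring {a. pure a 1 \<in> R}"
  unfolding std.sub_ring_def add_closed_def
proof (intro conjI ballI CollectI)
  note D = tensor.sub_ringD[OF R(1)]
  show "pure 0 1 \<in> R" by (rule subsetD[OF R(2) pure_zero_null(2)]) simp_all
  show "pure 1 1 \<in> R" by (rule D)
  fix a b assume ab: "a \<in> {a. pure a 1 \<in> R}" "b \<in> {a. pure a 1 \<in> R}"
  show "pure (a - b) 1 \<in> R"
    by (rule null_in_sub_ring[OF R pure_linear(1)], rule D(5)) (use ab in simp_all)
  show "pure (a * b) 1 \<in> R"
    using D(3)[of "pure a 1" "pure b 1"] ab by (simp add: tensor_mult_pure)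
qed

lemma sub_ring_right_factor:
  assumes R: "tensor.sub_ring R" "N \<subseteq> R"
  shows "std.sub_ring {a. pure 1 a \<in> R}"
  unfolding std.sub_ring_def add_closed_def
proof (intro conjI ballI CollectI)
  note D = tensor.sub_ringD[OF R(1)]
  show "pure 1 0 \<in> R" by (rule subsetD[OF R(2) pure_zero_null(1)]) simp_all
  show "pure 1 1 \<in> R" by (rule D)
  fix a b assume ab: "a \<in> {a. pure 1 a \<in> R}" "b \<in> {a. pure 1 a \<in> R}"
  show "pure 1 (a - b) \<in> R"
    by (rule null_in_sub_ring[OF R pure_linear(2)], rule D(5)) (use ab in simp_all)
  show "pure 1 (a * b) \<in> R"
    using D(3)[of "pure 1 b" "pure 1 a"] ab by (simp add: tensor_mult_pure)
qed

lemma span_subset_sub_ring: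
  assumes R: "tensor.sub_ring R" "N \<subseteq> R" and "\<And>a. a \<in> P \<Longrightarrow> pure a 1 \<in> R" "\<And>b. b \<in> Q \<Longrightarrow> pure 1 b \<in> R"
  shows "tensor_span P Q \<subseteq> R"
proof
  note D = tensor.sub_ringD[OF R(1)]
  fix z assume "z \<in> tensor_span P Q"
  then show "z \<in> R"
  proof (induction rule: span_induct)
    case (pure a b)
    then show ?case using D(3)[OF assms(3,4), of a b] by (simp add: tensor_mult_pure)
  next
    case (null z)
    then show ?case using R(2) by blast
  qed (rule D(5))
qed

text \<open>In the second entry the multiplication is the opposite one, which reverses the
  commutator: hence \<open>brk d a\<close> in the third line and \<open>brk a d\<close> in the
  fourth.\<close>

lemma bracket_pure:
  "tensor.bracket (pure a 1) (pure c d) - pure (brk a c) d \<in> N"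
  "tensor.bracket (pure c d) (pure a 1) - pure (brk c a) d \<in> N"
  "tensor.bracket (pure 1 a) (pure c d) - pure c (brk d a) \<in> N"
  "tensor.bracket (pure c d) (pure 1 a) - pure c (brk a d) \<in> N"
proof -
  have neg: "u - v \<in> N \<Longrightarrow> v - u \<in> N" for u v using nullD(3)[of "u - v"] by simp
  show "tensor.bracket (pure a 1) (pure c d) - pure (brk a c) d \<in> N"
    using neg[OF pure_linear(1)[of "a * c" "c * a" d]] by (simp add: tensor.bracket_def tensor_mult_pure brk_def)
  show "tensor.bracket (pure c d) (pure a 1) - pure (brk c a) d \<in> N"
    using neg[OF pure_linear(1)[of "c * a" "a * c" d]] by (simp add: tensor.bracket_def tensor_mult_pure brk_def)
  show "tensor.bracket (pure 1 a) (pure c d) - pure c (brk d a) \<in> N"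
    using neg[OF pure_linear(2)[of c "d * a" "a * d"]] by (simp add: tensor.bracket_def tensor_mult_pure brk_def)
  show "tensor.bracket (pure c d) (pure 1 a) - pure c (brk a d) \<in> N"
    using neg[OF pure_linear(2)[of c "a * d" "d * a"]] by (simp add: tensor.bracket_def tensor_mult_pure brk_def)
qed

end


section \<open>The Noetherian property of the enveloping algebra\<close>

context diffop_division_ring
begin

text \<open>Modulo \<open>N\<close>, taking the k-fold sum is multiplication by
  \<open>pure (\<kappa> (of_nat k)) 1\<close>, which is invertible in characteristic zero. This is
  the torsion-freeness required by the leading-term argument.\<close>

lemma multiple_in_null:
  assumes "tensor.multiple k Z \<in> N" "k > 0"
  shows "Z \<in> N"
proof -
  have "tensor.multiple k Z - tensor_mult (pure (\<kappa> (of_nat k)) 1) Z \<in> N" for k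
  proof (induction k)
    case 0
    have "tensor_mult (pure 0 1) Z \<in> N"
      by (rule tensor.two_sidedD(3)[OF two_sided_null pure_zero_null(2)]) simp_all
    then show ?case using nullD(3) by (simp add: tensor.multiple_simps)
  next
    case (Suc k)
    have "pure (\<kappa> (of_nat k) + 1) 1 - pure (\<kappa> (of_nat k)) 1 - pure 1 1 \<in> N"
      by (rule null_add_left) auto
    then have 1: "tensor_mult (pure (\<kappa> (of_nat k) + 1) 1 - pure (\<kappa> (of_nat k)) 1 - pure 1 1) Z \<in> N"
      by (rule tensor.two_sidedD(3)[OF two_sided_null])
    have 2: "tensor.multiple k Z - tensor_mult (pure (\<kappa> (of_nat k)) 1) Z -
      tensor_mult (pure (\<kappa> (of_nat k) + 1) 1 - pure (\<kappa> (of_nat k)) 1 - pure 1 1) Z =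
      tensor.multiple (Suc k) Z - tensor_mult (pure (\<kappa> (of_nat (Suc k))) 1) Z"
      by (simp add: tensor.multiple_simps \<kappa>_add tensor_mult_diffr add.commute)
    show ?case using nullD(2)[OF Suc 1] unfolding 2 .
  qed
  from nullD(2)[OF assms(1) this[of k]] have "tensor_mult (pure (\<kappa> (of_nat k)) 1) Z \<in> N" by simp
  then have "tensor_mult (pure (\<kappa> (inverse (of_nat k))) 1) (tensor_mult (pure (\<kappa> (of_nat k)) 1) Z) \<in> N"
    by (rule tensor.two_sidedD(2)[OF two_sided_null])
  moreover have "\<kappa> (inverse (of_nat k)) * \<kappa> (of_nat k) = 1"
    using assms(2) by (simp flip: \<kappa>_mult)
  ultimately show ?thesis by (simp add: tensor_mult_pure flip: tensor.assoc)
qed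

lemma common_left_multiple:
  assumes "s \<in> ops" "t \<in> ops" "s \<noteq> 0" "t \<noteq> 0"
  shows "\<exists>u\<in>ops. \<exists>v\<in>ops. u * s = v * t \<and> u * s \<noteq> 0"
proof -
  obtain u where u: "u \<in> ops" "u \<noteq> 0" "u * (s * inverse t) \<in> ops"
    using left_fraction[of "s * inverse t"] by (auto simp: ops_def)
  have "u * s = u * (s * inverse t) * t" using assms by (simp add: mult.assoc)
  then show ?thesis using u assms by (intro bexI[of _ u] bexI[of _ "u * (s * inverse t)"]) auto
qed

lemma common_right_multiple:
  assumes "s \<in> ops" "t \<in> ops" "s \<noteq> 0" "t \<noteq> 0"
  shows "\<exists>u\<in>ops. \<exists>v\<in>ops. s * u = t * v \<and> s * u \<noteq> 0"
proof -
  obtain u where u: "u \<in> ops" "u \<noteq> 0" "inverse t * s * u \<in> ops"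
    using right_fraction[of "inverse t * s"] by (auto simp: ops_def)
  have "s * u = t * (inverse t * s * u)" using assms by (simp flip: mult.assoc)
  then show ?thesis using u assms by (intro bexI[of _ u] bexI[of _ "inverse t * s * u"]) auto
qed

text \<open>Multiplying by \<open>pure s t\<close> acts on \<open>pure a b\<close> as
  \<open>s * a\<close> and \<open>b * t\<close>. So left denominators are needed in the first entry
  and right denominators in the second, and a difference needs common multiples of the matching
  kind.\<close>

lemma tensor_denominators:
  obtains s t where "s \<in> ops" "t \<in> ops" "s \<noteq> 0" "t \<noteq> 0" "tensor_mult (pure s t) Z \<in> tensor_span ops ops"
proof -
  note D = tensor.sub_ringD[OF sub_ring_span[OF sub_ring_ops sub_ring_ops]]
  have "\<exists>s\<in>ops - {0}. \<exists>t\<in>ops - {0}. tensor_mult (pure s t) Z \<in> tensor_span ops ops"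
  proof (rule tensor_induct[of Z UNIV UNIV])
    show "\<exists>s\<in>ops - {0}. \<exists>t\<in>ops - {0}. tensor_mult (pure s t) 0 \<in> tensor_span ops ops"
      using ops_D(2) D by (intro bexI[of _ 1]) auto
  next
    fix a b
    obtain s t where "s \<in> ops - {0}" "s * a \<in> ops" "t \<in> ops - {0}" "b * t \<in> ops"
      using left_fraction[of a] right_fraction[of b] by (auto simp: ops_def[symmetric])
    then show "\<exists>s\<in>ops - {0}. \<exists>t\<in>ops - {0}. tensor_mult (pure s t) (pure a b) \<in> tensor_span ops ops"
      unfolding tensor_mult_pure by (blast intro: pure_in_span)
  next
    fix x y assume
      "\<exists>s\<in>ops - {0}. \<exists>t\<in>ops - {0}. tensor_mult (pure s t) x \<in> tensor_span ops ops"
      "\<exists>s\<in>ops - {0}. \<exists>t\<in>ops - {0}. tensor_mult (pure s t) y \<in> tensor_span ops ops"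
    then obtain s t s' t' where st: "s \<in> ops" "t \<in> ops" "s' \<in> ops" "t' \<in> ops" "s \<noteq> 0" "t \<noteq> 0" "s' \<noteq> 0" "t' \<noteq> 0"
      "tensor_mult (pure s t) x \<in> tensor_span ops ops" "tensor_mult (pure s' t') y \<in> tensor_span ops ops"
      by blast
    obtain u u' where u: "u \<in> ops" "u' \<in> ops" "u * s = u' * s'" "u * s \<noteq> 0"
      using common_left_multiple[of s s'] st by blast
    obtain v v' where v: "v \<in> ops" "v' \<in> ops" "t * v = t' * v'" "t * v \<noteq> 0"
      using common_right_multiple[of t t'] st by blast
    have "tensor_mult (pure u v) (tensor_mult (pure s t) x) - tensor_mult (pure u' v') (tensor_mult (pure s' t') y)
      \<in> tensor_span ops ops"
      by (rule D(5)[OF D(3)[OF pure_in_span[OF u(1) v(1)] st(9)] D(3)[OF pure_in_span[OF u(2) v(2)] st(10)]])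
    also have "tensor_mult (pure u v) (tensor_mult (pure s t) x) - tensor_mult (pure u' v') (tensor_mult (pure s' t') y)
      = tensor_mult (pure (u * s) (t * v)) (x - y)"
      by (simp add: tensor_mult_pure tensor_mult_diffl u v flip: tensor.assoc)
    finally show "\<exists>s\<in>ops - {0}. \<exists>t\<in>ops - {0}. tensor_mult (pure s t) (x - y) \<in> tensor_span ops ops"
      using u v ops_D(3)[OF u(1) st(1)] ops_D(3)[OF st(2) v(1)] by blast
  qed auto
  then show ?thesis using that by blast
qed

lemma left_noetherian_span_fractions: "tensor.left_noetherian N (tensor_span fractions fractions)"
proof -
  let ?K = "range (\<lambda>c. pure (\<kappa> c) 1)" let ?C = "range (\<lambda>i. pure (x i) 1) \<union> range (\<lambda>i. pure 1 (x i))"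
  let ?S = "N \<union> ?K"
  let ?R = "tensor.ring_hull (?S \<union> ?C)"
  note ND = tensor.two_sidedD[OF two_sided_null]
  have hullS: "tensor.ring_hull ?S \<subseteq> tensor_span (range \<kappa>) {1}"
  proof (rule tensor.hull_minimal)
    show "?S \<subseteq> tensor_span (range \<kappa>) {1}"
      using null_subset_span by (auto intro: pure_in_span)
    have *: "tensor_mult (pure (\<kappa> a) 1) z \<in> tensor_span (range \<kappa>) {1}" if "z \<in> tensor_span (range \<kappa>) {1}" for a z
      using that
    proof (induction rule: span_induct)
      case (null z)
      then show ?case using ND null_subset_span by blast
    next
      case (pure b c)
      then show ?case by (auto simp: tensor_mult_pure simp flip: \<kappa>_mult intro!: pure_in_span)
    qed (auto simp: tensor_mult_diffl intro: span_D(2))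
    have "tensor_mult y z \<in> tensor_span (range \<kappa>) {1}"
      if "y \<in> tensor_span (range \<kappa>) {1}" "z \<in> tensor_span (range \<kappa>) {1}" for y z
      using that(1)
    proof (induction rule: span_induct)
      case (null z)
      then show ?case using ND null_subset_span by blast
    qed (use that(2) * in \<open>auto simp: tensor_mult_diffr intro: span_D(2)\<close>)
    moreover have "pure 1 1 \<in> tensor_span (range \<kappa>) {1}"
      by (rule pure_in_span) (auto intro: range_eqI[of _ _ 1])
    ultimately show "tensor.sub_ring (tensor_span (range \<kappa>) {1})"
      using add_closed_span by (auto simp: tensor.sub_ring_def)
  qed
  \<comment> \<open>Modulo \<open>N\<close> the starting ring consists of the scalars only.\<close>
  have scalar: "\<exists>c. z - pure (\<kappa> c) 1 \<in> N" if "z \<in> tensor.ring_hull ?S" for z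
  proof -
    have "z \<in> tensor_span (range \<kappa>) {1}" using that hullS by blast
    then show ?thesis
    proof (induction rule: span_induct)
      case (null z)
      then show ?case using nullD(2)[OF null pure_zero_null(2)[of UNIV 1 UNIV]]
        by (intro exI[of _ 0]) simp
    next
      case (pure a b)
      then obtain c where "a = \<kappa> c" "b = 1" by auto
      then show ?case using nullD(1) by (intro exI[of _ c]) simp
    next
      case (diff y z)
      then obtain c d where "y - pure (\<kappa> c) 1 \<in> N" "z - pure (\<kappa> d) 1 \<in> N" by blast
      from nullD(2)[OF nullD(2)[OF this] pure_linear(1)[of "\<kappa> c" "\<kappa> d" 1]]
      show ?case by (intro exI[of _ "c - d"]) (simp add: \<kappa>_diff algebra_simps)
    qed
  qed
  \<comment> \<open>Modulo \<open>N\<close> this ring is a field, so an ideal is either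
    \<open>N\<close> or everything, and a chain can jump at most once.\<close>
  have noeth0: "tensor.left_noetherian N (tensor.ring_hull ?S)"
  proof -
    have ideal: "I = N \<or> I = tensor.ring_hull ?S" if I: "tensor.left_ideal_over N (tensor.ring_hull ?S) I" for I
    proof (cases "I = N")
      case False
      have I': "add_closed I" "N \<subseteq> I" "I \<subseteq> tensor.ring_hull ?S"
        "\<And>r z. r \<in> tensor.ring_hull ?S \<Longrightarrow> z \<in> I \<Longrightarrow> tensor_mult r z \<in> I"
        using I by (auto simp: tensor.left_ideal_over_def)
      note ID = add_closedD[OF I'(1)]
      obtain z where z: "z \<in> I" "z \<notin> N" using False I' by blast
      obtain c where c: "z - pure (\<kappa> c) 1 \<in> N" using scalar z I' by blast
      have "pure (\<kappa> c) 1 \<in> I" using ID(2)[of z "z - pure (\<kappa> c) 1"] c z I' by auto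
      moreover have "c \<noteq> 0"
      proof
        assume "c = 0"
        then have "z - pure 0 1 \<in> N" "pure 0 1 \<in> N" using c pure_zero_null(2)[of UNIV 1 UNIV] by auto
        then show False using nullD(4) z(2) by fastforce
      qed
      moreover have K: "pure (\<kappa> a) 1 \<in> tensor.ring_hull ?S" for a
        using tensor.hull_subset[of ?S] by blast
      ultimately have "tensor_mult (pure (\<kappa> (a * inverse c)) 1) (pure (\<kappa> c) 1) \<in> I" for a
        using I'(4) by blast
      then have "pure (\<kappa> a) 1 \<in> I" for a
        using \<open>c \<noteq> 0\<close> by (simp add: tensor_mult_pure mult.assoc flip: \<kappa>_mult)
      then have "z \<in> I" if "z \<in> tensor.ring_hull ?S" for z
      proof -
        obtain a where "z - pure (\<kappa> a) 1 \<in> N" using scalar \<open>z \<in> tensor.ring_hull ?S\<close> by blast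
        then have "(z - pure (\<kappa> a) 1) + pure (\<kappa> a) 1 \<in> I"
          by (rule ID(4)[OF subsetD[OF I'(2)] \<open>pure (\<kappa> a) 1 \<in> I\<close>])
        then show ?thesis by simp
      qed
      then show ?thesis using I' by blast
    qed simp
    show ?thesis
      unfolding tensor.left_noetherian_def acc_on_def
    proof (intro allI impI)
      fix I :: "nat \<Rightarrow> ('d \<times> 'd \<Rightarrow>\<^sub>0 int) set"
      assume I: "(\<forall>n. tensor.left_ideal_over N (tensor.ring_hull ?S) (I n)) \<and> (\<forall>n. I n \<subseteq> I (Suc n))"
      have mono: "I m \<subseteq> I n" if "m \<le> n" for m n
        using lift_Suc_mono_le[of I, OF _ that] I by blast
      have top: "I n \<subseteq> tensor.ring_hull ?S" "N \<subseteq> I n" for n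
        using I by (auto simp: tensor.left_ideal_over_def)
      show "\<exists>M. \<forall>n\<ge>M. I n = I M"
      proof (cases "\<exists>M. I M \<noteq> N")
        case True
        then obtain M where "I M = tensor.ring_hull ?S" using ideal I by blast
        then have "\<forall>n\<ge>M. I n = I M" using mono top(1) by blast
        then show ?thesis ..
      qed auto
    qed
  qed
  have br: "tensor.bracket \<xi> s \<in> tensor.ring_hull ?S" if "\<xi> \<in> ?C" "s \<in> ?S \<union> ?C" for \<xi> s
  proof -
    have "tensor.bracket \<xi> s \<in> N"
    proof (cases "s \<in> N")
      case True
      then show ?thesis using ND unfolding tensor.bracket_def by (intro add_closedD(2)[OF ND(1)]) auto
    next
      case False
      have "x i * x j = x j * x i" "x i * \<kappa> c = \<kappa> c * x i" for i j c
        using A_commute x_mem \<kappa>_mem by auto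
      then have "tensor.bracket \<xi> s = 0"
        using that False by (auto simp: tensor.bracket_def tensor_mult_pure)
      then show ?thesis using nullD(1) by simp
    qed
    then show ?thesis using tensor.hull_subset[of ?S] by blast
  qed
  have noeth: "tensor.left_noetherian N ?R"
    by (rule tensor.left_noetherian_hull_Un[OF _ two_sided_null _ noeth0 br]) simp_all
  have R: "tensor.sub_ring ?R" "N \<subseteq> ?R" "?K \<subseteq> ?R" "?C \<subseteq> ?R"
    using tensor.sub_ring_hull tensor.hull_subset[of "?S \<union> ?C"] by blast+
  have "a \<in> {a. pure a 1 \<in> ?R}" if "a \<in> A" for a
    by (rule generated[OF that sub_ring_left_factor[OF R(1,2)]]) (use R in auto)
  moreover have "b \<in> {b. pure 1 b \<in> ?R}" if "b \<in> A" for b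
  proof (rule generated[OF that sub_ring_right_factor[OF R(1,2)]])
    have "pure 1 (\<kappa> c) \<in> ?R" for c
    proof (rule null_in_sub_ring[OF R(1,2)])
      show "pure 1 (\<kappa> c) - pure (\<kappa> c) 1 \<in> N"
        using nullD(3)[OF null_balanced[of 1 UNIV 1 UNIV c]] by simp
    qed (use R in auto)
    then show "range \<kappa> \<subseteq> {b. pure 1 b \<in> ?R}" by auto
  qed (use R in auto)
  ultimately have AA: "tensor_span A A \<subseteq> ?R"
    using R by (intro span_subset_sub_ring) auto
  show ?thesis
  proof (rule tensor.left_noetherian_localisation[OF two_sided_null R(1) _ _ R(2) _ noeth])
    show QQ: "tensor.sub_ring (tensor_span fractions fractions)"
      by (intro sub_ring_span sub_ring_fractions)
    show "?R \<subseteq> tensor_span fractions fractions"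
    proof (rule tensor.hull_minimal[OF QQ])
      show "?S \<union> ?C \<subseteq> tensor_span fractions fractions"
        using null_subset_span A_subset_fractions \<kappa>_mem x_mem fractions_D(2) by (auto intro!: pure_in_span)
    qed
    fix z assume "z \<in> tensor_span fractions fractions"
    \<comment> \<open>Since \<open>A\<close> is commutative, one \<open>s\<close> can serve as
      denominator in both entries, and the product of two such denominators serves a
      difference.\<close>
    then have "\<exists>s\<in>A - {0}. tensor_mult (pure s s) z \<in> tensor_span A A"
    proof (induction rule: span_induct)
      case (null z)
      show ?case
        using A_D(2) subsetD[OF null_subset_span null] by (intro bexI[of _ 1]) auto
    next
      case (pure p q)
      then obtain a b where a: "a \<in> A" "a \<noteq> 0" "a * p \<in> A" and b: "b \<in> A" "b \<noteq> 0" "b * q \<in> A"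
        by (auto simp: fractions_def)
      have "a * b * p = b * (a * p)"
        by (simp add: A_commute[OF a(1) b(1)] mult.assoc)
      moreover have "q * (a * b) = a * (b * q)"
        by (simp add: fractions_commute_A[OF pure(2) A_D(3)[OF a(1) b(1)]] mult.assoc)
      ultimately have "tensor_mult (pure (a * b) (a * b)) (pure p q) \<in> tensor_span A A"
        using a b A_D(3) by (auto simp: tensor_mult_pure intro!: pure_in_span)
      then show ?case using a b A_D(3) by (intro bexI[of _ "a * b"]) auto
    next
      case (diff y z)
      then obtain s t where s: "s \<in> A" "s \<noteq> 0" "tensor_mult (pure s s) y \<in> tensor_span A A"
        and t: "t \<in> A" "t \<noteq> 0" "tensor_mult (pure t t) z \<in> tensor_span A A" by blast
      note AD = tensor.sub_ringD[OF sub_ring_span[OF sub_ring_A sub_ring_A]]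
      have "tensor_mult (pure t t) (tensor_mult (pure s s) y) - tensor_mult (pure s s) (tensor_mult (pure t t) z)
        \<in> tensor_span A A"
        by (rule AD(5)[OF AD(3)[OF pure_in_span[OF t(1) t(1)] s(3)] AD(3)[OF pure_in_span[OF s(1) s(1)] t(3)]])
      also have "tensor_mult (pure t t) (tensor_mult (pure s s) y) - tensor_mult (pure s s) (tensor_mult (pure t t) z)
        = tensor_mult (pure (s * t) (s * t)) (y - z)"
        using A_commute[OF s(1) t(1)] by (simp add: tensor_mult_pure tensor_mult_diffl flip: tensor.assoc)
      finally show ?case using s t A_D(3) by (intro bexI[of _ "s * t"]) auto
    qed
    then obtain s where s: "s \<in> A" "s \<noteq> 0" "tensor_mult (pure s s) z \<in> ?R" using AA by blast
    then have "s \<in> fractions" "inverse s \<in> fractions" using A_subset_fractions inverse_fractions by auto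
    moreover have "tensor_mult (pure (inverse s) (inverse s)) (pure s s) - pure 1 1 \<in> N"
      using s nullD(1) by (simp add: tensor_mult_pure)
    ultimately show "\<exists>u\<in>tensor_span fractions fractions. \<exists>v\<in>tensor_span fractions fractions.
        tensor_mult v u - pure 1 1 \<in> N \<and> tensor_mult u z \<in> ?R"
      using s(3) by (blast intro: pure_in_span)
  qed
qed

end


context diffop_division_ring
begin

theorem left_noetherian_tensor: "tensor.left_noetherian N UNIV"
proof -
  obtain J y where J: "separating J" "\<And>j. j \<in> J \<Longrightarrow> y j \<in> derivations"
    "\<And>i j. i \<in> J \<Longrightarrow> j \<in> J \<Longrightarrow> brk (y j) (x i) = (if i = j then 1 else 0)"
    by (rule coordinate_derivations) (rule that; assumption)
  let ?S = "tensor_span fractions fractions"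
  let ?T = "(\<lambda>j. pure (y j) 1) ` J \<union> (\<lambda>j. pure 1 (y j)) ` J"
  let ?R = "tensor.ring_hull (?S \<union> ?T)"
  note ND = tensor.two_sidedD[OF two_sided_null] and SD = tensor.sub_ringD[OF sub_ring_span[OF sub_ring_fractions sub_ring_fractions]]
  have subS: "tensor.sub_ring ?S" by (intro sub_ring_span sub_ring_fractions)
  have hullS: "tensor.ring_hull ?S = ?S"
    using tensor.hull_minimal[OF subS subset_refl] tensor.hull_subset[of ?S] by blast
  have brS: "tensor.bracket (pure (y j) 1) s \<in> ?S \<and> tensor.bracket (pure 1 (y j)) s \<in> ?S" if j: "j \<in> J" and "s \<in> ?S" for j s
    using that(2)
  proof (induction rule: span_induct)
    case (null z)
    have "tensor.bracket \<xi> z \<in> N" for \<xi>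
      unfolding tensor.bracket_def by (rule nullD(2)[OF ND(2)[OF null] ND(3)[OF null]])
    then show ?case using subsetD[OF null_subset_span] by simp
  next
    case (pure a b)
    have 1: "brk (y j) a \<in> fractions" using derivations_fractions[OF J(2)[OF j]] pure by simp
    have "- brk (y j) b \<in> fractions"
      by (rule fractions_D(6)[OF derivations_fractions[OF J(2)[OF j] pure(2)]])
    then have 2: "brk b (y j) \<in> fractions" by (simp add: brk_def)
    show ?case
      using null_in_sub_ring[OF subS null_subset_span bracket_pure(1) pure_in_span[OF 1 pure(2)]]
        null_in_sub_ring[OF subS null_subset_span bracket_pure(3) pure_in_span[OF pure(1) 2]] by simp
  next
    case (diff u v)
    have "tensor.bracket z (u - v) = tensor.bracket z u - tensor.bracket z v" for z
      by (simp add: tensor.bracket_def tensor_mult_diffl tensor_mult_diffr)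
    then show ?case using diff SD(5) by simp
  qed
  have br: "tensor.bracket \<xi> s \<in> tensor.ring_hull ?S" if \<xi>: "\<xi> \<in> ?T" and s: "s \<in> ?S \<union> ?T" for \<xi> s
  proof (cases "s \<in> ?S")
    case True
    then show ?thesis using \<xi> brS hullS by auto
  next
    case False
    have yy: "brk (y i) (y j) \<in> fractions" if "i \<in> J" "j \<in> J" for i j
      using derivations_commute[OF J that] .
    have "pure (brk (y i) (y j)) 1 \<in> ?S" "pure 1 (brk (y i) (y j)) \<in> ?S" if "i \<in> J" "j \<in> J" for i j
      using yy[OF that] fractions_D(2) by (auto intro: pure_in_span)
    then have "tensor.bracket (pure (y i) 1) (pure (y j) 1) \<in> ?S" "tensor.bracket (pure 1 (y i)) (pure 1 (y j)) \<in> ?S"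
      if "i \<in> J" "j \<in> J" for i j
      using that null_in_sub_ring[OF subS null_subset_span bracket_pure(1)]
        null_in_sub_ring[OF subS null_subset_span bracket_pure(3)] by simp_all
    moreover have "tensor.bracket (pure a 1) (pure 1 b) = 0" "tensor.bracket (pure 1 b) (pure a 1) = 0" for a b :: 'd
      by (simp_all add: tensor.bracket_def tensor_mult_pure)
    ultimately show ?thesis using \<xi> s False hullS SD(4) by auto
  qed
  have noeth0: "tensor.left_noetherian N (tensor.ring_hull ?S)"
    unfolding hullS by (rule left_noetherian_span_fractions)
  have noeth: "tensor.left_noetherian N ?R"
    by (rule tensor.left_noetherian_hull_Un[OF _ two_sided_null null_subset_span noeth0 br]) simp_all
  have R: "tensor.sub_ring ?R" "?S \<subseteq> ?R" "?T \<subseteq> ?R"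
    using tensor.sub_ring_hull tensor.hull_subset[of "?S \<union> ?T"] by blast+
  have NR: "N \<subseteq> ?R" using R(2) null_subset_span by blast
  \<comment> \<open>Euler's formula enters here: the fractions and the finitely many
    \<open>y j\<close> give all operators in the first entry, and likewise below in the
    second.\<close>
  have "localised_ops \<subseteq> {a. pure a 1 \<in> ?R}"
    by (rule localised_subset_generated[OF J sub_ring_left_factor[OF R(1) NR]])
      (use R fractions_D(2) in \<open>auto intro: pure_in_span\<close>)
  moreover have "localised_ops \<subseteq> {a. pure 1 a \<in> ?R}"
    by (rule localised_subset_generated[OF J sub_ring_right_factor[OF R(1) NR]])
      (use R fractions_D(2) in \<open>auto intro: pure_in_span\<close>)
  ultimately have ops_R: "tensor_span ops ops \<subseteq> ?R"
    using ops_subset_localised by (intro span_subset_sub_ring[OF R(1) NR]) auto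
  show ?thesis
  proof (rule tensor.left_noetherian_localisation[OF two_sided_null R(1) tensor.sub_ring_UNIV subset_UNIV NR _ noeth])
    fix z
    obtain s t where st: "s \<noteq> 0" "t \<noteq> 0" "tensor_mult (pure s t) z \<in> tensor_span ops ops"
      by (rule tensor_denominators)
    then have "tensor_mult (pure (inverse s) (inverse t)) (pure s t) - pure 1 1 \<in> N"
      using nullD(1) by (simp add: tensor_mult_pure)
    then show "\<exists>u\<in>UNIV. \<exists>v\<in>UNIV. tensor_mult v u - pure 1 1 \<in> N \<and> tensor_mult u z \<in> ?R"
      using st(3) ops_R by blast
  qed
qed

section \<open>Absence of zero divisors in the enveloping algebra\<close>

lemma linear_subspace_A: "linear_subspace A" and linear_subspace_ops: "linear_subspace ops"
  using A_D(1,3) ops_D(1,3) \<kappa>_mem A_subset_ops[THEN subsetD, OF \<kappa>_mem] by (simp_all add: linear_subspace_def)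

lemma ad_left_nilpotent:
  "Z \<in> tensor_span (F n) Q \<Longrightarrow> (tensor.ad (pure (x i) 1) ^^ Suc n) Z \<in> N"
proof (induction n arbitrary: Z)
  case 0
  then show ?case
  proof (induction rule: span_induct)
    case (null z)
    then show ?case by (rule tensor.ad_N[OF two_sided_null])
  next
    case (pure a b)
    then show ?case
      using A_commute[OF _ x_mem] nullD(1) by (simp add: tensor.bracket_def tensor_mult_pure F_0)
  qed (auto simp: tensor.ad_linear intro: nullD(2))
next
  case (Suc n)
  have "tensor.ad (pure (x i) 1) Z \<in> tensor_span (F n) Q"
    using Suc.prems
  proof (induction rule: span_induct)
    case (null z)
    then show ?case using tensor.ad_null[OF two_sided_null] null_subset_span by blast
  next
    case (pure a b)
    have "pure (brk a (x i)) b \<in> tensor_span (F n) Q"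
      using F_brk[OF pure(1) x_mem] pure(2) by (rule pure_in_span)
    from span_D(4)[OF subsetD[OF null_subset_span bracket_pure(2)[where a = "x i" and c = a and d = b]] this]
    show ?case by simp
  qed (auto simp: tensor.ad_linear intro: span_D(2))
  from Suc.IH[OF this] show ?case by (simp only: funpow_Suc_right o_apply)
qed

lemma swap_ad: "swap_pairs (tensor.ad c Z) = - tensor.ad (swap_pairs c) (swap_pairs Z)"
  by (simp add: tensor.bracket_def swap_pairs_mult)

text \<open>Each commutator changes sign under the swap. The total sign is left undetermined because
  membership in \<open>N\<close> does not depend on it.\<close>

lemma swap_ad_pow:
  "swap_pairs ((tensor.ad c ^^ n) Z) = (tensor.ad (swap_pairs c) ^^ n) (swap_pairs Z) \<or>
   swap_pairs ((tensor.ad c ^^ n) Z) = - (tensor.ad (swap_pairs c) ^^ n) (swap_pairs Z)"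
proof (induction n)
  case (Suc n)
  have "tensor.ad c (- z) = - tensor.ad c z" for c z :: "'d \<times> 'd \<Rightarrow>\<^sub>0 int"
    by (simp add: tensor.bracket_def tensor.mult_minus)
  with Suc show ?case by (auto simp: swap_ad)
qed simp

lemma ad_nilpotent:
  assumes "Z \<in> tensor_span ops ops"
  shows "\<exists>n. (tensor.ad (pure (x i) 1) ^^ n) Z \<in> N" "\<exists>n. (tensor.ad (pure 1 (x i)) ^^ n) Z \<in> N"
proof -
  have span: "\<exists>n. Z \<in> tensor_span (F n) UNIV" if "Z \<in> tensor_span ops ops" for Z
    using that
  proof (induction rule: span_induct)
    case (null z)
    then show ?case using null_subset_span by blast
  next
    case (pure a b)
    then show ?case by (auto simp: ops_def intro: pure_in_span)
  next
    case (diff y z)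
    then obtain m n where "y \<in> tensor_span (F m) UNIV" "z \<in> tensor_span (F n) UNIV" by blast
    then have "y \<in> tensor_span (F (m + n)) UNIV" "z \<in> tensor_span (F (m + n)) UNIV"
      using span_mono[OF F_mono[of m "m + n"] subset_refl] span_mono[OF F_mono[of n "m + n"] subset_refl]
      by (meson le_add1 le_add2 subsetD)+
    then show ?case using span_D(2) by blast
  qed
  have left: "\<exists>n. (tensor.ad (pure (x i) 1) ^^ n) Z \<in> N" if "Z \<in> tensor_span ops ops" for Z
    using span[OF that] ad_left_nilpotent by blast
  then show "\<exists>n. (tensor.ad (pure (x i) 1) ^^ n) Z \<in> N" using assms by blast
  obtain n where n: "(tensor.ad (pure (x i) 1) ^^ n) (swap_pairs Z) \<in> N"
    using left[OF swap_pairs_span[OF assms]] by blast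
  have "swap_pairs ((tensor.ad (pure 1 (x i)) ^^ n) Z) \<in> N"
    using swap_ad_pow[where c = "pure 1 (x i)" and n = n and Z = Z] n nullD(3)[OF n] by auto
  then show "\<exists>n. (tensor.ad (pure 1 (x i)) ^^ n) Z \<in> N" using swap_pairs_null_iff by blast
qed

text \<open>In the normal form with independent right entries the commutator acts on the left
  entries separately, so each of them commutes with the coordinates in \<open>J\<close> and lies in
  \<open>A\<close>. The set \<open>Q\<close> is arbitrary because the lemma is used once for all
  operators and once after the other entry has already been brought into \<open>A\<close>.\<close>

lemma kernel_left:
  assumes J: "separating J" "\<And>j. j \<in> J \<Longrightarrow> y j \<in> derivations"
    "\<And>i j. i \<in> J \<Longrightarrow> j \<in> J \<Longrightarrow> brk (y j) (x i) = (if i = j then 1 else 0)"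
    and Z: "Z \<in> tensor_span ops Q" "linear_subspace Q" "\<And>j. j \<in> J \<Longrightarrow> tensor.ad (pure (x j) 1) Z \<in> N"
  shows "Z \<in> tensor_span A Q"
proof -
  obtain Y where Y: "Poly_Mapping.keys Y \<subseteq> ops \<times> Q" "Z - Y \<in> N" using Z by (auto simp: tensor_span_def)
  obtain B a where B: "finite B" "B \<subseteq> Q" "vs.independent B" "\<And>b. b \<in> B \<Longrightarrow> a b \<in> ops"
    "Y - (\<Sum>b\<in>B. pure (a b) b) \<in> null ops Q"
    by (rule reduce_right[OF linear_subspace_ops Z(2) Y(1)]) (rule that; assumption)
  let ?W = "\<Sum>b\<in>B. pure (a b) b"
  have "Y - ?W \<in> N" by (rule subsetD[OF null_mono B(5)]) simp_all
  from nullD(4)[OF Y(2) this] have W: "Z - ?W \<in> N" by simp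
  have "a b \<in> A" if b: "b \<in> B" for b
  proof (rule centraliser_coordinates[OF J B(4)[OF b]])
    fix j assume j: "j \<in> J"
    have "tensor.ad (pure (x j) 1) (\<Sum>b\<in>B'. pure (a b) b) = (\<Sum>b\<in>B'. tensor.ad (pure (x j) 1) (pure (a b) b))" for B'
      by (induction B' rule: infinite_finite_induct) (auto simp: tensor.ad_linear)
    then have 1: "tensor.ad (pure (x j) 1) ?W - (\<Sum>b\<in>B. pure (brk (a b) (x j)) b) \<in> N"
      by (auto simp flip: sum_subtractf intro!: add_closed_sum[OF add_closed_null] bracket_pure(2))
    have 2: "tensor.ad (pure (x j) 1) ?W \<in> N"
      using nullD(2)[OF Z(3)[OF j] tensor.ad_null[OF two_sided_null W, of "pure (x j) 1"]]
      by (simp add: tensor.ad_linear)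
    from nullD(2)[OF 2 1] have "(\<Sum>b\<in>B. pure (brk (a b) (x j)) b) \<in> N" by simp
    from independent_right[OF B(1,3) this b] show "brk (a b) (x j) = 0" .
  qed
  then have "?W \<in> tensor_span A Q"
    using B(2) by (intro add_closed_sum[OF add_closed_span] pure_in_span) auto
  from span_D(4)[OF subsetD[OF null_subset_span W] this] show ?thesis by simp
qed

theorem domain_tensor:
  assumes AA: "\<And>Y Z. Poly_Mapping.keys Y \<subseteq> A \<times> A \<Longrightarrow> Poly_Mapping.keys Z \<subseteq> A \<times> A \<Longrightarrow> tensor_mult Y Z \<in> N \<Longrightarrow>
      Y \<in> N \<or> Z \<in> N"
    and YZ: "tensor_mult Y Z \<in> N"
  shows "Y \<in> N \<or> Z \<in> N"
proof -
  obtain J y where J: "separating J" "\<And>j. j \<in> J \<Longrightarrow> y j \<in> derivations"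
    "\<And>i j. i \<in> J \<Longrightarrow> j \<in> J \<Longrightarrow> brk (y j) (x i) = (if i = j then 1 else 0)"
    by (rule coordinate_derivations) (rule that; assumption)
  let ?C = "(\<lambda>j. pure (x j) 1) ` J \<union> (\<lambda>j. pure 1 (x j)) ` J"
  note ND = tensor.two_sidedD[OF two_sided_null]
  note BD = tensor.sub_ringD[OF sub_ring_span[OF sub_ring_ops sub_ring_ops]]
  have C: "c \<in> tensor_span ops ops" if "c \<in> ?C" for c
    using that x_mem A_subset_ops ops_D(2) by (auto intro!: pure_in_span)
  \<comment> \<open>The second entries are treated first, through the swap, with
    \<open>Q = ops\<close>; swapping back, the first entries follow with
    \<open>Q = A\<close>.\<close>
  have kernel: "Z \<in> tensor_span A A" if Z: "Z \<in> tensor_span ops ops" "\<forall>c\<in>?C. tensor.ad c Z \<in> N" for Z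
  proof -
    have "tensor.ad (pure (x j) 1) (swap_pairs Z) \<in> N" if "j \<in> J" for j
    proof -
      have "swap_pairs (tensor.ad (pure 1 (x j)) Z) \<in> N" using Z(2) that swap_pairs_null_iff by blast
      then have "- tensor.ad (pure (x j) 1) (swap_pairs Z) \<in> N" by (simp add: swap_ad)
      from nullD(3)[OF this] show ?thesis by simp
    qed
    then have "swap_pairs Z \<in> tensor_span A ops"
      using kernel_left[OF J swap_pairs_span[OF Z(1)] linear_subspace_ops] by blast
    from swap_pairs_span[OF this] have "Z \<in> tensor_span ops A" by simp
    then show ?thesis using kernel_left[OF J _ linear_subspace_A] Z(2) by blast
  qed
  have B_domain: "U \<in> N \<or> V \<in> N"
    if UV: "U \<in> tensor_span ops ops" "V \<in> tensor_span ops ops" "tensor_mult U V \<in> N" for U V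
  proof (rule tensor.domain_of_common_kernel[OF two_sided_null multiple_in_null, where C = ?C and B = "tensor_span ops ops"])
    show "tensor_mult c d = tensor_mult d c" if "c \<in> ?C" "d \<in> ?C" for c d
      using that A_commute[OF x_mem x_mem] by (auto simp: tensor_mult_pure)
    show "tensor.ad c z \<in> tensor_span ops ops" if "c \<in> ?C" "z \<in> tensor_span ops ops" for c z
      using that C BD(3,5) by (simp add: tensor.bracket_def)
    show "\<exists>n. (tensor.ad c ^^ n) z \<in> N" if "c \<in> ?C" "z \<in> tensor_span ops ops" for c z
      using that(1) ad_nilpotent[OF that(2)] by auto
    fix U V
    assume UV: "U \<in> tensor_span ops ops" "V \<in> tensor_span ops ops" "\<forall>c\<in>?C. tensor.ad c U \<in> N"
      "\<forall>c\<in>?C. tensor.ad c V \<in> N" "tensor_mult U V \<in> N"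
    have "U \<in> tensor_span A A" "V \<in> tensor_span A A"
      by (rule kernel[OF UV(1,3)], rule kernel[OF UV(2,4)])
    then obtain U' V' where U': "Poly_Mapping.keys U' \<subseteq> A \<times> A" "U - U' \<in> N"
      and V': "Poly_Mapping.keys V' \<subseteq> A \<times> A" "V - V' \<in> N"
      by (auto simp: tensor_span_def)
    have "tensor_mult U' V' = tensor_mult U V - (tensor_mult (U - U') V + tensor_mult U' (V - V'))"
      by (simp add: tensor_mult_diffl tensor_mult_diffr)
    moreover have "tensor_mult U V - (tensor_mult (U - U') V + tensor_mult U' (V - V')) \<in> N"
      by (rule nullD(2)[OF UV(5) nullD(4)[OF ND(3)[OF U'(2)] ND(2)[OF V'(2)]]])
    ultimately have "tensor_mult U' V' \<in> N" by (simp only:)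
    from AA[OF U'(1) V'(1) this] show "U \<in> N \<or> V \<in> N"
    proof
      assume "U' \<in> N"
      from nullD(4)[OF U'(2) this] show ?thesis by simp
    next
      assume "V' \<in> N"
      from nullD(4)[OF V'(2) this] show ?thesis by simp
    qed
  qed (use UV in auto)
  obtain s t where st: "s \<noteq> 0" "t \<noteq> 0" "tensor_mult (pure s t) Y \<in> tensor_span ops ops"
    by (rule tensor_denominators)
  \<comment> \<open>The denominators of \<open>Z\<close> are taken on the right, by way of the swap,
    so that in the product with \<open>tensor_mult (pure s t) Y\<close> the factor
    \<open>tensor_mult Y Z\<close> stays intact.\<close>
  obtain u v where uv: "u \<noteq> 0" "v \<noteq> 0" "tensor_mult (pure u v) (swap_pairs Z) \<in> tensor_span ops ops"
    by (rule tensor_denominators)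
  have uv': "tensor_mult Z (pure v u) \<in> tensor_span ops ops"
    using swap_pairs_span[OF uv(3)] by (simp add: swap_pairs_mult)
  have "tensor_mult (tensor_mult (pure s t) Y) (tensor_mult Z (pure v u)) =
    tensor_mult (pure s t) (tensor_mult (tensor_mult Y Z) (pure v u))"
    by (simp add: tensor.assoc)
  also have "\<dots> \<in> N" using YZ ND by blast
  finally have "tensor_mult (pure s t) Y \<in> N \<or> tensor_mult Z (pure v u) \<in> N"
    using B_domain st(3) uv' by blast
  then show ?thesis
  proof
    assume "tensor_mult (pure s t) Y \<in> N"
    then have "tensor_mult (pure (inverse s) (inverse t)) (tensor_mult (pure s t) Y) \<in> N" by (rule ND(2))
    then show ?thesis using st by (simp add: tensor_mult_pure flip: tensor.assoc)
  next
    assume "tensor_mult Z (pure v u) \<in> N"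
    then have "tensor_mult (tensor_mult Z (pure v u)) (pure (inverse v) (inverse u)) \<in> N" by (rule ND(3))
    then show ?thesis using uv by (simp add: tensor_mult_pure tensor.assoc)
  qed
qed

end


section \<open>Automorphisms of the algebraic closure\<close>

text \<open>The graph of a ring homomorphism over \<open>'k\<close> from a subring of the algebraic closure to the closure.\<close>

definition hom_graph :: "('k::field alg_closure \<times> 'k alg_closure) set \<Rightarrow> bool" where
  "hom_graph G \<longleftrightarrow> (\<forall>c. (to_ac c, to_ac c) \<in> G) \<and>
     (\<forall>a b a' b'. (a, b) \<in> G \<and> (a', b') \<in> G \<longrightarrow> (a - a', b - b') \<in> G \<and> (a * a', b * b') \<in> G) \<and>
     (\<forall>b. (0, b) \<in> G \<longrightarrow> b = 0)"

lemma hom_graphD: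
  assumes "hom_graph G"
  shows "(to_ac c, to_ac c) \<in> G" "(a, b) \<in> G \<Longrightarrow> (a', b') \<in> G \<Longrightarrow> (a - a', b - b') \<in> G"
    "(a, b) \<in> G \<Longrightarrow> (a', b') \<in> G \<Longrightarrow> (a * a', b * b') \<in> G" "(0, b) \<in> G \<Longrightarrow> b = 0"
  using assms unfolding hom_graph_def by blast+

lemma hom_graph_zero: "hom_graph G \<Longrightarrow> (0, 0) \<in> G" and hom_graph_one: "hom_graph G \<Longrightarrow> (1, 1) \<in> G"
  using hom_graphD(1)[of G 0] hom_graphD(1)[of G 1] by auto

lemma hom_graph_add: "hom_graph G \<Longrightarrow> (a, b) \<in> G \<Longrightarrow> (a', b') \<in> G \<Longrightarrow> (a + a', b + b') \<in> G"
  using hom_graphD(2)[of G a b "0 - a'" "0 - b'"] hom_graphD(2)[of G 0 0 a' b'] hom_graph_zero[of G] by auto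

lemma hom_graph_sum:
  "hom_graph G \<Longrightarrow> (\<And>i. i \<in> I \<Longrightarrow> (f i, g i) \<in> G) \<Longrightarrow> (sum f I, sum g I) \<in> G"
  by (induction I rule: infinite_finite_induct) (auto intro: hom_graph_add hom_graph_zero)

lemma hom_graph_unique: "hom_graph G \<Longrightarrow> (a, b) \<in> G \<Longrightarrow> (a, b') \<in> G \<Longrightarrow> b = b'"
  using hom_graphD(2)[of G a b a b'] hom_graphD(4)[of G "b - b'"] by auto

lemma hom_graph_poly:
  assumes "hom_graph G" "(a, b) \<in> G"
  shows "(poly (map_poly to_ac q) a, poly (map_poly to_ac q) b) \<in> G"
proof (induction q)
  case (pCons c q)
  have "(to_ac c + a * poly (map_poly to_ac q) a, to_ac c + b * poly (map_poly to_ac q) b) \<in> G"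
    by (rule hom_graph_add[OF assms(1) hom_graphD(1)[OF assms(1)] hom_graphD(3)[OF assms(1,2) pCons(2)]])
  then show ?case by (simp add: map_poly_pCons)
qed (simp add: hom_graph_zero assms)

text \<open>Since \<open>a\<close> is not 0, factors X can be split off an annihilating polynomial
  until its constant term is nonzero.\<close>

lemma algebraic_nonzero_constant:
  fixes a :: "'k::field alg_closure"
  assumes "a \<noteq> 0"
  obtains q :: "'k poly" where "coeff q 0 \<noteq> 0" "poly (map_poly to_ac q) a = 0"
proof -
  obtain p :: "'k poly" where p: "p \<noteq> 0" "poly (map_poly to_ac p) a = 0" by (rule alg_closure_algebraic)
  have "\<exists>q :: 'k poly. coeff q 0 \<noteq> 0 \<and> poly (map_poly to_ac q) a = 0"
    using p
  proof (induction p)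
    case (pCons c p)
    show ?case
    proof (cases "c = 0")
      case True
      then have "poly (map_poly to_ac p) a = 0" "p \<noteq> 0"
        using pCons.prems assms by (auto simp: map_poly_pCons)
      then show ?thesis using pCons.IH by blast
    next
      case False
      then show ?thesis using pCons.prems by (intro exI[of _ "pCons c p"]) auto
    qed
  qed simp
  then show ?thesis using that by blast
qed

text \<open>Injectivity follows from algebraicity, which is why \<open>hom_graph\<close> demands
  only single-valuedness: if \<open>a\<close> were sent to 0, the constant term of an annihilating
  polynomial would be the image of 0.\<close>

lemma hom_graph_nonzero:
  assumes "hom_graph G" "(a, b) \<in> G" "a \<noteq> 0"
  shows "b \<noteq> 0"
proof
  assume "b = 0"
  obtain q where q: "coeff q 0 \<noteq> 0" "poly (map_poly to_ac q) a = 0"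
    using algebraic_nonzero_constant[OF assms(3)] by blast
  from hom_graph_poly[OF assms(1,2), of q] have "(0, to_ac (coeff q 0)) \<in> G"
    by (simp add: q \<open>b = 0\<close> poly_0_coeff_0 coeff_map_poly)
  from hom_graphD(4)[OF assms(1) this] show False using q(1) by simp
qed

text \<open>The polynomial \<open>g\<close> is obtained from \<open>f\<close> by applying the
  partial homomorphism \<open>G\<close> to its coefficients.\<close>

definition poly_rel :: "('k::field alg_closure \<times> 'k alg_closure) set \<Rightarrow>
    'k alg_closure poly \<Rightarrow> 'k alg_closure poly \<Rightarrow> bool" where
  "poly_rel G f g \<longleftrightarrow> (\<forall>i. (coeff f i, coeff g i) \<in> G)"

lemma poly_rel_diff: "hom_graph G \<Longrightarrow> poly_rel G f g \<Longrightarrow> poly_rel G f' g' \<Longrightarrow> poly_rel G (f - f') (g - g')"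
  using hom_graphD(2) unfolding poly_rel_def by fastforce

lemma poly_rel_mult: "hom_graph G \<Longrightarrow> poly_rel G f g \<Longrightarrow> poly_rel G f' g' \<Longrightarrow> poly_rel G (f * f') (g * g')"
  unfolding poly_rel_def coeff_mult by (intro allI hom_graph_sum hom_graphD(3)) auto

lemma poly_rel_monom: "hom_graph G \<Longrightarrow> (a, b) \<in> G \<Longrightarrow> poly_rel G (monom a n) (monom b n)"
  by (auto simp: poly_rel_def hom_graph_zero)

text \<open>The extension sends f(x) to g(y) for polynomials related by \<open>G\<close>. It is well
  defined because \<open>p\<close> has minimal degree among the polynomials that annihilate
  \<open>x\<close>: if f(x) = 0, pseudo-division by \<open>p\<close>, carried out on
  \<open>f\<close> and \<open>g\<close> in parallel, lowers the degree and ends at zero.\<close>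

lemma hom_graph_extend:
  assumes G: "hom_graph G" and rel: "poly_rel G p p'" and p: "p \<noteq> 0" "poly p x = 0" and y: "poly p' y = 0"
    and min: "\<And>f g. poly_rel G f g \<Longrightarrow> f \<noteq> 0 \<Longrightarrow> poly f x = 0 \<Longrightarrow> degree p \<le> degree f"
  shows "\<exists>G'. hom_graph G' \<and> G \<subseteq> G' \<and> (x, y) \<in> G'"
proof -
  define G' where "G' = {(poly f x, poly g y) | f g. poly_rel G f g}"
  have G'I: "(poly f x, poly g y) \<in> G'" if "poly_rel G f g" for f g
    using that unfolding G'_def by blast
  have const: "poly_rel G [:a:] [:b:]" if "(a, b) \<in> G" for a b
    using poly_rel_monom[OF G that, of 0] by (simp add: monom_0)
  have lc: "(lead_coeff p, coeff p' (degree p)) \<in> G" using rel by (simp add: poly_rel_def)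
  have lc': "coeff p' (degree p) \<noteq> 0" using hom_graph_nonzero[OF G lc] p by simp
  have zero: "poly g y = 0" if "poly_rel G f g" "poly f x = 0" for f g
    using that
  proof (induction "degree f" arbitrary: f g rule: less_induct)
    case less
    show ?case
    proof (cases "f = 0")
      case True
      then have "coeff g i = 0" for i
        using less.prems(1) hom_graphD(4)[OF G] by (simp add: poly_rel_def)
      then show ?thesis by (metis leading_coeff_0_iff poly_0)
    next
      case False
      have le: "degree p \<le> degree f" using min[OF less.prems(1) False less.prems(2)] .
      define k where "k = degree f - degree p"
      define a where "a = coeff g (degree f)"
      have a: "(lead_coeff f, a) \<in> G" using less.prems(1) by (simp add: poly_rel_def a_def)
      \<comment> \<open>Cross-multiplying by the leading coefficients avoids inverses, so the domain
        of \<open>G\<close> need only be known to be a ring.\<close>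
      define f1 where "f1 = [:lead_coeff p:] * f - monom (lead_coeff f) k * p"
      define g1 where "g1 = [:coeff p' (degree p):] * g - monom a k * p'"
      have rel1: "poly_rel G f1 g1"
        unfolding f1_def g1_def
        by (intro poly_rel_diff poly_rel_mult G const lc less.prems poly_rel_monom a rel)
      have x1: "poly f1 x = 0" by (simp add: f1_def less.prems p)
      have "poly g1 y = 0"
      proof (cases "f1 = 0 \<or> degree f1 < degree f")
        case True
        then show ?thesis
        proof
          assume "f1 = 0"
          then have "coeff g1 i = 0" for i
            using rel1 hom_graphD(4)[OF G] by (simp add: poly_rel_def)
          then show ?thesis by (metis leading_coeff_0_iff poly_0)
        qed (use less.hyps rel1 x1 in blast)
      next
        case False
        have deg: "degree f1 \<le> degree f"
        proof -
          have "degree (monom (lead_coeff f) k * p) \<le> degree f"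
            using degree_mult_le[of "monom (lead_coeff f) k" p] degree_monom_le[of "lead_coeff f" k] le
            by (simp add: k_def)
          moreover have "degree ([:lead_coeff p:] * f) \<le> degree f" by simp
          ultimately show ?thesis unfolding f1_def by (rule degree_diff_le[rotated])
        qed
        have "coeff (monom (lead_coeff f) k * p) (degree f) = lead_coeff f * lead_coeff p"
          using le by (simp add: coeff_monom_mult k_def)
        then have "coeff f1 (degree f) = 0" by (simp add: f1_def)
        then show ?thesis using False deg by (metis leading_coeff_0_iff le_neq_implies_less)
      qed
      then show ?thesis using lc' y by (simp add: g1_def)
    qed
  qed
  have "hom_graph G'"
    unfolding hom_graph_def
  proof (intro conjI allI impI)
    show "(to_ac c, to_ac c) \<in> G'" for c
      using G'I[OF const[OF hom_graphD(1)[OF G]]] by simp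
    fix a b a' b' assume "(a, b) \<in> G' \<and> (a', b') \<in> G'"
    then obtain f g f' g' where eq: "a = poly f x" "b = poly g y" "a' = poly f' x" "b' = poly g' y" and
      r: "poly_rel G f g" "poly_rel G f' g'" unfolding G'_def by blast
    show "(a - a', b - b') \<in> G'" using G'I[OF poly_rel_diff[OF G r]] by (simp add: eq)
    show "(a * a', b * b') \<in> G'" using G'I[OF poly_rel_mult[OF G r]] by (simp add: eq)
  next
    fix b assume "(0, b) \<in> G'"
    then obtain f g where "poly f x = 0" "b = poly g y" "poly_rel G f g" unfolding G'_def by auto
    then show "b = 0" using zero by simp
  qed
  moreover have "G \<subseteq> G'" using G'I[OF const] by auto
  moreover have "(x, y) \<in> G'"
    using G'I[OF poly_rel_monom[OF G hom_graph_one[OF G], of 1]] by (simp add: poly_monom)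
  ultimately show ?thesis by blast
qed

lemma minimal_poly_rel:
  assumes G: "hom_graph G"
  obtains p p' where "poly_rel G p p'" "p \<noteq> 0" "poly p x = 0"
    "\<And>f g. poly_rel G f g \<Longrightarrow> f \<noteq> 0 \<Longrightarrow> poly f x = 0 \<Longrightarrow> degree p \<le> degree f"
proof -
  obtain q where q: "q \<noteq> 0" "poly (map_poly to_ac q) x = 0" by (rule alg_closure_algebraic)
  let ?P = "\<lambda>f. (\<exists>g. poly_rel G f g) \<and> f \<noteq> 0 \<and> poly f x = 0"
  have "poly_rel G (map_poly to_ac q) (map_poly to_ac q)"
    using hom_graphD(1)[OF G] by (simp add: poly_rel_def coeff_map_poly)
  moreover have "map_poly to_ac q \<noteq> 0" using q(1) by (metis map_poly_eq_0_iff to_ac_0 to_ac_eq_0_iff)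
  ultimately have "?P (map_poly to_ac q)" using q by blast
  from ex_has_least_nat[of ?P, OF this, of degree]
  obtain p where "?P p" "\<forall>f. ?P f \<longrightarrow> degree p \<le> degree f" by blast
  then show ?thesis using that by blast
qed

text \<open>An element outside the ground field has a minimal polynomial of degree at least two,
  which is separable in characteristic zero. So \<open>c\<close> can be sent to another root
  \<open>y\<close>, and by Zorn's lemma this partial homomorphism extends to the whole
  closure.\<close>

theorem alg_closure_automorphism:
  fixes c :: "'k::field_char_0 alg_closure"
  assumes c: "c \<notin> range to_ac"
  obtains \<sigma> :: "'k alg_closure \<Rightarrow> 'k alg_closure" where
    "\<And>a b. \<sigma> (a + b) = \<sigma> a + \<sigma> b" "\<And>a b. \<sigma> (a * b) = \<sigma> a * \<sigma> b" "\<And>a. \<sigma> (to_ac a) = to_ac a"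
    "bij \<sigma>" "\<sigma> c \<noteq> c"
proof -
  define G0 :: "('k alg_closure \<times> 'k alg_closure) set" where "G0 = range (\<lambda>a. (to_ac a, to_ac a))"
  have G0: "hom_graph G0"
    unfolding hom_graph_def G0_def by (auto simp flip: to_ac_diff to_ac_mult)
  obtain p p' where p: "poly_rel G0 p p'" "p \<noteq> 0" "poly p c = 0"
    "\<And>f g. poly_rel G0 f g \<Longrightarrow> f \<noteq> 0 \<Longrightarrow> poly f c = 0 \<Longrightarrow> degree p \<le> degree f"
    using minimal_poly_rel[OF G0] by metis
  have coeffs: "\<exists>a. coeff p i = to_ac a \<and> coeff p' i = to_ac a" for i
    using p(1) unfolding poly_rel_def G0_def by blast
  have "p' = p" by (rule poly_eqI) (metis coeffs)
  obtain s where s: "p = [:- c, 1:] * s" using p(3) by (auto simp: poly_eq_0_iff_dvd dvd_def)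
  have "s \<noteq> 0" using s p(2) by auto
  have "degree s \<noteq> 0"
  proof
    assume "degree s = 0"
    then obtain a where a: "s = [:a:]" by (metis degree_eq_zeroE)
    then have "coeff p 0 = - (c * a)" "coeff p 1 = a" by (simp_all add: s)
    then obtain u v where "to_ac u = - (c * a)" "to_ac v = a"
      using coeffs by metis
    then have "c = to_ac (- u / v)" using \<open>s \<noteq> 0\<close> a by simp
    then show False using c by blast
  qed
  then obtain y where y: "poly s y = 0" using alg_closed_imp_poly_has_root by blast
  \<comment> \<open>A double root would be a root of the derivative, a nonzero polynomial of smaller
    degree over the ground field.\<close>
  have "y \<noteq> c"
  proof
    assume "y = c"
    then have "poly (pderiv p) c = 0" using y unfolding s pderiv_mult by (simp add: pderiv_pCons)
    moreover have "degree p \<noteq> 0"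
      unfolding s using \<open>degree s \<noteq> 0\<close> \<open>s \<noteq> 0\<close> by (subst degree_mult_eq) auto
    then have "pderiv p \<noteq> 0" by (simp add: pderiv_eq_0_iff)
    moreover have "poly_rel G0 (pderiv p) (pderiv p)"
      unfolding poly_rel_def coeff_pderiv
    proof
      fix i
      obtain a where "coeff p (Suc i) = to_ac a" using coeffs by metis
      then have "of_nat (Suc i) * coeff p (Suc i) = to_ac (of_nat (Suc i) * a)" by simp
      then show "(of_nat (Suc i) * coeff p (Suc i), of_nat (Suc i) * coeff p (Suc i)) \<in> G0"
        unfolding G0_def by blast
    qed
    ultimately have "degree p \<le> degree (pderiv p)" using p(4) by blast
    then show False using \<open>degree p \<noteq> 0\<close> unfolding degree_pderiv by simp
  qed
  have y': "poly p' y = 0" using y unfolding \<open>p' = p\<close> s by simp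
  have "\<exists>G1. hom_graph G1 \<and> G0 \<subseteq> G1 \<and> (c, y) \<in> G1"
    by (rule hom_graph_extend[OF G0 p(1-3) y'], rule p(4))
  then obtain G1 where G1: "hom_graph G1" "(c, y) \<in> G1" by blast
  define \<A> where "\<A> = {G. hom_graph G \<and> (c, y) \<in> G}"
  have "G1 \<in> \<A>" using G1 by (simp add: \<A>_def)
  have chain: "\<Union>\<C> \<in> \<A>" if ne: "\<C> \<noteq> {}" and ch: "subset.chain \<A> \<C>" for \<C>
  proof -
    have sub: "\<And>G. G \<in> \<C> \<Longrightarrow> hom_graph G \<and> (c, y) \<in> G"
      and tot: "\<And>S T. S \<in> \<C> \<Longrightarrow> T \<in> \<C> \<Longrightarrow> S \<subseteq> T \<or> T \<subseteq> S"
      using ch by (auto simp: subset.chain_def \<A>_def)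
    obtain G where G: "G \<in> \<C>" using ne by blast
    have "(a - a', b - b') \<in> \<Union>\<C> \<and> (a * a', b * b') \<in> \<Union>\<C>"
      if ab: "(a, b) \<in> \<Union>\<C>" "(a', b') \<in> \<Union>\<C>" for a b a' b'
    proof -
      obtain S T where S: "S \<in> \<C>" "(a, b) \<in> S" and T: "T \<in> \<C>" "(a', b') \<in> T" using ab by blast
      obtain R where R: "R \<in> \<C>" "(a, b) \<in> R" "(a', b') \<in> R"
        using tot[OF S(1) T(1)] S T by (metis subsetD)
      then have "(a - a', b - b') \<in> R" "(a * a', b * b') \<in> R"
        using hom_graphD(2,3) sub by blast+
      then show ?thesis using R(1) by blast
    qed
    moreover have "b = 0" if "(0, b) \<in> \<Union>\<C>" for b
      using that sub hom_graphD(4) by blast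
    moreover have "(to_ac a, to_ac a) \<in> \<Union>\<C>" for a
      using G sub hom_graphD(1) by blast
    moreover have "(c, y) \<in> \<Union>\<C>" using G sub by blast
    ultimately show ?thesis by (simp add: \<A>_def hom_graph_def)
  qed
  obtain G where G: "G \<in> \<A>" and max: "\<And>H. H \<in> \<A> \<Longrightarrow> G \<subseteq> H \<Longrightarrow> H = G"
    using subset_Zorn_nonempty[of \<A>] chain \<open>G1 \<in> \<A>\<close> by blast
  have hG: "hom_graph G" and cy: "(c, y) \<in> G" using G by (auto simp: \<A>_def)
  \<comment> \<open>A minimal polynomial of \<open>a\<close> over the domain of \<open>G\<close> is
    carried to a polynomial that is still nonconstant and so has a root in the closure; extending by
    that root gives nothing new, by maximality.\<close>
  have total: "\<exists>b. (a, b) \<in> G" for a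
  proof -
    obtain q q' where q: "poly_rel G q q'" "q \<noteq> 0" "poly q a = 0"
      "\<And>f g. poly_rel G f g \<Longrightarrow> f \<noteq> 0 \<Longrightarrow> poly f a = 0 \<Longrightarrow> degree q \<le> degree f"
      using minimal_poly_rel[OF hG] by metis
    have "degree q \<noteq> 0" using q(2,3) by (metis degree_eq_zeroE mult_zero_right add_0_right poly_0 poly_pCons pCons_0_0)
    moreover have "degree q \<le> degree q'"
    proof (rule le_degree)
      have "(lead_coeff q, coeff q' (degree q)) \<in> G" using q(1) by (simp add: poly_rel_def)
      from hom_graph_nonzero[OF hG this] show "coeff q' (degree q) \<noteq> 0" using q(2) by simp
    qed
    ultimately have "degree q' \<noteq> 0" by simp
    then obtain b where b: "poly q' b = 0" using alg_closed_imp_poly_has_root by blast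
    have "\<exists>H. hom_graph H \<and> G \<subseteq> H \<and> (a, b) \<in> H"
      by (rule hom_graph_extend[OF hG q(1-3) b], rule q(4))
    then obtain H where H: "hom_graph H" "G \<subseteq> H" "(a, b) \<in> H" by blast
    have "H \<in> \<A>" using H cy by (auto simp: \<A>_def)
    from max[OF this H(2)] show ?thesis using H(3) by blast
  qed
  define \<sigma> where "\<sigma> a = (SOME b. (a, b) \<in> G)" for a
  have \<sigma>: "(a, \<sigma> a) \<in> G" for a unfolding \<sigma>_def using total by (rule someI_ex)
  have \<sigma>_eq: "\<sigma> a = b" if "(a, b) \<in> G" for a b using hom_graph_unique[OF hG \<sigma> that] .
  have add: "\<sigma> (a + b) = \<sigma> a + \<sigma> b" for a b by (intro \<sigma>_eq hom_graph_add hG \<sigma>)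
  have mult: "\<sigma> (a * b) = \<sigma> a * \<sigma> b" for a b by (intro \<sigma>_eq hom_graphD(3)[OF hG] \<sigma>)
  have fixes_base: "\<sigma> (to_ac a) = to_ac a" for a by (intro \<sigma>_eq hom_graphD(1)[OF hG])
  have inj: "inj \<sigma>"
  proof (rule injI)
    fix a b assume "\<sigma> a = \<sigma> b"
    then have "(a - b, 0) \<in> G" using hom_graphD(2)[OF hG \<sigma>[of a] \<sigma>[of b]] by simp
    then show "a = b" using hom_graph_nonzero[OF hG] by fastforce
  qed
  \<comment> \<open>An injective map of the finite set of roots of an annihilating polynomial into
    itself is surjective.\<close>
  have "z \<in> range \<sigma>" for z
    proof -
      obtain q where q: "q \<noteq> 0" "poly (map_poly to_ac q) z = 0" by (rule alg_closure_algebraic)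
      let ?R = "{w. poly (map_poly to_ac q) w = 0}"
      have "map_poly to_ac q \<noteq> 0" using q(1) by (metis map_poly_eq_0_iff to_ac_0 to_ac_eq_0_iff)
      then have fin: "finite ?R" by (rule poly_roots_finite)
      have "\<sigma> ` ?R \<subseteq> ?R"
      proof (clarify)
        fix w assume w: "poly (map_poly to_ac q) w = 0"
        from hom_graph_poly[OF hG \<sigma>[of w], of q] show "poly (map_poly to_ac q) (\<sigma> w) = 0"
          using hom_graphD(4)[OF hG] by (simp add: w)
      qed
      then have "\<sigma> ` ?R = ?R"
        using fin inj by (intro endo_inj_surj) (auto intro: inj_on_subset)
      then show ?thesis using q(2) by blast
    qed
  then have "surj \<sigma>" by blast
  then have "bij \<sigma>" using inj by (simp add: bij_def)
  moreover have "\<sigma> c \<noteq> c" using \<sigma>_eq[OF cy] \<open>y \<noteq> c\<close> by simp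
  ultimately show ?thesis using that add mult fixes_base by blast
qed


section \<open>Polynomial functions\<close>

definition monomial_at :: "'c::field ^ 'n::finite \<Rightarrow> ('n \<Rightarrow>\<^sub>0 nat) \<Rightarrow> 'c" where
  "monomial_at p m = (\<Prod>i\<in>UNIV. (p $ i) ^ Poly_Mapping.lookup m i)"

lemma monomial_at_add: "monomial_at p (m + m') = monomial_at p m * monomial_at p m'"
  by (simp add: monomial_at_def lookup_add power_add prod.distrib)

lemma monomial_at_0 [simp]: "monomial_at p 0 = 1"
  by (simp add: monomial_at_def)

lemma poly_mapping_single_induct [case_names zero add]:
  assumes "P 0" "\<And>m c f. P f \<Longrightarrow> P (Poly_Mapping.single m c + f)"
  shows "P (f :: 'a \<Rightarrow>\<^sub>0 'b::comm_monoid_add)"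
proof -
  have "P (\<Sum>m\<in>K. Poly_Mapping.single m (Poly_Mapping.lookup f m))" for K
    by (induction K rule: infinite_finite_induct) (auto simp: assms)
  moreover have "(\<Sum>m\<in>Poly_Mapping.keys f. Poly_Mapping.single m (Poly_Mapping.lookup f m)) = f"
  proof (rule poly_mapping_eqI)
    fix k
    have "(\<Sum>m\<in>Poly_Mapping.keys f. Poly_Mapping.lookup f m when m = k) = Poly_Mapping.lookup f k"
      by (cases "k \<in> Poly_Mapping.keys f") (auto simp: when_def in_keys_iff)
    then show "Poly_Mapping.lookup (\<Sum>m\<in>Poly_Mapping.keys f. Poly_Mapping.single m (Poly_Mapping.lookup f m)) k =
        Poly_Mapping.lookup f k"
      by (simp add: lookup_sum lookup_single)
  qed
  ultimately show ?thesis by metis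
qed

lemma eval_at_map:
  assumes "h 0 = 0"
  shows "eval_at p (Poly_Mapping.map h f) = (\<Sum>m\<in>Poly_Mapping.keys f. h (Poly_Mapping.lookup f m) * monomial_at p m)"
proof -
  have "Poly_Mapping.lookup (Poly_Mapping.map h f) m = h (Poly_Mapping.lookup f m)" for m
    using assms by (simp add: Poly_Mapping.map.rep_eq when_def)
  then show ?thesis
    unfolding eval_at_def monomial_at_def using assms
    by (intro sum.mono_neutral_cong_left) (auto simp: in_keys_iff)
qed

lemma eval_at_sum: "eval_at p f = (\<Sum>m\<in>Poly_Mapping.keys f. Poly_Mapping.lookup f m * monomial_at p m)"
  by (simp add: eval_at_def monomial_at_def)

lemma eval_at_map_add:
  assumes h: "h 0 = 0" "\<And>a b. h (a + b) = h a + h b"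
  shows "eval_at p (Poly_Mapping.map h (f + g)) = eval_at p (Poly_Mapping.map h f) + eval_at p (Poly_Mapping.map h g)"
proof -
  let ?K = "Poly_Mapping.keys f \<union> Poly_Mapping.keys g"
  have *: "(\<Sum>m\<in>Poly_Mapping.keys u. h (Poly_Mapping.lookup u m) * monomial_at p m) =
      (\<Sum>m\<in>?K. h (Poly_Mapping.lookup u m) * monomial_at p m)" if "Poly_Mapping.keys u \<subseteq> ?K" for u
    using that h(1) by (intro sum.mono_neutral_left) (auto simp: in_keys_iff)
  show ?thesis
    unfolding eval_at_map[where h = h, OF h(1)] *[OF keys_add] *[OF Un_upper1] *[OF Un_upper2]
    by (simp add: lookup_add h(2) distrib_right sum.distrib)
qed

lemma map_id: "Poly_Mapping.map (\<lambda>x. x) f = f"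
  by (rule poly_mapping_eqI) (simp add: Poly_Mapping.map.rep_eq when_def)

lemma eval_at_add: "eval_at p (f + g) = eval_at p f + eval_at p g"
  using eval_at_map_add[of "\<lambda>x. x" p f g] by (simp add: map_id)

lemma eval_at_zero [simp]: "eval_at p 0 = 0"
  by (simp add: eval_at_def)

definition eval_base :: "'k::field_char_0 alg_closure ^ 'n::finite \<Rightarrow> ('n, 'k) polynomials \<Rightarrow> 'k alg_closure" where
  "eval_base p f = eval_at p (Poly_Mapping.map to_ac f)"

lemma eval_base_add: "eval_base p (f + g) = eval_base p f + eval_base p g"
  by (simp add: eval_base_def eval_at_map_add)

lemma eval_base_0 [simp]: "eval_base p 0 = 0"
  by (simp add: eval_base_def eval_at_map)

lemma eval_base_single: "eval_base p (Poly_Mapping.single m c) = to_ac c * monomial_at p m"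
  unfolding eval_base_def eval_at_map[of to_ac, OF to_ac_0] by simp

lemma eval_base_mult: "eval_base p (f * g) = eval_base p f * eval_base p g"
proof -
  have *: "eval_base p (Poly_Mapping.single m c * g) = eval_base p (Poly_Mapping.single m c) * eval_base p g" for m c
    by (induction g rule: poly_mapping_single_induct)
      (simp_all add: distrib_left eval_base_add mult_single eval_base_single monomial_at_add)
  show ?thesis
    by (induction f rule: poly_mapping_single_induct) (simp_all add: distrib_right eval_base_add *)
qed

lemma eval_base_1 [simp]: "eval_base p 1 = 1"
  using eval_base_single[of p 0 1] by simp

lemma eval_at_scaled:
  fixes f :: "('n::finite, 'k::field_char_0) polynomials"
  shows "eval_at p (Poly_Mapping.map (\<lambda>x. c * to_ac x) f) = c * eval_base p f"
  by (simp add: eval_base_def eval_at_map sum_distrib_left mult.assoc)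

definition coord_fun :: "('k::field_char_0 alg_closure ^ 'n::finite) set \<Rightarrow> ('n, 'k) polynomials \<Rightarrow>
    ('k alg_closure ^ 'n \<Rightarrow> 'k alg_closure)" where
  "coord_fun V f = (\<lambda>p\<in>V. eval_base p f)"

lemma coord_ring_simps:
  "carrier (coord_ring V) = range (coord_fun V)"
  "a \<otimes>\<^bsub>coord_ring V\<^esub> b = (\<lambda>p\<in>V. a p * b p)" "\<one>\<^bsub>coord_ring V\<^esub> = (\<lambda>p\<in>V. 1)"
  "\<zero>\<^bsub>coord_ring V\<^esub> = (\<lambda>p\<in>V. 0)" "a \<oplus>\<^bsub>coord_ring V\<^esub> b = (\<lambda>p\<in>V. a p + b p)"
  by (simp_all add: coord_ring_def coord_fun_def eval_base_def)

lemma coord_fun_mult: "coord_fun V f \<otimes>\<^bsub>coord_ring V\<^esub> coord_fun V g = coord_fun V (f * g)"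
  by (auto simp: coord_ring_simps coord_fun_def eval_base_mult)

lemma coord_fun_add: "coord_fun V f \<oplus>\<^bsub>coord_ring V\<^esub> coord_fun V g = coord_fun V (f + g)"
  by (auto simp: coord_ring_simps coord_fun_def eval_base_add)

lemma coord_fun_0: "\<zero>\<^bsub>coord_ring V\<^esub> = coord_fun V 0" and coord_fun_1: "\<one>\<^bsub>coord_ring V\<^esub> = coord_fun V 1"
  by (auto simp: coord_ring_simps coord_fun_def)

lemma coord_const_eq: "coord_const V c = coord_fun V (Poly_Mapping.single 0 c)"
  by (auto simp: coord_const_def coord_fun_def eval_base_single)

lemma cring_coord_ring: "cring (coord_ring V)"
proof (rule cringI)
  have neg: "\<exists>b\<in>carrier (coord_ring V). b \<oplus>\<^bsub>coord_ring V\<^esub> coord_fun V f = \<zero>\<^bsub>coord_ring V\<^esub>" for f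
    by (rule bexI[of _ "coord_fun V (- f)"]) (simp_all add: coord_fun_add coord_fun_0, simp add: coord_ring_simps(1))
  show "abelian_group (coord_ring V)"
    by (rule abelian_groupI)
      (use neg in \<open>auto simp: coord_ring_simps(1) coord_fun_add coord_fun_0 algebra_simps\<close>)
  show "comm_monoid (coord_ring V)"
    by (rule comm_monoidI)
      (auto simp: coord_ring_simps(1) coord_fun_mult coord_fun_1 algebra_simps)
qed (auto simp: coord_ring_simps(1) coord_fun_mult coord_fun_add algebra_simps)


section \<open>The ring of differential operators\<close>

locale comm_algebra = cring R for R (structure) +
  fixes s :: "'k::field \<Rightarrow> 'a"
  assumes s_closed [simp]: "s c \<in> carrier R" and s_add: "s (c + d) = s c \<oplus> s d"
    and s_mult: "s (c * d) = s c \<otimes> s d" and s_one: "s 1 = \<one>"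
begin

abbreviation "M \<equiv> mult_operator R"
abbreviation "L \<equiv> linear_endos R s"
abbreviation "D \<equiv> diffops_le R s"
abbreviation "comm \<equiv> commutator_with R"
abbreviation comp (infixl "\<circ>\<^sub>R" 70) where "P \<circ>\<^sub>R Q \<equiv> compose (carrier R) P Q"

definition op_add (infixl "+\<^sub>R" 65) where
  "P +\<^sub>R Q = (\<lambda>g\<in>carrier R. P g \<oplus> Q g)"

lemma linearD:
  assumes "P \<in> L"
  shows "P \<in> carrier R \<rightarrow>\<^sub>E carrier R" "f \<in> carrier R \<Longrightarrow> P f \<in> carrier R"
    "f \<in> carrier R \<Longrightarrow> g \<in> carrier R \<Longrightarrow> P (f \<oplus> g) = P f \<oplus> P g"
    "f \<in> carrier R \<Longrightarrow> P (s c \<otimes> f) = s c \<otimes> P f"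
  using assms by (auto simp: linear_endos_def)

lemma linearI:
  assumes "P \<in> extensional (carrier R)" "\<And>f. f \<in> carrier R \<Longrightarrow> P f \<in> carrier R"
    "\<And>f g. f \<in> carrier R \<Longrightarrow> g \<in> carrier R \<Longrightarrow> P (f \<oplus> g) = P f \<oplus> P g"
    "\<And>f c. f \<in> carrier R \<Longrightarrow> P (s c \<otimes> f) = s c \<otimes> P f"
  shows "P \<in> L"
  using assms by (auto simp: linear_endos_def PiE_iff)

lemma linear_eqI: "P \<in> L \<Longrightarrow> Q \<in> L \<Longrightarrow> (\<And>g. g \<in> carrier R \<Longrightarrow> P g = Q g) \<Longrightarrow> P = Q"
  using linearD(1) by (metis PiE_ext)

lemma linear_minus: "P \<in> L \<Longrightarrow> f \<in> carrier R \<Longrightarrow> g \<in> carrier R \<Longrightarrow> P (f \<ominus> g) = P f \<ominus> P g"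
proof -
  assume P: "P \<in> L" and fg: "f \<in> carrier R" "g \<in> carrier R"
  note PD = linearD[OF P]
  have cancel: "(a \<oplus> b) \<ominus> b = a" if "a \<in> carrier R" "b \<in> carrier R" for a b
    using that by (simp add: minus_eq a_assoc r_neg)
  have "P (f \<ominus> g) \<oplus> P g = P ((f \<ominus> g) \<oplus> g)" using fg by (simp add: PD)
  also have "(f \<ominus> g) \<oplus> g = f" using fg by (simp add: minus_eq a_assoc l_neg)
  finally have "P f = P (f \<ominus> g) \<oplus> P g" ..
  moreover have "P (f \<ominus> g) \<in> carrier R" "P g \<in> carrier R" using PD(2) fg by simp_all
  ultimately show ?thesis using cancel by simp
qed

lemma M_apply: "g \<in> carrier R \<Longrightarrow> M f g = f \<otimes> g"
  by (simp add: mult_operator_def)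

lemma linear_M: "f \<in> carrier R \<Longrightarrow> M f \<in> L"
  by (rule linearI) (auto simp: mult_operator_def r_distr m_lcomm)

lemma linear_comp: "P \<in> L \<Longrightarrow> Q \<in> L \<Longrightarrow> P \<circ>\<^sub>R Q \<in> L"
  by (rule linearI) (auto simp: compose_def linearD)

lemma linear_add: "P \<in> L \<Longrightarrow> Q \<in> L \<Longrightarrow> P +\<^sub>R Q \<in> L"
  by (rule linearI) (auto simp: op_add_def linearD r_distr a_ac)

lemma linear_comm:
  assumes "P \<in> L" "f \<in> carrier R"
  shows "comm P f \<in> L"
proof (rule linearI)
  fix g h c assume g: "g \<in> carrier R"
  have "P (f \<otimes> (s c \<otimes> g)) = s c \<otimes> P (f \<otimes> g)" "f \<otimes> P (s c \<otimes> g) = s c \<otimes> (f \<otimes> P g)"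
    using linearD[OF assms(1)] assms(2) g by (auto simp: m_lcomm[of f "s c"])
  then show "comm P f (s c \<otimes> g) = s c \<otimes> comm P f g"
    using linearD[OF assms(1)] assms(2) g
    by (simp add: commutator_with_def minus_eq r_distr r_minus)
  assume h: "h \<in> carrier R"
  show "comm P f (g \<oplus> h) = comm P f g \<oplus> comm P f h"
    using linearD[OF assms(1)] assms(2) g h
    by (simp add: commutator_with_def r_distr minus_eq minus_add a_ac)
qed (use linearD[OF assms(1)] assms(2) in \<open>auto simp: commutator_with_def\<close>)

lemma D_subset_L: "D n \<subseteq> L"
  by (cases n) (auto simp: linear_M)

lemma comm_M: "f \<in> carrier R \<Longrightarrow> g \<in> carrier R \<Longrightarrow> comm (M f) g = M \<zero>"
  unfolding commutator_with_def mult_operator_def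
  by (rule restrict_ext) (simp add: m_lcomm r_neg minus_eq)

lemma M_0_mem: "M \<zero> \<in> D n"
  by (induction n) (auto simp: linear_M comm_M)

lemma D_Suc: "D n \<subseteq> D (Suc n)"
proof (induction n)
  case 0
  show ?case using M_0_mem[of 0] by (auto simp: linear_M comm_M)
next
  case (Suc n)
  then show ?case by auto
qed

lemma D_mono: "m \<le> n \<Longrightarrow> D m \<subseteq> D n"
  using D_Suc by (rule lift_Suc_mono_le)

lemma comm_add: "P \<in> L \<Longrightarrow> Q \<in> L \<Longrightarrow> f \<in> carrier R \<Longrightarrow> comm (P +\<^sub>R Q) f = comm P f +\<^sub>R comm Q f"
  unfolding commutator_with_def op_add_def
  by (rule restrict_ext) (simp add: linearD r_distr minus_eq minus_add a_ac)

lemma M_add: "f \<in> carrier R \<Longrightarrow> g \<in> carrier R \<Longrightarrow> M f +\<^sub>R M g = M (f \<oplus> g)"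
  unfolding mult_operator_def op_add_def by (rule restrict_ext) (simp add: l_distr)

lemma M_comp: "f \<in> carrier R \<Longrightarrow> g \<in> carrier R \<Longrightarrow> M f \<circ>\<^sub>R M g = M (f \<otimes> g)"
  unfolding mult_operator_def compose_def by (rule restrict_ext) (simp add: m_assoc)

lemma D_add: "P \<in> D n \<Longrightarrow> Q \<in> D n \<Longrightarrow> P +\<^sub>R Q \<in> D n"
proof (induction n arbitrary: P Q)
  case 0
  then show ?case by (auto simp: M_add)
next
  case (Suc n)
  then show ?case by (auto simp: linear_add comm_add)
qed

lemma comm_comp:
  assumes "P \<in> L" "Q \<in> L" "f \<in> carrier R"
  shows "comm (P \<circ>\<^sub>R Q) f = P \<circ>\<^sub>R comm Q f +\<^sub>R comm P f \<circ>\<^sub>R Q"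
proof (rule linear_eqI)
  note P = linearD[OF assms(1)] and Q = linearD[OF assms(2)]
  fix g assume g: "g \<in> carrier R"
  have "P (Q (f \<otimes> g) \<ominus> f \<otimes> Q g) = P (Q (f \<otimes> g)) \<ominus> P (f \<otimes> Q g)"
    using assms(3) g Q by (simp add: linear_minus[OF assms(1)])
  then show "comm (P \<circ>\<^sub>R Q) f g = (P \<circ>\<^sub>R comm Q f +\<^sub>R comm P f \<circ>\<^sub>R Q) g"
    using assms(3) g P(2) Q(2)
    by (simp add: commutator_with_def op_add_def compose_def minus_eq a_assoc)
      (simp add: l_neg flip: a_assoc)
qed (use assms in \<open>auto intro: linear_comm linear_comp linear_add\<close>)

lemma comp_M_0: "P \<in> L \<Longrightarrow> P \<circ>\<^sub>R M \<zero> = M \<zero>" "P \<in> L \<Longrightarrow> M \<zero> \<circ>\<^sub>R P = M \<zero>"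
proof -
  assume P: "P \<in> L"
  have "P \<zero> = P (\<zero> \<ominus> \<zero>)" by (simp add: minus_eq)
  also have "\<dots> = \<zero>" using linearD(2)[OF P zero_closed] by (simp only: linear_minus[OF P] zero_closed) (simp add: minus_eq r_neg)
  finally have "P \<zero> = \<zero>" .
  then show "P \<circ>\<^sub>R M \<zero> = M \<zero>" "M \<zero> \<circ>\<^sub>R P = M \<zero>"
    unfolding mult_operator_def compose_def using linearD(2)[OF P] \<open>P \<zero> = \<zero>\<close>
    by (intro restrict_ext; simp)+
qed

text \<open>By the Leibniz rule a commutator lowers one of the two orders. Where that order is
  already 0 the commutator is the zero operator, which belongs to every order.\<close>

lemma D_comp: "P \<in> D m \<Longrightarrow> Q \<in> D n \<Longrightarrow> P \<circ>\<^sub>R Q \<in> D (m + n)"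
proof (induction "m + n" arbitrary: m n P Q)
  case 0
  then show ?case by (auto simp: M_comp)
next
  case (Suc k)
  have P: "P \<in> L" and Q: "Q \<in> L" using Suc.prems D_subset_L by auto
  have "comm (P \<circ>\<^sub>R Q) f \<in> D k" if f: "f \<in> carrier R" for f
  proof -
    have "P \<circ>\<^sub>R comm Q f \<in> D k"
    proof (cases n)
      case 0
      then have "comm Q f = M \<zero>" using Suc.prems f by (auto simp: comm_M)
      then show ?thesis using comp_M_0 P M_0_mem by simp
    next
      case (Suc n')
      then show ?thesis using Suc.hyps(1)[of m n' P "comm Q f"] Suc.hyps(2) Suc.prems f by auto
    qed
    moreover have "comm P f \<circ>\<^sub>R Q \<in> D k"
    proof (cases m)
      case 0
      then have "comm P f = M \<zero>" using Suc.prems f by (auto simp: comm_M)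
      then show ?thesis using comp_M_0 Q M_0_mem by simp
    next
      case (Suc m')
      then show ?thesis using Suc.hyps(1)[of m' n "comm P f" Q] Suc.hyps(2) Suc.prems f by auto
    qed
    ultimately show ?thesis by (simp add: comm_comp P Q f D_add)
  qed
  then have "P \<circ>\<^sub>R Q \<in> D (Suc k)" using linear_comp P Q by simp
  then show ?case using Suc.hyps(2) by simp
qed

lemma comp_M_eq: "P \<in> L \<Longrightarrow> f \<in> carrier R \<Longrightarrow> P \<circ>\<^sub>R M f = comm P f +\<^sub>R M f \<circ>\<^sub>R P"
proof (rule linear_eqI)
  fix g assume P: "P \<in> L" and f: "f \<in> carrier R" and g: "g \<in> carrier R"
  then show "(P \<circ>\<^sub>R M f) g = (comm P f +\<^sub>R M f \<circ>\<^sub>R P) g"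
    using linearD(2)[OF P]
    by (simp add: compose_def mult_operator_def op_add_def commutator_with_def minus_eq a_assoc l_neg)
qed (auto intro: linear_comp linear_M linear_comm linear_add)

text \<open>Commuting with multiplication by g and evaluating at \<one> gives P g = g
  P(\<one>).\<close>

lemma centraliser_M:
  assumes "P \<in> L" "\<And>f. f \<in> carrier R \<Longrightarrow> P \<circ>\<^sub>R M f = M f \<circ>\<^sub>R P"
  shows "P = M (P \<one>)"
proof (rule linear_eqI[OF assms(1) linear_M])
  show "P \<one> \<in> carrier R" using linearD(2)[OF assms(1)] by simp
  fix g assume g: "g \<in> carrier R"
  have "(P \<circ>\<^sub>R M g) \<one> = (M g \<circ>\<^sub>R P) \<one>" using assms(2)[OF g] by simp
  then have "P g = g \<otimes> P \<one>"
    using g linearD(2)[OF assms(1)] by (simp add: compose_def mult_operator_def)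
  then show "P g = M (P \<one>) g"
    using g linearD(2)[OF assms(1)] by (simp add: M_apply m_comm)
qed

lemma inj_M: "f \<in> carrier R \<Longrightarrow> g \<in> carrier R \<Longrightarrow> M f = M g \<Longrightarrow> f = g"
  by (metis M_apply one_closed r_one)

lemma diffop_ring_simps:
  "carrier (diffop_ring R s) = (\<Union>n. D n)" "P \<otimes>\<^bsub>diffop_ring R s\<^esub> Q = P \<circ>\<^sub>R Q"
  "\<one>\<^bsub>diffop_ring R s\<^esub> = M \<one>" "\<zero>\<^bsub>diffop_ring R s\<^esub> = M \<zero>" "P \<oplus>\<^bsub>diffop_ring R s\<^esub> Q = P +\<^sub>R Q"
  by (auto simp: diffop_ring_def op_add_def mult_operator_def intro!: restrict_ext)

context
  fixes \<iota> :: "('a \<Rightarrow> 'a) \<Rightarrow> 'd::division_ring"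
  assumes Frac: "is_Frac (diffop_ring R s) (UNIV :: 'd set) \<iota>"
begin

lemma \<iota>_hom:
  "P \<in> D m \<Longrightarrow> Q \<in> D n \<Longrightarrow> \<iota> (P \<circ>\<^sub>R Q) = \<iota> P * \<iota> Q"
  "P \<in> D m \<Longrightarrow> Q \<in> D n \<Longrightarrow> \<iota> (P +\<^sub>R Q) = \<iota> P + \<iota> Q" "\<iota> (M \<one>) = 1"
proof -
  have h: "\<iota> \<in> ring_hom (diffop_ring R s) (set_ring UNIV)" using Frac by (simp add: is_Frac_def)
  show "\<iota> (P \<circ>\<^sub>R Q) = \<iota> P * \<iota> Q" if "P \<in> D m" "Q \<in> D n" for P Q m n
    using ring_hom_mult[OF h, of P Q] that by (auto simp: diffop_ring_simps set_ring_def)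
  show "\<iota> (P +\<^sub>R Q) = \<iota> P + \<iota> Q" if "P \<in> D m" "Q \<in> D n" for P Q m n
    using ring_hom_add[OF h, of P Q] that by (auto simp: diffop_ring_simps set_ring_def)
  show "\<iota> (M \<one>) = 1"
    using ring_hom_one[OF h] by (simp add: diffop_ring_simps set_ring_def)
qed

lemma \<iota>_inj: "P \<in> D m \<Longrightarrow> Q \<in> D n \<Longrightarrow> \<iota> P = \<iota> Q \<Longrightarrow> P = Q"
  using Frac unfolding is_Frac_def inj_on_def diffop_ring_simps(1) by blast

lemma M_mem: "f \<in> carrier R \<Longrightarrow> M f \<in> D n"
  using D_mono[of 0 n] by auto

lemma \<iota>_M:
  "f \<in> carrier R \<Longrightarrow> g \<in> carrier R \<Longrightarrow> \<iota> (M (f \<oplus> g)) = \<iota> (M f) + \<iota> (M g)"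
  "f \<in> carrier R \<Longrightarrow> g \<in> carrier R \<Longrightarrow> \<iota> (M (f \<otimes> g)) = \<iota> (M f) * \<iota> (M g)"
  "\<iota> (M \<zero>) = 0"
proof -
  show *: "\<iota> (M (f \<oplus> g)) = \<iota> (M f) + \<iota> (M g)" if "f \<in> carrier R" "g \<in> carrier R" for f g
    using \<iota>_hom(2)[OF M_mem M_mem, of f g] that by (simp add: M_add)
  show "\<iota> (M (f \<otimes> g)) = \<iota> (M f) * \<iota> (M g)" if "f \<in> carrier R" "g \<in> carrier R" for f g
    using \<iota>_hom(1)[OF M_mem M_mem, of f g] that by (simp add: M_comp)
  show "\<iota> (M \<zero>) = 0" using *[of \<zero> \<zero>] by simp
qed

definition const :: "'k \<Rightarrow> 'd" where
  "const c = \<iota> (M (s c))"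

lemma const_central:
  "const c * q = q * const c"
proof -
  have comm: "const c * \<iota> P = \<iota> P * const c" if P: "P \<in> D n" for P n
  proof -
    have "M (s c) \<circ>\<^sub>R P = P \<circ>\<^sub>R M (s c)"
    proof (rule linear_eqI)
      fix g assume "g \<in> carrier R"
      then show "(M (s c) \<circ>\<^sub>R P) g = (P \<circ>\<^sub>R M (s c)) g"
        using linearD[of P] P D_subset_L by (auto simp: compose_def mult_operator_def subset_iff)
    qed (use P D_subset_L in \<open>auto intro!: linear_comp linear_M\<close>)
    then show ?thesis
      unfolding const_def \<iota>_hom(1)[OF M_mem[OF s_closed] P, symmetric]
        \<iota>_hom(1)[OF P M_mem[OF s_closed], symmetric] by (rule arg_cong)
  qed
  obtain P Q where "P \<in> (\<Union>n. D n)" "Q \<in> (\<Union>n. D n)" "q = inverse (\<iota> P) * \<iota> Q"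
    using Frac unfolding is_Frac_def diffop_ring_simps by blast
  then obtain m n where PQ: "P \<in> D m" "Q \<in> D n" "q = inverse (\<iota> P) * \<iota> Q" by blast
  have "const c * inverse (\<iota> P) = inverse (\<iota> P) * const c"
    using commute_inverse[OF comm[OF PQ(1), symmetric]] by simp
  then have "const c * q = inverse (\<iota> P) * (const c * \<iota> Q)" by (simp add: PQ(3) flip: mult.assoc)
  also have "\<dots> = q * const c" by (simp add: PQ(3) comm[OF PQ(2)] mult.assoc)
  finally show ?thesis .
qed

lemma central_field_const: "central_field const"
proof
  show "const (a + b) = const a + const b" for a b by (simp add: const_def s_add \<iota>_M)
  show "const (a * b) = const a * const b" for a b by (simp add: const_def s_mult \<iota>_M)
  show "const 1 = 1" by (simp add: const_def s_one \<iota>_hom)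
qed (rule const_central)

lemma \<iota>_comm:
  assumes "P \<in> D (Suc n)" "f \<in> carrier R"
  shows "\<iota> (comm P f) = brk (\<iota> P) (\<iota> (M f))"
proof -
  have "comm P f \<in> D n" "P \<in> L" using assms by auto
  have "M f \<circ>\<^sub>R P \<in> D (0 + Suc n)" by (rule D_comp[OF M_mem[OF assms(2)] assms(1)])
  then have "\<iota> (P \<circ>\<^sub>R M f) = \<iota> (comm P f) + \<iota> (M f \<circ>\<^sub>R P)"
    unfolding comp_M_eq[OF \<open>P \<in> L\<close> assms(2)] using \<open>comm P f \<in> D n\<close> by (intro \<iota>_hom(2))
  then show ?thesis
    using \<iota>_hom(1)[OF assms(1) M_mem[OF assms(2)]] \<iota>_hom(1)[OF M_mem[OF assms(2)] assms(1)]
    by (simp add: brk_def)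
qed

lemma \<iota>_centraliser:
  assumes "P \<in> D n" "\<And>f. f \<in> carrier R \<Longrightarrow> brk (\<iota> P) (\<iota> (M f)) = 0"
  shows "\<iota> P \<in> \<iota> ` D 0"
proof -
  have "P \<in> L" using assms(1) D_subset_L by blast
  have "P \<circ>\<^sub>R M f = M f \<circ>\<^sub>R P" if f: "f \<in> carrier R" for f
  proof (rule \<iota>_inj)
    show "P \<circ>\<^sub>R M f \<in> D (n + 0)" "M f \<circ>\<^sub>R P \<in> D (0 + n)"
      using D_comp M_mem[OF f] assms(1) by blast+
    show "\<iota> (P \<circ>\<^sub>R M f) = \<iota> (M f \<circ>\<^sub>R P)"
      using \<iota>_hom(1)[OF assms(1) M_mem[OF f]] \<iota>_hom(1)[OF M_mem[OF f] assms(1)] assms(2)[OF f]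
      by (simp add: brk_eq_0)
  qed
  then have "P = M (P \<one>)" using \<open>P \<in> L\<close> by (intro centraliser_M)
  moreover have "P \<one> \<in> carrier R" using linearD(2)[OF \<open>P \<in> L\<close>] by simp
  ultimately have "P \<in> D 0" by auto
  then show ?thesis by blast
qed

lemma add_closed_\<iota>_D: "add_closed (\<iota> ` D n)"
  unfolding add_closed_def
proof (intro conjI ballI)
  show "0 \<in> \<iota> ` D n" using \<iota>_M(3) M_0_mem by (metis imageI)
  fix u v assume "u \<in> \<iota> ` D n" "v \<in> \<iota> ` D n"
  then obtain P Q where PQ: "P \<in> D n" "Q \<in> D n" "u = \<iota> P" "v = \<iota> Q" by blast
  have neg: "M (\<ominus> \<one>) \<circ>\<^sub>R Q \<in> D (0 + n)" by (rule D_comp[OF M_mem PQ(2)]) simp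
  have "\<iota> (M (\<ominus> \<one>)) + 1 = 0"
    using \<iota>_M(1)[of "\<ominus> \<one>" \<one>] \<iota>_M(3) \<iota>_hom(3) by (simp add: l_neg)
  then have "\<iota> (M (\<ominus> \<one>)) = - 1" by (simp add: eq_neg_iff_add_eq_0)
  then have "\<iota> (M (\<ominus> \<one>) \<circ>\<^sub>R Q) = - v"
    using \<iota>_hom(1)[OF M_mem PQ(2), of "\<ominus> \<one>"] PQ(4) by simp
  then have "\<iota> (P +\<^sub>R (M (\<ominus> \<one>) \<circ>\<^sub>R Q)) = u - v"
    using \<iota>_hom(2)[OF PQ(1), of "M (\<ominus> \<one>) \<circ>\<^sub>R Q" n] neg PQ(3) by simp
  moreover have "P +\<^sub>R (M (\<ominus> \<one>) \<circ>\<^sub>R Q) \<in> D n" using D_add[OF PQ(1)] neg by simp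
  ultimately show "u - v \<in> \<iota> ` D n" by (metis imageI)
qed

text \<open>The map \<kappa> is kept apart from \<open>const\<close>, and only their ranges are
  compared, because its field is required to have characteristic zero while the field of
  \<open>comm_algebra\<close> is arbitrary.\<close>

lemma diffop_division_ring_\<iota>:
  fixes z :: "'n::finite \<Rightarrow> 'a" and \<kappa> :: "'l::field_char_0 \<Rightarrow> 'd"
  assumes \<kappa>: "central_field \<kappa>" "range \<kappa> = range const" and z: "\<And>i. z i \<in> carrier R"
    and gen: "\<And>f B. f \<in> carrier R \<Longrightarrow> std.sub_ring B \<Longrightarrow> range const \<subseteq> B \<Longrightarrow> range (\<lambda>i. \<iota> (M (z i))) \<subseteq> B \<Longrightarrow>
      \<iota> (M f) \<in> B"
  shows "diffop_division_ring \<kappa> (\<iota> ` D 0) (\<lambda>n. \<iota> ` D n) (\<lambda>i. \<iota> (M (z i)))"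
proof -
  interpret central_field \<kappa> by (rule \<kappa>(1))
  have frac: "\<exists>P\<in>(\<Union>n. \<iota> ` D n) - {0}. P * q \<in> (\<Union>n. \<iota> ` D n)"
    "\<exists>P\<in>(\<Union>n. \<iota> ` D n) - {0}. q * P \<in> (\<Union>n. \<iota> ` D n)" for q
  proof -
    have nz: "\<iota> P \<noteq> 0" if "P \<in> D n" "P \<noteq> M \<zero>" for P n
      using \<iota>_inj[OF that(1) M_0_mem] that(2) \<iota>_M(3) by auto
    obtain P Q m n where "P \<in> D m" "P \<noteq> M \<zero>" "Q \<in> D n" "q = inverse (\<iota> P) * \<iota> Q"
      using Frac unfolding is_Frac_def diffop_ring_simps by blast
    then have "\<iota> P * q = \<iota> Q" "\<iota> P \<noteq> 0" using nz by (auto simp flip: mult.assoc)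
    with \<open>P \<in> D m\<close> \<open>Q \<in> D n\<close> show "\<exists>P\<in>(\<Union>n. \<iota> ` D n) - {0}. P * q \<in> (\<Union>n. \<iota> ` D n)"
      by (intro bexI[of _ "\<iota> P"]) auto
    obtain P Q m n where "P \<in> D m" "P \<noteq> M \<zero>" "Q \<in> D n" "q = \<iota> Q * inverse (\<iota> P)"
      using Frac unfolding is_Frac_def diffop_ring_simps by blast
    then have "q * \<iota> P = \<iota> Q" "\<iota> P \<noteq> 0" using nz by (auto simp: mult.assoc)
    with \<open>P \<in> D m\<close> \<open>Q \<in> D n\<close> show "\<exists>P\<in>(\<Union>n. \<iota> ` D n) - {0}. q * P \<in> (\<Union>n. \<iota> ` D n)"
      by (intro bexI[of _ "\<iota> P"]) auto
  qed
  show ?thesis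
  proof unfold_locales
    show "\<iota> ` D 0 = \<iota> ` D 0" ..
    show "a * b = b * a" if "a \<in> \<iota> ` D 0" "b \<in> \<iota> ` D 0" for a b
      using that by (auto simp: m_comm simp flip: \<iota>_M(2))
    have "const c \<in> \<iota> ` D 0" for c by (auto simp: const_def)
    then show "\<kappa> c \<in> \<iota> ` D 0" for c using \<kappa>(2) by (metis rangeE rangeI)
    show "\<iota> (M (z i)) \<in> \<iota> ` D 0" for i using z by auto
    show "add_closed (\<iota> ` D n)" for n by (rule add_closed_\<iota>_D)
    show "P * Q \<in> \<iota> ` D (m + n)" if PQ: "P \<in> \<iota> ` D m" "Q \<in> \<iota> ` D n" for P Q m n
    proof -
      obtain P' Q' where P': "P' \<in> D m" "Q' \<in> D n" "P = \<iota> P'" "Q = \<iota> Q'" using PQ by blast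
      from \<iota>_hom(1)[OF P'(1,2)] D_comp[OF P'(1,2)] show ?thesis using P' by (metis imageI)
    qed
    show "\<iota> ` D n \<subseteq> \<iota> ` D (Suc n)" for n by (rule image_mono[OF D_Suc])
    show "brk P a \<in> \<iota> ` D n" if Pa: "P \<in> \<iota> ` D (Suc n)" "a \<in> \<iota> ` D 0" for P a n
    proof -
      obtain P' f where P': "P' \<in> D (Suc n)" "P = \<iota> P'" and f: "f \<in> carrier R" "a = \<iota> (M f)"
        using Pa by (auto simp del: diffops_le.simps(2))
      have "comm P' f \<in> D n" using P'(1) f(1) by simp
      then show ?thesis using \<iota>_comm[OF P'(1) f(1)] P' f by (metis imageI)
    qed
    show "P \<in> \<iota> ` D 0" if P: "P \<in> \<iota> ` D n" "\<And>a. a \<in> \<iota> ` D 0 \<Longrightarrow> brk P a = 0" for P n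
    proof -
      obtain P' where P': "P' \<in> D n" "P = \<iota> P'" using P(1) by blast
      show ?thesis unfolding P'(2)
        by (rule \<iota>_centraliser[OF P'(1)]) (use P(2) P'(2) in auto)
    qed
    show "a \<in> B" if "a \<in> \<iota> ` D 0" "std.sub_ring B" "range \<kappa> \<subseteq> B" "range (\<lambda>i. \<iota> (M (z i))) \<subseteq> B" for a B
      using that gen[of _ B] \<kappa>(2) by auto
  qed (use frac in blast)+
qed

end

end


section \<open>The division ring of a variety\<close>

lemma polynomials_generated:
  fixes T :: "('n::finite, 'k::field) polynomials set"
  assumes const: "\<And>c. Poly_Mapping.single 0 c \<in> T"
    and var: "\<And>i. Poly_Mapping.single (Poly_Mapping.single i 1) 1 \<in> T"
    and add: "\<And>f g. f \<in> T \<Longrightarrow> g \<in> T \<Longrightarrow> f + g \<in> T" and mult: "\<And>f g. f \<in> T \<Longrightarrow> g \<in> T \<Longrightarrow> f * g \<in> T"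
  shows "f \<in> T"
proof -
  have "Poly_Mapping.single m c \<in> T" for m c
  proof (induction "\<Sum>i\<in>UNIV. Poly_Mapping.lookup m i" arbitrary: m)
    case 0
    then have "m = 0" by (intro poly_mapping_eqI) simp
    then show ?case using const by simp
  next
    case (Suc d)
    then obtain i where i: "Poly_Mapping.lookup m i \<noteq> 0" by fastforce
    define m' where "m' = m - Poly_Mapping.single i 1"
    have m: "m = m' + Poly_Mapping.single i 1"
      using i by (intro poly_mapping_eqI) (auto simp: m'_def lookup_add lookup_minus lookup_single when_def)
    have "(\<Sum>j\<in>UNIV. Poly_Mapping.lookup m j) =
        (\<Sum>j\<in>UNIV. Poly_Mapping.lookup m' j) + (\<Sum>j\<in>UNIV. if i = j then 1 else 0)"
      unfolding sum.distrib[symmetric] by (intro sum.cong) (auto simp: m lookup_add lookup_single when_def)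
    then have "d = (\<Sum>j\<in>UNIV. Poly_Mapping.lookup m' j)" using Suc.hyps(2) by simp
    then have "Poly_Mapping.single m' c * Poly_Mapping.single (Poly_Mapping.single i 1) 1 \<in> T"
      by (intro mult var Suc.hyps(1))
    then show ?case by (simp add: mult_single m)
  qed
  then show ?thesis
    by (induction f rule: poly_mapping_single_induct) (use const[of 0] in \<open>auto intro: add\<close>)
qed

lemma comm_algebra_coord_ring: "comm_algebra (coord_ring V) (coord_const V)"
proof -
  interpret cring "coord_ring V" by (rule cring_coord_ring)
  show ?thesis
  proof
    show "coord_const V c \<in> carrier (coord_ring V)" for c
      by (simp add: coord_const_eq coord_ring_simps)
    show "coord_const V (c + d) = coord_const V c \<oplus>\<^bsub>coord_ring V\<^esub> coord_const V d" for c d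
      by (simp add: coord_const_eq coord_fun_add single_add)
    show "coord_const V (c * d) = coord_const V c \<otimes>\<^bsub>coord_ring V\<^esub> coord_const V d" for c d
      by (simp add: coord_const_eq coord_fun_mult mult_single)
    show "coord_const V 1 = \<one>\<^bsub>coord_ring V\<^esub>"
      by (simp add: coord_const_eq coord_fun_1)
  qed
qed

locale variety_division_ring =
  fixes V :: "('k::field_char_0 alg_closure ^ 'n::finite) set"
    and \<iota> :: "(('k alg_closure ^ 'n \<Rightarrow> 'k alg_closure) \<Rightarrow> ('k alg_closure ^ 'n \<Rightarrow> 'k alg_closure))
                \<Rightarrow> 'd::division_ring"
    and \<kappa> :: "'k \<Rightarrow> 'd"
  assumes defined_over: "\<exists>S :: ('n, 'k) polynomials set. V = zero_locus (Poly_Mapping.map to_ac ` S)"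
    and irreducible: "irreducible_closed V"
    and Frac: "is_Frac (variety_diffops V) (UNIV :: 'd set) \<iota>"
    and \<kappa>_def: "\<kappa> = structure_map V \<iota>"
begin

interpretation alg: comm_algebra "coord_ring V" "coord_const V"
  by (rule comm_algebra_coord_ring)

lemma Frac': "is_Frac (diffop_ring (coord_ring V) (coord_const V)) (UNIV :: 'd set) \<iota>"
  using Frac by (simp add: variety_diffops_def)

definition emb :: "('n, 'k) polynomials \<Rightarrow> 'd" where
  "emb f = \<iota> (mult_operator (coord_ring V) (coord_fun V f))"

definition coord :: "'n \<Rightarrow> ('n, 'k) polynomials" where
  "coord i = Poly_Mapping.single (Poly_Mapping.single i 1) 1"

lemma coord_fun_closed: "coord_fun V f \<in> carrier (coord_ring V)"
  by (simp add: coord_ring_simps)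

lemma emb_add: "emb (f + g) = emb f + emb g" and emb_mult: "emb (f * g) = emb f * emb g"
  using alg.\<iota>_M(1)[OF Frac' coord_fun_closed coord_fun_closed, of f g]
    alg.\<iota>_M(2)[OF Frac' coord_fun_closed coord_fun_closed, of f g]
  by (simp_all add: emb_def coord_fun_add coord_fun_mult)

lemma emb_const: "emb (Poly_Mapping.single 0 c) = \<kappa> c"
  by (simp add: emb_def \<kappa>_def structure_map_def coord_const_eq)

lemma emb_eq_iff: "emb f = emb g \<longleftrightarrow> coord_fun V f = coord_fun V g"
proof
  assume "emb f = emb g"
  then have "mult_operator (coord_ring V) (coord_fun V f) = mult_operator (coord_ring V) (coord_fun V g)"
    unfolding emb_def
    by (rule alg.\<iota>_inj[OF Frac' alg.M_mem[OF Frac' coord_fun_closed] alg.M_mem[OF Frac' coord_fun_closed]])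
  then show "coord_fun V f = coord_fun V g"
    by (rule alg.inj_M[OF coord_fun_closed coord_fun_closed])
qed (simp add: emb_def)

definition orders :: "nat \<Rightarrow> 'd set" where
  "orders n = \<iota> ` diffops_le (coord_ring V) (coord_const V) n"

lemma orders_0: "orders 0 = range emb"
  by (auto simp: orders_def emb_def coord_ring_simps(1))

lemma diffop_division_ring: "diffop_division_ring \<kappa> (range emb) orders (\<lambda>i. emb (coord i))"
proof -
  have const: "alg.const \<iota> = \<kappa>"
    by (rule ext) (simp add: alg.const_def[OF Frac'] \<kappa>_def structure_map_def)
  have "emb f \<in> B" if B: "std.sub_ring B" "range \<kappa> \<subseteq> B" "range (\<lambda>i. emb (coord i)) \<subseteq> B" for f B
  proof -
    have "f \<in> {f. emb f \<in> B}"
      by (rule polynomials_generated)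
        (use B std.sub_ringD[OF B(1)] in \<open>auto simp: emb_add emb_mult emb_const coord_def\<close>)
    then show ?thesis by simp
  qed
  then have "diffop_division_ring \<kappa> (orders 0) orders (\<lambda>i. emb (coord i))"
    unfolding orders_def emb_def
    by (intro alg.diffop_division_ring_\<iota>[OF Frac' _ _ coord_fun_closed])
      (auto simp: const alg.central_field_const[OF Frac', unfolded const] coord_ring_simps(1))
  then show ?thesis unfolding orders_0 .
qed

sublocale diffop_division_ring \<kappa> "range emb" orders "\<lambda>i. emb (coord i)"
  by (rule diffop_division_ring)

text \<open>Independent of the chosen polynomial for \<open>a \<in> range emb\<close> and
  \<open>p \<in> V\<close>, because \<open>emb f\<close> determines the function of \<open>f\<close>
  on \<open>V\<close>. Elsewhere the value is arbitrary.\<close>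

definition value_at :: "'d \<Rightarrow> 'k alg_closure ^ 'n \<Rightarrow> 'k alg_closure" where
  "value_at a p = eval_base p (SOME f. a = emb f)"

lemma value_at_emb: "p \<in> V \<Longrightarrow> value_at (emb f) p = eval_base p f"
proof -
  assume p: "p \<in> V"
  define g where "g = (SOME g. emb f = emb g)"
  have "emb f = emb g" unfolding g_def by (rule someI[of _ f]) simp
  then have "coord_fun V g p = coord_fun V f p" by (simp add: emb_eq_iff)
  then show ?thesis using p by (simp add: value_at_def g_def coord_fun_def)
qed

lemma value_at_add: "a \<in> range emb \<Longrightarrow> b \<in> range emb \<Longrightarrow> p \<in> V \<Longrightarrow> value_at (a + b) p = value_at a p + value_at b p"
  and value_at_mult: "a \<in> range emb \<Longrightarrow> b \<in> range emb \<Longrightarrow> p \<in> V \<Longrightarrow> value_at (a * b) p = value_at a p * value_at b p"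
  by (auto simp: value_at_emb eval_base_add eval_base_mult simp flip: emb_add emb_mult)

lemma value_at_\<kappa>: "p \<in> V \<Longrightarrow> value_at (\<kappa> c) p = to_ac c"
  using value_at_emb[of p "Poly_Mapping.single 0 c"] by (simp add: emb_const eval_base_single)

lemma value_at_0: "p \<in> V \<Longrightarrow> value_at 0 p = 0"
  using value_at_\<kappa>[of p 0] by simp

lemma value_at_sum:
  assumes "\<And>i. i \<in> I \<Longrightarrow> f i \<in> range emb" "p \<in> V"
  shows "value_at (\<Sum>i\<in>I. f i) p = (\<Sum>i\<in>I. value_at (f i) p)"
  using assms
proof (induction I rule: infinite_finite_induct)
  case (insert i I)
  have "(\<Sum>i\<in>I. f i) \<in> range emb" using insert.prems by (intro add_closed_sum[OF A_D(1)]) auto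
  then show ?case using insert by (simp add: value_at_add)
qed (auto simp: value_at_0)

lemma value_at_eq_0:
  assumes "a \<in> range emb" "\<And>p. p \<in> V \<Longrightarrow> value_at a p = 0"
  shows "a = 0"
proof -
  obtain f where f: "a = emb f" using assms(1) by blast
  have "coord_fun V f = coord_fun V (Poly_Mapping.single 0 0)"
    unfolding coord_fun_def by (rule restrict_ext) (use assms(2) f in \<open>simp add: value_at_emb\<close>)
  then have "emb f = emb (Poly_Mapping.single 0 0)" by (simp only: emb_eq_iff)
  then show ?thesis unfolding f emb_const by simp
qed

text \<open>
  Automorphisms of the algebraic closure permute the points of the variety, so that a relation over
  the algebraic closure of minimal length, normalised to have a coefficient \<open>1\<close>, has its
  coefficients in the ground field.
\<close>

lemma conjugate_relation:
  assumes \<sigma>: "\<And>a b. \<sigma> (a + b) = \<sigma> a + \<sigma> b" "\<And>a b. \<sigma> (a * b) = \<sigma> a * \<sigma> b" "\<And>a. \<sigma> (to_ac a) = to_ac a" "bij \<sigma>"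
    and B: "B \<subseteq> range emb" and rel: "\<And>q. q \<in> V \<Longrightarrow> (\<Sum>b\<in>B. c b * value_at b q) = 0" and q: "q \<in> V"
  shows "(\<Sum>b\<in>B. \<sigma> (c b) * value_at b q) = 0"
proof -
  have \<sigma>_0: "\<sigma> 0 = 0" and \<sigma>_1: "\<sigma> 1 = 1" using \<sigma>(3)[of 0] \<sigma>(3)[of 1] by simp_all
  have \<sigma>_sum: "\<sigma> (sum f I) = (\<Sum>i\<in>I. \<sigma> (f i))" for f :: "'i \<Rightarrow> _" and I
    by (induction I rule: infinite_finite_induct) (auto simp: \<sigma>_0 \<sigma>(1))
  have \<sigma>_pow: "\<sigma> (a ^ n) = \<sigma> a ^ n" for a n by (induction n) (auto simp: \<sigma>_1 \<sigma>(2))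
  have \<sigma>_prod: "\<sigma> (prod f I) = (\<Prod>i\<in>I. \<sigma> (f i))" for f :: "'i \<Rightarrow> _" and I
    by (induction I rule: infinite_finite_induct) (auto simp: \<sigma>_1 \<sigma>(2))
  \<comment> \<open>The inverse conjugate of \<open>q\<close>: applying \<sigma> to the relation at
    \<open>p\<close> gives the conjugated relation at \<open>q\<close>.\<close>
  define p where "p = (\<chi> i. inv_into UNIV \<sigma> (q $ i))"
  have \<sigma>p: "\<sigma> (p $ i) = q $ i" for i using \<sigma>(4) by (simp add: p_def bij_is_surj surj_f_inv_f)
  have \<sigma>_mon: "\<sigma> (monomial_at p m) = monomial_at q m" for m
    by (simp add: monomial_at_def \<sigma>_prod \<sigma>_pow \<sigma>p)
  have \<sigma>_eval: "\<sigma> (eval_base p f) = eval_base q f" for f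
    by (simp add: eval_base_def eval_at_map \<sigma>_sum \<sigma>(2,3) \<sigma>_mon)
  obtain S :: "('n, 'k) polynomials set" where S: "V = zero_locus (Poly_Mapping.map to_ac ` S)"
    using defined_over by blast
  have "eval_base p f = 0" if "f \<in> S" for f
  proof -
    have "\<sigma> (eval_base p f) = \<sigma> 0"
      using q S that by (simp add: \<sigma>_eval \<sigma>_0 zero_locus_def) (simp add: eval_base_def)
    then show ?thesis using \<sigma>(4) by (simp add: bij_is_inj inj_eq)
  qed
  then have p: "p \<in> V" by (simp add: S zero_locus_def eval_base_def)
  have "\<sigma> (value_at b p) = value_at b q" if "b \<in> B" for b
    using that B p q by (auto simp: value_at_emb \<sigma>_eval)
  then have "(\<Sum>b\<in>B. \<sigma> (c b) * value_at b q) = \<sigma> (\<Sum>b\<in>B. c b * value_at b p)"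
    unfolding \<sigma>_sum by (intro sum.cong) (auto simp: \<sigma>(2))
  then show ?thesis using rel[OF p] \<sigma>_0 by simp
qed

lemma geometrically_independent:
  assumes "finite B" "B \<subseteq> range emb" "vs.independent B"
    and "\<And>q. q \<in> V \<Longrightarrow> (\<Sum>b\<in>B. c b * value_at b q) = 0"
  shows "\<forall>b\<in>B. c b = 0"
  using assms(4)
proof (induction "card {b\<in>B. c b \<noteq> 0}" arbitrary: c rule: less_induct)
  case less
  show ?case
  proof (rule ccontr)
    assume "\<not> (\<forall>b\<in>B. c b = 0)"
    then obtain b0 where b0: "b0 \<in> B" "c b0 \<noteq> 0" by blast
    define d where "d b = c b / c b0" for b
    have d_rel: "(\<Sum>b\<in>B. d b * value_at b q) = 0" if "q \<in> V" for q
    proof -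
      have "(\<Sum>b\<in>B. d b * value_at b q) = (\<Sum>b\<in>B. c b * value_at b q) / c b0"
        by (simp add: d_def sum_divide_distrib)
      then show ?thesis using less.prems[OF that] by simp
    qed
    show False
    proof (cases "\<forall>b\<in>B. d b \<in> range to_ac")
      case True
      then have "\<forall>b\<in>B. \<exists>a. d b = to_ac a" by (simp add: image_iff)
      from bchoice[OF this] obtain e where e: "\<And>b. b \<in> B \<Longrightarrow> d b = to_ac (e b)" by auto
      have mem: "scale (e b) b \<in> range emb" if "b \<in> B" for b
        by (rule linear_subspaceD(2)[OF linear_subspace_A subsetD[OF assms(2) that]])
      \<comment> \<open>With all coefficients in the ground field, the relation between values
        becomes a linear relation in the division ring itself, against the independence of
        \<open>B\<close>.\<close>
      have "(\<Sum>b\<in>B. scale (e b) b) = 0"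
      proof (rule value_at_eq_0)
        show "(\<Sum>b\<in>B. scale (e b) b) \<in> range emb"
          using mem by (intro add_closed_sum[OF A_D(1)])
        fix p assume p: "p \<in> V"
        have "value_at (\<Sum>b\<in>B. scale (e b) b) p = (\<Sum>b\<in>B. value_at (scale (e b) b) p)"
          by (rule value_at_sum[OF mem p])
        also have "\<dots> = (\<Sum>b\<in>B. d b * value_at b p)"
        proof (rule sum.cong)
          fix b assume "b \<in> B"
          then show "value_at (scale (e b) b) p = d b * value_at b p"
            using value_at_mult[OF \<kappa>_mem _ p] assms(2) e value_at_\<kappa>[OF p] by auto
        qed simp
        finally show "value_at (\<Sum>b\<in>B. scale (e b) b) p = 0" using d_rel[OF p] by simp
      qed
      then have "e b0 = 0"
        using assms(1,3) b0(1) vs.independentD[of B B e b0] by simp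
      then show False using e[OF b0(1)] b0(2) by (simp add: d_def)
    next
      case False
      then obtain b1 where b1: "b1 \<in> B" "d b1 \<notin> range to_ac" by blast
      obtain \<sigma> where \<sigma>: "\<And>a b. \<sigma> (a + b) = \<sigma> a + \<sigma> b" "\<And>a b. \<sigma> (a * b) = \<sigma> a * \<sigma> b"
        "\<And>a. \<sigma> (to_ac a) = to_ac a" "bij \<sigma>" "\<sigma> (d b1) \<noteq> d b1"
        by (rule alg_closure_automorphism[OF b1(2)]) (rule that; assumption)
      have \<sigma>01: "\<sigma> 0 = 0" "\<sigma> 1 = 1" using \<sigma>(3)[of 0] \<sigma>(3)[of 1] by simp_all
      \<comment> \<open>The difference of the conjugated and the original relation. The coefficient
        at \<open>b0\<close> is 1 and cancels, so the difference is shorter, but it is nonzero at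
        \<open>b1\<close>.\<close>
      define u where "u b = \<sigma> (d b) - d b" for b
      have "u b0 = 0" using b0 \<sigma>01 by (simp add: u_def d_def)
      moreover have "u b = 0" if "c b = 0" for b using that \<sigma>01 by (simp add: u_def d_def)
      ultimately have "{b \<in> B. u b \<noteq> 0} \<subset> {b \<in> B. c b \<noteq> 0}" using b0 by blast
      then have "card {b \<in> B. u b \<noteq> 0} < card {b \<in> B. c b \<noteq> 0}"
        using assms(1) by (intro psubset_card_mono) auto
      moreover have "(\<Sum>b\<in>B. u b * value_at b q) = 0" if "q \<in> V" for q
        using conjugate_relation[OF \<sigma>(1-4) assms(2) d_rel that] d_rel[OF that]
        by (simp add: u_def left_diff_distrib sum_subtractf)
      ultimately have "\<forall>b\<in>B. u b = 0" by (rule less.hyps)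
      then show False using b1(1) \<sigma>(5) by (simp add: u_def)
    qed
  qed
qed

section \<open>Tensors over the coordinate ring as functions on pairs of points\<close>

definition value_at2 :: "('d \<times> 'd \<Rightarrow>\<^sub>0 int) \<Rightarrow> 'k alg_closure ^ 'n \<Rightarrow> 'k alg_closure ^ 'n \<Rightarrow> 'k alg_closure" where
  "value_at2 Z p q = pair_extend (\<lambda>a b. value_at a p * value_at b q) Z"

lemma value_at2_null:
  assumes "Z \<in> null (range emb) (range emb)" "p \<in> V" "q \<in> V"
  shows "value_at2 Z p q = 0"
  unfolding value_at2_def
  by (rule pair_extend_null[OF assms(1)])
    (use assms(2,3) \<kappa>_mem in \<open>simp_all add: value_at_add value_at_mult value_at_\<kappa> distrib_left distrib_right\<close>)

lemma value_at2_mult: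
  assumes "Poly_Mapping.keys Y \<subseteq> range emb \<times> range emb" "Poly_Mapping.keys Z \<subseteq> range emb \<times> range emb" "p \<in> V" "q \<in> V"
  shows "value_at2 (tensor_mult Y Z) p q = value_at2 Y p q * value_at2 Z p q"
proof -
  have *: "value_at2 (tensor_mult (pure a b) Z) p q = value_at2 (pure a b) p q * value_at2 Z p q"
    if "a \<in> range emb" "b \<in> range emb" for a b
    using assms(2)
  proof (induction rule: tensor_induct)
    case (pure c d)
    then show ?case using that assms(3,4) by (simp add: value_at2_def tensor_mult_pure value_at_mult)
  qed (simp_all add: value_at2_def tensor_mult_diffl pair_extend_diff right_diff_distrib)
  show ?thesis
    using assms(1)
  proof (induction rule: tensor_induct)
    case (pure a b)
    then show ?case by (rule *)
  qed (simp_all add: value_at2_def tensor_mult_diffr pair_extend_diff left_diff_distrib)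
qed

text \<open>In the normal form with independent right entries, fix the first point: what remains is
  a relation over the closure between the functions \<open>b\<close>, so every \<open>a b\<close>
  vanishes at that point. As the point was arbitrary, all left entries are 0.\<close>

lemma value_at2_eq_0_iff:
  assumes Z: "Poly_Mapping.keys Z \<subseteq> range emb \<times> range emb"
  shows "Z \<in> N \<longleftrightarrow> (\<forall>p\<in>V. \<forall>q\<in>V. value_at2 Z p q = 0)"
proof -
  obtain B a where B: "finite B" "B \<subseteq> range emb" "vs.independent B" "\<And>b. b \<in> B \<Longrightarrow> a b \<in> range emb"
    "Z - (\<Sum>b\<in>B. pure (a b) b) \<in> null (range emb) (range emb)"
    by (rule reduce_right[OF linear_subspace_A linear_subspace_A Z]) (rule that; assumption)
  let ?W = "\<Sum>b\<in>B. pure (a b) b"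
  have W: "Z - ?W \<in> N" by (rule subsetD[OF null_mono B(5)]) simp_all
  have val: "value_at2 Z p q = (\<Sum>b\<in>B. value_at (a b) p * value_at b q)" if "p \<in> V" "q \<in> V" for p q
    using value_at2_null[OF B(5) that] by (simp add: value_at2_def pair_extend_diff pair_extend_sum)
  show ?thesis
  proof
    assume "Z \<in> N"
    from nullD(2)[OF this W] have "?W \<in> N" by simp
    then have "a b = 0" if "b \<in> B" for b using independent_right B(1,3) that by blast
    then show "\<forall>p\<in>V. \<forall>q\<in>V. value_at2 Z p q = 0" by (simp add: val value_at_0)
  next
    assume 0: "\<forall>p\<in>V. \<forall>q\<in>V. value_at2 Z p q = 0"
    have "a b = 0" if b: "b \<in> B" for b
    proof (rule value_at_eq_0[OF B(4)[OF b]])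
      fix p assume p: "p \<in> V"
      have "\<forall>b\<in>B. value_at (a b) p = 0"
        by (rule geometrically_independent[OF B(1-3)]) (use 0 val p in simp)
      then show "value_at (a b) p = 0" using b by blast
    qed
    then have "?W = (\<Sum>b\<in>B. pure 0 b)" by simp
    then have "?W \<in> N"
      using add_closed_sum[OF add_closed_null, of B "\<lambda>b. pure 0 b"] pure_zero_null(2)[of UNIV _ UNIV] by simp
    from nullD(4)[OF W this] show "Z \<in> N" by simp
  qed
qed

text \<open>Fixing one point turns the values of the corresponding entry into scalars of the
  closure. The polynomials in the other variable thus have coefficients in the closure, so
  irreducibility over the closure is what applies to them.\<close>

lemma value_at2_polynomial:
  assumes "Poly_Mapping.keys Z \<subseteq> range emb \<times> range emb" "q \<in> V"
  shows "\<exists>g. \<forall>p\<in>V. value_at2 Z p q = eval_at p g" "\<exists>g. \<forall>p\<in>V. value_at2 Z q p = eval_at p g"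
proof -
  have diff: "eval_at p (g + Poly_Mapping.map (\<lambda>c. - c) h) = eval_at p g - eval_at p h" for p h g
    by (simp add: eval_at_add eval_at_map eval_at_sum[of p h] sum_negf)
  show "\<exists>g. \<forall>p\<in>V. value_at2 Z p q = eval_at p g"
    using assms(1)
  proof (induction rule: tensor_induct)
    case zero
    then show ?case by (intro exI[of _ 0]) (simp add: value_at2_def)
  next
    case (pure a b)
    then obtain f where "a = emb f" by blast
    then show ?case
      by (intro exI[of _ "Poly_Mapping.map (\<lambda>x. value_at b q * to_ac x) f"])
        (simp add: value_at2_def value_at_emb eval_at_scaled)
  next
    case (diff Y Z)
    then obtain g h where "\<forall>p\<in>V. value_at2 Y p q = eval_at p g" "\<forall>p\<in>V. value_at2 Z p q = eval_at p h" by blast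
    then show ?case
      by (intro exI[of _ "g + Poly_Mapping.map (\<lambda>c. - c) h"])
        (simp add: \<open>\<And>p h g. eval_at p (g + Poly_Mapping.map (\<lambda>c. - c) h) = eval_at p g - eval_at p h\<close>
          value_at2_def pair_extend_diff)
  qed
  show "\<exists>g. \<forall>p\<in>V. value_at2 Z q p = eval_at p g"
    using assms(1)
  proof (induction rule: tensor_induct)
    case zero
    then show ?case by (intro exI[of _ 0]) (simp add: value_at2_def)
  next
    case (pure a b)
    then obtain f where "b = emb f" by blast
    then show ?case
      by (intro exI[of _ "Poly_Mapping.map (\<lambda>x. value_at a q * to_ac x) f"])
        (simp add: value_at2_def value_at_emb eval_at_scaled)
  next
    case (diff Y Z)
    then obtain g h where "\<forall>p\<in>V. value_at2 Y q p = eval_at p g" "\<forall>p\<in>V. value_at2 Z q p = eval_at p h" by blast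
    then show ?case
      by (intro exI[of _ "g + Poly_Mapping.map (\<lambda>c. - c) h"])
        (simp add: \<open>\<And>p h g. eval_at p (g + Poly_Mapping.map (\<lambda>c. - c) h) = eval_at p g - eval_at p h\<close>
          value_at2_def pair_extend_diff)
  qed
qed

lemma irreducibleD:
  assumes "\<And>p. p \<in> V \<Longrightarrow> (\<forall>f\<in>S. eval_at p f = 0) \<or> (\<forall>f\<in>T. eval_at p f = 0)"
  shows "(\<forall>p\<in>V. \<forall>f\<in>S. eval_at p f = 0) \<or> (\<forall>p\<in>V. \<forall>f\<in>T. eval_at p f = 0)"
proof -
  have "V \<subseteq> zero_locus S \<union> zero_locus T" using assms by (auto simp: zero_locus_def)
  moreover have "zariski_closed (zero_locus S)" "zariski_closed (zero_locus T)"
    by (auto simp: zariski_closed_def)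
  ultimately have "V \<subseteq> zero_locus S \<or> V \<subseteq> zero_locus T"
    using irreducible unfolding irreducible_closed_def by blast
  then show ?thesis by (auto simp: zero_locus_def)
qed

text \<open>The classical argument for the irreducibility of a product. For each fixed p,
  irreducibility in the second variable makes one of the two functions vanish on {p} \<times>
  \<open>V\<close>; the points p for which a given one does so form a closed set, and two closed
  sets cover \<open>V\<close>.\<close>

lemma domain_coordinate_tensor:
  assumes Y: "Poly_Mapping.keys Y \<subseteq> range emb \<times> range emb" and Z: "Poly_Mapping.keys Z \<subseteq> range emb \<times> range emb"
    and YZ: "tensor_mult Y Z \<in> N"
  shows "Y \<in> N \<or> Z \<in> N"
proof -
  have "Poly_Mapping.keys (tensor_mult Y Z) \<subseteq> range emb \<times> range emb"
  proof
    fix w assume "w \<in> Poly_Mapping.keys (tensor_mult Y Z)"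
    then obtain y z where "y \<in> Poly_Mapping.keys Y" "z \<in> Poly_Mapping.keys Z" "w = (fst y * fst z, snd z * snd y)"
      using keys_frag_extend[of "\<lambda>x. frag_extend (\<lambda>y. pure (fst x * fst y) (snd y * snd x)) Z" Y]
        keys_frag_extend[of "\<lambda>y. pure (fst _ * fst y) (snd y * snd _)" Z]
      unfolding tensor_mult_def by (fastforce dest!: subsetD[OF keys_frag_extend])
    moreover from this have "y \<in> range emb \<times> range emb" "z \<in> range emb \<times> range emb" using Y Z by auto
    ultimately show "w \<in> range emb \<times> range emb" using A_D(3) by auto
  qed
  then have prod: "value_at2 Y p q * value_at2 Z p q = 0" if "p \<in> V" "q \<in> V" for p q
    using YZ that value_at2_mult[OF Y Z that] by (simp add: value_at2_eq_0_iff)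
  have point: "(\<forall>q\<in>V. value_at2 Y p q = 0) \<or> (\<forall>q\<in>V. value_at2 Z p q = 0)" if p: "p \<in> V" for p
  proof -
    obtain g h where g: "\<forall>q\<in>V. value_at2 Y p q = eval_at q g" and h: "\<forall>q\<in>V. value_at2 Z p q = eval_at q h"
      using value_at2_polynomial(2)[OF Y p] value_at2_polynomial(2)[OF Z p] by blast
    have "(\<forall>q\<in>V. \<forall>f\<in>{g}. eval_at q f = 0) \<or> (\<forall>q\<in>V. \<forall>f\<in>{h}. eval_at q f = 0)"
    proof (rule irreducibleD)
      fix q assume q: "q \<in> V"
      then have "eval_at q g * eval_at q h = 0" using prod[OF p q] g h by simp
      then show "(\<forall>f\<in>{g}. eval_at q f = 0) \<or> (\<forall>f\<in>{h}. eval_at q f = 0)" by simp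
    qed
    then show ?thesis using g h by simp
  qed
  \<comment> \<open>The two closed sets are cut out by the polynomials in the first variable that
    arise by fixing the second point in all possible ways.\<close>
  obtain g h where g: "\<And>q p. q \<in> V \<Longrightarrow> p \<in> V \<Longrightarrow> value_at2 Y p q = eval_at p (g q)"
    and h: "\<And>q p. q \<in> V \<Longrightarrow> p \<in> V \<Longrightarrow> value_at2 Z p q = eval_at p (h q)"
    using value_at2_polynomial(1)[OF Y] value_at2_polynomial(1)[OF Z] by metis
  have "(\<forall>p\<in>V. \<forall>f\<in>g ` V. eval_at p f = 0) \<or> (\<forall>p\<in>V. \<forall>f\<in>h ` V. eval_at p f = 0)"
  proof (rule irreducibleD)
    fix p assume "p \<in> V"
    then show "(\<forall>f\<in>g ` V. eval_at p f = 0) \<or> (\<forall>f\<in>h ` V. eval_at p f = 0)"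
      using point[of p] g h by simp
  qed
  then show ?thesis
    unfolding value_at2_eq_0_iff[OF Y] value_at2_eq_0_iff[OF Z] using g h by simp
qed

theorem enveloping_algebra:
  "nc_noetherian (tensor_with_opposite \<kappa>)" "nc_domain (tensor_with_opposite \<kappa>)"
proof -
  show "nc_noetherian (tensor_with_opposite \<kappa>)"
    unfolding tensor_with_opposite_quot
    by (intro tensor.nc_noetherian_quot two_sided_null left_noetherian_tensor right_noetherian_tensor)
  show "nc_domain (tensor_with_opposite \<kappa>)"
    unfolding tensor_with_opposite_quot
    by (intro tensor.nc_domain_quot two_sided_null independent_one domain_tensor[OF domain_coordinate_tensor])
qed

end


section \<open>Finitely generated abelian groups\<close>

context comm_group
begin

abbreviation T where "T \<equiv> torsion_part G"

definition monom_prod :: "('i \<Rightarrow> 'a) \<Rightarrow> ('i \<Rightarrow> int) \<Rightarrow> 'i set \<Rightarrow> 'a" where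
  "monom_prod g n I = finprod G (\<lambda>i. g i [^] n i) I"

lemma monom_prod_closed [simp]: "g \<in> I \<rightarrow> carrier G \<Longrightarrow> monom_prod g n I \<in> carrier G"
  by (auto simp: monom_prod_def intro!: finprod_closed)

lemma monom_prod_mult:
  "g \<in> I \<rightarrow> carrier G \<Longrightarrow> monom_prod g n I \<otimes> monom_prod g m I = monom_prod g (\<lambda>i. n i + m i) I"
proof -
  assume g: "g \<in> I \<rightarrow> carrier G"
  then have "monom_prod g n I \<otimes> monom_prod g m I = finprod G (\<lambda>i. g i [^] n i \<otimes> g i [^] m i) I"
    unfolding monom_prod_def by (intro finprod_multf[symmetric]) (auto simp: Pi_iff)
  also have "\<dots> = monom_prod g (\<lambda>i. n i + m i) I"
    unfolding monom_prod_def using g by (intro finprod_cong') (auto simp: Pi_iff int_pow_mult)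
  finally show ?thesis .
qed

lemma monom_prod_zero: "monom_prod g (\<lambda>_. 0) I = \<one>"
  by (simp add: monom_prod_def)

lemma monom_prod_inv: "g \<in> I \<rightarrow> carrier G \<Longrightarrow> inv (monom_prod g n I) = monom_prod g (\<lambda>i. - n i) I"
  by (rule inv_equality) (simp_all add: monom_prod_mult monom_prod_zero)

lemma monom_prod_insert:
  "finite I \<Longrightarrow> i \<notin> I \<Longrightarrow> g \<in> insert i I \<rightarrow> carrier G \<Longrightarrow>
    monom_prod g n (insert i I) = g i [^] n i \<otimes> monom_prod g n I"
  unfolding monom_prod_def by (subst finprod_insert) (auto simp: Pi_iff)

lemma monom_prod_cong:
  "g \<in> I \<rightarrow> carrier G \<Longrightarrow> (\<And>i. i \<in> I \<Longrightarrow> g i = g' i \<and> n i = n' i) \<Longrightarrow> monom_prod g n I = monom_prod g' n' I"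
  unfolding monom_prod_def by (intro finprod_cong') (auto simp: Pi_iff)

lemma torsion_mem: "a \<in> T \<longleftrightarrow> a \<in> carrier G \<and> (\<exists>m::nat. m > 0 \<and> a [^] m = \<one>)"
  by (auto simp: torsion_part_def)

lemma subgroup_torsion: "subgroup T G"
proof (rule subgroupI)
  have "\<one> \<in> T" by (auto simp: torsion_mem intro!: exI[of _ 1])
  then show "T \<noteq> {}" by blast
  fix a b assume "a \<in> T" "b \<in> T"
  then obtain m n :: nat where ab: "a \<in> carrier G" "b \<in> carrier G" "m > 0" "n > 0" "a [^] m = \<one>" "b [^] n = \<one>"
    by (auto simp: torsion_mem)
  have "a [^] (m * n) = (a [^] m) [^] n" "b [^] (m * n) = (b [^] n) [^] m"
    using ab(1,2) by (simp_all add: nat_pow_pow mult.commute)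
  then have "(a \<otimes> b) [^] (m * n) = \<one>" using ab by (simp add: nat_pow_distrib)
  then show "a \<otimes> b \<in> T" using ab by (auto simp: torsion_mem intro!: exI[of _ "m * n"])
  show "inv a \<in> T" using ab by (auto simp: torsion_mem nat_pow_inv intro!: exI[of _ m])
qed (auto simp: torsion_mem)

lemmas torsionD = subgroup.m_closed[OF subgroup_torsion] subgroup.one_closed[OF subgroup_torsion]
  subgroup.m_inv_closed[OF subgroup_torsion] subgroup.mem_carrier[OF subgroup_torsion]

lemma torsion_root:
  assumes "a \<in> carrier G" "a [^] (z::int) \<in> T" "z \<noteq> 0"
  shows "a \<in> T"
proof -
  obtain m :: nat where m: "m > 0" "(a [^] z) [^] m = \<one>" using assms(2) by (auto simp: torsion_mem)
  have "a [^] (z * int m) = \<one>" using m(2) assms(1) by (simp add: int_pow_pow flip: int_pow_int)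
  then have "a [^] (\<bar>z\<bar> * int m) = \<one>"
    using assms(1) int_pow_neg[of a "z * int m"] by (cases "z \<ge> 0") (auto simp: abs_if)
  then have "a [^] (nat \<bar>z\<bar> * m) = \<one>" by (simp flip: int_pow_int)
  then show ?thesis using assms m by (auto simp: torsion_mem intro!: exI[of _ "nat \<bar>z\<bar> * m"])
qed

text \<open>An indexed family rather than a set, so that a basis change keeps the index set and its
  size even when two members happen to coincide.\<close>

definition spans_mod_torsion :: "'i set \<Rightarrow> ('i \<Rightarrow> 'a) \<Rightarrow> bool" where
  "spans_mod_torsion I g \<longleftrightarrow> finite I \<and> g \<in> I \<rightarrow> carrier G \<and>
     (\<forall>x\<in>carrier G. \<exists>\<tau>\<in>T. \<exists>n. x = \<tau> \<otimes> monom_prod g n I)"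

lemma monom_prod_subgroup:
  assumes "finite I" "g \<in> I \<rightarrow> carrier G" "subgroup H G"
  shows "subgroup {\<tau> \<otimes> monom_prod g n I | \<tau> n. \<tau> \<in> H} G" (is "subgroup ?K G")
proof (rule subgroupI)
  note HD = subgroup.m_closed[OF assms(3)] subgroup.one_closed[OF assms(3)]
    subgroup.m_inv_closed[OF assms(3)] subgroup.mem_carrier[OF assms(3)]
  show "?K \<subseteq> carrier G" using assms(2) HD by auto
  show "?K \<noteq> {}" using HD(2) by blast
  fix x y assume "x \<in> ?K" "y \<in> ?K"
  then obtain \<tau> \<tau>' n n' where eq: "x = \<tau> \<otimes> monom_prod g n I" "y = \<tau>' \<otimes> monom_prod g n' I" "\<tau> \<in> H" "\<tau>' \<in> H"
    by blast
  have "x \<otimes> y = (\<tau> \<otimes> \<tau>') \<otimes> (monom_prod g n I \<otimes> monom_prod g n' I)"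
    using assms(2) HD eq by (simp add: m_ac)
  then show "x \<otimes> y \<in> ?K" using HD(1) eq assms(2) by (auto simp: monom_prod_mult)
  have "inv x = inv \<tau> \<otimes> monom_prod g (\<lambda>i. - n i) I"
    using assms(2) HD eq by (simp add: inv_mult monom_prod_inv)
  then show "inv x \<in> ?K" using HD(3) eq by blast
qed

lemma spans_mod_torsion_exists:
  assumes "finite S" "S \<subseteq> carrier G" "generate G S = carrier G"
  shows "spans_mod_torsion S (\<lambda>x. x)"
proof -
  let ?K = "{\<tau> \<otimes> monom_prod (\<lambda>x. x) n S | \<tau> n. \<tau> \<in> T}"
  have S: "(\<lambda>x. x) \<in> S \<rightarrow> carrier G" using assms(2) by auto
  have "s \<in> ?K" if s: "s \<in> S" for s
  proof -
    have "monom_prod (\<lambda>x. x) (\<lambda>i. if i = s then 1 else 0) S = finprod G (\<lambda>i. if s = i then i else \<one>) S"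
      unfolding monom_prod_def using assms(2) by (intro finprod_cong') auto
    also have "\<dots> = s" using s assms(1) S by (simp add: finprod_singleton)
    finally have "s = \<one> \<otimes> monom_prod (\<lambda>x. x) (\<lambda>i. if i = s then 1 else 0) S"
      using s assms(2) by auto
    then show ?thesis using torsionD(2) by blast
  qed
  then have "generate G S \<subseteq> ?K"
    by (intro generate_subgroup_incl monom_prod_subgroup assms S subgroup_torsion) auto
  then show ?thesis using assms S unfolding spans_mod_torsion_def by blast
qed

text \<open>One step of the Euclidean algorithm on the exponents: multiplying the member at
  \<open>j\<close> by a power of the member at \<open>i\<close> is compensated in the exponent at
  \<open>i\<close>, and the product does not change.\<close>

lemma monom_prod_basis_change:
  fixes m :: "'i \<Rightarrow> int"
  assumes "finite I" "g \<in> I \<rightarrow> carrier G" "i \<in> I" "j \<in> I" "i \<noteq> j"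
  shows "monom_prod g m I = monom_prod (g(j := g j \<otimes> g i [^] (\<epsilon>::int))) (m(i := m i - \<epsilon> * m j)) I"
proof -
  define J where "J = I - {i, j}"
  have I: "I = insert i (insert j J)" "i \<notin> insert j J" "j \<notin> J" "finite J" using assms by (auto simp: J_def)
  have gi: "g i \<in> carrier G" "g j \<in> carrier G" "g \<in> J \<rightarrow> carrier G" using assms by (auto simp: J_def)
  let ?g = "g(j := g j \<otimes> g i [^] \<epsilon>)" and ?m = "m(i := m i - \<epsilon> * m j)"
  have g': "?g \<in> insert i (insert j J) \<rightarrow> carrier G" and g: "g \<in> insert i (insert j J) \<rightarrow> carrier G"
    using gi by auto
  have J_eq: "monom_prod g m J = monom_prod ?g ?m J"
    by (rule monom_prod_cong[OF gi(3)]) (use I(2,3) in auto)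
  have "g i [^] (m i - \<epsilon> * m j) \<otimes> ((g j \<otimes> g i [^] \<epsilon>) [^] m j \<otimes> monom_prod g m J) =
    (g i [^] (m i - \<epsilon> * m j) \<otimes> g i [^] (\<epsilon> * m j)) \<otimes> (g j [^] m j \<otimes> monom_prod g m J)"
    using gi by (simp add: int_pow_distrib int_pow_pow m_ac)
  also have "g i [^] (m i - \<epsilon> * m j) \<otimes> g i [^] (\<epsilon> * m j) = g i [^] m i"
    using gi by (simp flip: int_pow_mult)
  finally have "g i [^] m i \<otimes> (g j [^] m j \<otimes> monom_prod g m J) =
    g i [^] (m i - \<epsilon> * m j) \<otimes> ((g j \<otimes> g i [^] \<epsilon>) [^] m j \<otimes> monom_prod g m J)"
    using gi by (simp add: m_assoc)
  then show ?thesis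
    unfolding I(1) monom_prod_insert[OF _ I(2) g, OF finite.insertI[OF I(4)]]
      monom_prod_insert[OF _ I(2) g', OF finite.insertI[OF I(4)]]
    using monom_prod_insert[OF I(4,3), of g] monom_prod_insert[OF I(4,3), of ?g] g g' assms(5) J_eq
    by (simp add: Pi_iff)
qed

lemma spans_mod_torsion_basis_change:
  assumes "spans_mod_torsion I g" "i \<in> I" "j \<in> I" "i \<noteq> j"
  shows "spans_mod_torsion I (g(j := g j \<otimes> g i [^] (\<epsilon>::int)))"
proof -
  have I: "finite I" "g \<in> I \<rightarrow> carrier G" "\<And>x. x \<in> carrier G \<Longrightarrow> \<exists>\<tau>\<in>T. \<exists>n. x = \<tau> \<otimes> monom_prod g n I"
    using assms(1) by (auto simp: spans_mod_torsion_def)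
  have "\<exists>\<tau>\<in>T. \<exists>n. x = \<tau> \<otimes> monom_prod (g(j := g j \<otimes> g i [^] \<epsilon>)) n I" if "x \<in> carrier G" for x
    using I(3)[OF that] monom_prod_basis_change[OF I(1,2) assms(2-4)] by metis
  moreover have "g(j := g j \<otimes> g i [^] \<epsilon>) \<in> I \<rightarrow> carrier G" using I(2) assms(2-) by (auto simp: Pi_iff)
  ultimately show ?thesis using I(1) by (simp add: spans_mod_torsion_def)
qed

text \<open>
  A spanning family of minimal size is independent: a shortest relation among all such families can
  be shortened by a basis change unless it involves only one member, which is then torsion.
\<close>

lemma minimal_spanning_independent:
  fixes I :: "'i set"
  assumes span: "spans_mod_torsion I g"
    and min: "\<And>J (h :: 'i \<Rightarrow> 'a). spans_mod_torsion J h \<Longrightarrow> card I \<le> card J"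
    and n: "monom_prod g n I \<in> T"
  shows "\<forall>i\<in>I. n i = 0"
proof (rule ccontr)
  assume "\<not> (\<forall>i\<in>I. n i = 0)"
  define rel where "rel = (\<lambda>(g, n). spans_mod_torsion I g \<and> monom_prod g n I \<in> T \<and> (\<exists>i\<in>I. n i \<noteq> (0::int)))"
  define size where "size = (\<lambda>(g :: 'i \<Rightarrow> 'a, n :: 'i \<Rightarrow> int). \<Sum>i\<in>I. nat \<bar>n i\<bar>)"
  have "rel (g, n)" using span n \<open>\<not> (\<forall>i\<in>I. n i = 0)\<close> by (auto simp: rel_def)
  from ex_has_least_nat[of rel, OF this, of size]
  obtain h m where hm: "rel (h, m)" and least: "\<And>h' m'. rel (h', m') \<Longrightarrow> size (h, m) \<le> size (h', m')"
    by (metis surj_pair)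
  then have h: "spans_mod_torsion I h" "monom_prod h m I \<in> T" and ex: "\<exists>i\<in>I. m i \<noteq> 0"
    by (auto simp: rel_def)
  have I: "finite I" "h \<in> I \<rightarrow> carrier G" using h(1) by (auto simp: spans_mod_torsion_def)
  have no_pair: False if ij: "i \<in> I" "j \<in> I" "i \<noteq> j" "m j \<noteq> 0" "\<bar>m j\<bar> \<le> \<bar>m i\<bar>" for i j
  proof -
    \<comment> \<open>The sign for which subtracting \<epsilon> times \<open>m j\<close> shrinks the
      absolute value of \<open>m i\<close>.\<close>
    define \<epsilon> :: int where "\<epsilon> = (if (m i > 0) = (m j > 0) then 1 else - 1)"
    let ?m = "m(i := m i - \<epsilon> * m j)" and ?h = "h(j := h j \<otimes> h i [^] \<epsilon>)"
    have small: "\<bar>m i - \<epsilon> * m j\<bar> < \<bar>m i\<bar>" using ij(4,5) by (auto simp: \<epsilon>_def)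
    \<comment> \<open>The relation stays nontrivial because the exponent at \<open>j\<close> is
      unchanged and nonzero.\<close>
    have "rel (?h, ?m)"
      using spans_mod_torsion_basis_change[OF h(1) ij(1-3)] h(2) ij
        monom_prod_basis_change[OF I ij(1-3), of m \<epsilon>] by (auto simp: rel_def intro!: bexI[of _ j])
    then have "size (h, m) \<le> size (?h, ?m)" by (rule least)
    moreover have "size (?h, ?m) < size (h, m)"
      unfolding size_def prod.case using I(1)
    proof (rule sum_strict_mono_ex1)
      show "\<exists>k\<in>I. nat \<bar>?m k\<bar> < nat \<bar>m k\<bar>" using small ij(1) by (intro bexI[of _ i]) auto
    qed (use small in auto)
    ultimately show False by simp
  qed
  obtain i where i: "i \<in> I" "m i \<noteq> 0" using ex by blast
  have others: "m j = 0" if "j \<in> I" "j \<noteq> i" for j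
    using no_pair[of i j] no_pair[of j i] i that by (cases "\<bar>m j\<bar> \<le> \<bar>m i\<bar>") auto
  have I_eq: "I = insert i (I - {i})" using i by blast
  have hi: "h i \<in> carrier G" "h \<in> I - {i} \<rightarrow> carrier G" "h \<in> insert i (I - {i}) \<rightarrow> carrier G"
    using I(2) i by auto
  have split: "monom_prod h k I = h i [^] k i \<otimes> monom_prod h k (I - {i})" for k
    using monom_prod_insert[of "I - {i}" i h k] I(1) hi I_eq by simp
  have "monom_prod h m (I - {i}) = monom_prod h (\<lambda>_. 0) (I - {i})"
    using hi others by (intro monom_prod_cong) auto
  then have "h i [^] m i \<in> T" using h(2) split[of m] hi by (simp add: monom_prod_zero)
  then have hiT: "h i \<in> T" using torsion_root[OF hi(1)] i by blast
  have "h i [^] k \<in> T" for k :: int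
    using hiT subgroup_int_pow_closed[OF subgroup_torsion] by blast
  then have "\<exists>\<tau>'\<in>T. \<exists>k. x = \<tau>' \<otimes> monom_prod h k (I - {i})" if x: "x \<in> carrier G" for x
  proof -
    obtain \<tau> k where \<tau>: "\<tau> \<in> T" "x = \<tau> \<otimes> monom_prod h k I"
      using h(1) x by (auto simp: spans_mod_torsion_def)
    then have "x = (\<tau> \<otimes> h i [^] k i) \<otimes> monom_prod h k (I - {i})"
      using hi torsionD(4) by (simp add: split m_assoc)
    moreover have "\<tau> \<otimes> h i [^] k i \<in> T" using \<tau>(1) \<open>\<And>k. h i [^] k \<in> T\<close> torsionD(1) by blast
    ultimately show ?thesis by blast
  qed
  then have "spans_mod_torsion (I - {i}) h" using I hi by (auto simp: spans_mod_torsion_def)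
  then have "card I \<le> card (I - {i})" by (rule min)
  then show False using i(1) I(1) by (metis card_Diff1_less leD)
qed

theorem free_part:
  assumes "finite S" "S \<subseteq> carrier G" "generate G S = carrier G"
  obtains r :: nat and g where "g \<in> {..<r} \<rightarrow> carrier G"
    "\<And>x. x \<in> carrier G \<Longrightarrow> \<exists>\<tau>\<in>T. \<exists>n. x = \<tau> \<otimes> monom_prod g n {..<r}"
    "\<And>n. monom_prod g n {..<r} \<in> T \<Longrightarrow> \<forall>i<r. n i = 0"
proof -
  let ?P = "\<lambda>(I :: 'a set, g :: 'a \<Rightarrow> 'a). spans_mod_torsion I g"
  have "?P (S, \<lambda>x. x)" using spans_mod_torsion_exists[OF assms] by simp
  from ex_has_least_nat[of ?P, OF this, of "\<lambda>(I, g). card I"]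
  obtain I :: "'a set" and g where Ig: "spans_mod_torsion I g"
    and min: "\<And>J (h :: 'a \<Rightarrow> 'a). spans_mod_torsion J h \<Longrightarrow> card I \<le> card J" by auto
  have I: "finite I" "g \<in> I \<rightarrow> carrier G" using Ig by (auto simp: spans_mod_torsion_def)
  obtain h where h: "bij_betw h {..<card I} I" using ex_bij_betw_nat_finite[OF I(1)] by (metis atLeast0LessThan)
  define f where "f = g \<circ> h"
  have f: "f \<in> {..<card I} \<rightarrow> carrier G" using I(2) h by (auto simp: f_def bij_betw_def Pi_iff)
  have re: "monom_prod f (n \<circ> h) {..<card I} = monom_prod g n I" for n
  proof -
    have "monom_prod g n (h ` {..<card I}) = monom_prod f (n \<circ> h) {..<card I}"
      unfolding monom_prod_def using h I(2)
      by (subst finprod_reindex) (auto simp: bij_betw_def f_def)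
    then show ?thesis using h by (simp add: bij_betw_def)
  qed
  show ?thesis
  proof (rule that[OF f])
    show "\<exists>\<tau>\<in>T. \<exists>n. x = \<tau> \<otimes> monom_prod f n {..<card I}" if "x \<in> carrier G" for x
      using Ig that re unfolding spans_mod_torsion_def by metis
    show "\<forall>i<card I. n i = 0" if n: "monom_prod f n {..<card I} \<in> T" for n
    proof -
      define m where "m = n \<circ> inv_into {..<card I} h"
      have "monom_prod f n {..<card I} = monom_prod f (m \<circ> h) {..<card I}"
        using f h by (intro monom_prod_cong) (auto simp: m_def bij_betw_def)
      then have "monom_prod g m I \<in> T" using n re by simp
      from minimal_spanning_independent[OF Ig min this] have "\<forall>i\<in>I. m i = 0" .
      moreover have "m (h i) = n i" "h i \<in> I" if "i < card I" for i
        using h that by (auto simp: m_def bij_betw_def)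
      ultimately show ?thesis by metis
    qed
  qed
qed

text \<open>Adjoining an element of finite order m enlarges the group at most m-fold, since
  exponents can be reduced modulo m.\<close>

lemma finite_torsion_generated:
  assumes "finite S" "S \<subseteq> T"
  shows "finite (generate G S)"
  using assms
proof (induction S rule: finite_induct)
  case empty
  have "generate G {} \<subseteq> {\<one>}" by (rule generate_subgroup_incl) (auto intro: triv_subgroup)
  then show ?case using finite_subset by blast
next
  case (insert s S)
  then have s: "s \<in> carrier G" "S \<subseteq> carrier G" using torsionD(4) by auto
  let ?H = "generate G S"
  obtain m :: nat where m: "m > 0" "s [^] m = \<one>" using insert.prems by (auto simp: torsion_mem)
  have H: "subgroup ?H G" using generate_is_subgroup[OF s(2)] .
  \<comment> \<open>The cyclic group of \<open>s\<close> is written as a family indexed by one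
    point, so that \<open>monom_prod_subgroup\<close> applies.\<close>
  let ?K = "{h \<otimes> monom_prod (\<lambda>_. s) n {()} | h n. h \<in> ?H}"
  have K: "subgroup ?K G" using s H by (intro monom_prod_subgroup) auto
  have one: "monom_prod (\<lambda>_. s) n {()} = s [^] n ()" for n
    using s by (simp add: monom_prod_def)
  have "insert s S \<subseteq> ?K"
  proof
    fix x assume "x \<in> insert s S"
    then show "x \<in> ?K"
    proof
      assume "x = s"
      then show ?thesis
        using s subgroup.one_closed[OF H] by (auto simp: one intro!: exI[of _ \<one>] exI[of _ "\<lambda>_. 1"])
    next
      assume "x \<in> S"
      then have "x \<in> ?H" by (rule generate.incl)
      then show ?thesis using s \<open>x \<in> S\<close> by (auto simp: one intro!: exI[of _ x] exI[of _ "\<lambda>_. 0"])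
    qed
  qed
  then have "generate G (insert s S) \<subseteq> ?K" by (rule generate_subgroup_incl[OF _ K])
  also have "?K \<subseteq> (\<lambda>(h, n). h \<otimes> s [^] (n::nat)) ` (?H \<times> {..<m})"
  proof
    fix x assume "x \<in> ?K"
    then obtain h and n :: int where x: "x = h \<otimes> s [^] n" "h \<in> ?H" by (auto simp: one)
    have "s [^] n = s [^] (int m * (n div int m) + n mod int m)" by simp
    also have "\<dots> = (s [^] int m) [^] (n div int m) \<otimes> s [^] (n mod int m)"
      using s by (simp only: int_pow_mult int_pow_pow)
    also have "\<dots> = s [^] nat (n mod int m)"
      using m s int_pow_int[of G s "nat (n mod int m)"] by (simp add: int_pow_int)
    finally show "x \<in> (\<lambda>(h, n). h \<otimes> s [^] (n::nat)) ` (?H \<times> {..<m})"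
      using x m(1) by (auto intro!: image_eqI[of _ _ "(h, nat (n mod int m))"] simp: nat_less_iff)
  qed
  finally show ?case using insert by (auto intro: finite_subset)
qed

lemma finite_torsion:
  assumes "finite S" "S \<subseteq> T" "generate G S = T"
  shows "finite T"
  using finite_torsion_generated[OF assms(1,2)] assms(3) by simp

section \<open>Decomposition into a torsion part and a free part\<close>

context
  fixes r :: nat and g :: "nat \<Rightarrow> 'a"
  assumes g: "g \<in> {..<r} \<rightarrow> carrier G"
    and span: "\<And>x. x \<in> carrier G \<Longrightarrow> \<exists>\<tau>\<in>T. \<exists>n. x = \<tau> \<otimes> monom_prod g n {..<r}"
    and indep: "\<And>n. monom_prod g n {..<r} \<in> T \<Longrightarrow> \<forall>i<r. n i = 0"
begin

lemma decomposition_unique: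
  assumes "\<tau> \<in> T" "\<tau>' \<in> T" "\<tau> \<otimes> monom_prod g n {..<r} = \<tau>' \<otimes> monom_prod g n' {..<r}"
  shows "\<tau> = \<tau>'" "\<forall>i<r. n i = n' i"
proof -
  note c = torsionD(4)[OF assms(1)] torsionD(4)[OF assms(2)] monom_prod_closed[OF g]
  have "monom_prod g n {..<r} \<otimes> inv (monom_prod g n' {..<r}) = inv \<tau> \<otimes> \<tau>'"
    using assms(3) c by (metis inv_closed inv_solve_left inv_solve_right m_assoc m_closed)
  then have "monom_prod g (\<lambda>i. n i - n' i) {..<r} \<in> T"
    using torsionD(1)[OF torsionD(3)[OF assms(1)] assms(2)] by (simp add: monom_prod_inv g monom_prod_mult)
  then show n: "\<forall>i<r. n i = n' i" using indep by fastforce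
  then have "monom_prod g n {..<r} = monom_prod g n' {..<r}" using g by (intro monom_prod_cong) auto
  then show "\<tau> = \<tau>'" using assms(3) c by simp
qed

lemma iso_torsion_free:
  "(\<lambda>(\<tau>, n). \<tau> \<otimes> finprod G (\<lambda>i. g i [^] (n i)) {..<r})
     \<in> iso (G\<lparr>carrier := T\<rparr> \<times>\<times> product_group {..<r} (\<lambda>_. integer_group)) G" (is "?f \<in> iso ?H G")
proof (rule isoI)
  have f: "?f (\<tau>, n) = \<tau> \<otimes> monom_prod g n {..<r}" for \<tau> n by (simp add: monom_prod_def)
  show "?f \<in> hom ?H G"
  proof (rule homI)
    fix x assume "x \<in> carrier ?H"
    then show "?f x \<in> carrier G"
      using torsionD(4) monom_prod_closed[OF g] by (cases x) (auto simp flip: monom_prod_def)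
  next
    fix x y assume xy: "x \<in> carrier ?H" "y \<in> carrier ?H"
    obtain \<tau> n \<tau>' n' where eq: "x = (\<tau>, n)" "y = (\<tau>', n')" by (meson surj_pair)
    have \<tau>: "\<tau> \<in> T" "\<tau>' \<in> T" using xy by (auto simp: eq)
    have "monom_prod g (\<lambda>i\<in>{..<r}. n i + n' i) {..<r} = monom_prod g (\<lambda>i. n i + n' i) {..<r}"
      using g by (intro monom_prod_cong) auto
    then have "?f (x \<otimes>\<^bsub>?H\<^esub> y) = (\<tau> \<otimes> \<tau>') \<otimes> (monom_prod g n {..<r} \<otimes> monom_prod g n' {..<r})"
      by (simp add: eq f monom_prod_mult g flip: monom_prod_def)
    also have "\<dots> = ?f x \<otimes> ?f y"
      using \<tau> torsionD(4) g by (simp add: eq f m_ac flip: monom_prod_def)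
    finally show "?f (x \<otimes>\<^bsub>?H\<^esub> y) = ?f x \<otimes> ?f y" .
  qed
  show "bij_betw ?f (carrier ?H) (carrier G)"
    unfolding bij_betw_def
  proof
    show "inj_on ?f (carrier ?H)"
    proof (rule inj_onI)
      fix x y assume xy: "x \<in> carrier ?H" "y \<in> carrier ?H" "?f x = ?f y"
      obtain \<tau> n \<tau>' n' where eq: "x = (\<tau>, n)" "y = (\<tau>', n')" by (meson surj_pair)
      have "\<tau> = \<tau>'" "\<forall>i<r. n i = n' i"
        using decomposition_unique[of \<tau> \<tau>' n n'] xy by (auto simp: eq f simp flip: monom_prod_def)
      have "n \<in> {..<r} \<rightarrow>\<^sub>E UNIV" "n' \<in> {..<r} \<rightarrow>\<^sub>E UNIV" using xy by (auto simp: eq)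
      then have "n = n'" by (rule PiE_ext) (use \<open>\<forall>i<r. n i = n' i\<close> in simp)
      with \<open>\<tau> = \<tau>'\<close> show "x = y" by (simp add: eq)
    qed
    show "?f ` carrier ?H = carrier G"
    proof
      show "?f ` carrier ?H \<subseteq> carrier G" using g torsionD(4) by (auto simp: f simp flip: monom_prod_def)
      show "carrier G \<subseteq> ?f ` carrier ?H"
      proof
        fix x assume "x \<in> carrier G"
        then obtain \<tau> n where x: "\<tau> \<in> T" "x = \<tau> \<otimes> monom_prod g n {..<r}" using span by blast
        have "monom_prod g (restrict n {..<r}) {..<r} = monom_prod g n {..<r}"
          using g by (intro monom_prod_cong) auto
        then have "x = ?f (\<tau>, restrict n {..<r})" using x(2) by (simp add: f flip: monom_prod_def)
        then show "x \<in> ?f ` carrier ?H" by (rule image_eqI) (use x(1) in auto)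
      qed
    qed
  qed
qed

text \<open>For \<open>i < r\<close> the value does not depend on the choice, by
  \<open>decomposition_unique\<close>. These are homomorphisms to the integers that kill torsion,
  and they separate coefficients in the rational tensor product.\<close>

definition coordinate :: "nat \<Rightarrow> 'a \<Rightarrow> int" where
  "coordinate i x = (SOME n. \<exists>\<tau>\<in>T. x = \<tau> \<otimes> monom_prod g n {..<r}) i"

lemma coordinate_eq:
  assumes "\<tau> \<in> T" "i < r"
  shows "coordinate i (\<tau> \<otimes> monom_prod g n {..<r}) = n i"
proof -
  let ?x = "\<tau> \<otimes> monom_prod g n {..<r}"
  have "\<exists>n'. \<exists>\<tau>'\<in>T. ?x = \<tau>' \<otimes> monom_prod g n' {..<r}" using assms(1) by blast
  then obtain \<tau>' where "\<tau>' \<in> T" "?x = \<tau>' \<otimes> monom_prod g (SOME n'. \<exists>\<tau>'\<in>T. ?x = \<tau>' \<otimes> monom_prod g n' {..<r}) {..<r}"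
    using someI_ex[of "\<lambda>n'. \<exists>\<tau>'\<in>T. ?x = \<tau>' \<otimes> monom_prod g n' {..<r}"] by blast
  from decomposition_unique(2)[OF assms(1) this] show ?thesis using assms(2) by (simp add: coordinate_def)
qed

lemma coordinate_mult:
  assumes "x \<in> carrier G" "y \<in> carrier G" "i < r"
  shows "coordinate i (x \<otimes> y) = coordinate i x + coordinate i y"
proof -
  obtain \<tau> n \<tau>' n' where x: "\<tau> \<in> T" "x = \<tau> \<otimes> monom_prod g n {..<r}" and y: "\<tau>' \<in> T" "y = \<tau>' \<otimes> monom_prod g n' {..<r}"
    using span assms(1,2) by meson
  have "x \<otimes> y = (\<tau> \<otimes> \<tau>') \<otimes> monom_prod g (\<lambda>i. n i + n' i) {..<r}"
    using x y torsionD(4) g by (simp add: m_ac flip: monom_prod_mult)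
  then show ?thesis using x y assms(3) torsionD(1) by (simp add: coordinate_eq)
qed

lemma coordinate_pow:
  assumes "x \<in> carrier G" "i < r"
  shows "coordinate i (x [^] (z::int)) = z * coordinate i x"
proof -
  have nat: "coordinate i (x [^] n) = int n * coordinate i x" for n :: nat
  proof (induction n)
    case 0
    have "coordinate i (\<one> \<otimes> \<one>) = coordinate i \<one> + coordinate i \<one>" using assms by (intro coordinate_mult) auto
    then show ?case by simp
  next
    case (Suc n)
    then show ?case using assms by (simp add: coordinate_mult algebra_simps)
  qed
  show ?thesis
  proof (cases "z \<ge> 0")
    case True
    then show ?thesis using nat[of "nat z"] by (simp flip: int_pow_int)
  next
    case False
    then have "coordinate i (x [^] (- z)) = (- z) * coordinate i x" using nat[of "nat (- z)"] by (simp flip: int_pow_int)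
    moreover have "coordinate i (x [^] z \<otimes> x [^] (- z)) = coordinate i (x [^] z) + coordinate i (x [^] (- z))"
      using assms by (intro coordinate_mult) auto
    moreover have "x [^] z \<otimes> x [^] (- z) = x [^] (0::int)" using assms by (simp flip: int_pow_mult)
    moreover have "coordinate i \<one> = 0" using nat[of 0] by simp
    ultimately show ?thesis by simp
  qed
qed

lemma coordinate_g: "i < r \<Longrightarrow> j < r \<Longrightarrow> coordinate i (g j) = (if i = j then 1 else 0)"
proof -
  assume ij: "i < r" "j < r"
  have "monom_prod g (\<lambda>i. if i = j then 1 else 0) {..<r} = finprod G (\<lambda>i. if j = i then g i else \<one>) {..<r}"
    unfolding monom_prod_def using g by (intro finprod_cong') (auto simp: Pi_iff)
  also have "\<dots> = g j" using ij g by (simp add: finprod_singleton)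
  finally have "g j = \<one> \<otimes> monom_prod g (\<lambda>i. if i = j then 1 else 0) {..<r}"
    using g ij by (simp add: Pi_iff)
  then have "coordinate i (g j) = coordinate i (\<one> \<otimes> monom_prod g (\<lambda>i. if i = j then 1 else 0) {..<r})" by simp
  also have "\<dots> = (if i = j then 1 else 0)" by (rule coordinate_eq[OF torsionD(2) ij(1)])
  finally show ?thesis .
qed

end

end


section \<open>The rank, computed in the tensor product with the rationals\<close>

context comm_group
begin

abbreviation rat_group :: "rat monoid" where
  "rat_group \<equiv> add_monoid (set_ring (UNIV :: rat set))"

definition rat_null :: "(rat \<times> 'a \<Rightarrow>\<^sub>0 int) set" where
  "rat_null = tensor_null rat_group G (\<lambda>m::int. \<lambda>q. of_int m * q) (\<lambda>m x. x [^] m)"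

definition FG :: "(rat \<times> 'a \<Rightarrow>\<^sub>0 int) monoid" where
  "FG = formal_group rat_group G"

lemma carrier_FG: "p \<in> carrier FG \<longleftrightarrow> Poly_Mapping.keys p \<subseteq> UNIV \<times> carrier G"
  by (simp add: FG_def formal_group_def formal_sums_def set_ring_def)

lemma FG_simps [simp]: "p \<otimes>\<^bsub>FG\<^esub> q = p + q" "\<one>\<^bsub>FG\<^esub> = 0"
  by (simp_all add: FG_def formal_group_def)

lemma add_closed_FG: "add_closed (carrier FG)"
  unfolding add_closed_def
proof (intro conjI ballI)
  fix x y :: "rat \<times> 'a \<Rightarrow>\<^sub>0 int"
  assume "x \<in> carrier FG" "y \<in> carrier FG"
  then show "x - y \<in> carrier FG" unfolding carrier_FG using keys_diff[of x y] by (meson Un_least subset_trans)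
qed (simp add: carrier_FG)

lemma pure_FG: "a \<in> carrier G \<Longrightarrow> pure q a \<in> carrier FG"
  by (simp add: carrier_FG)

lemmas FG_D = add_closedD[OF add_closed_FG]

lemma comm_group_FG: "comm_group FG"
proof (rule comm_groupI)
  show "\<exists>y\<in>carrier FG. y \<otimes>\<^bsub>FG\<^esub> x = \<one>\<^bsub>FG\<^esub>" if "x \<in> carrier FG" for x
    using FG_D(3)[OF that] by (intro bexI[of _ "- x"]) auto
qed (use FG_D in \<open>auto simp: algebra_simps\<close>)

lemma rat_null_add_left: "a \<in> carrier G \<Longrightarrow> pure (q + q') a - pure q a - pure q' a \<in> rat_null"
  using tensor_null.left_additive[of q rat_group q' a G] by (auto simp: rat_null_def set_ring_def)

lemma rat_null_add_right:
  "a \<in> carrier G \<Longrightarrow> b \<in> carrier G \<Longrightarrow> pure q (a \<otimes> b) - pure q a - pure q b \<in> rat_null"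
  using tensor_null.right_additive[of q rat_group a G b] by (auto simp: rat_null_def set_ring_def)

lemma rat_null_balanced: "a \<in> carrier G \<Longrightarrow> pure (of_int m * q) a - pure q (a [^] m) \<in> rat_null"
  using tensor_null.balanced[of q rat_group a G "\<lambda>m q. of_int m * q" m "\<lambda>m x. x [^] m"]
  by (auto simp: rat_null_def set_ring_def)

lemma add_closed_rat_null: "add_closed rat_null"
  by (auto simp: rat_null_def add_closed_def intro: tensor_null.zero tensor_null.diff)

lemmas rat_null_D = add_closedD[OF add_closed_rat_null]

lemma rat_null_induct [consumes 1, case_names left right balanced zero diff]:
  assumes "p \<in> rat_null"
    "\<And>q q' a. a \<in> carrier G \<Longrightarrow> Prop (pure (q + q') a - pure q a - pure q' a)"
    "\<And>q a b. a \<in> carrier G \<Longrightarrow> b \<in> carrier G \<Longrightarrow> Prop (pure q (a \<otimes> b) - pure q a - pure q b)"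
    "\<And>q a m. a \<in> carrier G \<Longrightarrow> Prop (pure (of_int m * q) a - pure q (a [^] m))"
    "Prop 0" "\<And>x y. Prop x \<Longrightarrow> Prop y \<Longrightarrow> Prop (x - y)"
  shows "Prop p"
  using assms(1) unfolding rat_null_def
  by (induction rule: tensor_null.induct) (use assms in \<open>auto simp: set_ring_def\<close>)

lemma rat_null_subset: "rat_null \<subseteq> carrier FG"
proof
  fix p assume "p \<in> rat_null"
  then show "p \<in> carrier FG"
    by (induction rule: rat_null_induct) (auto intro!: FG_D(1,2) pure_FG)
qed

lemma normal_rat_null: "rat_null \<lhd> FG"
proof (rule comm_group.subgroup_imp_normal[OF comm_group_FG])
  interpret FG: comm_group FG by (rule comm_group_FG)
  show "subgroup rat_null FG"
  proof (rule FG.subgroupI)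
    fix p assume p: "p \<in> rat_null"
    have "inv\<^bsub>FG\<^esub> p = - p"
      using p rat_null_subset FG_D(3) by (intro FG.inv_equality) auto
    then show "inv\<^bsub>FG\<^esub> p \<in> rat_null" using rat_null_D(3)[OF p] by simp
  qed (use rat_null_subset rat_null_D in auto)
qed

abbreviation "V \<equiv> rational_tensor G"

lemma V_eq: "V = FG Mod rat_null"
  unfolding rational_tensor_def tensor_group_def rat_null_def FG_def ..

abbreviation rat_class where "rat_class p \<equiv> rat_null #>\<^bsub>FG\<^esub> p"

lemma mem_rat_class: "p' \<in> rat_class p \<longleftrightarrow> p' - p \<in> rat_null"
  unfolding r_coset_def by (auto simp: algebra_simps) (metis diff_add_cancel add.commute)

lemma rat_class_eq: "p - p' \<in> rat_null \<Longrightarrow> rat_class p = rat_class p'"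
proof (rule Set.set_eqI)
  fix z assume *: "p - p' \<in> rat_null"
  have "z - p' = (z - p) + (p - p')" "z - p = (z - p') - (p - p')" by simp_all
  then show "z \<in> rat_class p \<longleftrightarrow> z \<in> rat_class p'"
    unfolding mem_rat_class using rat_null_D(2,4) * by metis
qed

lemma rat_class_eqD: "rat_class p = rat_class p' \<Longrightarrow> p - p' \<in> rat_null"
  using mem_rat_class[of p p] mem_rat_class[of p p'] rat_null_D(1) by simp

lemma carrier_V: "carrier V = rat_class ` carrier FG"
  by (auto simp: V_eq FactGroup_def RCOSETS_def)

lemma one_V: "\<one>\<^bsub>V\<^esub> = rat_null"
  by (simp add: V_eq FactGroup_def)

lemma comm_group_V: "comm_group V"
  unfolding V_eq
  by (rule comm_group.abelian_FactGroup[OF comm_group_FG normal_imp_subgroup[OF normal_rat_null]])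

lemma finprod_V:
  assumes "finite I" "\<And>i. i \<in> I \<Longrightarrow> f i \<in> carrier FG"
  shows "finprod V (\<lambda>i. rat_class (f i)) I = rat_class (\<Sum>i\<in>I. f i)"
  using assms
proof (induction I rule: finite_induct)
  case empty
  interpret VV: comm_group V by (rule comm_group_V)
  have "rat_class 0 = rat_null" by (rule Set.set_eqI) (simp add: mem_rat_class)
  then show ?case by (simp add: one_V)
next
  case (insert i I)
  interpret VV: comm_group V by (rule comm_group_V)
  have mem: "rat_class (f j) \<in> carrier V" if "j \<in> insert i I" for j
    using insert.prems that by (auto simp: carrier_V)
  have "(\<Sum>i\<in>I. f i) \<in> carrier FG" using insert.prems by (intro add_closed_sum[OF add_closed_FG]) auto
  then have "rat_class (f i) \<otimes>\<^bsub>V\<^esub> rat_class (\<Sum>i\<in>I. f i) = rat_class (f i + (\<Sum>i\<in>I. f i))"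
    using normal.rcos_sum[OF normal_rat_null, of "f i" "\<Sum>i\<in>I. f i"] insert.prems
    by (simp add: V_eq FactGroup_def)
  then show ?case using insert mem by (simp add: VV.finprod_insert Pi_iff)
qed

lemma formal_scale_extend: "formal_scale q p = frag_extend (\<lambda>x. pure (q * fst x) (snd x)) p"
  by (simp add: formal_scale_def frag_extend_def frag_cmul_single)

lemma formal_scale_simps [simp]:
  "formal_scale q (pure q' a) = pure (q * q') a" "formal_scale q 0 = 0"
  "formal_scale q (x - y) = formal_scale q x - formal_scale q y"
  by (simp_all add: formal_scale_extend frag_extend_diff)

lemma formal_scale_null: "p \<in> rat_null \<Longrightarrow> formal_scale q p \<in> rat_null"
proof (induction rule: rat_null_induct)
  case (balanced q' a m)
  then show ?case using rat_null_balanced[of a m "q * q'"] by (simp add: mult.left_commute)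
qed (auto simp: distrib_left intro: rat_null_add_left rat_null_add_right rat_null_D)

lemma rational_scale_class: "rational_scale G q (rat_class p) = rat_class (formal_scale q p)"
proof (rule Set.set_eqI)
  fix z
  show "z \<in> rational_scale G q (rat_class p) \<longleftrightarrow> z \<in> rat_class (formal_scale q p)"
  proof
    assume "z \<in> rational_scale G q (rat_class p)"
    then obtain p' k where z: "z = formal_scale q p' + k" "p' - p \<in> rat_null" "k \<in> rat_null"
      unfolding rational_scale_def one_V mem_rat_class by blast
    have "z - formal_scale q p = formal_scale q (p' - p) + k" by (simp add: z)
    then show "z \<in> rat_class (formal_scale q p)"
      unfolding mem_rat_class using rat_null_D(4)[OF formal_scale_null[OF z(2)] z(3)] by metis
  next
    assume "z \<in> rat_class (formal_scale q p)"
    then have "z - formal_scale q p \<in> rat_null" by (simp add: mem_rat_class)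
    moreover have "p \<in> rat_class p" by (simp add: mem_rat_class rat_null_D)
    ultimately show "z \<in> rational_scale G q (rat_class p)"
      unfolding rational_scale_def one_V
      by (intro CollectI exI[of _ p] exI[of _ "z - formal_scale q p"]) simp
  qed
qed

lemma pure_one_null: "pure q \<one> \<in> rat_null"
  using rat_null_D(3)[OF rat_null_add_right[of \<one> \<one> q]] by simp

text \<open>If \<tau> has order dividing m, then q \<otimes> \<tau> equals q/m \<otimes> \<tau>^m,
  which is null.\<close>

lemma pure_torsion_null:
  assumes "\<tau> \<in> T"
  shows "pure q \<tau> \<in> rat_null"
proof -
  obtain m :: nat where m: "\<tau> \<in> carrier G" "m > 0" "\<tau> [^] m = \<one>" using assms by (auto simp: torsion_mem)
  have "pure q \<tau> - pure (q / of_nat m) \<one> \<in> rat_null"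
    using rat_null_balanced[OF m(1), of "int m" "q / of_nat m"] m by (simp add: int_pow_int)
  from rat_null_D(4)[OF this pure_one_null[of "q / of_nat m"]] show ?thesis by simp
qed

lemma pure_monom_prod:
  assumes "finite I" "g \<in> I \<rightarrow> carrier G"
  shows "pure q (monom_prod g n I) - (\<Sum>i\<in>I. pure (of_int (n i) * q) (g i)) \<in> rat_null"
  using assms
proof (induction I rule: finite_induct)
  case empty
  then show ?case by (simp add: monom_prod_def pure_one_null)
next
  case (insert i I)
  have g: "g i \<in> carrier G" "g \<in> I \<rightarrow> carrier G" using insert.prems by auto
  let ?S = "\<Sum>i\<in>I. pure (of_int (n i) * q) (g i)" and ?m = "monom_prod g n I"
  have 1: "pure q (g i [^] n i \<otimes> ?m) - pure q (g i [^] n i) - pure q ?m \<in> rat_null"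
    using g by (intro rat_null_add_right) auto
  have 2: "pure (of_int (n i) * q) (g i) - pure q (g i [^] n i) \<in> rat_null"
    by (rule rat_null_balanced[OF g(1)])
  have 3: "pure q ?m - ?S \<in> rat_null" by (rule insert.IH[OF g(2)])
  have "pure q (g i [^] n i \<otimes> ?m) - (pure (of_int (n i) * q) (g i) + ?S) =
    ((pure q (g i [^] n i \<otimes> ?m) - pure q (g i [^] n i) - pure q ?m) -
    (pure (of_int (n i) * q) (g i) - pure q (g i [^] n i))) + (pure q ?m - ?S)" by simp
  also have "\<dots> \<in> rat_null" by (rule rat_null_D(4)[OF rat_null_D(2)[OF 1 2] 3])
  finally show ?case using insert by (simp add: monom_prod_insert)
qed

text \<open>A homomorphism from the group to the integers induces a well-defined rational-valued map
  on the tensor product.\<close>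

lemma pair_extend_rat_null:
  fixes f :: "'a \<Rightarrow> int"
  assumes "p \<in> rat_null" "\<And>a b. a \<in> carrier G \<Longrightarrow> b \<in> carrier G \<Longrightarrow> f (a \<otimes> b) = f a + f b"
    "\<And>a m. a \<in> carrier G \<Longrightarrow> f (a [^] (m::int)) = m * f a"
  shows "pair_extend (\<lambda>q a. q * of_int (f a)) p = 0"
  using assms(1)
  by (induction rule: rat_null_induct) (simp_all add: assms pair_extend_diff pair_extend_add algebra_simps)

text \<open>The classes of \<open>pure 1 (g i)\<close> form a basis: they span because torsion dies
  in the tensor product, and the maps induced by the coordinate homomorphisms read off the
  coefficients of a combination.\<close>

lemma has_rank_free:
  assumes g: "g \<in> {..<r} \<rightarrow> carrier G"
    and span: "\<And>x. x \<in> carrier G \<Longrightarrow> \<exists>\<tau>\<in>T. \<exists>n. x = \<tau> \<otimes> monom_prod g n {..<r}"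
    and indep: "\<And>n. monom_prod g n {..<r} \<in> T \<Longrightarrow> \<forall>i<r. n i = 0"
  shows "has_rank G r"
proof -
  note basis = g span indep
  define b where "b i = rat_class (pure 1 (g i))" for i
  have gc: "g i \<in> carrier G" if "i < r" for i using g that by auto
  have act: "rational_scale G q (b i) = rat_class (pure q (g i))" for q i
    by (simp add: b_def rational_scale_class)
  have comb: "finprod V (\<lambda>i. rational_scale G (c i) (b i)) {..<r} = rat_class (\<Sum>i<r. pure (c i) (g i))" for c
    unfolding act using gc pure_FG by (intro finprod_V) auto
  have sums: "(\<Sum>i<r. pure (c i) (g i)) \<in> carrier FG" for c
    using gc pure_FG by (intro add_closed_sum[OF add_closed_FG]) auto
  have unique: "c i = c' i"
    if eq: "rat_class (\<Sum>i<r. pure (c i) (g i)) = rat_class (\<Sum>i<r. pure (c' i) (g i))" and i: "i < r" for c c' i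
  proof -
    let ?f = "\<lambda>q a. q * of_int (coordinate r g i a) :: rat"
    have "pair_extend ?f ((\<Sum>i<r. pure (c i) (g i)) - (\<Sum>i<r. pure (c' i) (g i))) = 0"
      by (rule pair_extend_rat_null[OF rat_class_eqD[OF eq]])
        (use coordinate_mult[OF basis] coordinate_pow[OF basis] i in auto)
    moreover have "pair_extend ?f (\<Sum>i<r. pure (c i) (g i)) = c i" for c
    proof -
      have "pair_extend ?f (\<Sum>i<r. pure (c i) (g i)) = (\<Sum>j<r. if j = i then c i else 0)"
        unfolding pair_extend_sum by (rule sum.cong) (use coordinate_g[OF basis i] in auto)
      then show ?thesis using i by simp
    qed
    ultimately show ?thesis by (simp add: pair_extend_diff)
  qed
  have exists: "\<exists>c. p - (\<Sum>i<r. pure (c i) (g i)) \<in> rat_null" if "p \<in> carrier FG" for p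
    using that[unfolded carrier_FG]
  proof (induction rule: tensor_induct)
    case zero
    have "(\<Sum>i<r. pure 0 (g i)) \<in> rat_null"
    proof (rule add_closed_sum[OF add_closed_rat_null])
      fix i assume "i \<in> {..<r}"
      then show "pure 0 (g i) \<in> rat_null" using rat_null_D(3)[OF rat_null_add_left[of "g i" 0 0]] gc by simp
    qed
    then show ?case using rat_null_D(3) by (intro exI[of _ "\<lambda>_. 0"]) simp
  next
    case (pure q x)
    then obtain \<tau> n where x: "\<tau> \<in> T" "x = \<tau> \<otimes> monom_prod g n {..<r}" using span by blast
    let ?S = "\<Sum>i<r. pure (of_int (n i) * q) (g i)" and ?m = "monom_prod g n {..<r}"
    have "pure q x - pure q \<tau> - pure q ?m \<in> rat_null"
      unfolding x(2) using g torsionD(4)[OF x(1)] by (intro rat_null_add_right) auto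
    from rat_null_D(4)[OF rat_null_D(4)[OF this pure_torsion_null[OF x(1), of q]] pure_monom_prod[OF _ g, of q n]]
    have "pure q x - ?S \<in> rat_null" by simp
    then show ?case by (intro exI[of _ "\<lambda>i. of_int (n i) * q"])
  next
    case (diff p p')
    then obtain c c' where c: "p - (\<Sum>i<r. pure (c i) (g i)) \<in> rat_null" "p' - (\<Sum>i<r. pure (c' i) (g i)) \<in> rat_null"
      by blast
    have "(\<Sum>i<r. pure (c i - c' i + c' i) (g i) - pure (c i - c' i) (g i) - pure (c' i) (g i)) \<in> rat_null"
      using gc by (intro add_closed_sum[OF add_closed_rat_null] rat_null_add_left) auto
    from rat_null_D(4)[OF rat_null_D(2)[OF c] this]
    show ?case by (intro exI[of _ "\<lambda>i. c i - c' i"]) (simp add: sum_subtractf sum.distrib algebra_simps)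
  qed
  show ?thesis
    unfolding has_rank_def has_dimension_def
  proof (intro bexI[of _ b] ballI)
    show "b \<in> {..<r} \<rightarrow> carrier V" using gc pure_FG by (auto simp: b_def carrier_V)
    fix v assume "v \<in> carrier V"
    then obtain p where p: "p \<in> carrier FG" "v = rat_class p" by (auto simp: carrier_V)
    obtain c where c: "p - (\<Sum>i<r. pure (c i) (g i)) \<in> rat_null" using exists[OF p(1)] by blast
    have restr: "(\<Sum>i<r. pure (restrict c {..<r} i) (g i)) = (\<Sum>i<r. pure (c i) (g i))"
      by (rule sum.cong) auto
    show "\<exists>!c. c \<in> {..<r} \<rightarrow>\<^sub>E UNIV \<and> v = finprod V (\<lambda>i. rational_scale G (c i) (b i)) {..<r}"
    proof (rule ex1I[of _ "restrict c {..<r}"])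
      show "restrict c {..<r} \<in> {..<r} \<rightarrow>\<^sub>E UNIV \<and>
          v = finprod V (\<lambda>i. rational_scale G (restrict c {..<r} i) (b i)) {..<r}"
        unfolding comb restr p(2) using rat_class_eq[OF c] by auto
      fix c' assume c': "c' \<in> {..<r} \<rightarrow>\<^sub>E UNIV \<and> v = finprod V (\<lambda>i. rational_scale G (c' i) (b i)) {..<r}"
      then have "rat_class (\<Sum>i<r. pure (c' i) (g i)) = rat_class (\<Sum>i<r. pure (c i) (g i))"
        unfolding comb using p(2) rat_class_eq[OF c] by simp
      then have "c' i = c i" if "i < r" for i using unique that by blast
      then show "c' = restrict c {..<r}"
        using c' by (intro PiE_ext[of c' "{..<r}" "\<lambda>_. UNIV"]) auto
    qed
  qed
qed

end


section \<open>Graded rings\<close>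

lemma acc_on_subset: "acc_on P \<Longrightarrow> (\<And>I. Q I \<Longrightarrow> P I) \<Longrightarrow> acc_on Q"
  unfolding acc_on_def by meson

context ring_mult
begin

lemma two_sided_zero: "two_sided {0}"
  by (auto simp: two_sided_def add_closed_def)

lemma left_noetherian_division:
  assumes "\<And>x. x \<in> R \<Longrightarrow> x \<noteq> 0 \<Longrightarrow> \<exists>y\<in>R. y \<star> x = e"
  shows "left_noetherian {0} R"
proof -
  have dichotomy: "I = {0} \<or> I = R" if "left_ideal_over {0} R I" for I
  proof (rule ccontr)
    assume nontriv: "\<not> (I = {0} \<or> I = R)"
    have I: "0 \<in> I" "I \<subseteq> R" "\<And>r x. r \<in> R \<Longrightarrow> x \<in> I \<Longrightarrow> r \<star> x \<in> I"
      using that by (auto simp: left_ideal_over_def)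
    then obtain x where x: "x \<in> I" "x \<noteq> 0" using nontriv by blast
    then obtain y where y: "y \<in> R" "y \<star> x = e" using assms I(2) by blast
    have "r \<in> I" if "r \<in> R" for r using I(3)[OF that I(3)[OF y(1) x(1)]] y(2) by simp
    then show False using I(2) nontriv by blast
  qed
  show ?thesis
    unfolding left_noetherian_def acc_on_def
  proof (intro allI impI)
    fix I assume I: "(\<forall>n. left_ideal_over {0} R (I n)) \<and> (\<forall>n. I n \<subseteq> I (Suc n))"
    then have mono: "I m \<subseteq> I n" if "m \<le> n" for m n :: nat by (intro lift_Suc_mono_le[OF _ that]) blast
    show "\<exists>N. \<forall>n\<ge>N. I n = I N"
    proof (cases "\<forall>n. I n = {0}")
      case False
      then obtain m where "I m \<noteq> {0}" by blast
      have "I n = I m" if n: "n \<ge> m" for n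
      proof -
        have "left_ideal_over {0} R (I m)" using I by blast
        from dichotomy[OF this] have "I m = R" using \<open>I m \<noteq> {0}\<close> by blast
        moreover have "I n \<subseteq> R" using I by (auto simp: left_ideal_over_def)
        ultimately show ?thesis using mono[OF n] by blast
      qed
      then show ?thesis by blast
    qed auto
  qed
qed

text \<open>For a unit the exchange conditions hold with difference 0, the exchanged coefficient
  being a conjugate. After \<xi> is adjoined, conjugation still preserves the larger ring because
  \<xi> commutes with itself and with \<eta>, so \<eta> can be adjoined in the same way.\<close>

lemma left_noetherian_adjoin_unit:
  assumes N: "two_sided N" "N \<subseteq> R" and R: "sub_ring R" and noeth: "left_noetherian N R"
    and unit: "\<xi> \<star> \<eta> = e" "\<eta> \<star> \<xi> = e"
    and conj: "\<And>r. r \<in> R \<Longrightarrow> \<xi> \<star> r \<star> \<eta> \<in> R" "\<And>r. r \<in> R \<Longrightarrow> \<eta> \<star> r \<star> \<xi> \<in> R"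
  shows "left_noetherian N (ring_hull (insert \<eta> (insert \<xi> R)))"
proof -
  have cancel: "\<eta> \<star> (\<xi> \<star> z) = z" "\<xi> \<star> (\<eta> \<star> z) = z" for z
    by (simp_all add: unit flip: assoc)
  note D = sub_ringD[OF R]
  have ex1: "\<exists>r'\<in>R. r \<star> \<xi> - \<xi> \<star> r' \<in> R" if "r \<in> R" for r
    using conj(2)[OF that] D(4) by (intro bexI[of _ "\<eta> \<star> r \<star> \<xi>"]) (simp_all add: assoc cancel)
  have ex2: "\<exists>r'\<in>R. r' \<star> \<xi> - \<xi> \<star> r \<in> R" if "r \<in> R" for r
    using conj(1)[OF that] D(4) by (intro bexI[of _ "\<xi> \<star> r \<star> \<eta>"]) (simp_all add: assoc unit)
  note adj = N R ex1 ex2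
  let ?A = "ring_hull (insert \<xi> R)"
  note DA = sub_ringD[OF sub_ring_hull[of "insert \<xi> R"]]
  have sub: "insert \<xi> R \<subseteq> ?A" by (rule hull_subset)
  have noethA: "left_noetherian N ?A"
    using left_noetherian_adjoin[OF adj noeth] by (simp add: adjoin_eq_hull[OF adj])
  have conjA: "\<xi> \<star> a \<star> \<eta> \<in> ?A \<and> \<eta> \<star> a \<star> \<xi> \<in> ?A" if "a \<in> ?A" for a
  proof -
    let ?S = "{a. \<xi> \<star> a \<star> \<eta> \<in> ?A \<and> \<eta> \<star> a \<star> \<xi> \<in> ?A}"
    have "sub_ring ?S"
      unfolding sub_ring_def add_closed_def
    proof (intro conjI ballI)
      fix x y assume xy: "x \<in> ?S" "y \<in> ?S"
      have "\<xi> \<star> (x \<star> y) \<star> \<eta> = (\<xi> \<star> x \<star> \<eta>) \<star> (\<xi> \<star> y \<star> \<eta>)" "\<eta> \<star> (x \<star> y) \<star> \<xi> = (\<eta> \<star> x \<star> \<xi>) \<star> (\<eta> \<star> y \<star> \<xi>)"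
        by (simp_all add: assoc cancel)
      then show "x \<star> y \<in> ?S" using DA(3) xy by auto
      have "\<xi> \<star> (x - y) \<star> \<eta> = (\<xi> \<star> x \<star> \<eta>) - (\<xi> \<star> y \<star> \<eta>)" "\<eta> \<star> (x - y) \<star> \<xi> = (\<eta> \<star> x \<star> \<xi>) - (\<eta> \<star> y \<star> \<xi>)"
        by (simp_all add: mult_diff)
      then show "x - y \<in> ?S" using DA(5) xy by auto
    qed (simp_all add: unit DA(2,4))
    moreover have "insert \<xi> R \<subseteq> ?S"
      using sub conj by (auto simp: unit assoc[of \<xi> \<xi> \<eta>])
    ultimately show ?thesis using that hull_minimal by blast
  qed
  have NA: "N \<subseteq> ?A" using N(2) sub by blast
  have ex3: "\<exists>r'\<in>?A. r \<star> \<eta> - \<eta> \<star> r' \<in> ?A" if "r \<in> ?A" for r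
    using conjA[OF that] DA(4) by (intro bexI[of _ "\<xi> \<star> r \<star> \<eta>"]) (simp_all add: assoc cancel)
  have ex4: "\<exists>r'\<in>?A. r' \<star> \<eta> - \<eta> \<star> r \<in> ?A" if "r \<in> ?A" for r
    using conjA[OF that] DA(4) by (intro bexI[of _ "\<eta> \<star> r \<star> \<xi>"]) (simp_all add: assoc unit)
  note adjA = N(1) NA sub_ring_hull[of "insert \<xi> R"] ex3 ex4
  from left_noetherian_adjoin[OF adjA noethA] show ?thesis
    by (simp add: adjoin_eq_hull[OF adjA] hull_insert_hull)
qed

primrec ore_chain :: "'a set \<Rightarrow> 'a \<Rightarrow> 'a \<Rightarrow> nat \<Rightarrow> 'a set" where
  "ore_chain R a b 0 = {0}"
| "ore_chain R a b (Suc n) = {r \<star> a + w \<star> b | r w. r \<in> R \<and> w \<in> ore_chain R a b n}"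

text \<open>
  The chain of left ideals \<open>R a + R a b + \<dots> + R a b^n\<close> stabilises, and a nontrivial relation
  between the \<open>a b^i\<close> yields a common multiple.
\<close>

lemma left_ore:
  assumes R: "sub_ring R" and noeth: "left_noetherian {0} R"
    and domain: "\<And>x y. x \<in> R \<Longrightarrow> y \<in> R \<Longrightarrow> x \<star> y = 0 \<Longrightarrow> x = 0 \<or> y = 0"
    and ab: "a \<in> R" "b \<in> R" "a \<noteq> 0" "b \<noteq> 0"
  shows "\<exists>u\<in>R. \<exists>v\<in>R. u \<noteq> 0 \<and> u \<star> a = v \<star> b"
proof -
  note D = sub_ringD[OF R]
  let ?J = "ore_chain R a b"
  have J: "left_ideal_over {0} R (?J n)" for n
  proof (induction n)
    case 0
    then show ?case using D by (auto simp: left_ideal_over_def add_closed_def)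
  next
    case (Suc n)
    then have J: "add_closed (?J n)" "0 \<in> ?J n" "?J n \<subseteq> R" "\<And>r x. r \<in> R \<Longrightarrow> x \<in> ?J n \<Longrightarrow> r \<star> x \<in> ?J n"
      by (auto simp: left_ideal_over_def)
    have zero: "0 \<in> ?J (Suc n)" using J(2) D(4) by (auto intro!: exI[of _ 0])
    have "x - y \<in> ?J (Suc n)" if xy: "x \<in> ?J (Suc n)" "y \<in> ?J (Suc n)" for x y
    proof -
      obtain r w r' w' where eq: "x = r \<star> a + w \<star> b" "y = r' \<star> a + w' \<star> b" "r \<in> R" "r' \<in> R" "w \<in> ?J n" "w' \<in> ?J n"
        using xy by auto
      have "x - y = (r - r') \<star> a + (w - w') \<star> b" by (simp add: eq mult_algebra)
      then show ?thesis using D(5)[OF eq(3,4)] add_closedD(2)[OF J(1) eq(5,6)] by auto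
    qed
    moreover have "r \<star> x \<in> ?J (Suc n)" if rx: "r \<in> R" "x \<in> ?J (Suc n)" for r x
    proof -
      obtain s w where eq: "x = s \<star> a + w \<star> b" "s \<in> R" "w \<in> ?J n" using rx by auto
      have "r \<star> x = (r \<star> s) \<star> a + (r \<star> w) \<star> b" by (simp add: eq mult_algebra)
      then show ?thesis using D(3)[OF rx(1) eq(2)] J(4)[OF rx(1) eq(3)] by auto
    qed
    moreover have "?J (Suc n) \<subseteq> R" using D(3,7) J(3) ab by auto
    ultimately show ?case using zero by (simp add: left_ideal_over_def add_closed_def)
  qed
  have mono: "?J n \<subseteq> ?J (Suc n)" for n
  proof (induction n)
    case 0
    show ?case using J[of "Suc 0"] by (simp add: left_ideal_over_def)
  next
    case (Suc n)
    then show ?case unfolding ore_chain.simps(2)[of R a b n] ore_chain.simps(2)[of R a b "Suc n"] by blast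
  qed
  obtain M where M: "\<forall>n\<ge>M. ?J n = ?J M"
    using acc_onD[where I = ?J, OF noeth[unfolded left_noetherian_def] J mono] by (rule exE)
  \<comment> \<open>Hence a b^M is a combination of the a b^i with i < M.\<close>
  have stable: "?J (Suc M) = ?J M" by (rule M[rule_format]) simp
  let ?p = "\<lambda>n. ((\<lambda>z. z \<star> b) ^^ n) a"
  have p: "?p n \<in> R" for n using D(3) ab by (induction n) auto
  have "?p n \<in> ?J (Suc n)" for n
  proof (induction n)
    case 0
    have "a = e \<star> a + 0 \<star> b" by simp
    then show ?case using D(2) by (auto intro: exI[of _ e])
  next
    case (Suc n)
    have "?p (Suc n) = 0 \<star> a + ?p n \<star> b" by simp
    with Suc D(4) show ?case
      unfolding ore_chain.simps(2)[of R a b "Suc n"] by (intro CollectI exI[of _ 0] exI[of _ "?p n"]) auto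
  qed
  from this[of M] have "?p M \<in> ?J M" by (simp only: stable)
  then show ?thesis
  proof (induction M)
    case 0
    then show ?case using ab by simp
  next
    case (Suc n)
    then obtain r w where rw: "?p (Suc n) = r \<star> a + w \<star> b" "r \<in> R" "w \<in> ?J n" by auto
    have w: "w \<in> R" using J[of n] rw(3) by (auto simp: left_ideal_over_def)
    \<comment> \<open>A nonzero constant coefficient \<open>r\<close> gives the common multiple at
      once; otherwise \<open>b\<close> is cancelled on the right and the relation becomes
      shorter.\<close>
    have eq: "r \<star> a = (?p n - w) \<star> b" using rw(1) by (simp add: mult_diff algebra_simps)
    show ?case
    proof (cases "r = 0")
      case True
      then have "?p n - w = 0" using eq domain[OF D(5)[OF p w] ab(2)] ab by simp
      then show ?thesis using Suc.IH rw(3) by simp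
    next
      case False
      then show ?thesis using eq rw(2) D(5)[OF p w] by blast
    qed
  qed
qed

end

interpretation opp: ring_mult "\<lambda>x y :: 'a::ring_1. y * x" 1
  by (rule std.flip)

lemma set_ring_simps [simp]:
  "carrier (set_ring S) = S" "x \<otimes>\<^bsub>set_ring S\<^esub> y = x * y" "\<one>\<^bsub>set_ring S\<^esub> = 1" "\<zero>\<^bsub>set_ring S\<^esub> = 0"
  "x \<oplus>\<^bsub>set_ring S\<^esub> y = x + y"
  by (simp_all add: set_ring_def)

lemma ring_set_ring:
  assumes "std.sub_ring S"
  shows "ring (set_ring S)"
proof (rule ringI)
  note D = std.sub_ringD[OF assms]
  have "\<exists>y\<in>S. y + x = 0" if "x \<in> S" for x using D(6)[OF that] by (intro bexI[of _ "- x"]) simp_all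
  then show "abelian_group (set_ring S)"
    using D by (intro abelian_groupI) (simp_all add: algebra_simps)
  show "Group.monoid (set_ring S)"
    using D by (intro monoidI) (simp_all add: mult.assoc)
qed (simp_all add: algebra_simps)

lemma add_closed_additive_subgroup:
  assumes "std.sub_ring S" "additive_subgroup I (set_ring S)"
  shows "add_closed I"
proof -
  interpret R: ring "set_ring S" by (rule ring_set_ring[OF assms(1)])
  interpret I: additive_subgroup I "set_ring S" by fact
  have minus: "- y \<in> I" if y: "y \<in> I" for y
  proof -
    have "y \<in> S" using I.a_subset y by auto
    then have "\<ominus>\<^bsub>set_ring S\<^esub> y = - y"
      using R.minus_equality[of "- y" y] std.sub_ringD(6)[OF assms(1)] by simp
    then show ?thesis using I.a_inv_closed[OF y] by simp
  qed
  have "x - y \<in> I" if "x \<in> I" "y \<in> I" for x y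
    using I.a_closed[OF that(1) minus[OF that(2)]] by simp
  then show ?thesis using I.zero_closed by (simp add: add_closed_def)
qed

lemma nc_noetherian_set_ring:
  assumes "std.sub_ring S" "std.left_noetherian {0} S" "opp.left_noetherian {0} S"
  shows "nc_noetherian (set_ring S)"
  unfolding nc_noetherian_def
proof
  have sub: "I \<subseteq> S" "0 \<in> I" if "additive_subgroup I (set_ring S)" for I
    using additive_subgroup.a_subset[OF that] additive_subgroup.zero_closed[OF that] by auto
  show "acc_on (\<lambda>I. left_ideal I (set_ring S))"
    using assms(2) unfolding std.left_noetherian_def
    by (rule acc_on_subset)
      (use add_closed_additive_subgroup[OF assms(1)] sub in \<open>auto simp: left_ideal_def std.left_ideal_over_def\<close>)
  show "acc_on (\<lambda>I. right_ideal I (set_ring S))"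
    using assms(3) unfolding opp.left_noetherian_def
    by (rule acc_on_subset)
      (use add_closed_additive_subgroup[OF assms(1)] sub in \<open>auto simp: right_ideal_def opp.left_ideal_over_def\<close>)
qed

lemma nc_domain_set_ring:
  fixes S :: "'d::division_ring set"
  assumes "std.sub_ring S"
  shows "nc_domain (set_ring S)"
  using ring_set_ring[OF assms] by (simp add: nc_domain_def)

subsection \<open>Rings of fractions\<close>

lemma left_fractionsI: "u \<in> S \<Longrightarrow> u \<noteq> 0 \<Longrightarrow> w \<in> S \<Longrightarrow> inverse u * w \<in> left_fractions S"
  by (auto simp: left_fractions_def)

lemma subset_left_fractions: "std.sub_ring S \<Longrightarrow> (S :: 'd::division_ring set) \<subseteq> left_fractions S"
  using left_fractionsI[of 1 S] std.sub_ringD(2)[of S] by fastforce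

context
  fixes S :: "'d::division_ring set"
  assumes S: "std.sub_ring S"
    and ore: "\<And>a b. a \<in> S \<Longrightarrow> b \<in> S \<Longrightarrow> a \<noteq> 0 \<Longrightarrow> b \<noteq> 0 \<Longrightarrow> \<exists>u\<in>S. \<exists>v\<in>S. u \<noteq> 0 \<and> u * a = v * b"
begin

private lemmas D = std.sub_ringD[OF S]

lemma left_fractions_common_denominator:
  assumes "p \<in> left_fractions S" "q \<in> left_fractions S"
  obtains u v w where "u \<in> S" "u \<noteq> 0" "v \<in> S" "w \<in> S" "p = inverse u * v" "q = inverse u * w"
proof -
  obtain a b c d where eq: "p = inverse a * b" "q = inverse c * d" "a \<in> S" "c \<in> S" "b \<in> S" "d \<in> S"
    "a \<noteq> 0" "c \<noteq> 0" using assms by (auto simp: left_fractions_def)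
  obtain u v where uv: "u \<in> S" "v \<in> S" "u \<noteq> 0" "u * a = v * c" using ore eq by metis
  have v: "v \<noteq> 0"
  proof
    assume "v = 0"
    then show False using uv(3,4) eq(7) by simp
  qed
  have "inverse (u * a) * (u * b) = p"
    using uv(3) eq by (simp add: nonzero_inverse_mult_distrib mult.assoc) (simp flip: mult.assoc)
  moreover have "inverse (v * c) * (v * d) = q"
    using v eq by (simp add: nonzero_inverse_mult_distrib mult.assoc) (simp flip: mult.assoc)
  then have "inverse (u * a) * (v * d) = q" by (simp only: uv(4))
  moreover have "u * a \<noteq> 0" using uv(3) eq(7) by simp
  ultimately show ?thesis using that[of "u * a" "u * b" "v * d"] uv eq D(3) by metis
qed

lemma division_subring_left_fractions: "division_subring (left_fractions S)"
proof -
  let ?Q = "left_fractions S"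
  have "x - y \<in> ?Q" if xy: "x \<in> ?Q" "y \<in> ?Q" for x y
  proof -
    obtain u v w where eq: "u \<in> S" "u \<noteq> 0" "v \<in> S" "w \<in> S" "x = inverse u * v" "y = inverse u * w"
      using xy by (rule left_fractions_common_denominator)
    have "x - y = inverse u * (v - w)" by (simp add: eq right_diff_distrib)
    then show ?thesis using left_fractionsI[OF eq(1,2) D(5)[OF eq(3,4)]] by simp
  qed
  moreover have "x * y \<in> ?Q" if xy: "x \<in> ?Q" "y \<in> ?Q" for x y
  proof -
    obtain a b c d where eq: "x = inverse a * b" "y = inverse c * d" "a \<in> S" "c \<in> S" "b \<in> S" "d \<in> S"
      "a \<noteq> 0" "c \<noteq> 0" using xy by (auto simp: left_fractions_def)
    show ?thesis
    proof (cases "b = 0")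
      case True
      then show ?thesis using left_fractionsI[of 1 S 0] D by (simp add: eq)
    next
      case False
      obtain u v where uv: "u \<in> S" "v \<in> S" "u \<noteq> 0" "u * b = v * c"
        using ore[OF eq(5,4) False eq(8)] by blast
      have "b * inverse c = inverse u * v"
      proof -
        have "b = inverse u * v * c" using uv by (simp add: mult.assoc flip: uv(4)) (simp flip: mult.assoc)
        then show ?thesis using eq by (metis mult.assoc mult.right_neutral right_inverse)
      qed
      moreover have "x * y = inverse a * (b * inverse c) * d" by (simp add: eq mult.assoc)
      ultimately have "x * y = inverse a * (inverse u * v) * d" by simp
      also have "\<dots> = inverse (u * a) * (v * d)"
        using uv eq by (simp add: nonzero_inverse_mult_distrib mult.assoc)
      finally show ?thesis using left_fractionsI[of "u * a" S "v * d"] D(3) uv eq by simp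
    qed
  qed
  moreover have "inverse x \<in> ?Q" if x: "x \<in> ?Q" for x
  proof -
    obtain a b where eq: "x = inverse a * b" "a \<in> S" "b \<in> S" "a \<noteq> 0" using x by (auto simp: left_fractions_def)
    show ?thesis
    proof (cases "b = 0")
      case True
      then show ?thesis using x by (simp add: eq)
    next
      case False
      then have "inverse x = inverse b * a" using eq by (simp add: nonzero_inverse_mult_distrib)
      then show ?thesis using left_fractionsI eq False by simp
    qed
  qed
  ultimately show ?thesis
    using subset_left_fractions[OF S] D(2,4) by (auto simp: division_subring_def)
qed

lemma is_Frac_left_fractions:
  assumes right_ore: "\<And>a b. a \<in> S \<Longrightarrow> b \<in> S \<Longrightarrow> a \<noteq> 0 \<Longrightarrow> b \<noteq> 0 \<Longrightarrow> \<exists>u\<in>S. \<exists>v\<in>S. u \<noteq> 0 \<and> a * u = b * v"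
  shows "is_Frac (set_ring S) (left_fractions S) id"
  unfolding is_Frac_def
proof (intro conjI ballI)
  show "id \<in> ring_hom (set_ring S) (set_ring (left_fractions S))"
    using subset_left_fractions[OF S] by (intro ring_hom_memI) auto
  fix q assume "q \<in> left_fractions S"
  then obtain a b where eq: "q = inverse a * b" "a \<in> S" "b \<in> S" "a \<noteq> 0" by (auto simp: left_fractions_def)
  show "\<exists>s\<in>carrier (set_ring S) - {\<zero>\<^bsub>set_ring S\<^esub>}. \<exists>a\<in>carrier (set_ring S). q = inverse (id s) * id a"
    using eq by (intro bexI[of _ a] bexI[of _ b]) auto
  show "\<exists>s\<in>carrier (set_ring S) - {\<zero>\<^bsub>set_ring S\<^esub>}. \<exists>a\<in>carrier (set_ring S). q = id a * inverse (id s)"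
  proof (cases "b = 0")
    case True
    then show ?thesis using D(2,4) by (intro bexI[of _ 1] bexI[of _ 0]) (auto simp: eq)
  next
    case False
    obtain u v where uv: "u \<in> S" "v \<in> S" "u \<noteq> 0" "b * u = a * v" using right_ore eq False by blast
    have "inverse a * b * u = v" using eq uv by (simp add: mult.assoc) (simp flip: mult.assoc)
    then have "q = v * inverse u" using uv(3) by (metis eq(1) mult.assoc mult.right_neutral right_inverse)
    then show ?thesis using uv by (intro bexI[of _ u] bexI[of _ v]) auto
  qed
qed (simp_all add: division_subring_left_fractions)

end

subsection \<open>Sums of homogeneous components\<close>

definition graded_sum :: "('g \<Rightarrow> 'a::ab_group_add set) \<Rightarrow> 'g set \<Rightarrow> 'a set" where
  "graded_sum E L = {\<Sum>a\<in>S. u a | S u. finite S \<and> S \<subseteq> L \<and> (\<forall>a\<in>S. u a \<in> E a)}"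

lemma graded_sumI: "finite S \<Longrightarrow> S \<subseteq> L \<Longrightarrow> (\<And>a. a \<in> S \<Longrightarrow> u a \<in> E a) \<Longrightarrow> (\<Sum>a\<in>S. u a) \<in> graded_sum E L"
  unfolding graded_sum_def by blast

lemma graded_sumE:
  assumes "x \<in> graded_sum E L"
  obtains S u where "finite S" "S \<subseteq> L" "\<And>a. a \<in> S \<Longrightarrow> u a \<in> E a" "x = (\<Sum>a\<in>S. u a)"
  using assms unfolding graded_sum_def by blast

lemma graded_sum_mem: "a \<in> L \<Longrightarrow> x \<in> E a \<Longrightarrow> x \<in> graded_sum E L"
  using graded_sumI[of "{a}" L "\<lambda>_. x" E] by simp

lemma graded_sum_mono: "L \<subseteq> M \<Longrightarrow> graded_sum E L \<subseteq> graded_sum E M"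
  unfolding graded_sum_def by blast

lemma graded_sum_finite: "x \<in> graded_sum E L \<Longrightarrow> \<exists>S. finite S \<and> S \<subseteq> L \<and> x \<in> graded_sum E S"
  unfolding graded_sum_def by blast

lemma graded_sum_subset:
  assumes "add_closed H" "\<And>a. a \<in> L \<Longrightarrow> E a \<subseteq> H"
  shows "graded_sum E L \<subseteq> H"
proof
  fix x assume "x \<in> graded_sum E L"
  then obtain S u where S: "finite S" "S \<subseteq> L" "\<And>a. a \<in> S \<Longrightarrow> u a \<in> E a" "x = (\<Sum>a\<in>S. u a)"
    by (rule graded_sumE) (rule that; assumption)
  show "x \<in> H"
    unfolding S(4) by (rule add_closed_sum[OF assms(1)]) (use S assms(2) in blast)
qed

lemma graded_sum_superset:
  assumes E: "\<And>a. a \<in> L \<Longrightarrow> add_closed (E a)" and S: "finite M" "M \<subseteq> L" and x: "x \<in> graded_sum E M"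
  obtains u where "\<And>a. a \<in> M \<Longrightarrow> u a \<in> E a" "x = (\<Sum>a\<in>M. u a)"
proof -
  obtain S' u where S': "finite S'" "S' \<subseteq> M" "\<And>a. a \<in> S' \<Longrightarrow> u a \<in> E a" "x = (\<Sum>a\<in>S'. u a)"
    using graded_sumE[OF x] by metis
  show ?thesis
  proof (rule that)
    show "(if a \<in> S' then u a else 0) \<in> E a" if "a \<in> M" for a
      using that S'(3) add_closedD(1)[OF E] S(2) by auto
    show "x = (\<Sum>a\<in>M. if a \<in> S' then u a else 0)"
      unfolding S'(4) using S'(2) S(1) by (simp add: sum.If_cases Int_absorb1)
  qed
qed

lemma add_closed_graded_sum:
  assumes E: "\<And>a. a \<in> L \<Longrightarrow> add_closed (E a)"
  shows "add_closed (graded_sum E L)"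
  unfolding add_closed_def
proof (intro conjI ballI)
  show "0 \<in> graded_sum E L" using graded_sumI[of "{}" L] by force
  fix x y assume "x \<in> graded_sum E L" "y \<in> graded_sum E L"
  then obtain A B where AB: "finite A" "A \<subseteq> L" "x \<in> graded_sum E A" "finite B" "B \<subseteq> L" "y \<in> graded_sum E B"
    using graded_sum_finite by meson
  have U: "finite (A \<union> B)" "A \<union> B \<subseteq> L" "x \<in> graded_sum E (A \<union> B)" "y \<in> graded_sum E (A \<union> B)"
    using AB graded_sum_mono[of A "A \<union> B" E] graded_sum_mono[of B "A \<union> B" E] by auto
  obtain u where u: "\<And>a. a \<in> A \<union> B \<Longrightarrow> u a \<in> E a" "x = (\<Sum>a\<in>A \<union> B. u a)"
    using graded_sum_superset[OF E U(1,2,3)] by metis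
  obtain v where v: "\<And>a. a \<in> A \<union> B \<Longrightarrow> v a \<in> E a" "y = (\<Sum>a\<in>A \<union> B. v a)"
    using graded_sum_superset[OF E U(1,2,4)] by metis
  have "u a - v a \<in> E a" if "a \<in> A \<union> B" for a
    using add_closedD(2)[OF E u(1) v(1)] that U(2) by blast
  from graded_sumI[OF U(1,2) this] show "x - y \<in> graded_sum E L"
    by (simp add: u(2) v(2) sum_subtractf)
qed

text \<open>The multiplication is a parameter since the locale is interpreted for a division ring
  and for its opposite, which gives the chain conditions on both sides. Every component contains a
  unit, so it is obtained from the component of \<one> by multiplication with that unit.\<close>

locale graded_ring = ring_mult mult e + comm_group G
  for mult :: "'a::ab_group_add \<Rightarrow> 'a \<Rightarrow> 'a" (infixl "\<star>" 70) and e :: 'a and G :: "('g, 'm) monoid_scheme" (structure) +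
  fixes E :: "'g \<Rightarrow> 'a set"
  assumes component_add: "a \<in> carrier G \<Longrightarrow> add_closed (E a)"
    and component_mult: "a \<in> carrier G \<Longrightarrow> b \<in> carrier G \<Longrightarrow> x \<in> E a \<Longrightarrow> y \<in> E b \<Longrightarrow> x \<star> y \<in> E (a \<otimes> b)"
    and component_one: "e \<in> E \<one>"
    and component_unit: "a \<in> carrier G \<Longrightarrow> \<exists>x\<in>E a. \<exists>y\<in>E (inv a). x \<star> y = e \<and> y \<star> x = e"
    and component_noetherian: "left_noetherian {0} (E \<one>)"
begin

lemma graded_sum_mult:
  assumes "L \<subseteq> carrier G" "M \<subseteq> carrier G" "\<And>a b. a \<in> L \<Longrightarrow> b \<in> M \<Longrightarrow> a \<otimes> b \<in> K" "K \<subseteq> carrier G"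
    "x \<in> graded_sum E L" "y \<in> graded_sum E M"
  shows "x \<star> y \<in> graded_sum E K"
proof -
  obtain A u where A: "finite A" "A \<subseteq> L" "\<And>a. a \<in> A \<Longrightarrow> u a \<in> E a" "x = (\<Sum>a\<in>A. u a)"
    using assms(5) by (rule graded_sumE) (rule that; assumption)
  obtain B v where B: "finite B" "B \<subseteq> M" "\<And>a. a \<in> B \<Longrightarrow> v a \<in> E a" "y = (\<Sum>a\<in>B. v a)"
    using assms(6) by (rule graded_sumE) (rule that; assumption)
  have closed: "add_closed (graded_sum E K)"
    by (rule add_closed_graded_sum) (use component_add assms(4) in blast)
  have "u a \<star> v b \<in> graded_sum E K" if ab: "a \<in> A" "b \<in> B" for a b
  proof (rule graded_sum_mem)
    show "a \<otimes> b \<in> K" using assms(3) A(2) B(2) ab by blast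
    show "u a \<star> v b \<in> E (a \<otimes> b)" using component_mult[OF _ _ A(3)[OF ab(1)] B(3)[OF ab(2)]] A(2) B(2) assms(1,2) ab by blast
  qed
  then show ?thesis
    unfolding A(4) B(4) mult_sum_left mult_sum_right by (intro add_closed_sum[OF closed]) blast
qed

lemma sub_ring_graded_sum:
  assumes "subgroup F G"
  shows "sub_ring (graded_sum E F)"
proof -
  note F = subgroup.subset[OF assms]
  have "x \<star> y \<in> graded_sum E F" if "x \<in> graded_sum E F" "y \<in> graded_sum E F" for x y
    using graded_sum_mult[OF F F subgroup.m_closed[OF assms] F that] .
  moreover have "add_closed (graded_sum E F)"
    by (rule add_closed_graded_sum) (use component_add F in blast)
  ultimately show ?thesis
    using graded_sum_mem[OF subgroup.one_closed[OF assms], of e E] component_one by (simp add: sub_ring_def)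
qed

text \<open>The weights whose component and inverse component lie in the hull form a subgroup: an
  element of weight b c is multiplied by a unit of weight c^-1 into the component of b and then
  brought back. This subgroup contains \<open>F\<close> and \<open>g\<close>.\<close>

lemma graded_sum_generate_insert:
  assumes F: "subgroup F G" and g: "g \<in> carrier G" and x: "x \<in> E g" and y: "y \<in> E (inv g)" and unit: "x \<star> y = e" "y \<star> x = e"
  shows "graded_sum E (generate G (insert g F)) = ring_hull (insert y (insert x (graded_sum E F)))"
    (is "?L = ring_hull ?S")
proof
  note Fc = subgroup.subset[OF F]
  let ?K = "generate G (insert g F)"
  have K: "subgroup ?K G" using Fc g by (intro generate_is_subgroup) auto
  have sub: "insert g F \<subseteq> ?K" by (auto intro: generate.incl)
  have "y \<in> ?L" using y subgroup.m_inv_closed[OF K] sub by (intro graded_sum_mem[of "inv g"]) auto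
  moreover have "x \<in> ?L" using x sub by (intro graded_sum_mem[of g]) auto
  moreover have "graded_sum E F \<subseteq> ?L" using sub by (intro graded_sum_mono) auto
  ultimately show "ring_hull ?S \<subseteq> ?L"
    by (intro hull_minimal sub_ring_graded_sum[OF K]) auto
  note D = sub_ringD[OF sub_ring_hull[of ?S]]
  have S: "?S \<subseteq> ring_hull ?S" by (rule hull_subset)
  have one: "E \<one> \<subseteq> ring_hull ?S"
    using S graded_sum_mem[OF subgroup.one_closed[OF F], of _ E] by blast
  let ?H = "{b \<in> carrier G. E b \<subseteq> ring_hull ?S \<and> E (inv b) \<subseteq> ring_hull ?S}"
  have "subgroup ?H G"
  proof (rule subgroupI)
    have "\<one> \<in> ?H" using one by simp
    then show "?H \<noteq> {}" by blast
    show "inv b \<in> ?H" if "b \<in> ?H" for b using that by auto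
    have step: "E (b \<otimes> c) \<subseteq> ring_hull ?S"
      if bc: "b \<in> carrier G" "c \<in> carrier G" "E b \<subseteq> ring_hull ?S" "E c \<subseteq> ring_hull ?S" for b c
    proof
      fix z assume z: "z \<in> E (b \<otimes> c)"
      obtain p q where pq: "p \<in> E c" "q \<in> E (inv c)" "q \<star> p = e" using component_unit bc by blast
      have "z \<star> q \<in> E (b \<otimes> c \<otimes> inv c)" using component_mult z pq bc by blast
      then have "z \<star> q \<in> E b" using bc by (simp add: m_assoc)
      then have "z \<star> q \<star> p \<in> ring_hull ?S" using D(3) bc pq by blast
      then show "z \<in> ring_hull ?S" using pq(3) by (simp add: assoc)
    qed
    show "b \<otimes> c \<in> ?H" if "b \<in> ?H" "c \<in> ?H" for b c
      using that step[of b c] step[of "inv b" "inv c"] by (simp add: inv_mult)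
  qed auto
  moreover have "insert g F \<subseteq> ?H"
  proof -
    have "E b \<subseteq> ring_hull ?S" if "b \<in> F" for b
      using S graded_sum_mem[OF that, of _ E] by blast
    then have "F \<subseteq> ?H" using Fc subgroup.m_inv_closed[OF F] by auto
    moreover have "E g \<subseteq> ring_hull ?S"
    proof
      fix z assume "z \<in> E g"
      then have "z \<star> y \<in> E (g \<otimes> inv g)" using component_mult y g by blast
      then have "z \<star> y \<star> x \<in> ring_hull ?S" using D(3) one S g by auto
      then show "z \<in> ring_hull ?S" by (simp add: assoc unit)
    qed
    moreover have "E (inv g) \<subseteq> ring_hull ?S"
    proof
      fix z assume "z \<in> E (inv g)"
      then have "z \<star> x \<in> E (inv g \<otimes> g)" using component_mult x g by blast
      then have "z \<star> x \<star> y \<in> ring_hull ?S" using D(3) one S g by auto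
      then show "z \<in> ring_hull ?S" by (simp add: assoc unit)
    qed
    ultimately show ?thesis using g by blast
  qed
  ultimately have "?K \<subseteq> ?H" by (intro generate_subgroup_incl)
  then show "?L \<subseteq> ring_hull ?S" by (intro graded_sum_subset D(1)) blast
qed

text \<open>Each generator contributes one unit and its inverse. Conjugation by a unit of weight g
  preserves the sum over the smaller group because weights commute.\<close>

lemma left_noetherian_graded_sum:
  assumes "finite S" "S \<subseteq> carrier G"
  shows "left_noetherian {0} (graded_sum E (generate G S))"
  using assms
proof (induction S rule: finite_induct)
  case empty
  have "graded_sum E {\<one>} = E \<one>"
    using graded_sum_mem[of \<one> "{\<one>}" _ E] graded_sum_subset[of "E \<one>" "{\<one>}" E] component_add by blast
  then show ?case using component_noetherian by (simp add: generate_empty)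
next
  case (insert g S)
  then have g: "g \<in> carrier G" "S \<subseteq> carrier G" by auto
  let ?F = "generate G S"
  have F: "subgroup ?F G" by (rule generate_is_subgroup[OF g(2)])
  note Fc = subgroup.subset[OF F]
  obtain x y where xy: "x \<in> E g" "y \<in> E (inv g)" "x \<star> y = e" "y \<star> x = e" using component_unit[OF g(1)] by blast
  have mem: "x \<in> graded_sum E {g}" "y \<in> graded_sum E {inv g}" using xy by (auto intro: graded_sum_mem)
  have cancel: "g \<otimes> h \<otimes> inv g = h" "inv g \<otimes> h \<otimes> g = h" if "h \<in> carrier G" for h
    using that g m_comm[of g h] m_comm[of "inv g" h] by (simp_all add: m_assoc)
  have conj1: "x \<star> r \<star> y \<in> graded_sum E ?F" if "r \<in> graded_sum E ?F" for r
  proof -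
    have "x \<star> r \<in> graded_sum E ((\<otimes>) g ` ?F)"
      by (rule graded_sum_mult[OF _ Fc _ _ mem(1) that]) (use g Fc in auto)
    show ?thesis
      by (rule graded_sum_mult[OF _ _ _ Fc \<open>x \<star> r \<in> _\<close> mem(2)]) (use g Fc cancel in auto)
  qed
  have conj2: "y \<star> r \<star> x \<in> graded_sum E ?F" if "r \<in> graded_sum E ?F" for r
  proof -
    have "y \<star> r \<in> graded_sum E ((\<otimes>) (inv g) ` ?F)"
      by (rule graded_sum_mult[OF _ Fc _ _ mem(2) that]) (use g Fc in auto)
    show ?thesis
      by (rule graded_sum_mult[OF _ _ _ Fc \<open>y \<star> r \<in> _\<close> mem(1)]) (use g Fc cancel in auto)
  qed
  have "generate G (insert g ?F) = generate G (insert g S)"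
  proof
    have "?F \<subseteq> generate G (insert g S)" by (intro mono_generate) auto
    then show "generate G (insert g ?F) \<subseteq> generate G (insert g S)"
      using g by (intro generate_subgroup_incl generate_is_subgroup) (auto intro: generate.incl)
    show "generate G (insert g S) \<subseteq> generate G (insert g ?F)"
      by (intro mono_generate) (auto intro: generate.incl)
  qed
  moreover have "left_noetherian {0} (graded_sum E (generate G (insert g ?F)))"
    unfolding graded_sum_generate_insert[OF F g(1) xy]
    using sub_ringD(4)[OF sub_ring_graded_sum[OF F]]
    by (intro left_noetherian_adjoin_unit two_sided_zero sub_ring_graded_sum F insert.IH g(2) xy conj1 conj2) auto
  ultimately show ?case by simp
qed

end


section \<open>Graded division rings\<close>

text \<open>Gaussian elimination for more vectors than coordinates, with scalars acting from the
  left: a vector with nonzero entry at \<open>i\<close> clears that coordinate in all the others,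
  and its own coefficient is determined at the end.\<close>

lemma division_ring_dependence:
  fixes v :: "'j \<Rightarrow> 'i \<Rightarrow> 'd::division_ring"
  assumes D: "division_subring D" and "finite I" "finite J" "card I < card J"
    and "\<And>j i. j \<in> J \<Longrightarrow> i \<in> I \<Longrightarrow> v j i \<in> D"
  shows "\<exists>c. (\<forall>j\<in>J. c j \<in> D) \<and> (\<exists>j\<in>J. c j \<noteq> 0) \<and> (\<forall>i\<in>I. (\<Sum>j\<in>J. c j * v j i) = 0)"
  using assms(2-)
proof (induction I arbitrary: J v rule: finite_induct)
  case empty
  then obtain j where "j \<in> J" by fastforce
  then show ?case using division_subringD(3)[OF D] by (intro exI[of _ "\<lambda>_. 1"]) auto
next
  case (insert i I)
  note DD = division_subringD[OF D]
  show ?case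
  proof (cases "\<forall>j\<in>J. v j i = 0")
    case True
    have "\<exists>c. (\<forall>j\<in>J. c j \<in> D) \<and> (\<exists>j\<in>J. c j \<noteq> 0) \<and> (\<forall>l\<in>I. (\<Sum>j\<in>J. c j * v j l) = 0)"
      using insert by (intro insert.IH) auto
    then obtain c where c: "\<forall>j\<in>J. c j \<in> D" "\<exists>j\<in>J. c j \<noteq> 0" "\<forall>l\<in>I. (\<Sum>j\<in>J. c j * v j l) = 0" by blast
    moreover have "(\<Sum>j\<in>J. c j * v j i) = 0" by (rule sum.neutral) (use True in simp)
    ultimately show ?thesis by (intro exI[of _ c]) simp
  next
    case False
    then obtain k where k: "k \<in> J" "v k i \<noteq> 0" by blast
    let ?J = "J - {k}" and ?q = "\<lambda>j. v j i * inverse (v k i)"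
    let ?v = "\<lambda>j l. v j l - ?q j * v k l"
    have q: "?q j \<in> D" if "j \<in> J" for j using DD(5,6) insert.prems(3) k that by blast
    have "\<exists>c. (\<forall>j\<in>?J. c j \<in> D) \<and> (\<exists>j\<in>?J. c j \<noteq> 0) \<and> (\<forall>l\<in>I. (\<Sum>j\<in>?J. c j * ?v j l) = 0)"
    proof (rule insert.IH)
      show "card I < card ?J" using insert k by simp
      show "?v j l \<in> D" if "j \<in> ?J" "l \<in> I" for j l
        using that insert.prems(3) k by (intro DD(4) DD(5)[OF q]) auto
    qed (use insert in simp)
    then obtain c where c: "\<forall>j\<in>?J. c j \<in> D" "\<exists>j\<in>?J. c j \<noteq> 0" "\<And>l. l \<in> I \<Longrightarrow> (\<Sum>j\<in>?J. c j * ?v j l) = 0" by blast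
    define c' where "c' j = (if j = k then - (\<Sum>j\<in>?J. c j * ?q j) else c j)" for j
    have split: "(\<Sum>j\<in>J. c' j * v j l) = (\<Sum>j\<in>?J. c j * ?v j l)" for l
    proof -
      have "(\<Sum>j\<in>J. c' j * v j l) = c' k * v k l + (\<Sum>j\<in>?J. c' j * v j l)"
        using insert.prems(1) k(1) by (rule sum.remove)
      also have "(\<Sum>j\<in>?J. c' j * v j l) = (\<Sum>j\<in>?J. c j * v j l)" by (rule sum.cong) (auto simp: c'_def)
      finally show ?thesis
        by (simp add: c'_def sum_distrib_right right_diff_distrib sum_subtractf mult.assoc)
    qed
    have "(\<Sum>j\<in>J. c' j * v j l) = 0" if "l \<in> insert i I" for l
    proof (cases "l = i")
      case True
      then show ?thesis unfolding split using k by (simp add: mult.assoc)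
    next
      case False
      then show ?thesis unfolding split using c(3) that by simp
    qed
    moreover have "c' j \<in> D" if "j \<in> J" for j
    proof -
      have "(\<Sum>j\<in>?J. c j * ?q j) \<in> D"
        by (rule add_closed_sum[OF DD(1)]) (use c(1) q DD(5) in blast)
      then show ?thesis using DD(8) c(1) that by (simp add: c'_def)
    qed
    moreover have "\<exists>j\<in>J. c' j \<noteq> 0" using c(2) by (auto simp: c'_def)
    ultimately show ?thesis by blast
  qed
qed

lemma finprod_add_monoid_set_ring:
  assumes "std.sub_ring S" "finite I" "\<And>i. i \<in> I \<Longrightarrow> f i \<in> S"
  shows "finprod (add_monoid (set_ring S)) f I = sum f I"
proof -
  interpret R: ring "set_ring S" by (rule ring_set_ring[OF assms(1)])
  have "finsum (set_ring S) f I = sum f I"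
    using assms(2,3)
  proof (induction I rule: finite_induct)
    case (insert i I)
    then have "f \<in> I \<rightarrow> S" "f i \<in> S" by auto
    then show ?case using insert by (simp add: R.finsum_insert)
  qed simp
  then show ?thesis unfolding finsum_def .
qed

lemma (in group) finitely_generated_of_acc:
  assumes acc: "acc_on (\<lambda>F. subgroup F G)" and F: "subgroup F G"
  shows "\<exists>S. finite S \<and> S \<subseteq> F \<and> generate G S = F"
proof (rule ccontr)
  assume nfg: "\<not> ?thesis"
  have sub: "generate G S \<subseteq> F" if "S \<subseteq> F" for S by (rule generate_subgroup_incl[OF that F])
  have gen: "subgroup (generate G S) G" if "S \<subseteq> F" for S
    using that subgroup.subset[OF F] by (intro generate_is_subgroup) blast
  have "\<exists>S. \<forall>n. (finite (S n) \<and> S n \<subseteq> F) \<and> (S n \<subseteq> S (Suc n) \<and> \<not> S (Suc n) \<subseteq> generate G (S n))"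
  proof (rule dependent_nat_choice[of "\<lambda>_ S. finite S \<and> S \<subseteq> F" "\<lambda>_ S S'. S \<subseteq> S' \<and> \<not> S' \<subseteq> generate G S"])
    fix S n assume S: "finite S \<and> S \<subseteq> F"
    then obtain y where "y \<in> F" "y \<notin> generate G S" using nfg sub by blast
    then show "\<exists>S'. (finite S' \<and> S' \<subseteq> F) \<and> S \<subseteq> S' \<and> \<not> S' \<subseteq> generate G S"
      using S by (intro exI[of _ "insert y S"]) auto
  qed (auto intro: exI[of _ "{}"])
  then obtain S where S: "\<And>n. finite (S n) \<and> S n \<subseteq> F" "\<And>n. S n \<subseteq> S (Suc n)"
    "\<And>n. \<not> S (Suc n) \<subseteq> generate G (S n)" by blast
  have "subgroup (generate G (S n)) G" "generate G (S n) \<subseteq> generate G (S (Suc n))" for n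
    using gen S(1) mono_generate[OF S(2)] by blast+
  from acc_onD[where I = "\<lambda>n. generate G (S n)", OF acc this]
  obtain M where M: "\<forall>n\<ge>M. generate G (S n) = generate G (S M)" ..
  have "generate G (S (Suc M)) = generate G (S M)" by (rule M[rule_format]) simp
  then show False using S(3)[of M] generate.incl[of _ "S (Suc M)" G] by blast
qed

locale graded_division_ring = comm_group G for G :: "('g, 'm) monoid_scheme" (structure) +
  fixes E :: "'g \<Rightarrow> 'd::division_ring set"
  assumes E_add: "a \<in> carrier G \<Longrightarrow> add_closed (E a)"
    and E_mult: "a \<in> carrier G \<Longrightarrow> b \<in> carrier G \<Longrightarrow> x \<in> E a \<Longrightarrow> y \<in> E b \<Longrightarrow> x * y \<in> E (a \<otimes> b)"
    and E_one: "1 \<in> E \<one>"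
    and E_inverse: "a \<in> carrier G \<Longrightarrow> x \<in> E a \<Longrightarrow> inverse x \<in> E (inv a)"
    and E_nonzero: "a \<in> carrier G \<Longrightarrow> \<exists>x\<in>E a. x \<noteq> 0"
    and direct: "finite S \<Longrightarrow> S \<subseteq> carrier G \<Longrightarrow> (\<And>a. a \<in> S \<Longrightarrow> u a \<in> E a) \<Longrightarrow> (\<Sum>a\<in>S. u a) = 0 \<Longrightarrow>
      a \<in> S \<Longrightarrow> u a = 0"
begin

lemma division_subring_component_one: "division_subring (E \<one>)"
  using E_add[of \<one>] E_one E_mult[of \<one> \<one>] E_inverse[of \<one>] by (auto simp: division_subring_def add_closed_def)

lemma component_unit: "a \<in> carrier G \<Longrightarrow> \<exists>x\<in>E a. \<exists>y\<in>E (inv a). x * y = 1 \<and> y * x = 1"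
proof -
  assume a: "a \<in> carrier G"
  obtain x where x: "x \<in> E a" "x \<noteq> 0" using E_nonzero[OF a] by blast
  then show ?thesis using E_inverse[OF a] by (intro bexI[of _ x] bexI[of _ "inverse x"]) auto
qed

sublocale left: graded_ring "(*)" "1 :: 'd" G E
proof unfold_locales
  show "std.left_noetherian {0} (E \<one>)"
    using division_subringD(6)[OF division_subring_component_one]
    by (intro std.left_noetherian_division) (auto intro!: bexI[of _ "inverse _"])
qed (use E_add E_mult E_one component_unit in auto)

sublocale right: graded_ring "\<lambda>x y. y * x" "1 :: 'd" G E
proof unfold_locales
  show "opp.left_noetherian {0} (E \<one>)"
    using division_subringD(6)[OF division_subring_component_one]
    by (intro opp.left_noetherian_division) (auto intro!: bexI[of _ "inverse _"])
  show "y * x \<in> E (a \<otimes> b)" if "a \<in> carrier G" "b \<in> carrier G" "x \<in> E a" "y \<in> E b" for a b x y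
    using E_mult[OF that(2,1,4,3)] that by (simp add: m_comm)
  show "\<exists>x\<in>E a. \<exists>y\<in>E (inv a). y * x = 1 \<and> x * y = 1" if "a \<in> carrier G" for a
    using component_unit[OF that] by blast
qed (use E_add E_one in auto)

lemma sub_ring_sum: "subgroup F G \<Longrightarrow> std.sub_ring (graded_sum E F)"
  by (rule left.sub_ring_graded_sum)

lemma sum_components:
  assumes "finite M" "M \<subseteq> carrier G" "x \<in> graded_sum E M"
  shows "\<exists>u. (\<forall>a\<in>M. u a \<in> E a) \<and> x = (\<Sum>a\<in>M. u a)"
proof (rule graded_sum_superset[OF E_add assms])
  fix u assume "\<And>a. a \<in> M \<Longrightarrow> u a \<in> E a" "x = (\<Sum>a\<in>M. u a)"
  then show ?thesis by (intro exI[of _ u]) simp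
qed

lemma direct_family:
  assumes "finite J" "h ` J \<subseteq> carrier G" "inj_on h J" "\<And>j. j \<in> J \<Longrightarrow> y j \<in> E (h j)" "(\<Sum>j\<in>J. y j) = 0" "j \<in> J"
  shows "y j = 0"
proof -
  let ?u = "\<lambda>a. y (inv_into J h a)"
  have inv: "inv_into J h (h j) = j" if "j \<in> J" for j using assms(3) that by simp
  have "?u (h j) = 0"
  proof (rule direct[of "h ` J"])
    show "(\<Sum>a\<in>h ` J. ?u a) = 0"
      using assms(3,5) inv by (subst sum.reindex) (auto cong: sum.cong)
  qed (use assms inv in auto)
  then show ?thesis using inv assms(6) by simp
qed

text \<open>An expansion over \<open>A\<close> and one over \<open>F\<close> are compared on the
  union of their supports; by directness they agree weight by weight.\<close>

lemma component_outside_sum: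
  assumes A: "finite A" "A \<subseteq> carrier G" "\<And>a. a \<in> A \<Longrightarrow> u a \<in> E a" and F: "F \<subseteq> carrier G"
    and sum: "(\<Sum>a\<in>A. u a) \<in> graded_sum E F" and a: "a \<in> A" "a \<notin> F"
  shows "u a = 0"
proof -
  obtain C w where C: "finite C" "C \<subseteq> F" "\<And>c. c \<in> C \<Longrightarrow> w c \<in> E c" "(\<Sum>a\<in>A. u a) = (\<Sum>c\<in>C. w c)"
    using sum by (rule graded_sumE) (rule that; assumption)
  let ?z = "\<lambda>a. (if a \<in> A then u a else 0) - (if a \<in> C then w a else 0)"
  have Un: "finite (A \<union> C)" "A \<union> C \<subseteq> carrier G" using A C F by auto
  have "?z a = 0"
  proof (rule direct[OF Un])
    show "?z b \<in> E b" if "b \<in> A \<union> C" for b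
    proof -
      have b: "add_closed (E b)" using that Un(2) by (intro E_add) blast
      show ?thesis using add_closedD(1)[OF b] A(3) C(3) by (intro add_closedD(2)[OF b]) auto
    qed
    have "(\<Sum>a\<in>A \<union> C. if a \<in> A then u a else 0) = (\<Sum>a\<in>A. u a)"
      "(\<Sum>a\<in>A \<union> C. if a \<in> C then w a else 0) = (\<Sum>a\<in>C. w a)"
      using Un(1) by (simp_all add: sum.If_cases Int_absorb1)
    then show "(\<Sum>b\<in>A \<union> C. ?z b) = 0" by (simp add: sum_subtractf C(4))
  qed (use a in simp)
  then show ?thesis using a C(2) by auto
qed

lemma sum_subset_generated:
  assumes "subgroup F G" "a \<in> graded_sum E F" "b \<in> graded_sum E F"
  obtains A where "finite A" "A \<subseteq> carrier G" "generate G A \<subseteq> F"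
    "a \<in> graded_sum E (generate G A)" "b \<in> graded_sum E (generate G A)"
proof -
  obtain A B where AB: "finite A" "A \<subseteq> F" "a \<in> graded_sum E A" "finite B" "B \<subseteq> F" "b \<in> graded_sum E B"
    using graded_sum_finite assms by meson
  have "A \<subseteq> generate G (A \<union> B)" "B \<subseteq> generate G (A \<union> B)" by (auto intro: generate.incl)
  then have "a \<in> graded_sum E (generate G (A \<union> B))" "b \<in> graded_sum E (generate G (A \<union> B))"
    using AB graded_sum_mono by blast+
  moreover have "generate G (A \<union> B) \<subseteq> F" using AB by (intro generate_subgroup_incl assms) auto
  moreover have "A \<union> B \<subseteq> carrier G" using AB subgroup.subset[OF assms(1)] by auto
  ultimately show ?thesis using that[of "A \<union> B"] AB by blast
qed

text \<open>The subgroup \<open>F\<close> is not assumed to be finitely generated. The supports of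
  \<open>a\<close> and \<open>b\<close> generate a subgroup over which the sum is Noetherian, and
  the common multiple is found there.\<close>

lemma left_ore_sum:
  assumes F: "subgroup F G" and ab: "a \<in> graded_sum E F" "b \<in> graded_sum E F" "a \<noteq> 0" "b \<noteq> 0"
  shows "\<exists>u\<in>graded_sum E F. \<exists>v\<in>graded_sum E F. u \<noteq> 0 \<and> u * a = v * b"
proof -
  obtain A where A: "finite A" "A \<subseteq> carrier G" "generate G A \<subseteq> F"
    "a \<in> graded_sum E (generate G A)" "b \<in> graded_sum E (generate G A)"
    by (rule sum_subset_generated[OF F ab(1,2)])
  have "\<exists>u\<in>graded_sum E (generate G A). \<exists>v\<in>graded_sum E (generate G A). u \<noteq> 0 \<and> u * a = v * b"
    using A ab(3,4)
    by (intro std.left_ore sub_ring_sum generate_is_subgroup left.left_noetherian_graded_sum) auto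
  then show ?thesis using graded_sum_mono[OF A(3), of E] by blast
qed

lemma right_ore_sum:
  assumes F: "subgroup F G" and ab: "a \<in> graded_sum E F" "b \<in> graded_sum E F" "a \<noteq> 0" "b \<noteq> 0"
  shows "\<exists>u\<in>graded_sum E F. \<exists>v\<in>graded_sum E F. u \<noteq> 0 \<and> a * u = b * v"
proof -
  obtain A where A: "finite A" "A \<subseteq> carrier G" "generate G A \<subseteq> F"
    "a \<in> graded_sum E (generate G A)" "b \<in> graded_sum E (generate G A)"
    by (rule sum_subset_generated[OF F ab(1,2)])
  have "\<exists>u\<in>graded_sum E (generate G A). \<exists>v\<in>graded_sum E (generate G A). u \<noteq> 0 \<and> a * u = b * v"
    using A ab(3,4)
    by (intro opp.left_ore right.sub_ring_graded_sum generate_is_subgroup right.left_noetherian_graded_sum) auto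
  then show ?thesis using graded_sum_mono[OF A(3), of E] by blast
qed

abbreviation fractions :: "'g set \<Rightarrow> 'd set" where
  "fractions F \<equiv> left_fractions (graded_sum E F)"

lemma division_subring_fractions: "subgroup F G \<Longrightarrow> division_subring (fractions F)"
  by (intro division_subring_left_fractions sub_ring_sum left_ore_sum)

lemma is_Frac_fractions: "subgroup F G \<Longrightarrow> is_Frac (set_ring (graded_sum E F)) (fractions F) id"
  by (intro is_Frac_left_fractions sub_ring_sum left_ore_sum right_ore_sum)

lemma component_subset_fractions: "subgroup F G \<Longrightarrow> a \<in> F \<Longrightarrow> E a \<subseteq> fractions F"
  using graded_sum_mem[of a F _ E] subset_left_fractions[OF sub_ring_sum] by blast

lemma fractions_mono: "F \<subseteq> F' \<Longrightarrow> fractions F \<subseteq> fractions F'"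
  using graded_sum_mono[of F F' E] unfolding left_fractions_def by blast

text \<open>If v = s^-1 w, then the homogeneous components of w = s v are those of s multiplied by
  v. Any nonzero component u of s, of weight b, therefore gives a nonzero component u v of w, so
  that b \<otimes> a lies in \<open>F\<close>, and v = u^-1 (u v).\<close>

lemma homogeneous_fraction:
  assumes F: "subgroup F G" and a: "a \<in> carrier G" and v: "v \<in> fractions F" "v \<in> E a" "v \<noteq> 0"
  shows "a \<in> F \<and> (\<exists>b\<in>F. \<exists>u\<in>E b. \<exists>w\<in>E (a \<otimes> b). u \<noteq> 0 \<and> v = inverse u * w)"
proof -
  note Fc = subgroup.subset[OF F]
  obtain s w where sw: "s \<in> graded_sum E F" "s \<noteq> 0" "w \<in> graded_sum E F" "v = inverse s * w"
    using v(1) by (auto simp: left_fractions_def)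
  obtain B u where B: "finite B" "B \<subseteq> F" "\<And>b. b \<in> B \<Longrightarrow> u b \<in> E b" "s = (\<Sum>b\<in>B. u b)"
    using sw(1) by (rule graded_sumE) (rule that; assumption)
  obtain b where b: "b \<in> B" "u b \<noteq> 0" using sw(2) B(4) by (metis sum.neutral)
  have bF: "b \<in> F" "b \<in> carrier G" using b B(2) Fc by auto
  have BG: "B \<subseteq> carrier G" using B(2) Fc by auto
  let ?h = "\<lambda>b. b \<otimes> a"
  have inj: "inj_on ?h B" using BG a by (intro inj_onI) (metis r_cancel subsetD)
  let ?y = "\<lambda>c. u (c \<otimes> inv a) * v"
  have cancel: "?h b \<otimes> inv a = b" if "b \<in> B" for b using that BG a by (auto simp: m_assoc)
  have "(\<Sum>c\<in>?h ` B. ?y c) = (\<Sum>b\<in>B. u b * v)"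
    using inj cancel by (subst sum.reindex) (auto cong: sum.cong)
  also have "\<dots> = s * v" by (simp add: B(4) sum_distrib_right)
  also have "\<dots> = w" using sw by (simp flip: mult.assoc)
  finally have total: "(\<Sum>c\<in>?h ` B. ?y c) \<in> graded_sum E F" using sw(3) by simp
  have ba: "b \<otimes> a \<in> F"
  proof (rule ccontr)
    assume nF: "b \<otimes> a \<notin> F"
    have "?y (b \<otimes> a) = 0"
    proof (rule component_outside_sum[OF _ _ _ Fc total])
      show "?y c \<in> E c" if c: "c \<in> ?h ` B" for c
      proof -
        obtain b' where b': "c = b' \<otimes> a" "b' \<in> B" using c by blast
        have "u b' * v \<in> E (b' \<otimes> a)" using E_mult[OF _ a B(3)[OF b'(2)] v(2)] b'(2) BG by blast
        then show ?thesis using cancel[OF b'(2)] b'(1) by simp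
      qed
    qed (use B(1) BG a b nF in auto)
    then show False using cancel[OF b(1)] b(2) v(3) by simp
  qed
  have "b \<otimes> a \<otimes> inv b = a" using bF a by (simp add: m_comm[of b a] m_assoc)
  then have aF: "a \<in> F" using subgroup.m_closed[OF F ba subgroup.m_inv_closed[OF F bF(1)]] by simp
  have "u b * v \<in> E (a \<otimes> b)" using E_mult[OF bF(2) a B(3)[OF b(1)] v(2)] bF a by (simp add: m_comm)
  moreover have "v = inverse (u b) * (u b * v)" using b(2) by (simp flip: mult.assoc)
  ultimately show ?thesis using aF bF(1) B(3)[OF b(1)] b(2) by blast
qed

text \<open>A subgroup is recovered as the set of weights of the homogeneous elements among its fractions.\<close>

lemma acc_subgroups:
  assumes acc: "acc_on P" and P: "\<And>F. subgroup F G \<Longrightarrow> P (fractions F)"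
  shows "acc_on (\<lambda>F. subgroup F G)"
  unfolding acc_on_def
proof (intro allI impI)
  fix I :: "nat \<Rightarrow> 'g set"
  assume I: "(\<forall>n. subgroup (I n) G) \<and> (\<forall>n. I n \<subseteq> I (Suc n))"
  have sub: "subgroup (I n) G" and mono: "I n \<subseteq> I (Suc n)" for n using I by blast+
  have recover: "I n = {a \<in> carrier G. \<exists>x\<in>fractions (I n). x \<in> E a \<and> x \<noteq> 0}" for n
  proof (rule Set.set_eqI, rule iffI)
    fix a assume a: "a \<in> I n"
    then have "a \<in> carrier G" using subgroup.subset[OF sub[of n]] by blast
    then show "a \<in> {a \<in> carrier G. \<exists>x\<in>fractions (I n). x \<in> E a \<and> x \<noteq> 0}"
      using E_nonzero component_subset_fractions[OF sub a] by blast
  next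
    fix a assume "a \<in> {a \<in> carrier G. \<exists>x\<in>fractions (I n). x \<in> E a \<and> x \<noteq> 0}"
    then show "a \<in> I n" using homogeneous_fraction[OF sub] by blast
  qed
  from acc_onD[where I = "\<lambda>n. fractions (I n)", OF acc P[OF sub] fractions_mono[OF mono]]
  obtain M where M: "\<forall>n\<ge>M. fractions (I n) = fractions (I M)" ..
  have "I n = I M" if "n \<ge> M" for n
    by (subst recover[of n], subst recover[of M]) (simp only: M[rule_format, OF that])
  then show "\<exists>M. \<forall>n\<ge>M. I n = I M" by blast
qed

lemma nc_noetherian_sum:
  assumes "finite S" "S \<subseteq> carrier G"
  shows "nc_noetherian (set_ring (graded_sum E (generate G S)))"
  using assms
  by (intro nc_noetherian_set_ring sub_ring_sum generate_is_subgroup left.left_noetherian_graded_sum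
      right.left_noetherian_graded_sum)

lemma nc_domain_sum: "subgroup F G \<Longrightarrow> nc_domain (set_ring (graded_sum E F))"
  by (intro nc_domain_set_ring sub_ring_sum)

subsection \<open>Finite groups of weights\<close>

text \<open>One nonzero element from each component forms a basis, since each component is
  one-dimensional over the component of \<one>. The action is abstract in order to treat left and
  right scalars together.\<close>

lemma has_dimension_sum:
  assumes H: "subgroup H G" "finite H"
    and act_mem: "\<And>a c x. a \<in> H \<Longrightarrow> c \<in> E \<one> \<Longrightarrow> x \<in> E a \<Longrightarrow> act c x \<in> E a"
    and act_ex: "\<And>a b x. a \<in> H \<Longrightarrow> b \<in> E a \<Longrightarrow> b \<noteq> 0 \<Longrightarrow> x \<in> E a \<Longrightarrow> \<exists>c\<in>E \<one>. x = act c b"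
    and act_diff: "\<And>c c' b. act c b = act c' b \<Longrightarrow> b \<noteq> 0 \<Longrightarrow> c = c'"
  shows "has_dimension (E \<one>) act (add_monoid (set_ring (graded_sum E H))) (card H)"
proof -
  note Hc = subgroup.subset[OF H(1)] and S = sub_ring_sum[OF H(1)]
  obtain h where h: "bij_betw h {..<card H} H" using ex_bij_betw_nat_finite[OF H(2)] by (metis atLeast0LessThan)
  have hH: "h i \<in> H" if "i < card H" for i using h that by (auto simp: bij_betw_def)
  have "\<exists>b. \<forall>i\<in>{..<card H}. b i \<in> E (h i) \<and> b i \<noteq> 0"
    using E_nonzero hH Hc by (intro bchoice) blast
  then obtain b where b: "\<And>i. i < card H \<Longrightarrow> b i \<in> E (h i) \<and> b i \<noteq> 0" by blast
  have actS: "act c (b i) \<in> graded_sum E H" if "i < card H" "c \<in> E \<one>" for c i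
    using act_mem[OF hH[OF that(1)] that(2)] b[OF that(1)] hH[OF that(1)] by (intro graded_sum_mem[of "h i"]) auto
  have fin: "finprod (add_monoid (set_ring (graded_sum E H))) (\<lambda>i. act (c i) (b i)) {..<card H} =
      (\<Sum>i<card H. act (c i) (b i))" if "c \<in> {..<card H} \<rightarrow>\<^sub>E E \<one>" for c
    using that actS by (intro finprod_add_monoid_set_ring S) auto
  show ?thesis
    unfolding has_dimension_def
  proof (intro bexI[of _ b] ballI)
    show "b \<in> {..<card H} \<rightarrow> carrier (add_monoid (set_ring (graded_sum E H)))"
      using b hH graded_sum_mem[of _ H _ E] by auto
    fix v assume "v \<in> carrier (add_monoid (set_ring (graded_sum E H)))"
    then have v: "v \<in> graded_sum E H" by simp
    obtain u where u: "\<And>a. a \<in> H \<Longrightarrow> u a \<in> E a" "v = (\<Sum>a\<in>H. u a)"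
      using sum_components[OF H(2) Hc v] by auto
    have v_sum: "v = (\<Sum>i<card H. u (h i))" unfolding u(2) by (rule sum.reindex_bij_betw[OF h, symmetric])
    have "\<exists>c. \<forall>i\<in>{..<card H}. c i \<in> E \<one> \<and> u (h i) = act (c i) (b i)"
      using act_ex[OF hH _ _ u(1)[OF hH]] b by (intro bchoice) blast
    then obtain c where c: "\<And>i. i < card H \<Longrightarrow> c i \<in> E \<one> \<and> u (h i) = act (c i) (b i)" by blast
    let ?c = "restrict c {..<card H}"
    show "\<exists>!c. c \<in> {..<card H} \<rightarrow>\<^sub>E E \<one> \<and>
        v = finprod (add_monoid (set_ring (graded_sum E H))) (\<lambda>i. act (c i) (b i)) {..<card H}"
    proof (rule ex1I[of _ ?c])
      have mem: "?c \<in> {..<card H} \<rightarrow>\<^sub>E E \<one>" using c by auto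
      show "?c \<in> {..<card H} \<rightarrow>\<^sub>E E \<one> \<and>
          v = finprod (add_monoid (set_ring (graded_sum E H))) (\<lambda>i. act (?c i) (b i)) {..<card H}"
        unfolding fin[OF mem] v_sum using c mem by (auto intro!: sum.cong)
      fix c' assume c': "c' \<in> {..<card H} \<rightarrow>\<^sub>E E \<one> \<and>
        v = finprod (add_monoid (set_ring (graded_sum E H))) (\<lambda>i. act (c' i) (b i)) {..<card H}"
      then have "(\<Sum>i<card H. act (c' i) (b i)) = (\<Sum>i<card H. u (h i))"
        using fin v_sum by simp
      then have zero: "(\<Sum>i<card H. act (c' i) (b i) - u (h i)) = 0" by (simp add: sum_subtractf)
      have "act (c' i) (b i) - u (h i) = 0" if i: "i \<in> {..<card H}" for i
      proof (rule direct_family[OF _ _ _ _ zero i])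
        show "act (c' j) (b j) - u (h j) \<in> E (h j)" if j: "j \<in> {..<card H}" for j
        proof -
          have "c' j \<in> E \<one>" "j < card H" using c' j by auto
          then show ?thesis
            using act_mem[OF hH] b u(1)[OF hH] hH[of j] Hc by (intro add_closedD(2)[OF E_add]) auto
        qed
      qed (use h Hc in \<open>auto simp: bij_betw_def\<close>)
      then have "c' i = c i" if "i < card H" for i
        using act_diff[of "c' i" "b i" "c i"] c[OF that] b[OF that] that by simp
      then show "c' = ?c" using c' by (intro PiE_ext[of c' "{..<card H}" "\<lambda>_. E \<one>"]) (use mem in auto)
    qed
  qed
qed

lemma component_quotient:
  assumes "a \<in> carrier G" "b \<in> E a" "x \<in> E a"
  shows "x * inverse b \<in> E \<one>" "inverse b * x \<in> E \<one>"
  using E_mult[OF _ _ assms(3) E_inverse[OF assms(1,2)]] E_mult[OF _ _ E_inverse[OF assms(1,2)] assms(3)] assms(1)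
  by auto

lemma has_left_dimension:
  assumes "subgroup H G" "finite H"
  shows "has_dimension (E \<one>) (\<lambda>c v. c * v) (add_monoid (set_ring (graded_sum E H))) (card H)"
proof (rule has_dimension_sum[OF assms])
  fix a b c x assume a: "a \<in> H"
  then have ac: "a \<in> carrier G" using subgroup.subset[OF assms(1)] by blast
  show "c * x \<in> E a" if "c \<in> E \<one>" "x \<in> E a" using E_mult[OF one_closed ac that] ac by simp
  show "\<exists>c\<in>E \<one>. x = c * b" if "b \<in> E a" "b \<noteq> 0" "x \<in> E a"
    using component_quotient(1)[OF ac that(1,3)] that(2) by (intro bexI[of _ "x * inverse b"]) (auto simp: mult.assoc)
qed auto

lemma has_right_dimension:
  assumes "subgroup H G" "finite H"
  shows "has_dimension (E \<one>) (\<lambda>c v. v * c) (add_monoid (set_ring (graded_sum E H))) (card H)"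
proof (rule has_dimension_sum[OF assms])
  fix a b c x assume a: "a \<in> H"
  then have ac: "a \<in> carrier G" using subgroup.subset[OF assms(1)] by blast
  show "x * c \<in> E a" if "c \<in> E \<one>" "x \<in> E a" using E_mult[OF ac one_closed that(2,1)] ac by simp
  show "\<exists>c\<in>E \<one>. x = b * c" if "b \<in> E a" "b \<noteq> 0" "x \<in> E a"
    using component_quotient(2)[OF ac that(1,3)] that(2) by (intro bexI[of _ "inverse b * x"]) (auto simp flip: mult.assoc)
qed auto

text \<open>
  The elements \<open>1\<close> and \<open>b a * x\<close> for \<open>a \<in> H\<close> are one too many to be independent over the division ring
  \<open>E \<one>\<close>, which yields a left inverse of \<open>x\<close>.
\<close>

lemma division_subring_finite_sum:
  assumes H: "subgroup H G" "finite H"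
  shows "division_subring (graded_sum E H)"
proof -
  let ?S = "graded_sum E H"
  note Hc = subgroup.subset[OF H(1)] and D = std.sub_ringD[OF sub_ring_sum[OF H(1)]]
  note D0 = division_subringD[OF division_subring_component_one]
  have D0_sub: "E \<one> \<subseteq> ?S" using graded_sum_mem[OF subgroup.one_closed[OF H(1)], of _ E] by blast
  have "\<exists>b. \<forall>a\<in>H. b a \<in> E a \<and> b a \<noteq> 0" using E_nonzero Hc by (intro bchoice) blast
  then obtain b where b: "\<And>a. a \<in> H \<Longrightarrow> b a \<in> E a" "\<And>a. a \<in> H \<Longrightarrow> b a \<noteq> 0" by blast
  have bS: "b a \<in> ?S" if "a \<in> H" for a using b(1)[OF that] that by (rule graded_sum_mem[rotated])
  have "inverse x \<in> ?S" if x: "x \<in> ?S" "x \<noteq> 0" for x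
  proof -
    \<comment> \<open>The index \<open>None\<close> stands for 1 and \<open>Some a\<close> for
      \<open>b a * x\<close>, which gives \<open>card H + 1\<close> vectors.\<close>
    define z where "z j = (case j of None \<Rightarrow> 1 | Some a \<Rightarrow> b a * x)" for j
    let ?J = "insert None (Some ` H)"
    have z: "z j \<in> ?S" if "j \<in> ?J" for j
      using that D(2) D(3)[OF bS x(1)] by (auto simp: z_def)
    have "\<forall>j\<in>?J. \<exists>u. (\<forall>a\<in>H. u a \<in> E a) \<and> z j = (\<Sum>a\<in>H. u a)"
    proof
      fix j assume "j \<in> ?J"
      from sum_components[OF H(2) Hc z[OF this]]
      show "\<exists>u. (\<forall>a\<in>H. u a \<in> E a) \<and> z j = (\<Sum>a\<in>H. u a)" .
    qed
    from bchoice[OF this] obtain u where "\<forall>j\<in>?J. (\<forall>a\<in>H. u j a \<in> E a) \<and> z j = (\<Sum>a\<in>H. u j a)" ..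
    then have u: "j \<in> ?J \<Longrightarrow> a \<in> H \<Longrightarrow> u j a \<in> E a" "j \<in> ?J \<Longrightarrow> z j = (\<Sum>a\<in>H. u j a)" for j a
      using bspec[of ?J _ j] by blast+
    have "card H < card ?J" using H(2) by (simp add: card_image)
    \<comment> \<open>Dividing the component of weight \<open>a\<close> by \<open>b a\<close> yields
      coordinates in \<open>E \<one>\<close>, of which there are \<open>card H\<close> for each
      vector.\<close>
    moreover have "u j a * inverse (b a) \<in> E \<one>" if "j \<in> ?J" "a \<in> H" for j a
      using component_quotient(1)[OF _ b(1)[OF that(2)] u(1)[OF that]] that(2) Hc by blast
    ultimately have "\<exists>c. (\<forall>j\<in>?J. c j \<in> E \<one>) \<and> (\<exists>j\<in>?J. c j \<noteq> 0) \<and>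
        (\<forall>a\<in>H. (\<Sum>j\<in>?J. c j * (u j a * inverse (b a))) = 0)"
      using H(2) by (intro division_ring_dependence division_subring_component_one) simp_all
    then obtain c where c: "\<forall>j\<in>?J. c j \<in> E \<one>" "\<exists>j\<in>?J. c j \<noteq> 0"
      "\<forall>a\<in>H. (\<Sum>j\<in>?J. c j * (u j a * inverse (b a))) = 0" by (elim exE conjE)
    have "(\<Sum>j\<in>?J. c j * u j a) = 0" if a: "a \<in> H" for a
    proof -
      have "(\<Sum>j\<in>?J. c j * u j a) = (\<Sum>j\<in>?J. c j * (u j a * inverse (b a))) * b a"
        unfolding sum_distrib_right by (rule sum.cong) (simp_all add: mult.assoc b(2)[OF a])
      then show ?thesis using bspec[OF c(3) a] by simp
    qed
    moreover have "(\<Sum>j\<in>?J. c j * z j) = (\<Sum>j\<in>?J. \<Sum>a\<in>H. c j * u j a)"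
      by (rule sum.cong) (simp_all add: u(2) sum_distrib_left del: insert_iff)
    ultimately have "(\<Sum>j\<in>?J. c j * z j) = 0"
      using sum.swap[of "\<lambda>j a. c j * u j a" H ?J] by simp
    then have rel: "c None + (\<Sum>a\<in>H. c (Some a) * b a) * x = 0"
      using H(2) by (simp add: z_def sum.reindex sum_distrib_right mult.assoc)
    let ?y = "\<Sum>a\<in>H. c (Some a) * b a"
    \<comment> \<open>If this coefficient were 0, cancelling \<open>x\<close> would leave a relation
      between the \<open>b a\<close>, which have distinct weights; then all coefficients would
      vanish.\<close>
    have cN: "c None \<noteq> 0"
    proof
      assume cN: "c None = 0"
      then have zero: "?y = 0" using rel x(2) by simp
      have "c (Some a) * b a = 0" if a: "a \<in> H" for a
      proof (rule direct[OF H(2) Hc _ zero a])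
        show "c (Some a) * b a \<in> E a" if "a \<in> H" for a
          using E_mult[OF one_closed _ _ b(1)[OF that], of "c (Some a)"] that c(1) Hc by auto
      qed
      then show False using c(2) cN b(2) by auto
    qed
    have y: "?y \<in> ?S"
      by (rule add_closed_sum[OF D(1)]) (use D(3) c(1) D0_sub bS in blast)
    have "- inverse (c None) * ?y * x = 1"
    proof -
      have "?y * x = - c None" using rel by (simp add: eq_neg_iff_add_eq_0 add.commute)
      then show ?thesis using cN by (simp add: mult.assoc)
    qed
    then have "inverse x = - inverse (c None) * ?y" by (metis inverse_unique inverse_inverse_eq)
    then show ?thesis using D(3,6) y D0(6)[of "c None"] c(1) D0_sub by auto
  qed
  then have "inverse x \<in> ?S" if "x \<in> ?S" for x using that D(4) by (cases "x = 0") auto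
  then show ?thesis using D by (simp add: division_subring_def)
qed

subsection \<open>Skew Laurent extensions\<close>

lemma component_powi:
  assumes "a \<in> carrier G" "x \<in> E a"
  shows "x powi n \<in> E (a [^] n)"
proof -
  have nat: "x ^ k \<in> E (a [^] k)" for k :: nat
  proof (induction k)
    case 0
    then show ?case using E_one by simp
  next
    case (Suc k)
    then show ?case using E_mult[OF _ assms(1) Suc assms(2)] assms(1) by (simp add: power_Suc2 del: power_Suc)
  qed
  show ?thesis
  proof (cases n rule: int_cases2)
    case (nonneg k)
    then show ?thesis using nat[of k] by (simp add: int_pow_int)
  next
    case (nonpos k)
    then show ?thesis
      using E_inverse[OF _ nat[of k]] assms(1) by (simp add: int_pow_neg int_pow_int power_int_minus)
  qed
qed

text \<open>Every weight in \<open>F'\<close> is uniquely of the form f g^n with f in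
  \<open>F\<close>, so elements decompose uniquely by powers of \<open>x\<close>. The automorphism
  is conjugation by \<open>x\<close>, which preserves weights because the group is
  commutative.\<close>

lemma skew_laurent_sum:
  assumes F: "subgroup F G" and F': "subgroup F' G" and g: "g \<in> carrier G"
    and F'_eq: "F' = {f \<otimes> g [^] (n::int) | f n. f \<in> F}"
    and indep: "\<And>n::int. g [^] n \<in> F \<Longrightarrow> n = 0" and x: "x \<in> E g" "x \<noteq> 0"
  shows "skew_laurent (graded_sum E F) x (\<lambda>a. x * a * inverse x) (graded_sum E F')"
proof -
  let ?A = "graded_sum E F" and ?B = "graded_sum E F'" and ?\<sigma> = "\<lambda>a. x * a * inverse x"
  note Fc = subgroup.subset[OF F] and F'c = subgroup.subset[OF F']
  note A = sub_ring_sum[OF F] and B = sub_ring_sum[OF F']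
  note DA = std.sub_ringD[OF A] and DB = std.sub_ringD[OF B]
  have FF': "F \<subseteq> F'"
  proof
    fix f assume f: "f \<in> F"
    then have "f = f \<otimes> g [^] (0::int)" using Fc by auto
    then show "f \<in> F'" unfolding F'_eq using f by blast
  qed
  have "\<one> \<otimes> g [^] (1::int) \<in> F'" unfolding F'_eq using subgroup.one_closed[OF F] by blast
  then have gF': "g \<in> F'" using g by (simp add: int_pow_1)
  have AB: "?A \<subseteq> ?B" by (rule graded_sum_mono[OF FF'])
  have conj: "p * a * q \<in> ?A" if p: "p \<in> E h" "q \<in> E (inv h)" and h: "h \<in> carrier G" and a: "a \<in> ?A" for p q h a
  proof -
    have "?A \<subseteq> {a. p * a * q \<in> ?A}"
    proof (rule graded_sum_subset)
      show "add_closed {a. p * a * q \<in> ?A}"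
        using DA(4,5) by (simp add: add_closed_def right_diff_distrib left_diff_distrib)
      show "E f \<subseteq> {a. p * a * q \<in> ?A}" if f: "f \<in> F" for f
      proof
        fix y assume y: "y \<in> E f"
        have fc: "f \<in> carrier G" using f Fc by blast
        have "p * y * q \<in> E (h \<otimes> f \<otimes> inv h)" using p y h fc by (intro E_mult) auto
        also have "h \<otimes> f \<otimes> inv h = f" using h fc by (simp add: m_comm[of h f] m_assoc)
        finally show "y \<in> {a. p * a * q \<in> ?A}" using graded_sum_mem[OF f, of _ E] by blast
      qed
    qed
    then show ?thesis using a by blast
  qed
  have \<sigma>: "?\<sigma> a \<in> ?A" and \<sigma>': "inverse x * a * x \<in> ?A" if "a \<in> ?A" for a
    using conj[OF x(1) E_inverse[OF g x(1)] g that] conj[of "inverse x" "inv g" x a] E_inverse[OF g x(1)] x(1) g that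
    by simp_all
  have cancel: "inverse x * (x * z) = z" "x * (inverse x * z) = z" for z
    using x(2) by (simp_all flip: mult.assoc)
  have inj: "inj_on ?\<sigma> ?A" using x(2) by (intro inj_onI) simp
  have iso: "?\<sigma> \<in> ring_iso (set_ring ?A) (set_ring ?A)"
  proof (rule ring_iso_memI)
    show "bij_betw ?\<sigma> (carrier (set_ring ?A)) (carrier (set_ring ?A))"
      unfolding bij_betw_def
    proof
      show "?\<sigma> ` carrier (set_ring ?A) = carrier (set_ring ?A)"
      proof
        show "carrier (set_ring ?A) \<subseteq> ?\<sigma> ` carrier (set_ring ?A)"
        proof
          fix a assume "a \<in> carrier (set_ring ?A)"
          then have "inverse x * a * x \<in> carrier (set_ring ?A)" using \<sigma>' by simp
          moreover have "a = ?\<sigma> (inverse x * a * x)" using x(2) by (simp add: mult.assoc cancel)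
          ultimately show "a \<in> ?\<sigma> ` carrier (set_ring ?A)" by (rule rev_image_eqI)
        qed
      qed (use \<sigma> in auto)
    qed (use inj in simp)
  qed (use \<sigma> x(2) in \<open>auto simp: mult.assoc cancel distrib_left distrib_right\<close>)
  have comm: "x * a = ?\<sigma> a * x \<and> inverse x * a = inv_into ?A ?\<sigma> a * inverse x" if a: "a \<in> ?A" for a
  proof
    show "x * a = ?\<sigma> a * x" using x(2) by (simp add: mult.assoc)
    have "?\<sigma> (inverse x * a * x) = a" using x(2) by (simp add: mult.assoc cancel)
    then have "inv_into ?A ?\<sigma> a = inverse x * a * x" by (rule inv_into_f_eq[OF inj \<sigma>'[OF a]])
    then show "inverse x * a = inv_into ?A ?\<sigma> a * inverse x" using x(2) by (simp add: mult.assoc)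
  qed
  have pow: "x powi n \<in> E (g [^] n)" for n by (rule component_powi[OF g x(1)])
  have pow_nz: "x powi n \<noteq> 0" for n using x(2) by simp
  have inj_pair: "f = f' \<and> n = n'" if eq: "f \<otimes> g [^] n = f' \<otimes> g [^] n'" and f: "f \<in> F" "f' \<in> F" for f f' and n n' :: int
  proof -
    have fc: "f \<in> carrier G" "f' \<in> carrier G" using f Fc by auto
    have "g [^] (n - n') = inv f \<otimes> f'"
    proof -
      have "g [^] n = inv f \<otimes> (f' \<otimes> g [^] n')" using eq fc g by (metis inv_solve_left int_pow_closed m_closed)
      then have "g [^] n \<otimes> inv (g [^] n') = inv f \<otimes> f'" using fc g by (simp add: m_assoc)
      then show ?thesis using g by (simp add: int_pow_diff)
    qed
    also have "\<dots> \<in> F" using subgroup.m_closed[OF F subgroup.m_inv_closed[OF F f(1)] f(2)] .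
    finally have "n = n'" using indep by fastforce
    then show ?thesis using eq fc g by simp
  qed
  have free: "\<exists>!c :: int \<Rightarrow> 'd. range c \<subseteq> ?A \<and> finite {i. c i \<noteq> 0} \<and> b = (\<Sum>i | c i \<noteq> 0. c i * x powi i)"
    if b: "b \<in> ?B" for b
  proof -
    obtain M u where M: "finite M" "M \<subseteq> F'" "\<And>f. f \<in> M \<Longrightarrow> u f \<in> E f" "b = (\<Sum>f\<in>M. u f)"
      using b by (rule graded_sumE) (rule that; assumption)
    have "\<forall>f\<in>M. \<exists>n::int. \<exists>f'\<in>F. f = f' \<otimes> g [^] n" using M(2) unfolding F'_eq by blast
    from bchoice[OF this] obtain d :: "'g \<Rightarrow> int" where d: "\<forall>f\<in>M. \<exists>f'\<in>F. f = f' \<otimes> g [^] d f" ..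
    \<comment> \<open>The coefficient of the i-th power collects the components whose weight has
      g-exponent i, shifted back into the sum over \<open>F\<close>.\<close>
    define c where "c i = (\<Sum>f\<in>{f\<in>M. d f = i}. u f * x powi (- i))" for i
    have "u f * x powi (- d f) \<in> ?A" if f: "f \<in> M" for f
    proof -
      obtain f' where f': "f' \<in> F" "f = f' \<otimes> g [^] d f" using d f by blast
      have "f' \<in> carrier G" using f'(1) Fc by blast
      then have "f' \<otimes> g [^] d f \<otimes> inv (g [^] d f) = f'" using g by (simp add: m_assoc)
      then have "f \<otimes> g [^] (- d f) = f'" using g by (simp add: int_pow_neg flip: f'(2))
      moreover have "u f * x powi (- d f) \<in> E (f \<otimes> g [^] (- d f))"
        using M(2,3) f F'c g pow by (intro E_mult) auto
      ultimately show ?thesis using graded_sum_mem[OF f'(1), of _ E] by simp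
    qed
    then have cA: "range c \<subseteq> ?A"
      unfolding c_def by (auto intro!: add_closed_sum[OF DA(1)])
    have supp: "{i. c i \<noteq> 0} \<subseteq> d ` M"
    proof
      fix i assume "i \<in> {i. c i \<noteq> 0}"
      then have "{f\<in>M. d f = i} \<noteq> {}" unfolding c_def using sum.empty by fastforce
      then show "i \<in> d ` M" by blast
    qed
    then have fin: "finite {i. c i \<noteq> 0}" using M(1) finite_surj by blast
    have "(\<Sum>i | c i \<noteq> 0. c i * x powi i) = (\<Sum>i\<in>d ` M. c i * x powi i)"
      using supp M(1) by (intro sum.mono_neutral_left) auto
    also have "\<dots> = (\<Sum>i\<in>d ` M. \<Sum>f\<in>{f\<in>M. d f = i}. u f)"
      unfolding c_def sum_distrib_right using x(2) by (simp add: mult.assoc power_int_minus)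
    also have "\<dots> = b" unfolding M(4) by (rule sum.image_gen[OF M(1), symmetric])
    finally have ex: "range c \<subseteq> ?A \<and> finite {i. c i \<noteq> 0} \<and> b = (\<Sum>i | c i \<noteq> 0. c i * x powi i)"
      using cA fin by simp
    \<comment> \<open>The differences of coefficients are split into components over one finite set
      \<open>K\<close> of weights; multiplied by the powers of \<open>x\<close> they have pairwise
      distinct weights, so directness makes them all vanish.\<close>
    have "c' = c" if c': "range c' \<subseteq> ?A \<and> finite {i. c' i \<noteq> 0} \<and> b = (\<Sum>i | c' i \<noteq> 0. c' i * x powi i)" for c'
    proof -
      define I where "I = {i. c i \<noteq> 0} \<union> {i. c' i \<noteq> 0}"
      have I: "finite I" using fin c' by (simp add: I_def)
      have "(\<Sum>i | c i \<noteq> 0. c i * x powi i) = (\<Sum>i\<in>I. c i * x powi i)"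
        "(\<Sum>i | c' i \<noteq> 0. c' i * x powi i) = (\<Sum>i\<in>I. c' i * x powi i)"
        using I by (auto intro!: sum.mono_neutral_left simp: I_def)
      then have zero: "(\<Sum>i\<in>I. (c' i - c i) * x powi i) = 0"
        using ex c' by (simp add: left_diff_distrib sum_subtractf)
      have diff: "c' i - c i \<in> ?A" for i using DA(5) cA c' by blast
      have "\<forall>i\<in>I. \<exists>N. finite N \<and> N \<subseteq> F \<and> c' i - c i \<in> graded_sum E N"
        using graded_sum_finite[OF diff] by blast
      from bchoice[OF this] obtain N where N: "\<forall>i\<in>I. finite (N i) \<and> N i \<subseteq> F \<and> c' i - c i \<in> graded_sum E (N i)" ..
      define K where "K = (\<Union>i\<in>I. N i)"
      have K: "finite K" "K \<subseteq> F" using N I by (auto simp: K_def)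
      have "\<forall>i\<in>I. \<exists>w. (\<forall>f\<in>K. w f \<in> E f) \<and> c' i - c i = (\<Sum>f\<in>K. w f)"
      proof
        fix i assume i: "i \<in> I"
        then have "N i \<subseteq> K" by (auto simp: K_def)
        then have "c' i - c i \<in> graded_sum E K" using N i graded_sum_mono[of "N i" K E] by blast
        then show "\<exists>w. (\<forall>f\<in>K. w f \<in> E f) \<and> c' i - c i = (\<Sum>f\<in>K. w f)"
          using K Fc by (intro sum_components) auto
      qed
      from bchoice[OF this] obtain w where "\<forall>i\<in>I. (\<forall>f\<in>K. w i f \<in> E f) \<and> c' i - c i = (\<Sum>f\<in>K. w i f)" ..
      then have w: "i \<in> I \<Longrightarrow> f \<in> K \<Longrightarrow> w i f \<in> E f" "i \<in> I \<Longrightarrow> c' i - c i = (\<Sum>f\<in>K. w i f)" for i f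
        by simp_all
      have "(\<Sum>(i, f)\<in>I \<times> K. w i f * x powi i) = (\<Sum>i\<in>I. (c' i - c i) * x powi i)"
        unfolding sum.cartesian_product[symmetric] by (rule sum.cong) (simp_all add: w(2) sum_distrib_right)
      then have zero': "(\<Sum>p\<in>I \<times> K. w (fst p) (snd p) * x powi fst p) = 0"
        using zero by (simp add: case_prod_beta)
      have "w (fst p) (snd p) * x powi fst p = 0" if p: "p \<in> I \<times> K" for p
      proof (rule direct_family[OF _ _ _ _ zero' p, of "\<lambda>p. snd p \<otimes> g [^] fst p"])
        show "inj_on (\<lambda>p. snd p \<otimes> g [^] fst p) (I \<times> K)"
        proof (rule inj_onI)
          fix p q assume "p \<in> I \<times> K" "q \<in> I \<times> K" "snd p \<otimes> g [^] fst p = snd q \<otimes> g [^] fst q"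
          then show "p = q" using inj_pair[of "snd p" "fst p" "snd q" "fst q"] K(2) by (auto simp: prod_eq_iff subset_iff)
        qed
        show "w (fst j) (snd j) * x powi fst j \<in> E (snd j \<otimes> g [^] fst j)" if "j \<in> I \<times> K" for j
          using that w(1) pow K(2) Fc g by (intro E_mult) auto
      qed (use I K Fc g in auto)
      then have "w i f = 0" if "i \<in> I" "f \<in> K" for i f using that pow_nz[of i] by force
      then have "c' i = c i" if "i \<in> I" for i using w(2)[OF that] that by simp
      moreover have "c' i = c i" if "i \<notin> I" for i using that by (simp add: I_def)
      ultimately show "c' = c" by blast
    qed
    then show ?thesis using ex by (intro ex1I[of _ c]) blast+
  qed
  show ?thesis
    unfolding skew_laurent_def
  proof (intro conjI ballI)
    show "x \<in> ?B" using gF' x(1) by (rule graded_sum_mem)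
    show "inverse x \<in> ?B" using subgroup.m_inv_closed[OF F' gF'] E_inverse[OF g x(1)] by (rule graded_sum_mem)
  qed (use ring_set_ring[OF A] ring_set_ring[OF B] AB iso x(2) comm free in blast)+
qed

lemma iterated_skew_laurent_sum:
  assumes g: "g \<in> {..<r} \<rightarrow> carrier G"
    and span: "\<And>x. x \<in> carrier G \<Longrightarrow> \<exists>\<tau>\<in>T. \<exists>n. x = \<tau> \<otimes> monom_prod g n {..<r}"
    and indep: "\<And>n. monom_prod g n {..<r} \<in> T \<Longrightarrow> \<forall>i<r. n i = 0"
  shows "iterated_skew_laurent (graded_sum E T) r (graded_sum E (carrier G))"
proof -
  let ?F = "\<lambda>k. {\<tau> \<otimes> monom_prod g n {..<k} | \<tau> n. \<tau> \<in> T}"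
  have gk: "g \<in> {..<k} \<rightarrow> carrier G" if "k \<le> r" for k using g that by auto
  have F: "subgroup (?F k) G" if "k \<le> r" for k
    by (rule monom_prod_subgroup[OF _ gk[OF that] subgroup_torsion]) simp
  have monom_Suc: "monom_prod g n {..<Suc k} = g k [^] n k \<otimes> monom_prod g n {..<k}" if "k < r" for n k
    unfolding lessThan_Suc using g that by (intro monom_prod_insert) auto
  have chain: "iterated_skew_laurent (graded_sum E T) k (graded_sum E (?F k))" if "k \<le> r" for k
    using that
  proof (induction k)
    case 0
    have "?F 0 = (\<lambda>\<tau>. \<tau> \<otimes> \<one>) ` T" by (auto simp: monom_prod_def)
    also have "\<dots> = T" using torsionD(4) by (simp cong: image_cong)
    finally have "?F 0 = T" .
    then show ?case by (simp add: iterated_skew_laurent.base)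
  next
    case (Suc k)
    then have k: "k < r" and kr: "k \<le> r" by auto
    have gkc: "g k \<in> carrier G" using g k by auto
    obtain x where x: "x \<in> E (g k)" "x \<noteq> 0" using E_nonzero[OF gkc] by blast
    have "skew_laurent (graded_sum E (?F k)) x (\<lambda>a. x * a * inverse x) (graded_sum E (?F (Suc k)))"
    proof (rule skew_laurent_sum[OF F[OF kr] F[OF Suc.prems] gkc _ _ x])
      show "?F (Suc k) = {f \<otimes> g k [^] (n::int) | f n. f \<in> ?F k}"
      proof (rule Set.set_eqI, rule iffI)
        fix y assume "y \<in> ?F (Suc k)"
        then obtain \<tau> n where y: "\<tau> \<in> T" "y = \<tau> \<otimes> monom_prod g n {..<Suc k}" by blast
        then have "y = (\<tau> \<otimes> monom_prod g n {..<k}) \<otimes> g k [^] n k"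
          using gkc gk[OF kr] torsionD(4) by (simp add: monom_Suc[OF k] m_ac)
        then show "y \<in> {f \<otimes> g k [^] (n::int) | f n. f \<in> ?F k}" using y(1) by blast
      next
        fix y assume "y \<in> {f \<otimes> g k [^] (n::int) | f n. f \<in> ?F k}"
        then obtain \<tau> n and m :: int where y: "\<tau> \<in> T" "y = (\<tau> \<otimes> monom_prod g n {..<k}) \<otimes> g k [^] m" by blast
        have "monom_prod g (n(k := m)) {..<k} = monom_prod g n {..<k}"
          using gk[OF kr] by (intro monom_prod_cong) auto
        then have "y = \<tau> \<otimes> monom_prod g (n(k := m)) {..<Suc k}"
          using y gkc gk[OF kr] torsionD(4) by (simp add: monom_Suc[OF k] m_ac)
        then show "y \<in> ?F (Suc k)" using y(1) by blast
      qed
      fix m :: int assume "g k [^] m \<in> ?F k"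
      then obtain \<tau> n where \<tau>: "\<tau> \<in> T" "g k [^] m = \<tau> \<otimes> monom_prod g n {..<k}" by blast
      \<comment> \<open>The relation for a power of \<open>g k\<close> rewritten as one exponent
        vector, padded with zeros beyond \<open>k\<close> so that it can be extended to all
        \<open>r\<close> generators, where \<open>indep\<close> applies.\<close>
      define n' where "n' i = (if i < k then - n i else if i = k then m else 0)" for i
      have "monom_prod g n' {..<k} = monom_prod g (\<lambda>i. - n i) {..<k}"
        using gk[OF kr] by (intro monom_prod_cong) (auto simp: n'_def)
      then have "monom_prod g n' {..<Suc k} = (\<tau> \<otimes> monom_prod g n {..<k}) \<otimes> inv (monom_prod g n {..<k})"
        using gk[OF kr] by (simp add: monom_Suc[OF k] n'_def monom_prod_inv flip: \<tau>(2))
      also have "\<dots> = \<tau>" using \<tau>(1) torsionD(4) gk[OF kr] by (simp add: m_assoc)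
      finally have *: "monom_prod g n' {..<Suc k} \<in> T" using \<tau>(1) by simp
      have ext: "monom_prod g n' {..<l} = monom_prod g n' {..<Suc k}" if "Suc k \<le> l" "l \<le> r" for l
        using that
      proof (induction l rule: dec_induct)
        case (step l)
        then have "n' l = 0" "l < r" by (auto simp: n'_def)
        then show ?case using step monom_Suc[of l n'] gk[of l] gk[of "Suc k"] g by (auto simp: Pi_iff)
      qed simp
      have "monom_prod g n' {..<r} \<in> T" using * k by (subst ext) auto
      then have "n' k = 0" using indep k by blast
      then show "m = 0" by (simp add: n'_def)
    qed
    with Suc.IH[OF kr] show ?case by (rule iterated_skew_laurent.step)
  qed
  have "?F r = carrier G"
  proof
    show "carrier G \<subseteq> ?F r" using span by blast
  qed (rule subgroup.subset[OF F[OF order_refl]])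
  with chain[OF order_refl] show ?thesis by (simp only:)
qed

end


section \<open>Eigenvectors of commuting derivations or automorphisms\<close>

lemma comm_group_product_group:
  assumes "\<And>i. i \<in> I \<Longrightarrow> comm_group (G i)"
  shows "comm_group (product_group I G)"
proof (rule group.group_comm_groupI)
  show "group (product_group I G)" using assms by (intro product_group) (simp add: comm_group_def)
  show "x \<otimes>\<^bsub>product_group I G\<^esub> y = y \<otimes>\<^bsub>product_group I G\<^esub> x"
    if "x \<in> carrier (product_group I G)" "y \<in> carrier (product_group I G)" for x y
  proof -
    have "x i \<otimes>\<^bsub>G i\<^esub> y i = y i \<otimes>\<^bsub>G i\<^esub> x i" if "i \<in> I" for i
      using comm_monoid.m_comm[OF comm_group.axioms(1)[OF assms[OF that]], of "x i" "y i"]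
        \<open>x \<in> _\<close> \<open>y \<in> _\<close> that by (auto simp: PiE_iff)
    then show ?thesis by auto
  qed
qed

lemma comm_group_field_add: "comm_group \<lparr>carrier = UNIV, monoid.mult = (+), one = 0 :: 'k::field\<rparr>"
proof (rule comm_groupI)
  show "\<exists>y\<in>carrier \<lparr>carrier = UNIV, monoid.mult = (+), one = 0\<rparr>.
      y \<otimes>\<^bsub>\<lparr>carrier = UNIV, monoid.mult = (+), one = 0\<rparr>\<^esub> x = \<one>\<^bsub>\<lparr>carrier = UNIV, monoid.mult = (+), one = 0\<rparr>\<^esub>" for x :: 'k
    by (intro bexI[of _ "- x"]) auto
qed auto

lemma comm_group_field_mult: "comm_group \<lparr>carrier = UNIV - {0}, monoid.mult = (*), one = 1 :: 'k::field\<rparr>"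
proof (rule comm_groupI)
  show "\<exists>y\<in>carrier \<lparr>carrier = UNIV - {0}, monoid.mult = (*), one = 1\<rparr>.
      y \<otimes>\<^bsub>\<lparr>carrier = UNIV - {0}, monoid.mult = (*), one = 1\<rparr>\<^esub> x = \<one>\<^bsub>\<lparr>carrier = UNIV - {0}, monoid.mult = (*), one = 1\<rparr>\<^esub>"
    if "x \<in> carrier \<lparr>carrier = UNIV - {0}, monoid.mult = (*), one = 1\<rparr>" for x :: 'k
    using that by (intro bexI[of _ "inverse x"]) auto
qed auto

lemma comm_group_weight_group: "comm_group (weight_group kind t :: (nat \<Rightarrow> 'k::field) monoid)"
  unfolding weight_group_def
  by (rule comm_group_product_group) (cases kind; simp add: comm_group_field_add comm_group_field_mult)

lemma weight_group_mult:
  "i < t \<Longrightarrow> (a \<otimes>\<^bsub>weight_group Derivations t\<^esub> b) i = a i + b i"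
  "i < t \<Longrightarrow> (a \<otimes>\<^bsub>weight_group Automorphisms t\<^esub> b) i = a i * b i"
  by (simp_all add: weight_group_def)

lemma weight_group_one:
  "i < t \<Longrightarrow> \<one>\<^bsub>weight_group Derivations t\<^esub> i = 0" "i < t \<Longrightarrow> \<one>\<^bsub>weight_group Automorphisms t\<^esub> i = 1"
  by (simp_all add: weight_group_def)

lemma weight_group_inv:
  assumes a: "a \<in> carrier (weight_group kind t)" and i: "i < t"
  shows "kind = Derivations \<Longrightarrow> (inv\<^bsub>weight_group kind t\<^esub> a) i = - a i"
    "kind = Automorphisms \<Longrightarrow> (inv\<^bsub>weight_group kind t\<^esub> a) i = inverse (a i)"
proof -
  interpret W: comm_group "weight_group kind t" by (rule comm_group_weight_group)
  have "(inv\<^bsub>weight_group kind t\<^esub> a \<otimes>\<^bsub>weight_group kind t\<^esub> a) i = \<one>\<^bsub>weight_group kind t\<^esub> i"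
    using W.l_inv[OF a] by simp
  then show "kind = Derivations \<Longrightarrow> (inv\<^bsub>weight_group kind t\<^esub> a) i = - a i"
    "kind = Automorphisms \<Longrightarrow> (inv\<^bsub>weight_group kind t\<^esub> a) i = inverse (a i)"
    using i by (auto simp: weight_group_mult weight_group_one eq_neg_iff_add_eq_0 mult.commute intro: inverse_unique[symmetric])
qed

locale eigen_family = central_field \<kappa>
  for \<kappa> :: "'k::field \<Rightarrow> 'd::division_ring" +
  fixes kind :: family_kind and t :: nat and \<delta> :: "nat \<Rightarrow> 'd \<Rightarrow> 'd"
  assumes family: "commuting_family \<kappa> kind t \<delta>"
begin

abbreviation W :: "(nat \<Rightarrow> 'k) monoid" where "W \<equiv> weight_group kind t"
abbreviation EvG :: "(nat \<Rightarrow> 'k) monoid" where "EvG \<equiv> Ev_group \<kappa> kind t \<delta>"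
abbreviation E :: "(nat \<Rightarrow> 'k) \<Rightarrow> 'd set" where "E \<equiv> eigenspace \<kappa> t \<delta> UNIV"

sublocale W: comm_group W
  by (rule comm_group_weight_group)

lemma derivation:
  assumes "kind = Derivations" "i < t"
  shows "\<delta> i (x * y) = \<delta> i x * y + x * \<delta> i y"
  using family assms by (auto simp: commuting_family_def K_derivation_def)

lemma automorphism:
  assumes "kind = Automorphisms" "i < t"
  shows "\<delta> i (x * y) = \<delta> i x * \<delta> i y" "\<delta> i 1 = 1" "inj (\<delta> i)"
proof -
  have "\<delta> i \<in> ring_iso (set_ring UNIV) (set_ring UNIV)"
    using family assms by (auto simp: commuting_family_def K_automorphism_def)
  then show "\<delta> i (x * y) = \<delta> i x * \<delta> i y" "\<delta> i 1 = 1" "inj (\<delta> i)"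
    using ring_iso_memE by (auto simp: ring_iso_def ring_hom_def bij_betw_def)
qed

lemma family_add: "i < t \<Longrightarrow> \<delta> i (x + y) = \<delta> i x + \<delta> i y"
  using family by (cases kind)
    (auto simp: commuting_family_def K_derivation_def K_automorphism_def ring_iso_def ring_hom_def)

lemma family_scale:
  assumes "i < t"
  shows "\<delta> i (\<kappa> c * x) = \<kappa> c * \<delta> i x"
proof (cases kind)
  case Derivations
  then have "K_derivation \<kappa> (\<delta> i)" using family assms by (auto simp: commuting_family_def)
  then show ?thesis unfolding K_derivation_def by blast
next
  case Automorphisms
  then have "K_automorphism \<kappa> (\<delta> i)" using family assms by (auto simp: commuting_family_def)
  then show ?thesis unfolding K_automorphism_def by blast
qed

lemma family_zero: "i < t \<Longrightarrow> \<delta> i 0 = 0"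
  using family_add[of i 0 0] by simp

lemma family_diff: "i < t \<Longrightarrow> \<delta> i (x - y) = \<delta> i x - \<delta> i y"
  using family_add[of i "x - y" y] by (simp add: algebra_simps)

lemma family_sum: "i < t \<Longrightarrow> \<delta> i (\<Sum>j\<in>J. f j) = (\<Sum>j\<in>J. \<delta> i (f j))"
  by (induction J rule: infinite_finite_induct) (simp_all add: family_add family_zero)

lemma eigenspaceI: "(\<And>i. i < t \<Longrightarrow> \<delta> i u = \<kappa> (a i) * u) \<Longrightarrow> u \<in> E a"
  by (simp add: eigenspace_def)

lemma eigenspaceD: "u \<in> E a \<Longrightarrow> i < t \<Longrightarrow> \<delta> i u = \<kappa> (a i) * u"
  by (simp add: eigenspace_def)

lemma eigenspace_add_closed: "add_closed (E a)"
  by (auto simp: add_closed_def family_zero family_diff eigenspaceD right_diff_distrib intro: eigenspaceI)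

lemma eigenspace_scale: "u \<in> E a \<Longrightarrow> \<kappa> c * u \<in> E a"
proof (rule eigenspaceI)
  fix i assume "u \<in> E a" "i < t"
  then have "\<delta> i (\<kappa> c * u) = \<kappa> c * \<kappa> (a i) * u" by (simp add: family_scale eigenspaceD mult.assoc)
  then show "\<delta> i (\<kappa> c * u) = \<kappa> (a i) * (\<kappa> c * u)" using central[of c "\<kappa> (a i)"] by (simp add: mult.assoc)
qed

lemma eigenspace_one: "1 \<in> E \<one>\<^bsub>W\<^esub>"
proof (rule eigenspaceI)
  fix i assume i: "i < t"
  show "\<delta> i 1 = \<kappa> (\<one>\<^bsub>W\<^esub> i) * 1"
  proof (cases kind)
    case Derivations
    then show ?thesis using derivation[of i 1 1] i by (simp add: weight_group_one)
  next
    case Automorphisms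
    then show ?thesis using automorphism(2) i by (simp add: weight_group_one)
  qed
qed

lemma eigenspace_mult:
  assumes "x \<in> E a" "y \<in> E b"
  shows "x * y \<in> E (a \<otimes>\<^bsub>W\<^esub> b)"
proof (rule eigenspaceI)
  fix i assume i: "i < t"
  have swap: "x * (\<kappa> (b i) * y) = \<kappa> (b i) * (x * y)" using central[of "b i" x] by (metis mult.assoc)
  have \<delta>: "\<delta> i x = \<kappa> (a i) * x" "\<delta> i y = \<kappa> (b i) * y" using eigenspaceD assms i by auto
  show "\<delta> i (x * y) = \<kappa> ((a \<otimes>\<^bsub>W\<^esub> b) i) * (x * y)"
  proof (cases kind)
    case Derivations
    have "\<delta> i (x * y) = \<kappa> (a i) * (x * y) + \<kappa> (b i) * (x * y)"
      unfolding derivation[OF Derivations i] \<delta> swap by (simp add: mult.assoc)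
    then show ?thesis using i by (simp add: Derivations weight_group_mult \<kappa>_add distrib_right)
  next
    case Automorphisms
    have "\<delta> i (x * y) = \<kappa> (a i) * (\<kappa> (b i) * (x * y))"
      unfolding automorphism(1)[OF Automorphisms i] \<delta> by (simp only: mult.assoc swap)
    moreover have "\<kappa> ((a \<otimes>\<^bsub>W\<^esub> b) i) = \<kappa> (a i) * \<kappa> (b i)"
      using weight_group_mult(2)[OF i, of a b] by (simp add: Automorphisms \<kappa>_mult)
    ultimately show ?thesis by (simp only: mult.assoc)
  qed
qed

lemma eigenspace_inverse:
  assumes "a \<in> carrier W" "x \<in> E a"
  shows "inverse x \<in> E (inv\<^bsub>W\<^esub> a)"
proof (cases "x = 0")
  case True
  then show ?thesis using add_closedD(1)[OF eigenspace_add_closed] by simp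
next
  case False
  show ?thesis
  proof (rule eigenspaceI)
    fix i assume i: "i < t"
    have one: "\<delta> i 1 = \<kappa> (\<one>\<^bsub>W\<^esub> i) * 1" by (rule eigenspaceD[OF eigenspace_one i])
    show "\<delta> i (inverse x) = \<kappa> ((inv\<^bsub>W\<^esub> a) i) * inverse x"
    proof (cases kind)
      case Derivations
      have "0 = \<delta> i (inverse x * x)" using one i False Derivations by (simp add: weight_group_one)
      also have "\<dots> = \<delta> i (inverse x) * x + inverse x * (\<kappa> (a i) * x)"
        using derivation[OF Derivations i] eigenspaceD[OF assms(2) i] by simp
      also have "inverse x * (\<kappa> (a i) * x) = \<kappa> (a i)" using False central[of "a i" x] by (simp flip: mult.assoc)
      finally have "\<delta> i (inverse x) * x = - \<kappa> (a i)" by (simp add: eq_neg_iff_add_eq_0)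
      then have "\<delta> i (inverse x) = - \<kappa> (a i) * inverse x"
        using False by (metis mult.assoc mult.right_neutral right_inverse)
      then show ?thesis using weight_group_inv(1)[OF assms(1) i Derivations] by (simp add: \<kappa>_minus)
    next
      case Automorphisms
      have "1 = \<delta> i (x * inverse x)" using automorphism(2)[OF Automorphisms i] False by simp
      also have "\<dots> = \<kappa> (a i) * x * \<delta> i (inverse x)"
        using automorphism(1)[OF Automorphisms i] eigenspaceD[OF assms(2) i] by simp
      finally have "\<delta> i (inverse x) = inverse (\<kappa> (a i) * x)" by (metis inverse_unique)
      also have "\<dots> = \<kappa> (inverse (a i)) * inverse x"
        using False by (cases "a i = 0") (simp_all add: \<kappa>_inverse nonzero_inverse_mult_distrib, metis \<kappa>_inverse central)
      finally show ?thesis using weight_group_inv(2)[OF assms(1) i Automorphisms] by simp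
    qed
  qed
qed

lemma constants_scalar: "range \<kappa> \<subseteq> E \<one>\<^bsub>W\<^esub>"
  using eigenspace_scale[OF eigenspace_one] by auto

lemma carrier_EvG: "a \<in> carrier EvG \<longleftrightarrow> a \<in> carrier W \<and> (\<exists>u\<in>E a. u \<noteq> 0)"
  by (auto simp: Ev_group_def Ev_def)

lemma EvG_simps [simp]: "a \<otimes>\<^bsub>EvG\<^esub> b = a \<otimes>\<^bsub>W\<^esub> b" "\<one>\<^bsub>EvG\<^esub> = \<one>\<^bsub>W\<^esub>"
  by (simp_all add: Ev_group_def)

lemma subgroup_EvG: "subgroup (carrier EvG) W"
proof (rule W.subgroupI)
  show "carrier EvG \<subseteq> carrier W" by (auto simp: carrier_EvG)
  have "\<one>\<^bsub>W\<^esub> \<in> carrier EvG" using eigenspace_one by (auto simp: carrier_EvG intro!: bexI[of _ 1])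
  then show "carrier EvG \<noteq> {}" by blast
  show "inv\<^bsub>W\<^esub> a \<in> carrier EvG" if a: "a \<in> carrier EvG" for a
  proof -
    obtain u where "a \<in> carrier W" "u \<in> E a" "u \<noteq> 0" using a by (auto simp: carrier_EvG)
    then show ?thesis using eigenspace_inverse[of a u] by (auto simp: carrier_EvG intro!: bexI[of _ "inverse u"])
  qed
  show "a \<otimes>\<^bsub>W\<^esub> b \<in> carrier EvG" if ab: "a \<in> carrier EvG" "b \<in> carrier EvG" for a b
  proof -
    obtain u v where "a \<in> carrier W" "u \<in> E a" "u \<noteq> 0" "b \<in> carrier W" "v \<in> E b" "v \<noteq> 0"
      using ab by (auto simp: carrier_EvG)
    then show ?thesis using eigenspace_mult[of u a v b] by (auto simp: carrier_EvG intro!: bexI[of _ "u * v"])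
  qed
qed

lemma comm_group_EvG: "comm_group EvG"
proof (rule group.group_comm_groupI)
  have "EvG = W\<lparr>carrier := carrier EvG\<rparr>" by (simp add: Ev_group_def)
  then show "group EvG" using W.subgroup_imp_group[OF subgroup_EvG] by (simp only:)
  show "a \<otimes>\<^bsub>EvG\<^esub> b = b \<otimes>\<^bsub>EvG\<^esub> a" if "a \<in> carrier EvG" "b \<in> carrier EvG" for a b
    using that W.m_comm by (simp add: carrier_EvG)
qed

lemma inv_EvG: "a \<in> carrier EvG \<Longrightarrow> inv\<^bsub>EvG\<^esub> a = inv\<^bsub>W\<^esub> a"
  using W.m_inv_consistent[OF subgroup_EvG] by (simp add: Ev_group_def)

text \<open>
  Applying \<open>\<delta> i - \<kappa> (b i)\<close> to a relation between eigenvectors removes the term of weight \<open>b\<close>.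
\<close>

lemma eigenvectors_independent:
  assumes "finite S" "S \<subseteq> carrier W" "\<And>a. a \<in> S \<Longrightarrow> u a \<in> E a" "(\<Sum>a\<in>S. u a) = 0" "a \<in> S"
  shows "u a = 0"
  using assms
proof (induction S arbitrary: u a rule: finite_induct)
  case (insert b S)
  have other: "u c = 0" if c: "c \<in> S" for c
  proof -
    have "c \<noteq> b" using c insert.hyps by blast
    have "c \<in> carrier W" "b \<in> carrier W" using c insert.prems by auto
    then have ext: "c \<in> extensional {..<t}" "b \<in> extensional {..<t}"
      by (auto simp: weight_group_def PiE_def)
    \<comment> \<open>Weights are extensional functions, so distinct weights differ at an index
      below \<open>t\<close>, where some \<open>\<delta> i\<close> tells them apart.\<close>
    obtain i where i: "i < t" "c i \<noteq> b i"
      using \<open>c \<noteq> b\<close> extensionalityI[OF ext] by auto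
    have zero: "(\<Sum>a\<in>S. \<kappa> (a i - b i) * u a) = 0"
    proof -
      have "0 = \<delta> i (\<Sum>a\<in>insert b S. u a) - \<kappa> (b i) * (\<Sum>a\<in>insert b S. u a)"
        using insert.prems(3) i by (simp add: family_zero)
      also have "\<dots> = (\<Sum>a\<in>insert b S. \<kappa> (a i) * u a - \<kappa> (b i) * u a)"
        unfolding family_sum[OF i(1)] sum_subtractf sum_distrib_left
        using eigenspaceD[OF insert.prems(2) i(1)] by (simp only: cong: sum.cong)
      also have "\<dots> = (\<Sum>a\<in>S. \<kappa> (a i - b i) * u a)"
        using insert.hyps by (simp add: \<kappa>_diff left_diff_distrib)
      finally show ?thesis by simp
    qed
    have "\<kappa> (c i - b i) * u c = 0"
    proof (rule insert.IH[OF _ _ zero c])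
      show "\<kappa> (a i - b i) * u a \<in> E a" if "a \<in> S" for a
        using insert.prems(2) that by (intro eigenspace_scale) simp
    qed (use insert.prems in simp)
    then show ?thesis using i(2) by simp
  qed
  moreover have "u b = 0" using insert.prems(3) insert.hyps other by simp
  ultimately show ?case using insert.prems(4) by auto
qed simp

sublocale graded_division_ring EvG E
proof (intro graded_division_ring.intro comm_group_EvG graded_division_ring_axioms.intro)
  show "\<exists>x\<in>E a. x \<noteq> 0" if "a \<in> carrier EvG" for a using that by (simp add: carrier_EvG)
  show "inverse x \<in> E (inv\<^bsub>EvG\<^esub> a)" if "a \<in> carrier EvG" "x \<in> E a" for a x
    using eigenspace_inverse[OF _ that(2)] that(1) by (simp add: inv_EvG carrier_EvG)
  show "u a = 0"
    if "finite S" "S \<subseteq> carrier EvG" "\<And>a. a \<in> S \<Longrightarrow> u a \<in> E a" "(\<Sum>a\<in>S. u a) = 0" "a \<in> S" for S u a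
    by (rule eigenvectors_independent[OF that(1) order_trans[OF that(2) subgroup.subset[OF subgroup_EvG]] that(3-5)])
qed (use eigenspace_add_closed eigenspace_mult eigenspace_one in auto)

lemma eigen_sum_eq: "eigen_sum \<kappa> t \<delta> = graded_sum E"
  by (intro ext) (simp add: eigen_sum_def graded_sum_def)

lemma division_subalgebraI: "division_subring Q \<Longrightarrow> E \<one>\<^bsub>W\<^esub> \<subseteq> Q \<Longrightarrow> division_subalgebra \<kappa> Q"
  using constants_scalar by (auto simp: division_subalgebra_def)

lemma eigenspace_subset_fractions: "subgroup F EvG \<Longrightarrow> a \<in> F \<Longrightarrow> E a \<subseteq> fractions F"
  by (rule component_subset_fractions)

lemma division_subalgebra_fractions: "subgroup F EvG \<Longrightarrow> division_subalgebra \<kappa> (fractions F)"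
  using subgroup.one_closed[of F EvG]
  by (intro division_subalgebraI division_subring_fractions eigenspace_subset_fractions) simp_all

lemma family_eigen_sum:
  assumes F: "F \<subseteq> carrier EvG" and i: "i < t" and x: "x \<in> graded_sum E F"
  shows "\<delta> i x \<in> graded_sum E F"
proof -
  obtain S u where S: "finite S" "S \<subseteq> F" "\<And>a. a \<in> S \<Longrightarrow> u a \<in> E a" "x = (\<Sum>a\<in>S. u a)"
    using x by (rule graded_sumE) (rule that; assumption)
  have "\<delta> i x = (\<Sum>a\<in>S. \<kappa> (a i) * u a)"
    unfolding S(4) family_sum[OF i] by (rule sum.cong[OF refl eigenspaceD[OF S(3) i]])
  also have "\<dots> \<in> graded_sum E F"
    using S by (intro graded_sumI eigenspace_scale) auto
  finally show ?thesis .
qed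

lemma automorphism_eigen_sum:
  assumes F: "F \<subseteq> carrier EvG" and i: "i < t" and kind: "kind = Automorphisms" and x: "x \<in> graded_sum E F"
  shows "\<exists>y\<in>graded_sum E F. x = \<delta> i y"
proof -
  obtain S u where S: "finite S" "S \<subseteq> F" "\<And>a. a \<in> S \<Longrightarrow> u a \<in> E a" "x = (\<Sum>a\<in>S. u a)"
    using x by (rule graded_sumE) (rule that; assumption)
  let ?y = "\<Sum>a\<in>S. \<kappa> (inverse (a i)) * u a"
  have "a i \<noteq> 0" if "a \<in> S" for a
  proof -
    have "a \<in> carrier W" using that S(2) F by (auto simp: carrier_EvG)
    then show ?thesis using i kind by (auto simp: weight_group_def PiE_def Pi_iff)
  qed
  then have "\<delta> i (\<kappa> (inverse (a i)) * u a) = u a" if "a \<in> S" for a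
    using that eigenspaceD[OF S(3)[OF that] i] family_scale[OF i, of "inverse (a i)" "u a"]
    by (simp flip: mult.assoc \<kappa>_mult)
  then have "\<delta> i ?y = x"
    unfolding S(4) family_sum[OF i] by (rule sum.cong[OF refl])
  moreover have "?y \<in> graded_sum E F"
    using S by (intro graded_sumI eigenspace_scale) auto
  ultimately show ?thesis by auto
qed

lemma automorphism_quotient:
  assumes "kind = Automorphisms" "i < t" "u \<noteq> 0"
  shows "\<delta> i (inverse u * w) = inverse (\<delta> i u) * \<delta> i w" "\<delta> i u \<noteq> 0"
proof -
  have "\<delta> i u * \<delta> i (inverse u) = 1" using automorphism[OF assms(1,2)] assms(3) by (metis right_inverse)
  then have "\<delta> i (inverse u) = inverse (\<delta> i u)" by (metis inverse_unique)
  then show "\<delta> i (inverse u * w) = inverse (\<delta> i u) * \<delta> i w" using automorphism(1)[OF assms(1,2)] by simp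
  show "\<delta> i u \<noteq> 0" using \<open>_ = 1\<close> by auto
qed

lemma invariant_fractions:
  assumes F: "subgroup F EvG"
  shows "invariant_under kind t \<delta> (fractions F)"
proof -
  note Fc = subgroup.subset[OF F] and Q = division_subringD[OF division_subring_fractions[OF F]]
  have sub: "graded_sum E F \<subseteq> fractions F" by (rule subset_left_fractions[OF sub_ring_sum[OF F]])
  show ?thesis
  proof (cases kind)
    case Derivations
    have "\<delta> i q \<in> fractions F" if i: "i < t" and q: "q \<in> fractions F" for i q
    proof -
      obtain u w where uw: "u \<in> graded_sum E F" "u \<noteq> 0" "w \<in> graded_sum E F" "q = inverse u * w"
        using q by (auto simp: left_fractions_def)
      \<comment> \<open>The quotient rule is read off by differentiating this product, which needs
        no formula for the derivative of an inverse.\<close>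
      have "w = u * q" using uw by (simp flip: mult.assoc)
      then have "\<delta> i w = \<delta> i u * q + u * \<delta> i q" using derivation[OF Derivations i] by simp
      then have "u * \<delta> i q = \<delta> i w - \<delta> i u * q" by simp
      then have "\<delta> i q = inverse u * (\<delta> i w - \<delta> i u * q)"
        using uw(2) by (metis left_inverse mult.assoc mult.left_neutral)
      moreover have "\<delta> i w \<in> fractions F" "\<delta> i u \<in> fractions F" "u \<in> fractions F"
        using family_eigen_sum[OF Fc i] uw sub by blast+
      ultimately show ?thesis using Q(4-6) q by simp
    qed
    then show ?thesis using Derivations by (auto simp: invariant_under_def)
  next
    case Automorphisms
    have "\<delta> i ` fractions F = fractions F" if i: "i < t" for i
    proof
      show "\<delta> i ` fractions F \<subseteq> fractions F"
      proof
        fix y assume "y \<in> \<delta> i ` fractions F"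
        then obtain u w where uw: "u \<in> graded_sum E F" "u \<noteq> 0" "w \<in> graded_sum E F" "y = \<delta> i (inverse u * w)"
          by (auto simp: left_fractions_def)
        then show "y \<in> fractions F"
          using family_eigen_sum[OF Fc i] automorphism_quotient[OF Automorphisms i uw(2)]
          by (simp add: left_fractionsI)
      qed
      show "fractions F \<subseteq> \<delta> i ` fractions F"
      proof
        fix y assume "y \<in> fractions F"
        then obtain u w where uw: "u \<in> graded_sum E F" "u \<noteq> 0" "w \<in> graded_sum E F" "y = inverse u * w"
          by (auto simp: left_fractions_def)
        obtain u' w' where uw': "u' \<in> graded_sum E F" "u = \<delta> i u'" "w' \<in> graded_sum E F" "w = \<delta> i w'"
          using automorphism_eigen_sum[OF Fc i Automorphisms] uw by meson
        have "u' \<noteq> 0" using uw(2) uw'(2) family_zero[OF i] by auto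
        then have "y = \<delta> i (inverse u' * w')" "inverse u' * w' \<in> fractions F"
          using automorphism_quotient[OF Automorphisms i] uw uw' by (simp_all add: left_fractionsI)
        then show "y \<in> \<delta> i ` fractions F" by blast
      qed
    qed
    then show ?thesis using Automorphisms by (simp add: invariant_under_def)
  qed
qed

lemma eigenvector_fraction:
  assumes F: "subgroup F EvG" and a: "a \<in> carrier W" and v: "v \<in> eigenspace \<kappa> t \<delta> (fractions F) a" "v \<noteq> 0"
  shows "a \<in> F \<and> (\<exists>b\<in>F. \<exists>u\<in>E b. \<exists>w\<in>E (a \<otimes>\<^bsub>W\<^esub> b). u \<noteq> 0 \<and> v = inverse u * w)"
proof -
  have v': "v \<in> fractions F" "v \<in> E a" using v(1) by (auto simp: eigenspace_def)
  then have "a \<in> carrier EvG" using a v(2) by (auto simp: carrier_EvG)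
  from homogeneous_fraction[OF F this v' v(2)] show ?thesis by simp
qed

lemma Ev_fractions:
  assumes F: "subgroup F EvG"
  shows "Ev \<kappa> kind t \<delta> (fractions F) = F"
proof
  show "Ev \<kappa> kind t \<delta> (fractions F) \<subseteq> F"
    using eigenvector_fraction[OF F] by (auto simp: Ev_def)
  show "F \<subseteq> Ev \<kappa> kind t \<delta> (fractions F)"
  proof
    fix a assume a: "a \<in> F"
    then have "a \<in> carrier EvG" using subgroup.subset[OF F] by blast
    then obtain u where u: "a \<in> carrier W" "u \<in> E a" "u \<noteq> 0" by (auto simp: carrier_EvG)
    then have "u \<in> eigenspace \<kappa> t \<delta> (fractions F) a"
      using eigenspace_subset_fractions[OF F a] by (auto simp: eigenspace_def)
    then show "a \<in> Ev \<kappa> kind t \<delta> (fractions F)" using u by (auto simp: Ev_def)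
  qed
qed

lemma eigen_sum_direct: "eigen_sum_direct \<kappa> t \<delta> (carrier EvG)"
  unfolding eigen_sum_direct_def by (metis direct)

lemma finitely_generated_weights:
  assumes "acc_on (division_subalgebra \<kappa>)" "subgroup F EvG"
  shows "\<exists>S. finite S \<and> S \<subseteq> F \<and> generate EvG S = F"
  by (rule finitely_generated_of_acc[OF acc_subgroups[OF assms(1) division_subalgebra_fractions] assms(2)])

end


theorem corollary3p2:
  fixes V :: "('k::field_char_0 alg_closure ^ 'n::finite) set"
    and \<iota> :: "(('k alg_closure ^ 'n \<Rightarrow> 'k alg_closure) \<Rightarrow> ('k alg_closure ^ 'n \<Rightarrow> 'k alg_closure))
                \<Rightarrow> 'd::division_ring"
    and \<kappa> :: "'k \<Rightarrow> 'd"
  assumes V: "smooth_irreducible_affine_variety V"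
    and D: "is_Frac (variety_diffops V) (UNIV :: 'd set) \<iota>"
    and \<kappa>: "\<kappa> = structure_map V \<iota>"
  shows "nc_noetherian (tensor_with_opposite \<kappa>) \<and> nc_domain (tensor_with_opposite \<kappa>) \<and>
    acc_on (division_subalgebra \<kappa>) \<and>
    (\<forall>E. division_subalgebra \<kappa> E \<longrightarrow> fg_division_algebra \<kappa> E) \<and>
    (\<forall>kind t \<delta>. commuting_family \<kappa> kind t \<delta> \<longrightarrow>
      (let W = weight_group kind t;
           G = Ev_group \<kappa> kind t \<delta>;
           T = torsion_part G;
           D\<^sub>0 = eigenspace \<kappa> t \<delta> UNIV \<one>\<^bsub>W\<^esub>;
           D\<^sub>T = eigen_sum \<kappa> t \<delta> T;
           D\<^sub>\<Delta> = eigen_sum \<kappa> t \<delta> (carrier G)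
       in
        subgroup (carrier G) W \<and>
        (\<exists>S. finite S \<and> S \<subseteq> carrier G \<and> generate G S = carrier G) \<and>
        subgroup T G \<and> finite T \<and>
        eigen_sum_direct \<kappa> t \<delta> (carrier G) \<and>
        nc_noetherian (set_ring D\<^sub>\<Delta>) \<and> nc_domain (set_ring D\<^sub>\<Delta>) \<and>
        division_subalgebra \<kappa> D\<^sub>0 \<and> division_subalgebra \<kappa> D\<^sub>T \<and>
        has_dimension D\<^sub>0 (\<lambda>c v. c * v) (add_monoid (set_ring D\<^sub>T)) (card T) \<and>
        has_dimension D\<^sub>0 (\<lambda>c v. v * c) (add_monoid (set_ring D\<^sub>T)) (card T) \<and>
        (\<exists>r. has_rank G r \<and>
          (\<exists>g \<in> {..<r} \<rightarrow> carrier G.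
            (\<lambda>(\<tau>, n). \<tau> \<otimes>\<^bsub>G\<^esub> finprod G (\<lambda>i. g i [^]\<^bsub>G\<^esub> (n i)) {..<r})
              \<in> iso (G\<lparr>carrier := T\<rparr> \<times>\<times> product_group {..<r} (\<lambda>_. integer_group)) G) \<and>
          iterated_skew_laurent D\<^sub>T r D\<^sub>\<Delta>) \<and>
        (\<forall>F. subgroup F G \<longrightarrow>
          (let S = eigen_sum \<kappa> t \<delta> F; Q = left_fractions S in
            nc_noetherian (set_ring S) \<and> nc_domain (set_ring S) \<and>
            is_Frac (set_ring S) Q id \<and> division_subalgebra \<kappa> Q \<and>
            invariant_under kind t \<delta> Q \<and>
            Ev \<kappa> kind t \<delta> Q = F \<and>
            (\<forall>a\<in>carrier W. \<forall>v\<in>eigenspace \<kappa> t \<delta> Q a. v \<noteq> 0 \<longrightarrow>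
              a \<in> F \<and> (\<exists>b\<in>F. \<exists>u\<in>eigenspace \<kappa> t \<delta> UNIV b. \<exists>w\<in>eigenspace \<kappa> t \<delta> UNIV (a \<otimes>\<^bsub>W\<^esub> b).
                u \<noteq> 0 \<and> v = inverse u * w))))))"
proof -
  interpret variety_division_ring V \<iota> \<kappa>
    using V D \<kappa> by unfold_locales (auto simp: smooth_irreducible_affine_variety_def)
  have acc: "acc_on (division_subalgebra \<kappa>)"
    by (rule acc_division_subalgebras[OF left_noetherian_tensor])
  show ?thesis
  proof (intro conjI allI impI, goal_cases)
    case (5 kind t \<delta>)
    then interpret D: eigen_family \<kappa> kind t \<delta>
      by unfold_locales
    obtain S where S: "finite S" "S \<subseteq> carrier D.EvG" "generate D.EvG S = carrier D.EvG"
      using D.finitely_generated_weights[OF acc D.subgroup_self] by (elim exE conjE)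
    \<comment> \<open>The torsion part is itself a subgroup of weights, hence finitely generated by
      the chain condition; being generated by finitely many elements of finite order, it is
      finite.\<close>
    obtain S' where S': "finite S'" "S' \<subseteq> torsion_part D.EvG" "generate D.EvG S' = torsion_part D.EvG"
      using D.finitely_generated_weights[OF acc D.subgroup_torsion] by (elim exE conjE)
    have T: "finite (torsion_part D.EvG)" by (rule D.finite_torsion[OF S'])
    have one: "D.E \<one>\<^bsub>D.W\<^esub> \<subseteq> graded_sum D.E F" if "subgroup F D.EvG" for F
      using graded_sum_mem[of "\<one>\<^bsub>D.W\<^esub>" F _ D.E] subgroup.one_closed[OF that] by auto
    show ?case
      unfolding Let_def D.eigen_sum_eq
    proof (intro conjI allI ballI impI)
      show "subgroup (carrier D.EvG) D.W" by (rule D.subgroup_EvG)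
      show "\<exists>S. finite S \<and> S \<subseteq> carrier D.EvG \<and> generate D.EvG S = carrier D.EvG"
        using S by blast
      show "subgroup (torsion_part D.EvG) D.EvG" by (rule D.subgroup_torsion)
      show "finite (torsion_part D.EvG)" by (rule T)
      show "eigen_sum_direct \<kappa> t \<delta> (carrier D.EvG)" by (rule D.eigen_sum_direct)
      show "nc_noetherian (set_ring (graded_sum D.E (carrier D.EvG)))"
        using D.nc_noetherian_sum[OF S(1,2)] by (simp only: S(3))
      show "nc_domain (set_ring (graded_sum D.E (carrier D.EvG)))"
        by (rule D.nc_domain_sum[OF D.subgroup_self])
      show "division_subalgebra \<kappa> (D.E \<one>\<^bsub>D.W\<^esub>)"
        using D.division_subring_component_one by (intro D.division_subalgebraI) simp_all
      show "division_subalgebra \<kappa> (graded_sum D.E (torsion_part D.EvG))"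
        by (intro D.division_subalgebraI D.division_subring_finite_sum D.subgroup_torsion T one)
      show "has_dimension (D.E \<one>\<^bsub>D.W\<^esub>) (\<lambda>c v. c * v)
          (add_monoid (set_ring (graded_sum D.E (torsion_part D.EvG)))) (card (torsion_part D.EvG))"
        using D.has_left_dimension[OF D.subgroup_torsion T] by (simp only: D.EvG_simps)
      show "has_dimension (D.E \<one>\<^bsub>D.W\<^esub>) (\<lambda>c v. v * c)
          (add_monoid (set_ring (graded_sum D.E (torsion_part D.EvG)))) (card (torsion_part D.EvG))"
        using D.has_right_dimension[OF D.subgroup_torsion T] by (simp only: D.EvG_simps)
      obtain r :: nat and g where basis: "g \<in> {..<r} \<rightarrow> carrier D.EvG"
        "\<And>x. x \<in> carrier D.EvG \<Longrightarrow> \<exists>\<tau>\<in>torsion_part D.EvG. \<exists>n. x = \<tau> \<otimes>\<^bsub>D.EvG\<^esub> D.monom_prod g n {..<r}"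
        "\<And>n. D.monom_prod g n {..<r} \<in> torsion_part D.EvG \<Longrightarrow> \<forall>i<r. n i = 0"
        by (rule D.free_part[OF S]) (rule that; assumption)
      show "\<exists>r. has_rank D.EvG r \<and>
          (\<exists>g \<in> {..<r} \<rightarrow> carrier D.EvG.
            (\<lambda>(\<tau>, n). \<tau> \<otimes>\<^bsub>D.EvG\<^esub> finprod D.EvG (\<lambda>i. g i [^]\<^bsub>D.EvG\<^esub> (n i)) {..<r})
              \<in> iso (D.EvG\<lparr>carrier := torsion_part D.EvG\<rparr> \<times>\<times> product_group {..<r} (\<lambda>_. integer_group)) D.EvG) \<and>
          iterated_skew_laurent (graded_sum D.E (torsion_part D.EvG)) r (graded_sum D.E (carrier D.EvG))"
        using basis(1) D.has_rank_free[OF basis] D.iso_torsion_free[OF basis] D.iterated_skew_laurent_sum[OF basis]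
        by (intro exI[of _ r] conjI bexI[of _ g])
    next
      fix F assume F: "subgroup F D.EvG"
      obtain S where S: "finite S" "S \<subseteq> F" "generate D.EvG S = F"
        using D.finitely_generated_weights[OF acc F] by (elim exE conjE)
      show "nc_noetherian (set_ring (graded_sum D.E F))"
        using D.nc_noetherian_sum[OF S(1) order_trans[OF S(2) subgroup.subset[OF F]]] by (simp only: S(3))
      show "nc_domain (set_ring (graded_sum D.E F))" by (rule D.nc_domain_sum[OF F])
      show "is_Frac (set_ring (graded_sum D.E F)) (left_fractions (graded_sum D.E F)) id"
        by (rule D.is_Frac_fractions[OF F])
      show "division_subalgebra \<kappa> (left_fractions (graded_sum D.E F))"
        by (rule D.division_subalgebra_fractions[OF F])
      show "invariant_under kind t \<delta> (left_fractions (graded_sum D.E F))"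
        by (rule D.invariant_fractions[OF F])
      show "Ev \<kappa> kind t \<delta> (left_fractions (graded_sum D.E F)) = F"
        by (rule D.Ev_fractions[OF F])
      fix a v
      assume av: "a \<in> carrier D.W" "v \<in> eigenspace \<kappa> t \<delta> (left_fractions (graded_sum D.E F)) a" "v \<noteq> 0"
      show "a \<in> F" using D.eigenvector_fraction[OF F av] by (rule conjunct1)
      show "\<exists>b\<in>F. \<exists>u\<in>D.E b. \<exists>w\<in>D.E (a \<otimes>\<^bsub>D.W\<^esub> b). u \<noteq> 0 \<and> v = inverse u * w"
        using D.eigenvector_fraction[OF F av] by (rule conjunct2)
    qed
  qed (use enveloping_algebra acc fg_division_subalgebra[OF acc] in simp_all)
qed

end
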